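(* Let $0\le r\le p$, and for each $\mathrm e\in\mathcal E$ let $\boldsymbol P^1_{\mathrm e}:V^1_{\mathrm{pw}}\to V^1_{\mathrm{pw}}$ be the edge-conforming projection with moment order $r$ defined in the context. Then the operator $$\boldsymbol P^1=\prod_{\mathrm e\in\mathcal E}\boldsymbol P^1_{\mathrm e}:V^1_{\mathrm{pw}}\to V^1_{\mathrm{pw}}$$ (composition in any order) is an $r$-th order moment-preserving projection onto the conforming subspace $V^1_h=V^1_{\mathrm{pw}}\cap H(\mathrm{curl};\Omega)$.
   Context: **Multipatch domain.** $\Omega\subset\mathbb R^2$ is an open bounded domain with Lipschitz boundary, $\Omega=\mathrm{int}\big(\bigcup_{k\in\mathcal K}\overline{\Omega_k}\big)$, $\mathcal K=\{1,\dots,K\}$, with patches $\Omega_k=F_k(\hat\Omega)$, $\hat\Omega=(0,1)^2$, where $F_k$ is a $C^1$-diffeomorphism (up to the boundary). The patches have pairwise disjoint interiors and are geometrically conforming: for $k_1\ne k_2$, $\overline{\Omega_{k_1}}\cap\overline{\Omega_{k_2}}$ is empty, a common vertex, or one complete common patch edge. Patch edges are the images under $F_k$ of the sides of $[0,1]^2$; $\mathcal E$ is the set of all patch edges and $\mathcal K(\mathrm e)=\{k:\mathrm e\subset\partial\Omega_k\}$. An edge is interior if $\#\mathcal K(\mathrm e)=2$, otherwise a boundary edge. **Splines.** For each $k$, $\mathbb V^0_k$ is the space of splines on $[0,1]$ of degree $p\ge1$ with clamped knot vector $\Xi_k=(\xi^k_i)_{i=0}^{n_k+1+p}$ (end knots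 $0$ and $1$ of multiplicity $p+1$, interior distinct knots of multiplicity $m$, $1\le m\le p$, distinct knots uniformly spaced), so $\dim\mathbb V^0_k=n_k+1$, with B-spline basis $\lambda^k_0,\dots,\lambda^k_{n_k}$ satisfying $\lambda^k_i(0)=\delta_{i,0}$, $\lambda^k_i(1)=\delta_{i,n_k}$. $\mathbb V^1_k=\partial_{\hat x}\mathbb V^0_k$ is the space of splines of degree $p-1$ on the knot vector $(\xi^k_i)_{i=1}^{n_k+p}$, $\dim\mathbb V^1_k=n_k$, with B-spline basis $\lambda^{1,k}_0,\dots,\lambda^{1,k}_{n_k-1}$. The logical space is $\hat V^1_k=(\mathbb V^1_k\otimes\mathbb V^0_k)\times(\mathbb V^0_k\otimes\mathbb V^1_k)$ (vector fields), the pushforward is $\mathcal F^1_k(\hat{\boldsymbol u})=(DF_k^{-T}\hat{\boldsymbol u})\circ F_k^{-1}$, $V^1_k=\mathcal F^1_k(\hat V^1_k)$, and the broken space is $V^1_{\mathrm{pw}}=\{\boldsymbol v\in L^2(\Omega)^2:\boldsymbol v|_{\Omega_k}\in V^1_k\ \forall k\in\mathcal K\}$. **Standing assumptions.** (i) $n_k>p+1$ for all $k$. (ii) $p$ and $m$ are the same on all patches, and each interior edge $\mathrm e$ is shared by two patches $\mathcal K(\mathrm e)=\{k^-,k^+\}$ (coarse, fine) such that every interval between consecutive distinct knots of $\Xi_{k^-}$ is subdivided into the same number of equal subintervals by the distinct knots of $\Xi_{k^+}$; hence $\mathbb V^\ell_{k^-}\subset\mathbb V^\ell_{k^+}$ for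 $\ell=0,1$. **Moment preservation.** An operator $P:V^1_{\mathrm{pw}}\to V^1_{\mathrm{pw}}$ is moment-preserving of order $r\ge0$ if for all $\boldsymbol u\in V^1_{\mathrm{pw}}$, $k\in\mathcal K$ and all vector-valued polynomials $\boldsymbol q$ on $\hat\Omega$ with components in $\mathbb Q_{r-1,r-1}$ (degree $\le r-1$ in each variable), $\int_{\hat\Omega}(\mathcal F^1_k)^{-1}((P\boldsymbol u)|_{\Omega_k})\cdot\boldsymbol q=\int_{\hat\Omega}(\mathcal F^1_k)^{-1}(\boldsymbol u|_{\Omega_k})\cdot\boldsymbol q$. For $r=0$ the condition is empty. **Correction coefficients.** Let $\gamma^{1d}=(M^k)^{-1}b^k\in\mathbb R^r$ with $M^k=(\int_0^1\lambda^k_mq_j)_{1\le j,m\le r}$, $b^k=(\int_0^1\lambda^k_0q_j)_{1\le j\le r}$, $(q_j)_{j=1}^r$ a basis of the univariate polynomials of degree $\le r-1$; equivalently $\sum_{m=1}^r\gamma^{1d}_m\int_0^1\lambda^k_mq=\int_0^1\lambda^k_0q$ for all such $q$. Throughout, $\gamma^{1d}$ is taken to be the same vector for any two patches sharing a vertex, so $k$ is dropped. If $r=0$ all sums over $1\le m\le r$ are empty. **Edge-local notation.** Fix an interior edge $\mathrm e$; write $\pm$ for $k^\pm$. Let $\Omega(\mathrm e)=\mathrm{int}(\overline{\Omega_-}\cup\overline{\Omega_+})$. There is a homeomorphism $F_{\mathrm e}:[0,1]\times[-1,1]\to\overline{\Omega(\mathrm e)}$, mapping $[0,1]\times\{0\}$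 onto $\mathrm e$, whose restrictions to $[0,1]\times[-1,0]$ and $[0,1]\times[0,1]$ coincide with $F_{k^-}$ and $F_{k^+}$ up to affine coordinate changes (swaps, reflections, translations of the unit square), and $F_{\mathrm e}$ is a $C^1$-diffeomorphism on each of these two squares. Coordinates are $(\hat x_\parallel,\hat x_\perp)$; the first component of a logical field is the one parallel to the edge. $\mathcal F^1_{\mathrm e}(\hat{\boldsymbol u})=(DF_{\mathrm e}^{-T}\hat{\boldsymbol u})\circ F_{\mathrm e}^{-1}$ patch-wise on $\Omega(\mathrm e)$. Let $\lambda^-_{\perp,i}(\hat x_\perp)=\lambda^-_i(-\hat x_\perp)$ on $[-1,0]$ and $0$ on $(0,1]$; $\lambda^+_{\perp,i}(\hat x_\perp)=\lambda^+_i(\hat x_\perp)$ on $(0,1]$ and $0$ on $[-1,0]$; $\mathbb V^0_{\perp,\pm}=\mathrm{Span}\{\lambda^\pm_{\perp,i}\}_{0\le i\le n_\pm}$. Put $\bar\lambda^{\mathrm e}_\perp=\frac12(\lambda^-_{\perp,0}+\lambda^+_{\perp,0})$ and $C^{\mathrm e}=\frac12\sum_{m=1}^r\gamma^{1d}_m(\lambda^-_{\perp,m}-\lambda^+_{\perp,m})$. The tangential logical space is $\hat V^1_1(\mathrm e)=(\mathbb V^1_+\otimes\mathbb V^0_{\perp,+})\oplus(\mathbb V^1_-\otimes\mathbb V^0_{\perp,-})$, and $\hat V^1(\mathrm e)$ is the space of pullbacks $(\mathcal F^1_{\mathrm e})^{-1}(\boldsymbol u|_{\Omega(\mathrm e)})$,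 $\boldsymbol u\in V^1_{\mathrm{pw}}$, whose first components form $\hat V^1_1(\mathrm e)$. Let $\mathscr R^1:\mathbb V^1_+\to\mathbb V^1_-$ be the $L^2(0,1)$-projection onto $\mathbb V^1_-$. **Edge operator.** The linear map $\hat P^1_{\mathrm e}:\hat V^1_1(\mathrm e)\to\hat V^1_1(\mathrm e)$ is defined by - $\lambda^{1,-}_{j_1}\otimes\lambda^-_{\perp,0}\mapsto\lambda^{1,-}_{j_1}\otimes(\bar\lambda^{\mathrm e}_\perp+C^{\mathrm e})$ for $0\le j_1\le n_--1$; - $\lambda^{1,+}_{j_1}\otimes\lambda^+_{\perp,0}\mapsto\mathscr R^1\lambda^{1,+}_{j_1}\otimes(\bar\lambda^{\mathrm e}_\perp-C^{\mathrm e})$ for $0\le j_1\le n_+-1$; - $\lambda^{1,\pm}_{j_1}\otimes\lambda^\pm_{\perp,j_2}$ unchanged for $j_2\ne0$. For $\hat{\boldsymbol u}=(\hat u_1,\hat u_2)\in\hat V^1(\mathrm e)$ set $\hat{\boldsymbol P}^1_{\mathrm e}\hat{\boldsymbol u}=(\hat P^1_{\mathrm e}\hat u_1,\hat u_2)$. Then $\boldsymbol P^1_{\mathrm e}\boldsymbol u|_{\Omega(\mathrm e)}=\mathcal F^1_{\mathrm e}\hat{\boldsymbol P}^1_{\mathrm e}\big((\mathcal F^1_{\mathrm e})^{-1}(\boldsymbol u|_{\Omega(\mathrm e)})\big)$ and $\boldsymbol P^1_{\mathrm e}\boldsymbol u|_{\Omega_k}=\boldsymbol u|_{\Omega_k}$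 for $k\notin\mathcal K(\mathrm e)$. For a boundary edge, $\boldsymbol P^1_{\mathrm e}$ is the identity. *)

theory Defs
  imports "HOL-Analysis.Analysis" "HOL-Computational_Algebra.Polynomial"
begin

section \<open>Function spaces on planar sets\<close>

text \<open>
  Elements of Lebesgue spaces are represented by functions on the whole plane; equality of
  two elements is equality almost everywhere on the set under consideration.
\<close>

definition L2_on :: "(real^2) set \<Rightarrow> (real^2 \<Rightarrow> 'b::euclidean_space) set" where
  "L2_on S = {f. f \<in> borel_measurable (lebesgue_on S) \<and>
                 integrable (lebesgue_on S) (\<lambda>x. (norm (f x))\<^sup>2)}"

definition ae_eq_on :: "(real^2) set \<Rightarrow> (real^2 \<Rightarrow> 'b) \<Rightarrow> (real^2 \<Rightarrow> 'b) \<Rightarrow> bool" where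
  "ae_eq_on S f g \<longleftrightarrow> (AE x in lebesgue_on S. f x = g x)"

definition partial_deriv :: "2 \<Rightarrow> (real^2 \<Rightarrow> real) \<Rightarrow> real^2 \<Rightarrow> real" where
  "partial_deriv i f x = frechet_derivative f (at x) (axis i 1)"

primrec Ck_fun :: "nat \<Rightarrow> (real^2 \<Rightarrow> real) \<Rightarrow> bool" where
  "Ck_fun 0 f \<longleftrightarrow> continuous_on UNIV f"
| "Ck_fun (Suc k) f \<longleftrightarrow> (\<forall>x. f differentiable at x) \<and> (\<forall>i. Ck_fun k (partial_deriv i f))"

definition test_functions :: "(real^2) set \<Rightarrow> (real^2 \<Rightarrow> real) set" where
  "test_functions S = {\<phi>. (\<forall>k. Ck_fun k \<phi>) \<and>
     compact (closure {x. \<phi> x \<noteq> 0}) \<and> closure {x. \<phi> x \<noteq> 0} \<subseteq> S}"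

text \<open>
  The scalar curl is \<open>\<partial>\<^sub>1 u\<^sub>2 - \<partial>\<^sub>2 u\<^sub>1\<close>, taken in the sense of distributions;
  \<open>w\<close> below is the weak curl of \<open>u\<close>.
\<close>

definition H_curl :: "(real^2) set \<Rightarrow> (real^2 \<Rightarrow> real^2) set" where
  "H_curl S = {u \<in> L2_on S. \<exists>w \<in> L2_on S. \<forall>\<phi> \<in> test_functions S.
     (LINT x|lebesgue_on S. u x $ 1 * partial_deriv 2 \<phi> x - u x $ 2 * partial_deriv 1 \<phi> x) =
     (LINT x|lebesgue_on S. (w x :: real) * \<phi> x)}"

definition lipschitz_boundary :: "(real^2) set \<Rightarrow> bool" where
  "lipschitz_boundary S \<longleftrightarrow> (\<forall>x \<in> frontier S.
     \<exists>T \<phi> L a b. orthogonal_transformation T \<and> L-lipschitz_on UNIV \<phi> \<and> 0 < a \<and> 0 < b \<and>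
       (\<forall>y :: real^2. \<bar>y$1\<bar> < a \<and> \<bar>y$2\<bar> < b \<longrightarrow> (x + T y \<in> S \<longleftrightarrow> \<phi> (y$1) < y$2)))"

text \<open>On closed sets, continuous differentiability is understood up to the boundary.\<close>

definition C1_on :: "(real^2) set \<Rightarrow> (real^2 \<Rightarrow> real^2) \<Rightarrow> bool" where
  "C1_on S f \<longleftrightarrow> (\<exists>f' :: real^2 \<Rightarrow> real^2^2.
     (\<forall>x\<in>S. (f has_derivative (*v) (f' x)) (at x within S)) \<and> continuous_on S f')"

definition C1_diffeo_on :: "(real^2) set \<Rightarrow> (real^2 \<Rightarrow> real^2) \<Rightarrow> bool" where
  "C1_diffeo_on S f \<longleftrightarrow> inj_on f S \<and> C1_on S f \<and> C1_on (f ` S) (inv_into S f)"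


section \<open>Pushforward and pullback of vector fields\<close>

text \<open>
  \<open>push S F\<close> is \<open>(DF\<^sup>-\<^sup>T u) \<circ> F\<^sup>-\<^sup>1\<close>, where \<open>F\<close> is inverted on \<open>S\<close>, and \<open>pull F\<close> is its inverse.
  Where \<open>F\<close> is not differentiable the values are irrelevant: in all uses this is a null set.
\<close>

definition push :: "(real^2) set \<Rightarrow> (real^2 \<Rightarrow> real^2) \<Rightarrow> (real^2 \<Rightarrow> real^2) \<Rightarrow> real^2 \<Rightarrow> real^2" where
  "push S F u x = (let y = inv_into S F x in
     transpose (matrix_inv (jacobian F (at y))) *v u y)"

definition pull :: "(real^2 \<Rightarrow> real^2) \<Rightarrow> (real^2 \<Rightarrow> real^2) \<Rightarrow> real^2 \<Rightarrow> real^2" where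
  "pull F u y = transpose (jacobian F (at y)) *v u (F y)"


section \<open>Splines\<close>

text \<open>
  Cox--de Boor recursion on \<open>[0,1]\<close>. The convention \<open>0/0 = 0\<close> for repeated knots is that of HOL
  division. The last non-empty knot interval is closed at the right endpoint \<open>1\<close>.
\<close>

fun bspline :: "(nat \<Rightarrow> real) \<Rightarrow> nat \<Rightarrow> nat \<Rightarrow> real \<Rightarrow> real" where
  "bspline \<xi> 0 i x =
     (if \<xi> i \<le> x \<and> x < \<xi> (i+1) \<or> x = 1 \<and> \<xi> i < 1 \<and> \<xi> (i+1) = 1 then 1 else 0)"
| "bspline \<xi> (Suc d) i x =
     (x - \<xi> i) / (\<xi> (i+d+1) - \<xi> i) * bspline \<xi> d i x +
     (\<xi> (i+d+2) - x) / (\<xi> (i+d+2) - \<xi> (i+1)) * bspline \<xi> d (i+1) x"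

text \<open>
  Clamped knot vector \<open>\<xi>\<^sub>0, \<dots>, \<xi>\<^sub>n\<^sub>+\<^sub>p\<^sub>+\<^sub>1\<close> of degree \<open>p\<close> with uniformly spaced distinct knots
  and interior multiplicity \<open>m\<close>; \<open>N\<close> is the number of cells.
\<close>

definition clamped_knots :: "nat \<Rightarrow> nat \<Rightarrow> nat \<Rightarrow> (nat \<Rightarrow> real) \<Rightarrow> bool" where
  "clamped_knots p m n \<xi> \<longleftrightarrow> mono_on {..n+p+1} \<xi> \<and>
     (\<exists>N\<ge>1. \<xi> ` {..n+p+1} = {real j / real N | j. j \<le> N} \<and>
        card {i. i \<le> n+p+1 \<and> \<xi> i = 0} = p + 1 \<and>
        card {i. i \<le> n+p+1 \<and> \<xi> i = 1} = p + 1 \<and>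
        (\<forall>j\<in>{1..<N}. card {i. i \<le> n+p+1 \<and> \<xi> i = real j / real N} = m))"

definition uniformly_subdivides :: "real set \<Rightarrow> real set \<Rightarrow> bool" where
  "uniformly_subdivides X Y \<longleftrightarrow> (\<exists>s\<ge>(1::nat). \<forall>a\<in>X. \<forall>b\<in>X. a < b \<and> X \<inter> {a<..<b} = {} \<longrightarrow>
     Y \<inter> {a..b} = {a + real i / real s * (b - a) | i. i \<le> s})"

definition lin_combs :: "nat set \<Rightarrow> (nat \<Rightarrow> real \<Rightarrow> real) \<Rightarrow> (real \<Rightarrow> real) set" where
  "lin_combs I f = {\<lambda>x. \<Sum>i\<in>I. c i * f i x | c. True}"

definition tensor_combs ::
  "nat set \<Rightarrow> (nat \<Rightarrow> real \<Rightarrow> real) \<Rightarrow> nat set \<Rightarrow> (nat \<Rightarrow> real \<Rightarrow> real) \<Rightarrow> (real^2 \<Rightarrow> real) set" where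
  "tensor_combs I f J g = {\<lambda>x. \<Sum>i\<in>I. \<Sum>j\<in>J. c i j * f i (x$1) * g j (x$2) | c. True}"


section \<open>Multipatch domains with spline spaces\<close>

text \<open>
  Patches are numbered \<open>1, \<dots>, npatch\<close>. For an interior edge \<open>e\<close>, \<open>kcoarse e\<close> and \<open>kfine e\<close> are the
  patches \<open>k\<^sup>-\<close> and \<open>k\<^sup>+\<close> and \<open>emap e\<close> is the edge map \<open>F\<^sub>e\<close>; on other sets these fields
  are irrelevant.
\<close>

record multipatch =
  Dom :: "(real^2) set"
  npatch :: nat
  pmap :: "nat \<Rightarrow> real^2 \<Rightarrow> real^2"
  sdeg :: nat
  smult :: nat
  sdim :: "nat \<Rightarrow> nat"
  knot :: "nat \<Rightarrow> nat \<Rightarrow> real"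
  kcoarse :: "(real^2) set \<Rightarrow> nat"
  kfine :: "(real^2) set \<Rightarrow> nat"
  emap :: "(real^2) set \<Rightarrow> real^2 \<Rightarrow> real^2"

definition patches :: "multipatch \<Rightarrow> nat set" where
  "patches M = {1..npatch M}"

definition patch :: "multipatch \<Rightarrow> nat \<Rightarrow> (real^2) set" where
  "patch M k = pmap M k ` box 0 1"

definition patch_edges :: "multipatch \<Rightarrow> nat \<Rightarrow> (real^2) set set" where
  "patch_edges M k = {pmap M k ` {x \<in> cbox 0 1. x $ i = c} | i c. c \<in> {0, 1}}"

definition patch_vertices :: "multipatch \<Rightarrow> nat \<Rightarrow> (real^2) set" where
  "patch_vertices M k = pmap M k ` {x. \<forall>i. x $ i \<in> {0, 1}}"

definition edges :: "multipatch \<Rightarrow> (real^2) set set" where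
  "edges M = (\<Union>k\<in>patches M. patch_edges M k)"

definition edge_patches :: "multipatch \<Rightarrow> (real^2) set \<Rightarrow> nat set" where
  "edge_patches M e = {k \<in> patches M. e \<subseteq> frontier (patch M k)}"

definition interior_edge :: "multipatch \<Rightarrow> (real^2) set \<Rightarrow> bool" where
  "interior_edge M e \<longleftrightarrow> e \<in> edges M \<and> card (edge_patches M e) = 2"

definition multipatch_domain :: "multipatch \<Rightarrow> bool" where
  "multipatch_domain M \<longleftrightarrow>
     open (Dom M) \<and> connected (Dom M) \<and> Dom M \<noteq> {} \<and> bounded (Dom M) \<and>
     lipschitz_boundary (Dom M) \<and>
     Dom M = interior (\<Union>k\<in>patches M. closure (patch M k)) \<and>
     (\<forall>k\<in>patches M. C1_diffeo_on (cbox 0 1) (pmap M k)) \<and>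
     (\<forall>k\<in>patches M. \<forall>l\<in>patches M. k \<noteq> l \<longrightarrow>
        patch M k \<inter> patch M l = {} \<and>
        (let I = closure (patch M k) \<inter> closure (patch M l) in
           I = {} \<or>
           (\<exists>v \<in> patch_vertices M k \<inter> patch_vertices M l. I = {v}) \<or>
           I \<in> patch_edges M k \<inter> patch_edges M l))"

definition knots :: "multipatch \<Rightarrow> nat \<Rightarrow> real set" where
  "knots M k = knot M k ` {..sdim M k + sdeg M + 1}"

definition multipatch_splines :: "multipatch \<Rightarrow> bool" where
  "multipatch_splines M \<longleftrightarrow>
     1 \<le> smult M \<and> smult M \<le> sdeg M \<and>
     (\<forall>k\<in>patches M. clamped_knots (sdeg M) (smult M) (sdim M k) (knot M k) \<and>
        sdeg M + 1 < sdim M k) \<and>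
     (\<forall>e. interior_edge M e \<longrightarrow> edge_patches M e = {kcoarse M e, kfine M e} \<and>
        uniformly_subdivides (knots M (kcoarse M e)) (knots M (kfine M e)))"

text \<open>
  \<open>\<lambda>\<^sup>k\<^sub>i\<close> and \<open>\<lambda>\<^sup>1\<^sup>,\<^sup>k\<^sub>i\<close>. The latter lives on the knots \<open>\<xi>\<^sub>1, \<dots>, \<xi>\<^sub>n\<^sub>+\<^sub>p\<close>, whence the index shift.
\<close>

definition lam0 :: "multipatch \<Rightarrow> nat \<Rightarrow> nat \<Rightarrow> real \<Rightarrow> real" where
  "lam0 M k i = bspline (knot M k) (sdeg M) i"

definition lam1 :: "multipatch \<Rightarrow> nat \<Rightarrow> nat \<Rightarrow> real \<Rightarrow> real" where
  "lam1 M k i = bspline (knot M k) (sdeg M - 1) (i + 1)"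

definition V1_spline :: "multipatch \<Rightarrow> nat \<Rightarrow> (real \<Rightarrow> real) set" where
  "V1_spline M k = lin_combs {..<sdim M k} (lam1 M k)"

definition V1_hat :: "multipatch \<Rightarrow> nat \<Rightarrow> (real^2 \<Rightarrow> real^2) set" where
  "V1_hat M k = {u.
     (\<lambda>x. u x $ 1) \<in> tensor_combs {..<sdim M k} (lam1 M k) {..sdim M k} (lam0 M k) \<and>
     (\<lambda>x. u x $ 2) \<in> tensor_combs {..sdim M k} (lam0 M k) {..<sdim M k} (lam1 M k)}"

definition V1_pw :: "multipatch \<Rightarrow> (real^2 \<Rightarrow> real^2) set" where
  "V1_pw M = {v \<in> L2_on (Dom M). \<forall>k\<in>patches M. \<exists>u\<in>V1_hat M k.
     ae_eq_on (patch M k) v (push (cbox 0 1) (pmap M k) u)}"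

definition V1_h :: "multipatch \<Rightarrow> (real^2 \<Rightarrow> real^2) set" where
  "V1_h M = V1_pw M \<inter> H_curl (Dom M)"


section \<open>Edge operators\<close>

abbreviation edge_rect :: "(real^2) set" where
  "edge_rect \<equiv> cbox (vector [0, -1]) (vector [1, 1])"

abbreviation minus_square :: "(real^2) set" where
  "minus_square \<equiv> cbox (vector [0, -1]) (vector [1, 0])"

abbreviation plus_square :: "(real^2) set" where
  "plus_square \<equiv> cbox 0 1"

definition coord_change :: "(real^2 \<Rightarrow> real^2) \<Rightarrow> bool" where
  "coord_change A \<longleftrightarrow> (\<exists>t a b. a \<in> {-1, 1} \<and> b \<in> {-1, 1} \<and>
     (A = (\<lambda>x. t + vector [a * x$1, b * x$2]) \<or> A = (\<lambda>x. t + vector [a * x$2, b * x$1])))"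

definition edge_dom :: "multipatch \<Rightarrow> (real^2) set \<Rightarrow> (real^2) set" where
  "edge_dom M e = interior (closure (patch M (kcoarse M e)) \<union> closure (patch M (kfine M e)))"

definition edge_maps :: "multipatch \<Rightarrow> bool" where
  "edge_maps M \<longleftrightarrow> (\<forall>e. interior_edge M e \<longrightarrow>
     (\<exists>G. homeomorphism edge_rect (closure (edge_dom M e)) (emap M e) G) \<and>
     emap M e ` {x \<in> edge_rect. x $ 2 = 0} = e \<and>
     (\<exists>A. coord_change A \<and> A ` minus_square = cbox 0 1 \<and>
        (\<forall>x\<in>minus_square. emap M e x = pmap M (kcoarse M e) (A x))) \<and>
     (\<exists>A. coord_change A \<and> A ` plus_square = cbox 0 1 \<and>
        (\<forall>x\<in>plus_square. emap M e x = pmap M (kfine M e) (A x))) \<and>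
     C1_diffeo_on minus_square (emap M e) \<and> C1_diffeo_on plus_square (emap M e))"

text \<open>
  \<open>\<gamma> k\<close> is the vector \<open>\<gamma>\<^sup>1\<^sup>d\<close> of patch \<open>k\<close>, with components \<open>1, \<dots>, r\<close>. The linear system
  \<open>M\<^sup>k \<gamma> = b\<^sup>k\<close> is tested with all polynomials of degree at most \<open>r - 1\<close>, written \<open>degree q < r\<close>
  so that it is empty for \<open>r = 0\<close>.
\<close>

definition correction_coeffs :: "multipatch \<Rightarrow> nat \<Rightarrow> (nat \<Rightarrow> nat \<Rightarrow> real) \<Rightarrow> bool" where
  "correction_coeffs M r \<gamma> \<longleftrightarrow>
     (\<forall>k\<in>patches M. \<forall>q :: real poly. degree q < r \<longrightarrow>
        (\<Sum>m=1..r. \<gamma> k m * (LINT x|lebesgue_on {0..1}. lam0 M k m x * poly q x)) =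
        (LINT x|lebesgue_on {0..1}. lam0 M k 0 x * poly q x)) \<and>
     (\<forall>k\<in>patches M. \<forall>l\<in>patches M. patch_vertices M k \<inter> patch_vertices M l \<noteq> {} \<longrightarrow>
        (\<forall>m\<in>{1..r}. \<gamma> k m = \<gamma> l m))"

definition lam_minus :: "multipatch \<Rightarrow> (real^2) set \<Rightarrow> nat \<Rightarrow> real \<Rightarrow> real" where
  "lam_minus M e i t = (if t \<in> {-1..0} then lam0 M (kcoarse M e) i (- t) else 0)"

definition lam_plus :: "multipatch \<Rightarrow> (real^2) set \<Rightarrow> nat \<Rightarrow> real \<Rightarrow> real" where
  "lam_plus M e i t = (if t \<in> {0<..1} then lam0 M (kfine M e) i t else 0)"

definition lam_bar :: "multipatch \<Rightarrow> (real^2) set \<Rightarrow> real \<Rightarrow> real" where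
  "lam_bar M e t = (lam_minus M e 0 t + lam_plus M e 0 t) / 2"

text \<open>The two patches of \<open>e\<close> share a vertex, so \<open>\<gamma> (kcoarse M e)\<close> and \<open>\<gamma> (kfine M e)\<close> agree.\<close>

definition corr :: "multipatch \<Rightarrow> nat \<Rightarrow> (nat \<Rightarrow> nat \<Rightarrow> real) \<Rightarrow> (real^2) set \<Rightarrow> real \<Rightarrow> real" where
  "corr M r \<gamma> e t =
     (\<Sum>m=1..r. \<gamma> (kcoarse M e) m * (lam_minus M e m t - lam_plus M e m t)) / 2"

definition L2_proj_coarse :: "multipatch \<Rightarrow> (real^2) set \<Rightarrow> (real \<Rightarrow> real) \<Rightarrow> real \<Rightarrow> real" where
  "L2_proj_coarse M e f = (SOME g. g \<in> V1_spline M (kcoarse M e) \<and>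
     (\<forall>s \<in> V1_spline M (kcoarse M e).
        (LINT x|lebesgue_on {0..1}. g x * s x) = (LINT x|lebesgue_on {0..1}. f x * s x)))"

text \<open>
  A linear combination, with coefficients \<open>a\<close> on the coarse and \<open>b\<close> on the fine side, of the
  tensor-product basis of the tangential logical space of \<open>e\<close> and, below, of the images of the
  basis functions under the edge operator.
\<close>

definition edge_comb ::
  "multipatch \<Rightarrow> (real^2) set \<Rightarrow> (nat \<Rightarrow> nat \<Rightarrow> real) \<Rightarrow> (nat \<Rightarrow> nat \<Rightarrow> real) \<Rightarrow> real^2 \<Rightarrow> real" where
  "edge_comb M e a b x =
     (\<Sum>i<sdim M (kcoarse M e). \<Sum>j\<le>sdim M (kcoarse M e).
        a i j * (lam1 M (kcoarse M e) i (x$1) * lam_minus M e j (x$2))) +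
     (\<Sum>i<sdim M (kfine M e). \<Sum>j\<le>sdim M (kfine M e).
        b i j * (lam1 M (kfine M e) i (x$1) * lam_plus M e j (x$2)))"

definition edge_image_minus ::
  "multipatch \<Rightarrow> nat \<Rightarrow> (nat \<Rightarrow> nat \<Rightarrow> real) \<Rightarrow> (real^2) set \<Rightarrow> nat \<Rightarrow> nat \<Rightarrow> real^2 \<Rightarrow> real" where
  "edge_image_minus M r \<gamma> e i j x =
     (if j = 0 then lam1 M (kcoarse M e) i (x$1) * (lam_bar M e (x$2) + corr M r \<gamma> e (x$2))
      else lam1 M (kcoarse M e) i (x$1) * lam_minus M e j (x$2))"

definition edge_image_plus ::
  "multipatch \<Rightarrow> nat \<Rightarrow> (nat \<Rightarrow> nat \<Rightarrow> real) \<Rightarrow> (real^2) set \<Rightarrow> nat \<Rightarrow> nat \<Rightarrow> real^2 \<Rightarrow> real" where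
  "edge_image_plus M r \<gamma> e i j x =
     (if j = 0 then L2_proj_coarse M e (lam1 M (kfine M e) i) (x$1) *
        (lam_bar M e (x$2) - corr M r \<gamma> e (x$2))
      else lam1 M (kfine M e) i (x$1) * lam_plus M e j (x$2))"

definition edge_image_comb ::
  "multipatch \<Rightarrow> nat \<Rightarrow> (nat \<Rightarrow> nat \<Rightarrow> real) \<Rightarrow> (real^2) set \<Rightarrow>
   (nat \<Rightarrow> nat \<Rightarrow> real) \<Rightarrow> (nat \<Rightarrow> nat \<Rightarrow> real) \<Rightarrow> real^2 \<Rightarrow> real" where
  "edge_image_comb M r \<gamma> e a b x =
     (\<Sum>i<sdim M (kcoarse M e). \<Sum>j\<le>sdim M (kcoarse M e). a i j * edge_image_minus M r \<gamma> e i j x) +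
     (\<Sum>i<sdim M (kfine M e). \<Sum>j\<le>sdim M (kfine M e). b i j * edge_image_plus M r \<gamma> e i j x)"

text \<open>
  The linear extension: the coefficients of a member of the tangential logical space are
  unique in the index range of \<open>edge_comb\<close>, because the basis is linearly independent up to null sets.
\<close>

definition edge_op_hat ::
  "multipatch \<Rightarrow> nat \<Rightarrow> (nat \<Rightarrow> nat \<Rightarrow> real) \<Rightarrow> (real^2) set \<Rightarrow> (real^2 \<Rightarrow> real) \<Rightarrow> real^2 \<Rightarrow> real" where
  "edge_op_hat M r \<gamma> e g =
     (let (a, b) = (SOME (a, b). ae_eq_on edge_rect g (edge_comb M e a b))
      in edge_image_comb M r \<gamma> e a b)"

definition edge_op ::
  "multipatch \<Rightarrow> nat \<Rightarrow> (nat \<Rightarrow> nat \<Rightarrow> real) \<Rightarrow> (real^2) set \<Rightarrow> (real^2 \<Rightarrow> real^2) \<Rightarrow> real^2 \<Rightarrow> real^2" where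
  "edge_op M r \<gamma> e u =
     (if interior_edge M e then
        (let v = pull (emap M e) u;
             w = (\<lambda>y. vector [edge_op_hat M r \<gamma> e (\<lambda>z. v z $ 1) y, v y $ 2])
         in (\<lambda>x. if x \<in> edge_dom M e then push edge_rect (emap M e) w x else u x))
      else u)"

definition edge_op_prod ::
  "multipatch \<Rightarrow> nat \<Rightarrow> (nat \<Rightarrow> nat \<Rightarrow> real) \<Rightarrow> (real^2) set list \<Rightarrow>
   (real^2 \<Rightarrow> real^2) \<Rightarrow> real^2 \<Rightarrow> real^2" where
  "edge_op_prod M r \<gamma> es = foldr (\<lambda>e P. edge_op M r \<gamma> e \<circ> P) es id"


section \<open>Projections and moment preservation\<close>

text \<open>
  Operators on \<open>V1_pw\<close> act on representatives; the first conjunct says that they descend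
  to almost-everywhere classes.
\<close>

definition linear_operator :: "multipatch \<Rightarrow> ((real^2 \<Rightarrow> real^2) \<Rightarrow> real^2 \<Rightarrow> real^2) \<Rightarrow> bool" where
  "linear_operator M P \<longleftrightarrow>
     (\<forall>u\<in>V1_pw M. \<forall>v\<in>V1_pw M. ae_eq_on (Dom M) u v \<longrightarrow> ae_eq_on (Dom M) (P u) (P v)) \<and>
     (\<forall>u\<in>V1_pw M. P u \<in> V1_pw M) \<and>
     (\<forall>u\<in>V1_pw M. \<forall>v\<in>V1_pw M. \<forall>a b.
        ae_eq_on (Dom M) (P (\<lambda>x. a *\<^sub>R u x + b *\<^sub>R v x)) (\<lambda>x. a *\<^sub>R P u x + b *\<^sub>R P v x))"

definition projection_onto ::
  "multipatch \<Rightarrow> ((real^2 \<Rightarrow> real^2) \<Rightarrow> real^2 \<Rightarrow> real^2) \<Rightarrow> (real^2 \<Rightarrow> real^2) set \<Rightarrow> bool" where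
  "projection_onto M P W \<longleftrightarrow> linear_operator M P \<and>
     (\<forall>u\<in>V1_pw M. ae_eq_on (Dom M) (P (P u)) (P u)) \<and>
     (\<forall>u\<in>V1_pw M. P u \<in> W) \<and> (\<forall>w\<in>W. \<exists>u\<in>V1_pw M. ae_eq_on (Dom M) (P u) w)"

text \<open>Vector polynomials of degree less than \<open>r\<close> in each variable; only \<open>0\<close> if \<open>r = 0\<close>.\<close>

definition vec_polys :: "nat \<Rightarrow> (real^2 \<Rightarrow> real^2) set" where
  "vec_polys r = {\<lambda>x. \<chi> l. \<Sum>i<r. \<Sum>j<r. c l i j * (x$1)^i * (x$2)^j | c. True}"

definition moment_preserving ::
  "multipatch \<Rightarrow> nat \<Rightarrow> ((real^2 \<Rightarrow> real^2) \<Rightarrow> real^2 \<Rightarrow> real^2) \<Rightarrow> bool" where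
  "moment_preserving M r P \<longleftrightarrow>
     (\<forall>u\<in>V1_pw M. \<forall>k\<in>patches M. \<forall>q\<in>vec_polys r.
        (LINT x|lebesgue_on (box 0 1). pull (pmap M k) (P u) x \<bullet> q x) =
        (LINT x|lebesgue_on (box 0 1). pull (pmap M k) u x \<bullet> q x))"

end

theory Submission
  imports Defs
begin

text \<open>
  Let \<open>V\<close> be the broken space. By integration by parts, a field in \<open>V\<close> belongs to \<open>H(curl)\<close> if and
  only if its tangential traces from the two sides agree on every interior edge. So it suffices to
  show, for a single interior edge \<open>e\<close>, that \<open>P\<^sub>e\<close> maps \<open>V\<close> into itself, makes the two traces on
  \<open>e\<close> agree, keeps the traces on all other edges, preserves moments, and fixes every field
  whose traces on \<open>e\<close> agree already. Then every factor of the product establishes conformity at its own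
  edge without destroying it elsewhere, whatever the order, and the product fixes the conforming fields.

  \<^bold>\<open>A single edge.\<close> Each patch is viewed in a chart of the unit square that has \<open>e\<close> as its bottom
  side. There, with \<open>A\<close> and \<open>B\<close> the coarse and the fine trace and \<open>R\<close> the \<open>L\<^sup>2\<close> projection of \<open>B\<close> onto the
  coarse trace space, \<open>P\<^sub>e\<close> subtracts \<open>(A - R) / 2 \<otimes> \<chi>\<close> from the tangential component on the
  coarse side and adds \<open>(A - R) / 2 \<otimes> \<chi> - (B - R) \<otimes> \<lambda>\<^sub>0\<close> on the fine side (\<open>edge_op_local\<close>).
  The profile \<open>\<chi> = \<lambda>\<^sub>0 - (\<Sum>m=1..r. \<gamma>\<^sub>m \<lambda>\<^sub>m)\<close> has the values one and zero at the
  two ends, and the equations for \<open>\<gamma>\<close> say that its moments of order below \<open>r\<close> vanish. So both traces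
  become \<open>(A + R) / 2\<close>. The moments of \<open>(B - R) \<otimes> \<lambda>\<^sub>0\<close> vanish as well, since \<open>B - R\<close> is orthogonal to
  the coarse trace space, which contains the polynomials of degree below \<open>p\<close>. The corrections are invisible on the
  other three sides: on the adjacent ones the tangential component is the other one, and on the opposite side
  they are zero. If \<open>A = B\<close>, then \<open>B\<close> belongs to the coarse space, so \<open>R = B\<close> and nothing changes.
  On the fine side the corrections are splines of the patch because coarse splines are fine splines: both
  spaces have bases of truncated powers (\<open>trunc_pow_triangular\<close>).

  \<^bold>\<open>Conformity.\<close> On each patch the covariant transform reduces the weak curl to integration by parts
  for tensor-product splines on the square (\<open>patch_by_parts\<close>). The boundary terms are sorted by edges. At an edge
  of only one patch the test function vanishes, because the inner points of the edge lie outside the domain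
  (\<open>boundary_edge_notin_Dom\<close>). At an interior edge the charts have opposite orientation (\<open>opposite_orientation\<close>), so the jump of the
  traces remains. If there is no jump, the patchwise curl is the weak curl (\<open>jump_free_H_curl\<close>). Conversely, a jump is felt by a
  test function of width \<open>\<epsilon>\<close> as a term of order \<open>\<epsilon>\<close>, whereas a square integrable curl contributes
  only \<open>o(\<epsilon>)\<close> (\<open>H_curl_traces_agree\<close>).
\<close>

abbreviation borel_fun where "borel_fun f \<equiv> f \<in> borel_measurable borel"

section \<open>B-splines on knot sequences\<close>

lemma bspline_cong:
  assumes "\<And>l. i \<le> l \<Longrightarrow> l \<le> i + e + 1 \<Longrightarrow> \<xi> l = \<zeta> l"
  shows "bspline \<xi> e i x = bspline \<zeta> e i x"
  using assms
proof (induction e arbitrary: i)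
  case 0
  then show ?case by auto
next
  case (Suc e)
  have a: "bspline \<xi> e i x = bspline \<zeta> e i x" by (rule Suc.IH) (use Suc.prems in auto)
  have b: "bspline \<xi> e (i+1) x = bspline \<zeta> e (i+1) x" by (rule Suc.IH) (use Suc.prems in auto)
  show ?case
    using a b Suc.prems[of i] Suc.prems[of "i+1"] Suc.prems[of "i+e+1"] Suc.prems[of "i+e+2"] by simp
qed

lemma bspline_shift: "bspline \<xi> e (i + 1) x = bspline (\<lambda>l. \<xi> (l + 1)) e i x"
proof (induction e arbitrary: i)
  case (Suc e)
  show ?case using Suc.IH[of i] Suc.IH[of "Suc i"] by (simp add: algebra_simps)
qed auto

text \<open>
  Everything about B-splines at a point \<open>x\<close> depends only on the knots and on the index of the
  knot interval containing \<open>x\<close>, which is the meaning of the following predicate. Phrasing it through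
  the B-splines of degree zero covers the right endpoint \<open>x = 1\<close> as well.
\<close>

definition active_cell :: "(nat \<Rightarrow> real) \<Rightarrow> real \<Rightarrow> nat \<Rightarrow> bool" where
  "active_cell \<xi> x j \<longleftrightarrow> \<xi> j \<le> x \<and> \<xi> j < \<xi> (Suc j) \<and> (\<forall>i. bspline \<xi> 0 i x = (if i = j then 1 else 0))"

lemma bspline_support:
  assumes "active_cell \<xi> x j" "i > j \<or> i + e < j"
  shows "bspline \<xi> e i x = 0"
  using assms(2)
proof (induction e arbitrary: i)
  case 0
  then show ?case using assms(1) unfolding active_cell_def by (metis add_0_right nat_neq_iff)
next
  case (Suc e)
  have "bspline \<xi> e i x = 0" "bspline \<xi> e (i+1) x = 0" using Suc by auto
  then show ?case by simp
qed

text \<open>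
  Marsden's identity, by induction on the degree: the two terms of the recursion in which a given
  B-spline of lower degree occurs combine to the factor \<open>x - \<tau>\<close>.
\<close>

lemma marsden:
  assumes mono: "mono \<xi>" and act: "active_cell \<xi> x j" and "d \<le> j" "j \<le> K"
  shows "(\<Sum>i\<le>K. (\<Prod>l=1..d. \<xi> (i+l) - \<tau>) * bspline \<xi> d i x) = (x - \<tau>) ^ d"
  using \<open>d \<le> j\<close>
proof (induction d)
  case 0
  have "(\<Sum>i\<le>K. bspline \<xi> 0 i x) = (\<Sum>i\<le>K. if i = j then 1 else 0)"
    using act unfolding active_cell_def by (intro sum.cong) auto
  then show ?case using \<open>j \<le> K\<close> by simp
next
  case (Suc d)
  define \<psi> where "\<psi> e i = (\<Prod>l=1..e. \<xi> (i+l) - \<tau>)" for e i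
  define a where "a i = (x - \<xi> i) / (\<xi> (i+d+1) - \<xi> i)" for i
  define b where "b i = (\<xi> (i+d+1) - x) / (\<xi> (i+d+1) - \<xi> i)" for i
  let ?B = "\<lambda>i. bspline \<xi> d i x"
  have rec: "bspline \<xi> (Suc d) i x = a i * ?B i + b (Suc i) * ?B (Suc i)" for i
    by (simp add: a_def b_def)
  have B0: "?B 0 = 0" using bspline_support[OF act] Suc.prems by auto
  have BK: "?B (Suc K) = 0" using bspline_support[OF act] \<open>j \<le> K\<close> by auto
  have "(\<Sum>i\<le>K. \<psi> (Suc d) i * bspline \<xi> (Suc d) i x) =
     (\<Sum>i\<le>K. \<psi> (Suc d) i * a i * ?B i) + (\<Sum>i\<le>K. \<psi> (Suc d) i * b (Suc i) * ?B (Suc i))"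
    unfolding rec sum.distrib[symmetric] by (intro sum.cong refl) (simp add: algebra_simps)
  also have "(\<Sum>i\<le>K. \<psi> (Suc d) i * b (Suc i) * ?B (Suc i)) =
     (\<Sum>i\<le>Suc K. \<psi> (Suc d) (i - 1) * b i * ?B i)"
    using sum.atMost_Suc_shift[of "\<lambda>i. \<psi> (Suc d) (i - 1) * b i * ?B i" K] by (simp add: B0)
  also have "\<dots> = (\<Sum>i\<le>K. \<psi> (Suc d) (i - 1) * b i * ?B i)"
    by (simp add: BK del: sum.atMost_Suc_shift)
  also have "(\<Sum>i\<le>K. \<psi> (Suc d) i * a i * ?B i) + \<dots> = (\<Sum>i\<le>K. (x - \<tau>) * (\<psi> d i * ?B i))"
    unfolding sum.distrib[symmetric]
  proof (intro sum.cong refl)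
    fix i assume "i \<in> {..K}"
    show "\<psi> (Suc d) i * a i * ?B i + \<psi> (Suc d) (i - 1) * b i * ?B i = (x - \<tau>) * (\<psi> d i * ?B i)"
    proof (cases "?B i = 0")
      case False
      then have "i \<le> j" "j \<le> i + d" using bspline_support[OF act] by (meson not_le)+
      with Suc.prems have "0 < i" by simp
      have "\<xi> i \<le> \<xi> j" "\<xi> (Suc j) \<le> \<xi> (i+d+1)"
        using \<open>i \<le> j\<close> \<open>j \<le> i + d\<close> mono by (auto intro!: monoD[OF mono])
      then have ne: "\<xi> i < \<xi> (i+d+1)" using act unfolding active_cell_def by linarith
      have p1: "\<psi> (Suc d) i = \<psi> d i * (\<xi> (i+d+1) - \<tau>)"
        unfolding \<psi>_def by (simp add: prod.nat_ivl_Suc' mult.commute)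
      have "\<psi> (Suc d) (i - 1) = (\<Prod>l=Suc 0..Suc d. \<xi> (i-1+l) - \<tau>)" by (simp add: \<psi>_def)
      also have "\<dots> = (\<Prod>l=0..d. \<xi> (i+l) - \<tau>)"
        using \<open>0 < i\<close> by (subst prod.shift_bounds_cl_Suc_ivl) (auto intro!: prod.cong)
      also have "\<dots> = (\<xi> i - \<tau>) * \<psi> d i"
        unfolding \<psi>_def by (subst prod.atLeast_Suc_atMost) auto
      finally have p2: "\<psi> (Suc d) (i - 1) = (\<xi> i - \<tau>) * \<psi> d i" .
      have "(\<xi> (i+d+1) - \<tau>) * a i + (\<xi> i - \<tau>) * b i = x - \<tau>"
        using ne unfolding a_def b_def by (simp add: divide_simps) (simp add: algebra_simps)
      then have "\<psi> d i * ?B i * ((\<xi> (i+d+1) - \<tau>) * a i + (\<xi> i - \<tau>) * b i) = \<psi> d i * ?B i * (x - \<tau>)"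
        by simp
      then show ?thesis unfolding p1 p2 by (simp add: algebra_simps)
    qed simp
  qed
  also have "\<dots> = (x - \<tau>) * (x - \<tau>) ^ d"
    using Suc.IH Suc.prems unfolding \<psi>_def by (simp add: sum_distrib_left[symmetric])
  finally show ?case unfolding \<psi>_def by simp
qed

text \<open>Knot sequences are infinite here; a clamped knot vector is continued by copies of its last knot.\<close>

definition clamped_seq :: "nat \<Rightarrow> nat \<Rightarrow> (nat \<Rightarrow> real) \<Rightarrow> bool" where
  "clamped_seq d n \<xi> \<longleftrightarrow> mono \<xi> \<and> d \<le> n \<and> (\<forall>i. \<xi> i = 0 \<longleftrightarrow> i \<le> d) \<and> (\<forall>i. \<xi> i = 1 \<longleftrightarrow> n < i)"

lemma clamped_seq_range:
  assumes "clamped_seq d n \<xi>" shows "0 \<le> \<xi> i" "\<xi> i \<le> 1"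
proof -
  have m: "mono \<xi>" and z: "\<xi> 0 = 0" and o: "\<xi> (i + n + 1) = 1"
    using assms unfolding clamped_seq_def by auto
  show "0 \<le> \<xi> i" using monoD[OF m, of 0 i] z by simp
  show "\<xi> i \<le> 1" using monoD[OF m, of i "i+n+1"] o by simp
qed

lemma ex_active_cell:
  assumes cl: "clamped_seq d n \<xi>" and x: "0 \<le> x" "x \<le> 1"
  obtains j where "active_cell \<xi> x j" "d \<le> j" "j \<le> n"
    "\<And>i. \<xi> i \<le> x \<Longrightarrow> i \<le> n \<Longrightarrow> i \<le> j"
proof -
  have m: "mono \<xi>" and z: "\<And>i. \<xi> i = 0 \<longleftrightarrow> i \<le> d" and o: "\<And>i. \<xi> i = 1 \<longleftrightarrow> n < i" and dn: "d \<le> n"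
    using cl unfolding clamped_seq_def by auto
  define j where "j = Max {i. i \<le> n \<and> \<xi> i \<le> x}"
  have fin: "finite {i. i \<le> n \<and> \<xi> i \<le> x}" by auto
  have "d \<in> {i. i \<le> n \<and> \<xi> i \<le> x}" using z[of d] x dn by auto
  then have ne: "{i. i \<le> n \<and> \<xi> i \<le> x} \<noteq> {}" and dj: "d \<le> j"
    unfolding j_def using fin by (auto intro: Max_ge)
  have j: "j \<le> n" "\<xi> j \<le> x" using Max_in[OF fin ne] unfolding j_def by auto
  have mx: "i \<le> j" if "\<xi> i \<le> x" "i \<le> n" for i unfolding j_def using fin that by (auto intro: Max_ge)
  have rng: "0 \<le> \<xi> i" "\<xi> i \<le> 1" for i using clamped_seq_range[OF cl] by auto
  have lt: "\<xi> j < \<xi> (Suc j)"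
  proof (cases "Suc j \<le> n")
    case True
    then have "x < \<xi> (Suc j)" using mx[of "Suc j"] by force
    then show ?thesis using j by simp
  next
    case False
    then have "\<xi> (Suc j) = 1" using o by auto
    moreover have "\<xi> j \<noteq> 1" using o j by auto
    ultimately show ?thesis using rng(2)[of j] by simp
  qed
  have "bspline \<xi> 0 i x = (if i = j then 1 else 0)" for i
  proof -
    consider "i < j" | "i = j" | "j < i" by linarith
    then show ?thesis
    proof cases
      case 1
      then have "\<xi> (Suc i) \<le> \<xi> j" by (intro monoD[OF m]) auto
      moreover have "\<xi> j \<noteq> 1" using o j by auto
      ultimately have "\<xi> (Suc i) \<noteq> 1" using rng(2)[of j] by linarith
      then show ?thesis using 1 \<open>\<xi> (Suc i) \<le> \<xi> j\<close> j by simp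
    next
      case 2
      show ?thesis
      proof (cases "Suc j \<le> n")
        case True
        then have "x < \<xi> (Suc j)" using mx[of "Suc j"] by force
        then show ?thesis using 2 j by simp
      next
        case False
        then have "\<xi> (Suc j) = 1" using o by auto
        then show ?thesis using 2 j lt x by auto
      qed
    next
      case 3
      show ?thesis
      proof (cases "i \<le> n")
        case True
        then have "x < \<xi> i" using mx[of i] 3 by force
        then show ?thesis using 3 rng(2)[of i] by simp
      next
        case False
        then have "\<xi> i = 1" "\<xi> (Suc i) = 1" using o by auto
        then show ?thesis using 3 x by simp
      qed
    qed
  qed
  then have "active_cell \<xi> x j" using j lt unfolding active_cell_def by auto
  then show ?thesis using that j dj mx by blast
qed

lemma marsden_clamped:
  assumes cl: "clamped_seq d n \<xi>" and x: "0 \<le> x" "x \<le> 1"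
  shows "(\<Sum>i\<le>n. (\<Prod>l=1..d. \<xi> (i+l) - \<tau>) * bspline \<xi> d i x) = (x - \<tau>) ^ d"
proof -
  obtain j where "active_cell \<xi> x j" "d \<le> j" "j \<le> n" by (rule ex_active_cell[OF assms])
  then show ?thesis using marsden cl unfolding clamped_seq_def by blast
qed

text \<open>
  The truncated power attached to the knot with index \<open>i\<close>; \<open>k\<close> is the number of later copies of
  this knot.
\<close>

definition trunc_pow :: "real \<Rightarrow> nat \<Rightarrow> real \<Rightarrow> real" where
  "trunc_pow \<tau> e x = (if \<tau> \<le> x then (x - \<tau>) ^ e else 0)"

text \<open>
  The coefficient of \<open>z^k\<close> in Marsden's identity at \<open>\<tau> = \<xi> i + z\<close> is a truncated power. To the right
  of the knot, the B-splines with index below \<open>i\<close> that do not vanish have all \<open>k + 1\<close> copies of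
  the knot in the interior of their support, so their coefficients have a zero of order \<open>k + 1\<close>; the
  coefficient of the \<open>i\<close>-th B-spline has a zero of order exactly \<open>k\<close>. So the truncated powers and
  the B-splines are related by an invertible triangular system.
\<close>

lemma trunc_pow_triangular:
  assumes cl: "clamped_seq d n \<xi>" and i: "i \<le> n" and kd: "k \<le> d"
    and eq: "\<And>l. i \<le> l \<Longrightarrow> l \<le> i + k \<Longrightarrow> \<xi> l = \<xi> i" and gt: "\<xi> i < \<xi> (i + k + 1)"
  shows "\<exists>c. c i \<noteq> 0 \<and> (\<forall>x\<in>{0..1}. trunc_pow (\<xi> i) (d - k) x = (\<Sum>l=i..n. c l * bspline \<xi> d l x))"
proof -
  have m: "mono \<xi>" and o: "\<And>i. \<xi> i = 1 \<longleftrightarrow> n < i"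
    using cl unfolding clamped_seq_def by auto
  define \<Psi> where "\<Psi> j = (\<Prod>l=1..d. [:\<xi> (j+l) - \<xi> i, -1:])" for j
  have id: "(\<Sum>j\<le>n. coeff (\<Psi> j) k * bspline \<xi> d j x) = of_nat (d choose k) * (-1) ^ k * (x - \<xi> i) ^ (d - k)"
    if "0 \<le> x" "x \<le> 1" for x
  proof -
    have "(\<Sum>j\<le>n. Polynomial.smult (bspline \<xi> d j x) (\<Psi> j)) = [:x - \<xi> i, -1:] ^ d"
    proof (rule poly_eq_poly_eq_iff[THEN iffD1], rule ext)
      fix z
      show "poly (\<Sum>j\<le>n. Polynomial.smult (bspline \<xi> d j x) (\<Psi> j)) z = poly ([:x - \<xi> i, -1:] ^ d) z"
        using marsden_clamped[OF cl that, of "\<xi> i + z"]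
        by (simp add: poly_sum \<Psi>_def poly_prod algebra_simps)
    qed
    then have "coeff (\<Sum>j\<le>n. Polynomial.smult (bspline \<xi> d j x) (\<Psi> j)) k = coeff ([:x - \<xi> i, -1:] ^ d) k" by simp
    then show ?thesis using kd by (simp add: coeff_sum coeff_linear_poly_power mult.commute)
  qed
  have zero: "coeff (\<Psi> j) k = 0" if "\<And>l. i \<le> l \<Longrightarrow> l \<le> i + k \<Longrightarrow> j < l \<and> l \<le> j + d" for j
  proof -
    have "(\<Prod>l\<in>{i-j..i+k-j}. [:\<xi> (j+l) - \<xi> i, -1:]) dvd \<Psi> j"
      unfolding \<Psi>_def using that[of i] that[of "i+k"] by (intro prod_dvd_prod_subset) auto
    moreover have "(\<Prod>l\<in>{i-j..i+k-j}. [:\<xi> (j+l) - \<xi> i, -1:]) = (\<Prod>l\<in>{i-j..i+k-j}. [:0, -1:])"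
    proof (intro prod.cong refl)
      fix l assume "l \<in> {i-j..i+k-j}"
      then have "\<xi> (j+l) = \<xi> i" using that[of i] by (intro eq) auto
      then show "[:\<xi> (j+l) - \<xi> i, -1:] = [:0, -1:]" by simp
    qed
    moreover have "card {i-j..i+k-j} = k+1" using that[of i] by auto
    then have "(\<Prod>l\<in>{i-j..i+k-j}. [:0, -1::real:]) = [:0,-1:] ^ (k+1)" by (simp only: prod_constant)
    ultimately have "[:0,-1:] ^ (k+1) dvd \<Psi> j" by simp
    moreover have "monom 1 (k+1) dvd [:0,-1::real:] ^ (k+1)"
    proof -
      have "[:0,-1::real:] = - monom 1 1" by (simp add: monom_altdef)
      then show ?thesis by (metis dvd_power_same dvd_minus_iff dvd_refl monom_power power_one mult_1)
    qed
    ultimately have "monom 1 (k+1) dvd \<Psi> j" by (rule dvd_trans[rotated])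
    then show ?thesis unfolding monom_1_dvd_iff' by simp
  qed
  have nz: "coeff (\<Psi> i) k \<noteq> 0"
  proof -
    let ?Q = "\<Prod>l\<in>{k+1..d}. [:\<xi> (i+l) - \<xi> i, -1:]"
    have "\<Psi> i = (\<Prod>l\<in>{1..k}. [:\<xi> (i+l) - \<xi> i, -1:]) * ?Q"
      unfolding \<Psi>_def using kd prod.ub_add_nat[of 1 k "\<lambda>l. [:\<xi> (i+l) - \<xi> i, -1:]" "d-k"] by simp
    also have "(\<Prod>l\<in>{1..k}. [:\<xi> (i+l) - \<xi> i, -1:]) = (\<Prod>l\<in>{1..k}. [:0, -1:])"
    proof (intro prod.cong refl)
      fix l assume "l \<in> {1..k}"
      then have "\<xi> (i+l) = \<xi> i" by (intro eq) auto
      then show "[:\<xi> (i+l) - \<xi> i, -1:] = [:0, -1:]" by simp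
    qed
    also have "\<dots> = [:0,-1:] ^ k" by simp
    also have "[:0,-1::real:] = Polynomial.smult (-1) (monom 1 1)" by (simp add: monom_altdef)
    also have "\<dots> ^ k = Polynomial.smult ((-1)^k) (monom 1 k)" by (simp only: smult_power monom_power power_one mult_1)
    finally have "\<Psi> i = Polynomial.smult ((-1)^k) (monom 1 k * ?Q)" by simp
    then have "coeff (\<Psi> i) k = (-1)^k * coeff ?Q 0" by (simp add: coeff_monom_mult)
    moreover have "coeff ?Q 0 = (\<Prod>l\<in>{k+1..d}. \<xi> (i+l) - \<xi> i)"
      by (simp add: poly_0_coeff_0[symmetric] poly_prod)
    moreover have "(\<Prod>l\<in>{k+1..d}. \<xi> (i+l) - \<xi> i) \<noteq> 0"
    proof -
      have "\<xi> (i+k+1) \<le> \<xi> (i+l)" if "l \<in> {k+1..d}" for l using that by (intro monoD[OF m]) auto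
      then show ?thesis using gt by (force simp: prod_zero_iff)
    qed
    ultimately show ?thesis by simp
  qed
  have bin: "of_nat (d choose k) * (-1::real) ^ k \<noteq> 0" using kd by auto
  define c where "c j = coeff (\<Psi> j) k / (of_nat (d choose k) * (-1) ^ k)" for j
  have "trunc_pow (\<xi> i) (d - k) x = (\<Sum>l=i..n. c l * bspline \<xi> d l x)" if x: "x \<in> {0..1}" for x
  proof -
    obtain j where j: "active_cell \<xi> x j" "d \<le> j" "j \<le> n" and mx: "\<And>i. \<xi> i \<le> x \<Longrightarrow> i \<le> n \<Longrightarrow> i \<le> j"
      by (rule ex_active_cell[OF cl, of x]) (use x in auto)
    show ?thesis
    proof (cases "\<xi> i \<le> x")
      case True
      have "i + k \<le> n" using eq[of "i+k"] o[of i] o[of "i+k"] i by (metis le_add1 not_le order_refl)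
      then have ikj: "i + k \<le> j" using mx[of "i+k"] eq[of "i+k"] True by simp
      have "(\<Sum>l=i..n. c l * bspline \<xi> d l x) = (\<Sum>l\<le>n. c l * bspline \<xi> d l x)"
      proof (rule sum.mono_neutral_left)
        show "\<forall>l\<in>{..n} - {i..n}. c l * bspline \<xi> d l x = 0"
        proof
          fix l assume "l \<in> {..n} - {i..n}"
          then have "l < i" by auto
          show "c l * bspline \<xi> d l x = 0"
          proof (cases "l + d < j")
            case True
            then show ?thesis using bspline_support[OF j(1)] by simp
          next
            case False
            then have "c l = 0" unfolding c_def using zero[of l] ikj \<open>l < i\<close> by auto
            then show ?thesis by simp
          qed
        qed
      qed auto
      also have "\<dots> = (\<Sum>l\<le>n. coeff (\<Psi> l) k * bspline \<xi> d l x) / (of_nat (d choose k) * (-1) ^ k)"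
        by (simp add: c_def sum_divide_distrib)
      also have "\<dots> = (x - \<xi> i) ^ (d - k)" using id[of x] x bin by simp
      finally show ?thesis using True by (simp add: trunc_pow_def)
    next
      case False
      then have "j < l" if "i \<le> l" for l
        using monoD[OF m, of i l] monoD[OF m, of l j] that j(1) unfolding active_cell_def by force
      then have "(\<Sum>l=i..n. c l * bspline \<xi> d l x) = 0"
        using bspline_support[OF j(1)] by (intro sum.neutral) auto
      then show ?thesis using False by (simp add: trunc_pow_def)
    qed
  qed
  moreover have "c i \<noteq> 0" using nz bin unfolding c_def by simp
  ultimately show ?thesis by blast
qed

definition span_on_unit :: "nat \<Rightarrow> (nat \<Rightarrow> real \<Rightarrow> real) \<Rightarrow> (real \<Rightarrow> real) \<Rightarrow> bool" where
  "span_on_unit n f g \<longleftrightarrow> (\<exists>c. \<forall>x\<in>{0..1}. g x = (\<Sum>l\<le>n. c l * f l x))"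

lemma span_on_unit_base: "l \<le> n \<Longrightarrow> span_on_unit n f (f l)"
  unfolding span_on_unit_def
  by (intro exI[of _ "\<lambda>j. if j = l then 1 else 0"]) (auto simp: if_distrib[of "\<lambda>c. c * _"] cong: if_cong)

lemma span_on_unit_cong: "span_on_unit n f g \<Longrightarrow> (\<And>x. x \<in> {0..1} \<Longrightarrow> h x = g x) \<Longrightarrow> span_on_unit n f h"
  unfolding span_on_unit_def by metis

lemma span_on_unit_cmult: "span_on_unit n f g \<Longrightarrow> span_on_unit n f (\<lambda>x. a * g x)"
  unfolding span_on_unit_def
proof (elim exE)
  fix c assume "\<forall>x\<in>{0..1}. g x = (\<Sum>l\<le>n. c l * f l x)"
  then show "\<exists>c. \<forall>x\<in>{0..1}. a * g x = (\<Sum>l\<le>n. c l * f l x)"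
    by (intro exI[of _ "\<lambda>l. a * c l"]) (simp add: sum_distrib_left mult.assoc)
qed

lemma span_on_unit_add: "span_on_unit n f g \<Longrightarrow> span_on_unit n f h \<Longrightarrow> span_on_unit n f (\<lambda>x. g x + h x)"
  unfolding span_on_unit_def
proof (elim exE)
  fix c d assume "\<forall>x\<in>{0..1}. g x = (\<Sum>l\<le>n. c l * f l x)" "\<forall>x\<in>{0..1}. h x = (\<Sum>l\<le>n. d l * f l x)"
  then show "\<exists>c. \<forall>x\<in>{0..1}. g x + h x = (\<Sum>l\<le>n. c l * f l x)"
    by (intro exI[of _ "\<lambda>l. c l + d l"]) (simp add: algebra_simps sum.distrib)
qed

lemma span_on_unit_sum:
  assumes "finite A" "\<And>i. i \<in> A \<Longrightarrow> span_on_unit n f (g i)"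
  shows "span_on_unit n f (\<lambda>x. \<Sum>i\<in>A. c i * g i x)"
  using assms
proof (induction A rule: finite_induct)
  case empty
  show ?case unfolding span_on_unit_def by (intro exI[of _ "\<lambda>_. 0"]) auto
next
  case (insert a A)
  then show ?case by (simp add: span_on_unit_add span_on_unit_cmult)
qed

lemma span_on_unit_trans:
  assumes "span_on_unit n f g" "\<And>l. l \<le> n \<Longrightarrow> span_on_unit n' f' (f l)"
  shows "span_on_unit n' f' g"
proof -
  obtain c where "\<forall>x\<in>{0..1}. g x = (\<Sum>l\<le>n. c l * f l x)" using assms(1) unfolding span_on_unit_def by auto
  moreover have "span_on_unit n' f' (\<lambda>x. \<Sum>l\<le>n. c l * f l x)" using assms(2) by (intro span_on_unit_sum) auto
  ultimately show ?thesis by (auto intro: span_on_unit_cong)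
qed

text \<open>
  Backward substitution in the triangular system, starting with the last B-spline. It gives continuity,
  differentiability, nestedness and polynomial reproduction of splines, which are all visible for truncated powers.
\<close>

lemma trunc_pow_bspline_span:
  assumes cl: "clamped_seq d n \<xi>"
    and k: "\<And>i. i \<le> n \<Longrightarrow> k i \<le> d \<and> (\<forall>l. i \<le> l \<and> l \<le> i + k i \<longrightarrow> \<xi> l = \<xi> i) \<and> \<xi> i < \<xi> (i + k i + 1)"
    and i: "i \<le> n"
  shows "span_on_unit n (bspline \<xi> d) (trunc_pow (\<xi> i) (d - k i))"
    and "span_on_unit n (\<lambda>l. trunc_pow (\<xi> l) (d - k l)) (bspline \<xi> d i)"
proof -
  let ?T = "\<lambda>l. trunc_pow (\<xi> l) (d - k l)"
  have tri: "\<exists>c. c i \<noteq> 0 \<and> (\<forall>x\<in>{0..1}. ?T i x = (\<Sum>l=i..n. c l * bspline \<xi> d l x))" if "i \<le> n" for i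
    by (rule trunc_pow_triangular[OF cl that]) (use k[OF that] in blast)+
  obtain c where "\<forall>x\<in>{0..1}. ?T i x = (\<Sum>l=i..n. c l * bspline \<xi> d l x)" using tri[OF i] by blast
  then show "span_on_unit n (bspline \<xi> d) (?T i)"
    by (rule_tac span_on_unit_cong[OF span_on_unit_sum[of "{i..n}" n "bspline \<xi> d" "bspline \<xi> d" c]])
       (auto intro: span_on_unit_base)
  have "span_on_unit n ?T (bspline \<xi> d (n - j))" if "j \<le> n" for j
    using that
  proof (induction j rule: less_induct)
    case (less j)
    let ?i = "n - j"
    obtain c where c: "c ?i \<noteq> 0" "\<forall>x\<in>{0..1}. ?T ?i x = (\<Sum>l=?i..n. c l * bspline \<xi> d l x)"
      using tri[of ?i] by auto
    have "span_on_unit n ?T (bspline \<xi> d l)" if "l \<in> {Suc ?i..n}" for l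
      using less.IH[of "n - l"] that less.prems by auto
    then have "span_on_unit n ?T (\<lambda>x. \<Sum>l=Suc ?i..n. c l * bspline \<xi> d l x)"
      by (intro span_on_unit_sum) auto
    then have "span_on_unit n ?T (\<lambda>x. (1 / c ?i) * (?T ?i x + (-1) * (\<Sum>l=Suc ?i..n. c l * bspline \<xi> d l x)))"
      by (intro span_on_unit_cmult span_on_unit_add span_on_unit_base[of ?i n ?T]) auto
    moreover have "(\<Sum>l=?i..n. c l * bspline \<xi> d l x) =
        c ?i * bspline \<xi> d ?i x + (\<Sum>l=Suc ?i..n. c l * bspline \<xi> d l x)" for x
      by (rule sum.atLeast_Suc_atMost) auto
    ultimately show ?case
      using c by (elim span_on_unit_cong) auto
  qed
  from this[of "n - i"] i show "span_on_unit n ?T (bspline \<xi> d i)" by simp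
qed

subsection \<open>Uniformly spaced knots of constant multiplicity\<close>

text \<open>
  The knot sequence with end knots \<open>0\<close> and \<open>1\<close> of multiplicity \<open>d + 1\<close> and the \<open>N - 1\<close> equidistant inner knots
  of multiplicity \<open>m\<close>. Knots with an index above \<open>d + (N - 1) * m\<close> are equal to \<open>1\<close> because of the minimum.
\<close>

definition uknot :: "nat \<Rightarrow> nat \<Rightarrow> nat \<Rightarrow> nat \<Rightarrow> real" where
  "uknot d m N i = (if i \<le> d then 0 else min 1 (real ((i - d - 1) div m + 1) / real N))"

text \<open>
  The number of indices \<open>l > i\<close> with the same knot as \<open>i\<close>, for \<open>i \<le> d + (N - 1) * m\<close>.
\<close>

definition later_copies :: "nat \<Rightarrow> nat \<Rightarrow> nat \<Rightarrow> nat" where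
  "later_copies d m i = (if i \<le> d then d - i else m - 1 - (i - d - 1) mod m)"

lemma uknot_inner:
  assumes "1 \<le> m" "d < i" "i \<le> d + (N - 1) * m"
  shows "(i - d - 1) div m + 1 < N" "uknot d m N i = real ((i - d - 1) div m + 1) / real N"
proof -
  have N: "1 \<le> N" using assms by (cases N) auto
  have "i - d - 1 < (N - 1) * m" using assms by linarith
  then have "(i - d - 1) div m < N - 1" using assms(1) by (simp add: less_mult_imp_div_less)
  then show *: "(i - d - 1) div m + 1 < N" by linarith
  then show "uknot d m N i = real ((i - d - 1) div m + 1) / real N"
    using assms N unfolding uknot_def by (simp add: min_def divide_simps)
qed

lemma clamped_seq_uknot:
  assumes "1 \<le> m" "1 \<le> N"
  shows "clamped_seq d (d + (N - 1) * m) (uknot d m N)"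
  unfolding clamped_seq_def
proof (intro conjI allI)
  let ?n = "d + (N - 1) * m"
  show "mono (uknot d m N)"
  proof (rule monoI)
    fix i j :: nat assume "i \<le> j"
    then have "(i - d - 1) div m \<le> (j - d - 1) div m" by (intro div_le_mono) auto
    then have "real ((i - d - 1) div m + 1) / real N \<le> real ((j - d - 1) div m + 1) / real N"
      by (intro divide_right_mono) auto
    then show "uknot d m N i \<le> uknot d m N j" using \<open>i \<le> j\<close> unfolding uknot_def by auto
  qed
  show "d \<le> ?n" by simp
  fix i
  have "0 < uknot d m N i" if "d < i" using that assms unfolding uknot_def by auto
  moreover have "uknot d m N i = 0" if "i \<le> d" using that unfolding uknot_def by auto
  ultimately show "(uknot d m N i = 0) = (i \<le> d)" by force
  show "(uknot d m N i = 1) = (?n < i)"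
  proof (cases "?n < i")
    case True
    then have "(N - 1) * m \<le> i - d - 1" by linarith
    then have "N - 1 \<le> (i - d - 1) div m" using assms by (simp add: less_eq_div_iff_mult_less_eq)
    then have "N \<le> (i - d - 1) div m + 1" by linarith
    then have "1 \<le> real ((i - d - 1) div m + 1) / real N" using assms by (subst le_divide_eq_1_pos) auto
    then show ?thesis using True unfolding uknot_def by auto
  next
    case False
    show ?thesis
    proof (cases "i \<le> d")
      case True then show ?thesis using False by (simp add: uknot_def)
    next
      case False
      then have "(i - d - 1) div m + 1 < N" "uknot d m N i = real ((i - d - 1) div m + 1) / real N"
        using uknot_inner[OF assms(1)] \<open>\<not> ?n < i\<close> by auto
      then have "uknot d m N i < 1" using divide_less_eq_1[of "real ((i - d - 1) div m + 1)" "real N"] by simp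
      then show ?thesis using \<open>\<not> ?n < i\<close> by simp
    qed
  qed
qed

lemma later_copies_uknot:
  assumes m: "1 \<le> m" "m \<le> d + 1" and N: "1 \<le> N" and i: "i \<le> d + (N - 1) * m"
  shows "later_copies d m i \<le> d"
    and "i \<le> l \<Longrightarrow> l \<le> i + later_copies d m i \<Longrightarrow> uknot d m N l = uknot d m N i"
    and "uknot d m N i < uknot d m N (i + later_copies d m i + 1)"
proof -
  let ?r = "(i - d - 1) mod m" and ?q = "(i - d - 1) div m"
  have r: "?r < m" using m by simp
  show "later_copies d m i \<le> d" using m unfolding later_copies_def by auto
  have i': "i = d + 1 + (m * ?q + ?r)" if "d < i"
    using that mult_div_mod_eq[of m "i - d - 1"] by linarith
  show "uknot d m N l = uknot d m N i" if "i \<le> l" "l \<le> i + later_copies d m i"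
  proof (cases "i \<le> d")
    case True
    then show ?thesis using that unfolding later_copies_def uknot_def by auto
  next
    case False
    define s where "s = l - i"
    have s: "l = i + s" "?r + s < m" using that False r unfolding s_def later_copies_def by auto
    have "l - d - 1 = m * ?q + (?r + s)" using i' False s by linarith
    moreover have "(m * ?q + (?r + s)) div m = ?q"
      using s m by (subst div_mult_self4) (auto simp del: add.assoc)
    ultimately have "(l - d - 1) div m = ?q" by (simp only:)
    then show ?thesis using False that unfolding uknot_def by auto
  qed
  show "uknot d m N i < uknot d m N (i + later_copies d m i + 1)"
  proof (cases "i \<le> d")
    case True
    then show ?thesis using N unfolding later_copies_def uknot_def by auto
  next
    case False
    let ?l = "i + later_copies d m i + 1"
    have "?l = i + (m - 1 - ?r) + 1" using False unfolding later_copies_def by simp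
    moreover have "i + (m - 1 - ?r) + 1 = d + 1 + (m * ?q + m)" using i' False r by linarith
    moreover have "m * ?q + m = m * (?q + 1)" by simp
    ultimately have "?l - d - 1 = m * (?q + 1)" by linarith
    then have "(?l - d - 1) div m = ?q + 1" using m nonzero_mult_div_cancel_left[of m "?q+1"] by (simp only:)
    then have "uknot d m N ?l = min 1 (real (?q + 2) / real N)" using False unfolding uknot_def by auto
    moreover have "?q + 1 < N" "uknot d m N i = real (?q + 1) / real N"
      using uknot_inner[OF m(1) _ i] False by auto
    moreover have "real (?q + 1) / real N < 1" "real (?q + 1) / real N < real (?q + 2) / real N"
      using \<open>?q + 1 < N\<close> by (auto simp: divide_simps)
    ultimately show ?thesis by simp
  qed
qed

text \<open>
  A monotone sequence is determined by its values and their multiplicities; counting the indices up to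
  each value gives the position of every knot.
\<close>

lemma clamped_knots_unique:
  assumes ck: "clamped_knots d m n \<xi>" and m: "1 \<le> m"
  obtains N where "1 \<le> N" "n = d + (N - 1) * m" "\<And>i. i \<le> n + d + 1 \<Longrightarrow> \<xi> i = uknot d m N i"
    "\<xi> ` {..n+d+1} = {real j / real N | j. j \<le> N}"
proof -
  define T where "T = n + d + 1"
  obtain N where mono: "mono_on {..T} \<xi>" and N: "1 \<le> N" and im: "\<xi> ` {..T} = {real j / real N | j. j \<le> N}"
    and c0: "card {i. i \<le> T \<and> \<xi> i = 0} = d + 1"
    and c1: "card {i. i \<le> T \<and> \<xi> i = 1} = d + 1"
    and cj: "\<And>j. j \<in> {1..<N} \<Longrightarrow> card {i. i \<le> T \<and> \<xi> i = real j / real N} = m"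
    using ck unfolding clamped_knots_def T_def by blast
  have val: "\<exists>j\<le>N. \<xi> i = real j / real N" if "i \<le> T" for i using im that by blast
  have le_iff: "real j / real N \<le> real j' / real N \<longleftrightarrow> j \<le> j'" for j j' using N by (simp add: divide_simps)
  have eq_iff: "real j / real N = real j' / real N \<longleftrightarrow> j = j'" for j j' using N by (simp add: divide_simps)
  have cnt: "card {i. i \<le> T \<and> \<xi> i \<le> real j / real N} = d + 1 + j * m" if "j < N" for j
    using that
  proof (induction j)
    case 0
    have "{i. i \<le> T \<and> \<xi> i \<le> real 0 / real N} = {i. i \<le> T \<and> \<xi> i = 0}"
    proof (intro set_eqI iffI; clarify)
      fix i assume "i \<le> T" "\<xi> i \<le> real 0 / real N"
      moreover obtain j where "\<xi> i = real j / real N" using val[OF \<open>i \<le> T\<close>] by blast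
      ultimately have "j = 0" using le_iff[of j 0] by simp
      then show "\<xi> i = 0" using \<open>\<xi> i = real j / real N\<close> by simp
    qed simp
    then show ?case using c0 by simp
  next
    case (Suc j)
    have "{i. i \<le> T \<and> \<xi> i \<le> real (Suc j) / real N} =
      {i. i \<le> T \<and> \<xi> i \<le> real j / real N} \<union> {i. i \<le> T \<and> \<xi> i = real (Suc j) / real N}" (is "?A = ?B \<union> ?C")
    proof (intro set_eqI iffI)
      fix i assume "i \<in> ?A"
      then have i: "i \<le> T" "\<xi> i \<le> real (Suc j) / real N" by blast+
      then obtain j' where j': "\<xi> i = real j' / real N" using val by blast
      with i(2) have "j' \<le> Suc j" by (simp only: le_iff)
      note i(1) j' this
      then show "i \<in> ?B \<union> ?C" using le_iff[of j' j] by (cases "j' = Suc j") auto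
    next
      fix i assume "i \<in> ?B \<union> ?C"
      moreover have "real j / real N \<le> real (Suc j) / real N" by (simp only: le_iff)
      ultimately show "i \<in> ?A" by auto
    qed
    then have "card ?A = card (?B \<union> ?C)" by (rule arg_cong)
    also have "\<dots> = card ?B + card ?C"
      using le_iff[of "Suc j" j] by (intro card_Un_disjoint) auto
    finally have "card ?A = card ?B + card ?C" .
    then show ?case using Suc.IH Suc.prems cj[of "Suc j"] by simp
  qed
  have seg: "i \<le> T \<and> \<xi> i \<le> real j / real N \<longleftrightarrow> i < d + 1 + j * m" if "j < N" for i j
  proof -
    define A where "A = {i. i \<le> T \<and> \<xi> i \<le> real j / real N}"
    have fin: "finite A" unfolding A_def by simp
    have card: "card A = d + 1 + j * m" using cnt[OF that] unfolding A_def .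
    then have ne: "A \<noteq> {}" by auto
    have dc: "a' \<in> A" if "a \<in> A" "a' \<le> a" for a a'
      using that mono_onD[OF mono, of a' a] unfolding A_def by auto
    have "A = {..Max A}" using dc[OF Max_in[OF fin ne]] Max_ge[OF fin] by blast
    then have "card A = Suc (Max A)" by (metis card_atMost)
    then have "A = {..<d + 1 + j * m}" using \<open>A = {..Max A}\<close> card by (metis lessThan_Suc_atMost)
    then have "i \<in> A \<longleftrightarrow> i < d + 1 + j * m" by blast
    then show ?thesis unfolding A_def by simp
  qed
  have n: "n = d + (N - 1) * m"
  proof -
    let ?A = "{i. i \<le> T \<and> \<xi> i \<le> real (N-1) / real N}" and ?B = "{i. i \<le> T \<and> \<xi> i = 1}"
    have one: "real N / real N = 1" using N by simp
    have "{..T} = ?A \<union> ?B"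
    proof (intro set_eqI iffI)
      fix i assume "i \<in> {..T}"
      then obtain j where "i \<le> T" "j \<le> N" "\<xi> i = real j / real N" using val by auto
      then show "i \<in> ?A \<union> ?B" using le_iff[of j "N-1"] one by (cases "j = N") auto
    qed auto
    then have "card {..T} = card (?A \<union> ?B)" by (rule arg_cong)
    also have "\<dots> = card ?A + card ?B"
      using le_iff[of N "N-1"] one N by (intro card_Un_disjoint) auto
    finally have "card {..T} = card ?A + card ?B" .
    then have "T + 1 = (d + 1 + (N - 1) * m) + (d + 1)" using cnt[of "N-1"] c1 N by simp
    then show ?thesis unfolding T_def by linarith
  qed
  have "\<xi> i = uknot d m N i" if i: "i \<le> T" for i
  proof -
    obtain j where j: "j \<le> N" "\<xi> i = real j / real N" using val[OF i] by auto
    have seg': "j \<le> j' \<longleftrightarrow> i < d + 1 + j' * m" if "j' < N" for j'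
      using seg[OF that, of i] i j le_iff by simp
    consider "i \<le> d" | "d < i" "i \<le> n" | "n < i" by linarith
    then show ?thesis
    proof cases
      case 1
      then have "j = 0" using seg'[of 0] N by linarith
      then have "\<xi> i = 0" using j(2) by simp
      then show ?thesis using 1 unfolding uknot_def by simp
    next
      case 2
      let ?q = "(i - d - 1) div m"
      have q: "?q + 1 < N" "uknot d m N i = real (?q + 1) / real N"
        using uknot_inner[OF m 2(1), of N] 2(2) unfolding n by blast+
      have "i - d - 1 < (?q + 1) * m" using m div_less_iff_less_mult[of m "i-d-1" "?q+1"] by linarith
      then have "i < d + 1 + (?q + 1) * m" using 2 by linarith
      then have a: "j \<le> ?q + 1" using seg'[OF q(1)] by blast
      have "?q * m \<le> i - d - 1" by (rule div_times_less_eq_dividend)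
      then have ni: "\<not> i < d + 1 + ?q * m" using 2 by linarith
      have "?q < N" using q(1) by linarith
      from seg'[OF this] ni have "\<not> j \<le> ?q" by simp
      then have "j = ?q + 1" using a by linarith
      then show ?thesis using j(2) q(2) by metis
    next
      case 3
      then have "\<not> i < d + 1 + (N-1) * m" using n by linarith
      then have "\<not> j \<le> N - 1" using seg'[of "N-1"] N by linarith
      then have "j = N" using j(1) by linarith
      then have "\<xi> i = 1" using j(2) N by simp
      moreover have "uknot d m N i = 1" using clamped_seq_uknot[OF m N, of d] 3 n unfolding clamped_seq_def by auto
      ultimately show ?thesis by simp
    qed
  qed
  then show ?thesis using that N n im unfolding T_def by blast
qed

abbreviation ubs :: "nat \<Rightarrow> nat \<Rightarrow> nat \<Rightarrow> nat \<Rightarrow> real \<Rightarrow> real" where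
  "ubs d m N \<equiv> bspline (uknot d m N) d"

lemma ubs_trunc_pow_span:
  assumes "1 \<le> m" "m \<le> d + 1" "1 \<le> N" "i \<le> d + (N - 1) * m"
  shows "span_on_unit (d + (N - 1) * m) (ubs d m N) (trunc_pow (uknot d m N i) (d - later_copies d m i))"
    and "span_on_unit (d + (N - 1) * m) (\<lambda>l. trunc_pow (uknot d m N l) (d - later_copies d m l)) (ubs d m N i)"
proof -
  have k: "later_copies d m i \<le> d \<and> (\<forall>l. i \<le> l \<and> l \<le> i + later_copies d m i \<longrightarrow> uknot d m N l = uknot d m N i)
     \<and> uknot d m N i < uknot d m N (i + later_copies d m i + 1)" if "i \<le> d + (N - 1) * m" for i
    using later_copies_uknot[OF assms(1-3) that] by blast
  show "span_on_unit (d + (N - 1) * m) (ubs d m N) (trunc_pow (uknot d m N i) (d - later_copies d m i))"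
    by (rule trunc_pow_bspline_span(1)[OF clamped_seq_uknot[OF assms(1,3)] k assms(4)])
  show "span_on_unit (d + (N - 1) * m) (\<lambda>l. trunc_pow (uknot d m N l) (d - later_copies d m l)) (ubs d m N i)"
    by (rule trunc_pow_bspline_span(2)[OF clamped_seq_uknot[OF assms(1,3)] k assms(4)])
qed

text \<open>
  Every truncated power of the coarse knot sequence is one of the fine sequence: refinement keeps the
  inner multiplicity, so the exponent belonging to a knot does not change.
\<close>

lemma ubs_nested:
  assumes m: "1 \<le> m" "m \<le> d + 1" and N: "1 \<le> N" and s: "1 \<le> s" and i: "i \<le> d + (N - 1) * m"
  shows "span_on_unit (d + (s * N - 1) * m) (ubs d m (s * N)) (ubs d m N i)"
proof (rule span_on_unit_trans[OF ubs_trunc_pow_span(2)[OF m N i]])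
  fix l assume l: "l \<le> d + (N - 1) * m"
  have sN: "1 \<le> s * N" using s N by simp
  define q where "q = (l - d - 1) div m + 1"
  define l' where "l' = (if l \<le> d then l else l + (s - 1) * q * m)"
  have "l' \<le> d + (s * N - 1) * m \<and> uknot d m (s * N) l' = uknot d m N l \<and> later_copies d m l' = later_copies d m l"
  proof (cases "l \<le> d")
    case True
    then show ?thesis unfolding l'_def uknot_def later_copies_def by simp
  next
    case False
    have q: "q < N" "uknot d m N l = real q / real N"
      using uknot_inner[OF m(1) _ l] False unfolding q_def by auto
    have "l = d + 1 + ((q - 1) * m + (l - d - 1) mod m)"
      using False div_mult_mod_eq[of "l - d - 1" m] unfolding q_def by simp
    then have l'eq: "l' - d - 1 = (l - d - 1) + (s - 1) * q * m" "d < l'" using False unfolding l'_def by auto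
    have dv: "(l' - d - 1) div m = (q - 1) + (s - 1) * q"
      unfolding l'eq(1) q_def using m by (simp only: div_mult_self1) simp
    have md: "(l' - d - 1) mod m = (l - d - 1) mod m" unfolding l'eq(1) by simp
    have qs: "(q - 1) + (s - 1) * q + 1 = s * q" using s unfolding q_def by (cases s) auto
    have "l - d - 1 < q * m" unfolding q_def using m div_less_iff_less_mult[of m "l-d-1" "(l-d-1) div m + 1"] by simp
    then have "l' - d - 1 < q * m + (s - 1) * q * m" using l'eq by simp
    also have "\<dots> = s * q * m" using s by (cases s) (auto simp: algebra_simps)
    also have "\<dots> \<le> (s * (N - 1)) * m" using q(1) by (intro mult_le_mono) auto
    also have "\<dots> \<le> (s * N - 1) * m" using s by (intro mult_le_mono) (auto simp: diff_mult_distrib2)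
    finally have "l' \<le> d + (s * N - 1) * m" by linarith
    moreover have "uknot d m (s * N) l' = real (s * q) / real (s * N)"
      using uknot_inner(2)[OF m(1) l'eq(2) calculation] unfolding dv qs .
    then have "uknot d m (s * N) l' = uknot d m N l" using q s by simp
    moreover have "later_copies d m l' = later_copies d m l"
      using md False l'eq(2) unfolding later_copies_def by simp
    ultimately show ?thesis by blast
  qed
  then show "span_on_unit (d + (s * N - 1) * m) (ubs d m (s * N)) (trunc_pow (uknot d m N l) (d - later_copies d m l))"
    using ubs_trunc_pow_span(1)[OF m sN, of l'] by auto
qed

text \<open>
  The first \<open>d + 1\<close> knots are \<open>0\<close>, and their truncated powers are the monomials.
\<close>

lemma ubs_poly:
  assumes m: "1 \<le> m" "m \<le> d + 1" and N: "1 \<le> N" and q: "degree q \<le> d"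
  shows "span_on_unit (d + (N - 1) * m) (ubs d m N) (poly q)"
proof -
  have "span_on_unit (d + (N - 1) * m) (ubs d m N) (\<lambda>x. x ^ i)" if "i \<le> d" for i
  proof -
    have "span_on_unit (d + (N - 1) * m) (ubs d m N) (trunc_pow (uknot d m N i) (d - later_copies d m i))"
      using that by (intro ubs_trunc_pow_span(1)[OF m N]) auto
    then show ?thesis
      by (rule span_on_unit_cong) (use that in \<open>auto simp: uknot_def later_copies_def trunc_pow_def\<close>)
  qed
  then have "span_on_unit (d + (N - 1) * m) (ubs d m N) (\<lambda>x. \<Sum>i\<le>d. coeff q i * x ^ i)"
    by (intro span_on_unit_sum) auto
  then show ?thesis using q
    by (elim span_on_unit_cong) (auto simp: poly_altdef intro!: sum.mono_neutral_left coeff_eq_0)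
qed

text \<open>
  The knots are excluded because B-splines of degree zero are continuous from the right only, and
  reflection turns this into continuity from the left.
\<close>

lemma bspline_reflect:
  assumes "\<And>l. l \<le> T \<Longrightarrow> \<zeta> l = 1 - \<xi> (T - l)" "i + e + 1 \<le> T"
    and "0 < x" "x < 1" "\<And>l. l \<le> T \<Longrightarrow> x \<noteq> \<zeta> l"
  shows "bspline \<xi> e i (1 - x) = bspline \<zeta> e (T - e - 1 - i) x"
  using assms(2)
proof (induction e arbitrary: i)
  case 0
  have a: "\<zeta> (T - 1 - i) = 1 - \<xi> (i + 1)" "\<zeta> (T - 1 - i + 1) = 1 - \<xi> i"
    using 0 assms(1)[of "T - 1 - i"] assms(1)[of "T - 1 - i + 1"] by auto
  have "x \<noteq> 1 - \<xi> (i + 1)" "x \<noteq> 1 - \<xi> i"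
    using assms(5)[of "T - 1 - i"] assms(5)[of "T - 1 - i + 1"] 0 a by auto
  then show ?case using a assms(3,4) by auto
next
  case (Suc e)
  let ?I = "T - Suc e - 1 - i"
  have i1: "T - e - 1 - i = ?I + 1" and i2: "T - e - 1 - (i+1) = ?I" using Suc.prems by auto
  have z: "\<zeta> ?I = 1 - \<xi> (i+e+2)" "\<zeta> (?I + 1) = 1 - \<xi> (i+e+1)" "\<zeta> (?I + e + 1) = 1 - \<xi> (i + 1)"
    "\<zeta> (?I + e + 2) = 1 - \<xi> i"
  proof -
    have "T - ?I = i+e+2" "T - (?I+1) = i+e+1" "T - (?I+e+1) = i+1" "T - (?I+e+2) = i"
      "?I + e + 2 \<le> T" using Suc.prems by auto
    then show "\<zeta> ?I = 1 - \<xi> (i+e+2)" "\<zeta> (?I + 1) = 1 - \<xi> (i+e+1)" "\<zeta> (?I + e + 1) = 1 - \<xi> (i + 1)"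
      "\<zeta> (?I + e + 2) = 1 - \<xi> i"
      using assms(1)[of "?I"] assms(1)[of "?I+1"] assms(1)[of "?I+e+1"] assms(1)[of "?I+e+2"] by (simp_all only:)
  qed
  have a: "bspline \<xi> e i (1 - x) = bspline \<zeta> e (?I + 1) x"
    using Suc.IH[of i] Suc.prems unfolding i1 by simp
  have b: "bspline \<xi> e (i+1) (1 - x) = bspline \<zeta> e ?I x"
    using Suc.IH[of "i+1"] Suc.prems unfolding i2 by simp
  show ?case
    by (simp only: bspline.simps a b z) (simp add: algebra_simps)
qed

lemma uknot_reflect:
  assumes m: "1 \<le> m" and N: "1 \<le> N" and T: "T = 2 * d + 1 + (N - 1) * m" and l: "l \<le> T"
  shows "uknot d m N l = 1 - uknot d m N (T - l)"
proof -
  let ?n = "d + (N - 1) * m"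
  note cs = clamped_seq_uknot[OF m N, of d, unfolded clamped_seq_def]
  have n: "?n = T - d - 1" "d + 1 \<le> T" using T by auto
  have z: "uknot d m N i = 0" if "i \<le> d" for i using cs that by auto
  have o: "uknot d m N i = 1" if "?n < i" for i using cs that by auto
  consider "l \<le> d" | "?n < l" | "d < l" "l \<le> ?n" by linarith
  then show ?thesis
  proof cases
    case 1
    then show ?thesis using z[of l] o[of "T-l"] n by auto
  next
    case 2
    then show ?thesis using o[of l] z[of "T-l"] n l by auto
  next
    case 3
    define a where "a = l - d - 1"
    have a: "a < (N - 1) * m" using 3 unfolding a_def by linarith
    have "l = d + 1 + a" using 3 unfolding a_def by simp
    then have b: "T - l - d - 1 = (N - 1) * m - 1 - a" unfolding T by simp
    have l': "d < T - l" "T - l \<le> ?n" using 3 n by linarith+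
    have q: "a div m + 1 < N" "uknot d m N l = real (a div m + 1) / real N"
      using uknot_inner[OF m 3] unfolding a_def by auto
    have q': "uknot d m N (T - l) = real (((N - 1) * m - 1 - a) div m + 1) / real N"
      using uknot_inner(2)[OF m l'] unfolding b .
    have "((N - 1) * m - 1 - a) div m = N - 2 - a div m"
    proof -
      have r: "a mod m < m" using m by simp
      have e: "a = a div m * m + a mod m" by simp
      have "N - 1 = (N - 2 - a div m) + (a div m + 1)" using q(1) by linarith
      then have "(N - 1) * m = (N - 2 - a div m) * m + a div m * m + m" by (metis add_mult_distrib mult_1 add.assoc)
      then have "(N - 1) * m - 1 - a = (m - 1 - a mod m) + (N - 2 - a div m) * m" using e r by linarith
      then have "((N - 1) * m - 1 - a) div m = (m - 1 - a mod m) div m + (N - 2 - a div m)"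
        using m by (simp only: div_mult_self1)
      moreover have "(m - 1 - a mod m) div m = 0" using m by (intro div_less) linarith
      ultimately show ?thesis by simp
    qed
    then have "uknot d m N (T - l) = real (N - (a div m + 1)) / real N" using q(1) q' by (simp add: Suc_diff_Suc)
    also have "\<dots> = 1 - real (a div m + 1) / real N" using q(1) N by (simp add: of_nat_diff field_simps)
    finally show ?thesis using q(2) by simp
  qed
qed

lemma ubs_reflect:
  assumes m: "1 \<le> m" and N: "1 \<le> N" and n: "n = d + (N - 1) * m" and i: "i \<le> n"
    and x: "0 < x" "x < 1" "x \<notin> range (uknot d m N)"
  shows "ubs d m N i (1 - x) = ubs d m N (n - i) x"
proof -
  have "ubs d m N i (1 - x) = bspline (uknot d m N) d ((n + d + 1) - d - 1 - i) x"
  proof (rule bspline_reflect)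
    have "n + d + 1 = 2 * d + 1 + (N - 1) * m" using n by simp
    then show "uknot d m N l = 1 - uknot d m N (n + d + 1 - l)" if "l \<le> n + d + 1" for l
      using uknot_reflect[OF m N _ that] by blast
    show "i + d + 1 \<le> n + d + 1" using i by simp
    show "x \<noteq> uknot d m N l" for l using x(3) by blast
  qed (fact x)+
  then show ?thesis by simp
qed

lemma bspline_left_end:
  assumes cl: "clamped_seq d n \<xi>" and "e \<le> d"
  shows "bspline \<xi> e i 0 = (if i = d - e then 1 else 0)"
  using \<open>e \<le> d\<close>
proof (induction e arbitrary: i)
  case 0
  have "0 \<le> \<xi> i" "0 \<le> \<xi> (i+1)" "0 \<le> \<xi> (Suc d)" using clamped_seq_range[OF cl] by auto
  moreover have "\<xi> (Suc d) \<noteq> 0" using cl unfolding clamped_seq_def by auto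
  moreover have "\<xi> i = 0 \<longleftrightarrow> i \<le> d" "\<xi> (i+1) = 0 \<longleftrightarrow> i + 1 \<le> d" using cl unfolding clamped_seq_def by auto
  ultimately show ?case by (cases "i = d") auto
next
  case (Suc e)
  have z: "\<xi> j = 0 \<longleftrightarrow> j \<le> d" for j using cl unfolding clamped_seq_def by auto
  have IH: "bspline \<xi> e i 0 = (if i = d - e then 1 else 0)" for i using Suc by simp
  have "(0 - \<xi> i) / (\<xi> (i+e+1) - \<xi> i) * bspline \<xi> e i 0 = 0" using IH[of i] z[of i] by auto
  moreover have "(\<xi> (i+e+2) - 0) / (\<xi> (i+e+2) - \<xi> (i+1)) * bspline \<xi> e (i+1) 0 = (if i = d - Suc e then 1 else 0)"
  proof (cases "i = d - Suc e")
    case True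
    then have "\<xi> (i+1) = 0" "\<xi> (i+e+2) \<noteq> 0" "i + 1 = d - e" using z Suc.prems by auto
    then show ?thesis using IH[of "i+1"] True by simp
  next
    case False
    then have "i + 1 \<noteq> d - e" using Suc.prems by auto
    then show ?thesis using IH[of "i+1"] False by simp
  qed
  ultimately show ?case by simp
qed

lemma bspline_right_end:
  assumes cl: "clamped_seq d n \<xi>" and "e \<le> d"
  shows "bspline \<xi> e i 1 = (if i = n then 1 else 0)"
  using \<open>e \<le> d\<close>
proof (induction e arbitrary: i)
  case 0
  have "\<xi> i \<le> 1" "\<xi> (i+1) \<le> 1" "\<xi> n \<le> 1" using clamped_seq_range[OF cl] by auto
  moreover have "\<xi> n \<noteq> 1" using cl unfolding clamped_seq_def by auto
  moreover have "\<xi> i = 1 \<longleftrightarrow> n < i" "\<xi> (i+1) = 1 \<longleftrightarrow> n < i + 1" using cl unfolding clamped_seq_def by auto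
  ultimately show ?case by (cases "i = n") auto
next
  case (Suc e)
  have o: "\<xi> j = 1 \<longleftrightarrow> n < j" for j using cl unfolding clamped_seq_def by auto
  have IH: "bspline \<xi> e i 1 = (if i = n then 1 else 0)" for i using Suc by simp
  have "(\<xi> (i+e+2) - 1) / (\<xi> (i+e+2) - \<xi> (i+1)) * bspline \<xi> e (i+1) 1 = 0" using IH[of "i+1"] o[of "i+e+2"] by auto
  moreover have "(1 - \<xi> i) / (\<xi> (i+e+1) - \<xi> i) * bspline \<xi> e i 1 = (if i = n then 1 else 0)"
    using o[of i] o[of "i+e+1"] IH[of i] by auto
  ultimately show ?case by simp
qed

lemma ubs_ends:
  assumes "1 \<le> m" "1 \<le> N" "n = d + (N - 1) * m"
  shows "ubs d m N i 0 = (if i = 0 then 1 else 0)" "ubs d m N i 1 = (if i = n then 1 else 0)"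
  using bspline_left_end[OF clamped_seq_uknot[OF assms(1,2)], of d d i]
    bspline_right_end[OF clamped_seq_uknot[OF assms(1,2)], of d d i] assms(3) by auto

lemma borel_measurable_bspline [measurable]: "borel_fun (bspline \<xi> e i)"
proof (induction e arbitrary: i)
  case 0
  have "bspline \<xi> 0 i = (\<lambda>x. if \<xi> i \<le> x \<and> x < \<xi> (i+1) \<or> x = 1 \<and> \<xi> i < 1 \<and> \<xi> (i+1) = 1 then 1 else 0)" by auto
  then show ?case by (simp del: bspline.simps)
next
  case (Suc e)
  note [measurable] = Suc
  have "bspline \<xi> (Suc e) i = (\<lambda>x. (x - \<xi> i) / (\<xi> (i+e+1) - \<xi> i) * bspline \<xi> e i x +
     (\<xi> (i+e+2) - x) / (\<xi> (i+e+2) - \<xi> (i+1)) * bspline \<xi> e (i+1) x)" by auto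
  then show ?case by (simp del: bspline.simps)
qed

lemma trunc_pow_bound: "0 \<le> \<tau> \<Longrightarrow> x \<in> {0..1} \<Longrightarrow> \<bar>trunc_pow \<tau> e x\<bar> \<le> 1"
  by (auto simp: trunc_pow_def intro!: power_le_one)

lemma borel_measurable_trunc_pow [measurable]: "borel_fun (trunc_pow \<tau> e)"
  unfolding trunc_pow_def[abs_def] by measurable

lemma uknot_range: "1 \<le> m \<Longrightarrow> 1 \<le> N \<Longrightarrow> 0 \<le> uknot d m N i" "1 \<le> m \<Longrightarrow> 1 \<le> N \<Longrightarrow> uknot d m N i \<le> 1"
  using clamped_seq_range[OF clamped_seq_uknot] by auto

lemma trunc_pow_has_deriv:
  assumes "x \<noteq> \<tau>"
  shows "(trunc_pow \<tau> e has_real_derivative real e * trunc_pow \<tau> (e - 1) x) (at x)"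
proof (cases "\<tau> < x")
  case True
  have "((\<lambda>x. (x - \<tau>) ^ e) has_real_derivative real e * trunc_pow \<tau> (e - 1) x) (at x)"
    using True by (auto intro!: derivative_eq_intros simp: trunc_pow_def)
  then show ?thesis
    by (rule has_field_derivative_transform_within_open[of _ _ _ "{\<tau><..}"]) (use True in \<open>auto simp: trunc_pow_def\<close>)
next
  case False
  have "((\<lambda>x. 0) has_real_derivative real e * trunc_pow \<tau> (e - 1) x) (at x)"
    using False assms by (auto simp: trunc_pow_def)
  then show ?thesis
    by (rule has_field_derivative_transform_within_open[of _ _ _ "{..<\<tau>}"]) (use False assms in \<open>auto simp: trunc_pow_def\<close>)
qed

lemma continuous_on_trunc_pow: "1 \<le> e \<or> \<tau> = 0 \<Longrightarrow> continuous_on {0..1} (trunc_pow \<tau> e)"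
proof (erule disjE)
  assume "1 \<le> e"
  then have "trunc_pow \<tau> e = (\<lambda>x. max 0 (x - \<tau>) ^ e)" by (auto simp: trunc_pow_def fun_eq_iff max_def)
  then show ?thesis by (auto intro!: continuous_intros)
next
  assume t: "\<tau> = 0"
  have "continuous_on {0..1} (\<lambda>x::real. x ^ e)" by (intro continuous_intros)
  then show ?thesis by (rule continuous_on_eq) (simp add: t trunc_pow_def)
qed

definition piecewise_C1_unit :: "(real \<Rightarrow> real) \<Rightarrow> (real \<Rightarrow> real) \<Rightarrow> bool" where
  "piecewise_C1_unit f f' \<longleftrightarrow> continuous_on {0..1} f \<and> borel_fun f' \<and>
     (\<exists>C. \<forall>x\<in>{0..1}. \<bar>f' x\<bar> \<le> C) \<and>
     (\<exists>S. finite S \<and> (\<forall>x\<in>{0<..<1} - S. (f has_real_derivative f' x) (at x)))"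

lemma ubs_piecewise_C1:
  assumes m: "1 \<le> m" "m \<le> d" and N: "1 \<le> N" and i: "i \<le> d + (N - 1) * m"
  shows "\<exists>f'. piecewise_C1_unit (ubs d m N i) f'"
proof -
  let ?n = "d + (N - 1) * m"
  let ?e = "\<lambda>l. d - later_copies d m l" and ?\<tau> = "uknot d m N"
  obtain c where c: "\<And>x. x \<in> {0..1} \<Longrightarrow> ubs d m N i x = (\<Sum>l\<le>?n. c l * trunc_pow (?\<tau> l) (?e l) x)"
    using ubs_trunc_pow_span(2)[OF m(1) _ N i] m unfolding span_on_unit_def by auto
  define f' where "f' x = (\<Sum>l\<le>?n. c l * (real (?e l) * trunc_pow (?\<tau> l) (?e l - 1) x))" for x
  have "continuous_on {0..1} (\<lambda>x. \<Sum>l\<le>?n. c l * trunc_pow (?\<tau> l) (?e l) x)"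
  proof (intro continuous_on_sum continuous_on_mult continuous_on_const continuous_on_trunc_pow)
    fix l
    show "1 \<le> ?e l \<or> ?\<tau> l = 0" using m by (auto simp: later_copies_def uknot_def)
  qed
  then have "continuous_on {0..1} (ubs d m N i)" by (rule continuous_on_eq) (simp add: c)
  moreover have "borel_fun f'" unfolding f'_def[abs_def] by measurable
  moreover have "\<forall>x\<in>{0..1}. \<bar>f' x\<bar> \<le> (\<Sum>l\<le>?n. \<bar>c l\<bar> * real (?e l))"
    unfolding f'_def
  proof (intro ballI order.trans[OF sum_abs] sum_mono)
    fix x l assume x: "x \<in> {0..1::real}"
    have "\<bar>c l * (real (?e l) * trunc_pow (?\<tau> l) (?e l - 1) x)\<bar> = \<bar>c l\<bar> * real (?e l) * \<bar>trunc_pow (?\<tau> l) (?e l - 1) x\<bar>"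
      by (simp add: abs_mult)
    also have "\<dots> \<le> \<bar>c l\<bar> * real (?e l) * 1"
      by (rule mult_left_mono) (use trunc_pow_bound[OF uknot_range(1)[OF m(1) N] x] in auto)
    finally show "\<bar>c l * (real (?e l) * trunc_pow (?\<tau> l) (?e l - 1) x)\<bar> \<le> \<bar>c l\<bar> * real (?e l)" by simp
  qed
  moreover have "(ubs d m N i has_real_derivative f' x) (at x)" if x: "x \<in> {0<..<1} - ?\<tau> ` {..?n}" for x
  proof -
    have "((\<lambda>x. \<Sum>l\<le>?n. c l * trunc_pow (?\<tau> l) (?e l) x) has_real_derivative f' x) (at x)"
      unfolding f'_def using x by (intro DERIV_sum DERIV_cmult trunc_pow_has_deriv) auto
    then show ?thesis
      by (rule has_field_derivative_transform_within_open[of _ _ _ "{0<..<1}"]) (use x in \<open>auto simp: c\<close>)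
  qed
  moreover have "finite (?\<tau> ` {..?n})" by simp
  ultimately show ?thesis unfolding piecewise_C1_unit_def by blast
qed

lemma ubs_right_continuous:
  assumes m: "1 \<le> m" "m \<le> d + 1" and N: "1 \<le> N" and i: "i \<le> d + (N - 1) * m" and x: "0 \<le> x" "x < 1"
  shows "(ubs d m N i \<longlongrightarrow> ubs d m N i x) (at_right x)"
proof -
  let ?n = "d + (N - 1) * m"
  let ?e = "\<lambda>l. d - later_copies d m l" and ?\<tau> = "uknot d m N"
  obtain c where c: "\<And>x. x \<in> {0..1} \<Longrightarrow> ubs d m N i x = (\<Sum>l\<le>?n. c l * trunc_pow (?\<tau> l) (?e l) x)"
    using ubs_trunc_pow_span(2)[OF m N i] unfolding span_on_unit_def by auto
  have "(trunc_pow \<tau> e \<longlongrightarrow> trunc_pow \<tau> e x) (at_right x)" for \<tau> e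
  proof (cases "\<tau> \<le> x")
    case True
    have "((\<lambda>y. (y - \<tau>) ^ e) \<longlongrightarrow> trunc_pow \<tau> e x) (at_right x)"
      using True by (auto simp: trunc_pow_def intro!: tendsto_intros)
    then show ?thesis
      by (rule Lim_transform_eventually) (use True in \<open>auto simp: trunc_pow_def eventually_at_right_field intro!: exI[of _ "x+1"]\<close>)
  next
    case False
    have "((\<lambda>y. 0) \<longlongrightarrow> trunc_pow \<tau> e x) (at_right x)" using False by (auto simp: trunc_pow_def)
    then show ?thesis
      by (rule Lim_transform_eventually) (use False in \<open>auto simp: trunc_pow_def eventually_at_right_field intro!: exI[of _ "\<tau>"]\<close>)
  qed
  then have "((\<lambda>y. \<Sum>l\<le>?n. c l * trunc_pow (?\<tau> l) (?e l) y) \<longlongrightarrow> ubs d m N i x) (at_right x)"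
    using c[of x] x by (auto intro!: tendsto_intros)
  then show ?thesis
    by (rule Lim_transform_eventually) (use x in \<open>auto simp: c eventually_at_right_field intro!: exI[of _ "1"]\<close>)
qed

lemma ubs_bounded:
  assumes m: "1 \<le> m" "m \<le> d + 1" and N: "1 \<le> N" and i: "i \<le> d + (N - 1) * m"
  shows "\<exists>C. \<forall>x\<in>{0..1}. \<bar>ubs d m N i x\<bar> \<le> C"
proof -
  let ?n = "d + (N - 1) * m"
  let ?e = "\<lambda>l. d - later_copies d m l" and ?\<tau> = "uknot d m N"
  obtain c where c: "\<And>x. x \<in> {0..1} \<Longrightarrow> ubs d m N i x = (\<Sum>l\<le>?n. c l * trunc_pow (?\<tau> l) (?e l) x)"
    using ubs_trunc_pow_span(2)[OF m N i] unfolding span_on_unit_def by auto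
  have "\<bar>ubs d m N i x\<bar> \<le> (\<Sum>l\<le>?n. \<bar>c l\<bar> * 1)" if x: "x \<in> {0..1}" for x
    unfolding c[OF x]
  proof (intro order.trans[OF sum_abs] sum_mono)
    fix l
    show "\<bar>c l * trunc_pow (?\<tau> l) (?e l) x\<bar> \<le> \<bar>c l\<bar> * 1"
      unfolding abs_mult by (rule mult_left_mono) (use trunc_pow_bound[OF uknot_range(1)[OF m(1) N] x] in auto)
  qed
  then show ?thesis by blast
qed

section \<open>Orthogonal projection onto a finite-dimensional function space\<close>

text \<open>
  The functions that occur in one variable are bounded and measurable on the unit interval;
  all integrals below exist for this reason.
\<close>

definition bmf :: "(real \<Rightarrow> real) \<Rightarrow> bool" where
  "bmf f \<longleftrightarrow> borel_fun f \<and> (\<exists>C. \<forall>x\<in>{0..1}. \<bar>f x\<bar> \<le> C)"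

abbreviation leb_unit :: "real measure" where "leb_unit \<equiv> lebesgue_on {0..1}"

abbreviation ip01 :: "(real \<Rightarrow> real) \<Rightarrow> (real \<Rightarrow> real) \<Rightarrow> real" where
  "ip01 f g \<equiv> LINT x|leb_unit. f x * g x"

lemma bmf_add: "bmf f \<Longrightarrow> bmf g \<Longrightarrow> bmf (\<lambda>x. f x + g x)"
  unfolding bmf_def
proof (elim conjE exE, intro conjI)
  fix C D assume "\<forall>x\<in>{0..1}. \<bar>f x\<bar> \<le> C" "\<forall>x\<in>{0..1}. \<bar>g x\<bar> \<le> D"
  then have "\<forall>x\<in>{0..1}. \<bar>f x + g x\<bar> \<le> C + D" by (smt (verit))
  then show "\<exists>C. \<forall>x\<in>{0..1}. \<bar>f x + g x\<bar> \<le> C" by blast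
qed auto

lemma bmf_mult: "bmf f \<Longrightarrow> bmf g \<Longrightarrow> bmf (\<lambda>x. f x * g x)"
  unfolding bmf_def
proof (elim conjE exE, intro conjI)
  fix C D assume C: "\<forall>x\<in>{0..1}. \<bar>f x\<bar> \<le> C" and D: "\<forall>x\<in>{0..1}. \<bar>g x\<bar> \<le> D"
  have "\<bar>f x * g x\<bar> \<le> C * D" if "x \<in> {0..1}" for x
    unfolding abs_mult using C D that by (intro mult_mono) (auto intro: order.trans[OF abs_ge_zero])
  then show "\<exists>C. \<forall>x\<in>{0..1}. \<bar>f x * g x\<bar> \<le> C" by blast
qed auto

lemma bmf_const: "bmf (\<lambda>x. c)"
  unfolding bmf_def by auto

lemma bmf_cmult: "bmf f \<Longrightarrow> bmf (\<lambda>x. c * f x)"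
  using bmf_mult[OF bmf_const] .

lemma bmf_diff: "bmf f \<Longrightarrow> bmf g \<Longrightarrow> bmf (\<lambda>x. f x - g x)"
  using bmf_add[OF _ bmf_cmult[of g "-1"], of f] by simp

lemma bmf_sum: "finite A \<Longrightarrow> (\<And>i. i \<in> A \<Longrightarrow> bmf (f i)) \<Longrightarrow> bmf (\<lambda>x. \<Sum>i\<in>A. f i x)"
  by (induction A rule: finite_induct) (auto intro: bmf_const bmf_add)

lemma bmf_continuous: "continuous_on UNIV f \<Longrightarrow> bmf f"
  unfolding bmf_def
proof (intro conjI borel_measurable_continuous_onI)
  assume c: "continuous_on UNIV f"
  have "compact (f ` {0..1})" using c by (intro compact_continuous_image) (auto intro: continuous_on_subset)
  then show "\<exists>C. \<forall>x\<in>{0..1}. \<bar>f x\<bar> \<le> C"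
    using compact_imp_bounded[of "f ` {0..1}"] unfolding bounded_iff by auto
qed

lemma bmf_power: "bmf (\<lambda>x. x ^ i)"
  by (rule bmf_continuous) (intro continuous_intros)

lemma bmf_poly: "bmf (poly q)"
  by (rule bmf_continuous) (intro continuous_intros)

lemma integrable_bounded_lebesgue_on:
  fixes f :: "'a::euclidean_space \<Rightarrow> real"
  assumes "f \<in> borel_measurable (lebesgue_on S)" "S \<in> lmeasurable" "\<And>x. x \<in> S \<Longrightarrow> \<bar>f x\<bar> \<le> C"
  shows "integrable (lebesgue_on S) f"
proof (rule finite_measure.integrable_const_bound[of _ _ C])
  have S: "S \<in> sets lebesgue" using assms(2) by auto
  show "finite_measure (lebesgue_on S)"
    using assms(2) by (simp add: finite_measure_lebesgue_on)
  show "AE x in lebesgue_on S. norm (f x) \<le> C" by (rule AE_I2) (use assms(3) S in auto)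
qed (rule assms(1))

lemma bmf_integrable: "bmf f \<Longrightarrow> integrable leb_unit f"
  unfolding bmf_def
proof (elim conjE exE)
  fix C assume f: "borel_fun f" "\<forall>x\<in>{0..1}. \<bar>f x\<bar> \<le> C"
  have "f \<in> borel_measurable leb_unit"
    using f(1) by (intro measurable_restrict_space1 measurable_completion) auto
  then show ?thesis using f(2) by (intro integrable_bounded_lebesgue_on[of _ _ C]) auto
qed

lemma bmf_integral_zero_AE:
  assumes f: "bmf f" and z: "ip01 f f = 0"
  shows "AE x in leb_unit. f x = 0"
proof -
  have "AE x in leb_unit. f x * f x = 0"
    using z by (subst (asm) integral_nonneg_eq_0_iff_AE) (auto intro: bmf_integrable bmf_mult f)
  then show ?thesis by auto
qed

lemma ip01_add_left: "bmf f \<Longrightarrow> bmf g \<Longrightarrow> bmf h \<Longrightarrow> ip01 (\<lambda>x. f x + g x) h = ip01 f h + ip01 g h"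
  by (simp add: distrib_right bmf_integrable bmf_mult)

lemma ip01_diff_left: "bmf f \<Longrightarrow> bmf g \<Longrightarrow> bmf h \<Longrightarrow> ip01 (\<lambda>x. f x - g x) h = ip01 f h - ip01 g h"
  by (simp add: left_diff_distrib bmf_integrable bmf_mult)

lemma ip01_cmult_left: "ip01 (\<lambda>x. c * f x) h = c * ip01 f h"
  by (simp add: mult.assoc)

lemma ip01_commute: "ip01 f h = ip01 h f"
  by (simp add: mult.commute)

lemma ip01_sum_left: "finite A \<Longrightarrow> (\<And>i. i \<in> A \<Longrightarrow> bmf (f i)) \<Longrightarrow> bmf h \<Longrightarrow>
    ip01 (\<lambda>x. \<Sum>i\<in>A. c i * f i x) h = (\<Sum>i\<in>A. c i * ip01 (f i) h)"
proof (induction A rule: finite_induct)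
  case (insert a A)
  have "ip01 (\<lambda>x. c a * f a x + (\<Sum>i\<in>A. c i * f i x)) h = ip01 (\<lambda>x. c a * f a x) h + ip01 (\<lambda>x. \<Sum>i\<in>A. c i * f i x) h"
    using insert by (intro ip01_add_left bmf_cmult bmf_sum) auto
  then show ?case using insert by (simp add: ip01_cmult_left)
qed simp

lemma lin_combs_bmf: "finite I \<Longrightarrow> (\<And>i. i \<in> I \<Longrightarrow> bmf (f i)) \<Longrightarrow> g \<in> lin_combs I f \<Longrightarrow> bmf g"
  unfolding lin_combs_def by (auto intro!: bmf_sum bmf_cmult)

lemma lin_combs_add: "g \<in> lin_combs I f \<Longrightarrow> h \<in> lin_combs I f \<Longrightarrow> (\<lambda>x. g x + h x) \<in> lin_combs I f"
  unfolding lin_combs_def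
proof clarify
  fix c d
  show "\<exists>e. (\<lambda>x. (\<Sum>i\<in>I. c i * f i x) + (\<Sum>i\<in>I. d i * f i x)) = (\<lambda>x. \<Sum>i\<in>I. e i * f i x) \<and> True"
    by (intro exI[of _ "\<lambda>i. c i + d i"]) (simp add: distrib_right sum.distrib)
qed

lemma lin_combs_cmult: "g \<in> lin_combs I f \<Longrightarrow> (\<lambda>x. a * g x) \<in> lin_combs I f"
  unfolding lin_combs_def
proof clarify
  fix c
  show "\<exists>e. (\<lambda>x. a * (\<Sum>i\<in>I. c i * f i x)) = (\<lambda>x. \<Sum>i\<in>I. e i * f i x) \<and> True"
    by (intro exI[of _ "\<lambda>i. a * c i"]) (simp add: mult.assoc sum_distrib_left)
qed

lemma lin_combs_diff: "g \<in> lin_combs I f \<Longrightarrow> h \<in> lin_combs I f \<Longrightarrow> (\<lambda>x. g x - h x) \<in> lin_combs I f"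
  using lin_combs_add[OF _ lin_combs_cmult[of h I f "-1"], of g] by simp

lemma lin_combs_sum: "finite A \<Longrightarrow> (\<And>a. a \<in> A \<Longrightarrow> g a \<in> lin_combs I f) \<Longrightarrow> (\<lambda>x. \<Sum>a\<in>A. c a * g a x) \<in> lin_combs I f"
proof (induction A rule: finite_induct)
  case empty
  show ?case unfolding lin_combs_def mem_Collect_eq by (intro exI[of _ "\<lambda>_. 0"]) simp
next
  case (insert a A)
  then show ?case using lin_combs_add[OF lin_combs_cmult] by simp
qed

lemma lin_combs_base: "finite I \<Longrightarrow> i \<in> I \<Longrightarrow> f i \<in> lin_combs I f"
  unfolding lin_combs_def mem_Collect_eq
  by (intro exI[of _ "\<lambda>j. if j = i then 1 else 0"]) (auto simp: if_distrib[of "\<lambda>c. c * _"] cong: if_cong)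

text \<open>
  Gram--Schmidt: a generator whose component \<open>w\<close> orthogonal to the preceding ones is null adds
  nothing up to null sets; otherwise \<open>w\<close> contributes the usual quotient.
\<close>

lemma orthogonal_projection_exists:
  assumes "\<And>i. i < n \<Longrightarrow> bmf (f i)" "bmf h"
  shows "\<exists>g\<in>lin_combs {..<n} f. \<forall>i<n. ip01 g (f i) = ip01 h (f i)"
  using assms
proof (induction n arbitrary: h)
  case 0
  then show ?case using lin_combs_sum[of "{}"] by auto
next
  case (Suc n)
  have mono: "g \<in> lin_combs {..<Suc n} f" if gc: "g \<in> lin_combs {..<n} f" for g
  proof -
    obtain c where "g = (\<lambda>x. \<Sum>i<n. c i * f i x)" using gc unfolding lin_combs_def by auto
    moreover have "(\<Sum>i<n. c i * f i x) = (\<Sum>i<Suc n. (if i < n then c i else 0) * f i x)" for x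
      by (auto intro!: sum.cong)
    ultimately have "g = (\<lambda>x. \<Sum>i<Suc n. (if i < n then c i else 0) * f i x)" by (simp only:)
    then show ?thesis unfolding lin_combs_def mem_Collect_eq by (intro exI[of _ "\<lambda>i. if i < n then c i else 0"] conjI TrueI)
  qed
  have fb: "bmf (f i)" if "i < Suc n" for i using Suc.prems that by auto
  obtain p where p: "p \<in> lin_combs {..<n} f" "\<forall>i<n. ip01 p (f i) = ip01 (f n) (f i)"
    using Suc.IH[of "f n"] fb by auto
  obtain g where g: "g \<in> lin_combs {..<n} f" "\<forall>i<n. ip01 g (f i) = ip01 h (f i)"
    using Suc.IH[of h] Suc.prems by auto
  have pb: "bmf p" and gb: "bmf g" using lin_combs_bmf[of "{..<n}" f] p g fb by auto
  define w where "w x = f n x - p x" for x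
  have wb: "bmf w" unfolding w_def[abs_def] using fb pb by (intro bmf_diff) auto
  have w_f: "ip01 w (f i) = 0" if "i < n" for i
    unfolding w_def using that p fb pb by (subst ip01_diff_left) auto
  have orth: "ip01 w s = 0" if "s \<in> lin_combs {..<n} f" for s
  proof -
    obtain c where "s = (\<lambda>x. \<Sum>i<n. c i * f i x)" using \<open>s \<in> _\<close> unfolding lin_combs_def by auto
    then have "ip01 w s = (\<Sum>i<n. c i * ip01 (f i) w)"
      using fb wb by (subst ip01_commute) (auto intro!: ip01_sum_left)
    also have "\<dots> = 0" using w_f by (intro sum.neutral) (auto simp: ip01_commute)
    finally show ?thesis .
  qed
  have split: "ip01 u (f n) = ip01 u p + ip01 u w" if "bmf u" for u
    using ip01_add_left[OF pb wb that] unfolding ip01_commute[of u] by (simp add: w_def)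
  have gh: "ip01 g p = ip01 h p"
  proof -
    obtain c where c: "p = (\<lambda>x. \<Sum>i<n. c i * f i x)" using p unfolding lin_combs_def by auto
    have "ip01 p u = (\<Sum>i<n. c i * ip01 (f i) u)" if "bmf u" for u
      unfolding c using fb that by (intro ip01_sum_left) auto
    then show ?thesis
      using g gb Suc.prems by (simp add: ip01_commute[of g p] ip01_commute[of h p] ip01_commute[of "f _"])
  qed
  have lin: "w \<in> lin_combs {..<Suc n} f"
    unfolding w_def[abs_def] using p mono by (intro lin_combs_diff lin_combs_base) auto
  show ?case
  proof (cases "ip01 w w = 0")
    case True
    then have w0: "AE x in leb_unit. w x = 0" by (rule bmf_integral_zero_AE[OF wb])
    have wz: "ip01 u w = 0" if "bmf u" for u
      using w0 by (intro integral_eq_zero_AE) auto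
    have "ip01 g (f n) = ip01 h (f n)"
      unfolding split[OF gb] split[OF Suc.prems(2)] wz[OF gb] wz[OF Suc.prems(2)] using gh by simp
    then show ?thesis using g mono by (intro bexI[of _ g]) (auto simp: less_Suc_eq)
  next
    case False
    define a where "a = ip01 h w / ip01 w w"
    let ?g = "\<lambda>x. g x + a * w x"
    have gl: "?g \<in> lin_combs {..<Suc n} f" using g mono lin by (intro lin_combs_add lin_combs_cmult) auto
    have gi: "ip01 ?g u = ip01 g u + a * ip01 w u" if "bmf u" for u
      using ip01_add_left[OF gb bmf_cmult[OF wb] that] by (simp only: ip01_cmult_left)
    have "\<forall>i<Suc n. ip01 ?g (f i) = ip01 h (f i)"
    proof (intro allI impI)
      fix i assume "i < Suc n"
      show "ip01 ?g (f i) = ip01 h (f i)"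
    proof (cases "i < n")
      case True
      then show ?thesis using gi[of "f i"] w_f g fb by simp
    next
      case False
      then have i: "i = n" using \<open>i < Suc n\<close> by simp
      have "ip01 w (f n) = ip01 w w" unfolding split[OF wb] orth[OF p(1)] by (rule add_0)
      moreover have "ip01 g w = 0" by (subst ip01_commute) (rule orth[OF g(1)])
      ultimately have "ip01 ?g (f n) = ip01 g p + a * ip01 w w"
        unfolding gi[OF fb[OF lessI]] split[OF gb] by (simp only: add_0_right)
      also have "\<dots> = ip01 h p + ip01 h w" unfolding gh a_def using \<open>ip01 w w \<noteq> 0\<close> by simp
      finally show ?thesis unfolding i split[OF Suc.prems(2)] .
    qed
    qed
    then show ?thesis by (rule bexI[OF _ gl])
  qed
qed

definition proj_onto :: "(real \<Rightarrow> real) set \<Rightarrow> (real \<Rightarrow> real) \<Rightarrow> (real \<Rightarrow> real) \<Rightarrow> bool" where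
  "proj_onto V h g \<longleftrightarrow> g \<in> V \<and> (\<forall>s\<in>V. ip01 g s = ip01 h s)"

lemma proj_onto_exists:
  assumes f: "\<And>i. i < n \<Longrightarrow> bmf (f i)" and h: "bmf h"
  shows "\<exists>g. proj_onto (lin_combs {..<n} f) h g"
proof -
  obtain g where g: "g \<in> lin_combs {..<n} f" "\<forall>i<n. ip01 g (f i) = ip01 h (f i)"
    using orthogonal_projection_exists[of n f h] assms by auto
  have gb: "bmf g" using lin_combs_bmf[of "{..<n}" f g] g f by auto
  have "ip01 g s = ip01 h s" if sl: "s \<in> lin_combs {..<n} f" for s
  proof -
    obtain c where s: "s = (\<lambda>x. \<Sum>i<n. c i * f i x)" using sl unfolding lin_combs_def by auto
    have "ip01 s u = (\<Sum>i<n. c i * ip01 (f i) u)" if "bmf u" for u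
      unfolding s using f that by (intro ip01_sum_left) auto
    then show ?thesis
      using g gb h by (simp add: ip01_commute[of g s] ip01_commute[of h s] ip01_commute[of "f _"])
  qed
  then show ?thesis using g unfolding proj_onto_def by blast
qed

text \<open>
  The difference of two projections belongs to the space and is orthogonal to it, so its square has
  integral zero.
\<close>

lemma proj_onto_unique:
  assumes V: "V = lin_combs I f" "finite I" "\<And>i. i \<in> I \<Longrightarrow> bmf (f i)"
    and h: "bmf h" "bmf h'" "AE x in leb_unit. h x = h' x"
    and g: "proj_onto V h g" "proj_onto V h' g'"
  shows "AE x in leb_unit. g x = g' x"
proof -
  let ?d = "\<lambda>x. g x - g' x"
  have gb: "bmf g" "bmf g'" using lin_combs_bmf[of I f g] lin_combs_bmf[of I f g'] V g unfolding proj_onto_def by blast+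
  have d: "?d \<in> V" using g lin_combs_diff unfolding proj_onto_def V(1) by blast
  have db: "bmf ?d" using gb by (rule bmf_diff)
  have "ip01 ?d ?d = ip01 g ?d - ip01 g' ?d" using ip01_diff_left[OF gb db] .
  also have "\<dots> = ip01 h ?d - ip01 h' ?d" using g d unfolding proj_onto_def by simp
  also have "ip01 h ?d = ip01 h' ?d"
    using h db gb by (intro integral_cong_AE borel_measurable_integrable bmf_integrable bmf_mult) auto
  finally have "ip01 ?d ?d = 0" by simp
  from bmf_integral_zero_AE[OF db this] show ?thesis by auto
qed

lemma proj_onto_self: "g \<in> V \<Longrightarrow> proj_onto V g g"
  unfolding proj_onto_def by simp

lemma proj_onto_sum:
  assumes V: "V = lin_combs I f" and J: "finite J" and V': "finite I" "\<And>i. i \<in> I \<Longrightarrow> bmf (f i)"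
    and p: "\<And>j. j \<in> J \<Longrightarrow> proj_onto V (h j) (g j)" and h: "\<And>j. j \<in> J \<Longrightarrow> bmf (h j)"
  shows "proj_onto V (\<lambda>x. \<Sum>j\<in>J. c j * h j x) (\<lambda>x. \<Sum>j\<in>J. c j * g j x)"
  unfolding proj_onto_def
proof (intro conjI ballI)
  show "(\<lambda>x. \<Sum>j\<in>J. c j * g j x) \<in> V" using p J unfolding V proj_onto_def by (intro lin_combs_sum) auto
  fix s assume s: "s \<in> V"
  have sb: "bmf s" using lin_combs_bmf[of I f s] V' s V by blast
  have gb: "bmf (g j)" if "j \<in> J" for j using lin_combs_bmf[of I f "g j"] V' p[OF that] V unfolding proj_onto_def by blast
  have "ip01 (\<lambda>x. \<Sum>j\<in>J. c j * g j x) s = (\<Sum>j\<in>J. c j * ip01 (g j) s)" using J gb sb by (intro ip01_sum_left)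
  also have "\<dots> = (\<Sum>j\<in>J. c j * ip01 (h j) s)" using p s unfolding proj_onto_def by (intro sum.cong) auto
  also have "\<dots> = ip01 (\<lambda>x. \<Sum>j\<in>J. c j * h j x) s" using J h sb by (intro ip01_sum_left[symmetric])
  finally show "ip01 (\<lambda>x. \<Sum>j\<in>J. c j * g j x) s = ip01 (\<lambda>x. \<Sum>j\<in>J. c j * h j x) s" .
qed

section \<open>Integration on the plane\<close>

abbreviation vec2 :: "real \<Rightarrow> real \<Rightarrow> real^2" where
  "vec2 s t \<equiv> vector [s, t]"

lemma vec2_eta [simp]: "vec2 (y $ 1) (y $ 2) = y"
  by (simp add: vec_eq_iff forall_2)

lemma vec2_eq_iff: "x = (y :: real^2) \<longleftrightarrow> x $ 1 = y $ 1 \<and> x $ 2 = y $ 2"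
  by (simp add: vec_eq_iff forall_2)

lemma mem_unit_box: "y \<in> box (0::real^2) 1 \<longleftrightarrow> 0 < y$1 \<and> y$1 < 1 \<and> 0 < y$2 \<and> y$2 < 1"
  by (auto simp: mem_box_cart forall_2)

lemma mem_unit_cbox: "y \<in> cbox (0::real^2) 1 \<longleftrightarrow> 0 \<le> y$1 \<and> y$1 \<le> 1 \<and> 0 \<le> y$2 \<and> y$2 \<le> 1"
  by (auto simp: mem_box_cart forall_2)

abbreviation leb_square :: "(real^2) measure" where "leb_square \<equiv> lebesgue_on (box 0 1)"

lemma vec2_measurable [measurable]: "(\<lambda>(s, t). vec2 s t) \<in> borel_measurable (borel \<Otimes>\<^sub>M borel)"
proof -
  have "continuous_on UNIV (\<lambda>p. vec2 (fst p) (snd p))"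
  proof -
    have "continuous_on UNIV (\<lambda>p::real\<times>real. if i = 1 then fst p else snd p)" for i :: 2
      by (cases "i = 1") (auto intro!: continuous_intros)
    moreover have "(\<lambda>p. vec2 (fst p) (snd p)) = (\<lambda>p. \<chi> i. if i = 1 then fst p else snd p)"
      by (auto simp: fun_eq_iff vec2_eq_iff)
    ultimately show ?thesis by (simp only: continuous_on_vec_lambda)
  qed
  then have "borel_fun (\<lambda>p. vec2 (fst p) (snd p))" by (rule borel_measurable_continuous_onI)
  then show ?thesis by (simp add: borel_prod case_prod_unfold)
qed

lemma borel_measurable_vec_nth [measurable]: "borel_fun (\<lambda>x::real^2. x $ i)"
  by (intro borel_measurable_continuous_onI continuous_intros)

lemma lborel_plane: "(lborel :: (real^2) measure) = distr (lborel \<Otimes>\<^sub>M lborel) borel (\<lambda>(s, t). vec2 s t)"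
proof (rule lborel_eqI)
  fix l u :: "real^2" assume lu: "\<And>b. b \<in> Basis \<Longrightarrow> l \<bullet> b \<le> u \<bullet> b"
  have B: "Basis = {axis 1 1, axis 2 1 :: real^2}" by (auto simp: Basis_vec_def UNIV_2)
  have ne: "axis 1 1 \<noteq> (axis 2 1 :: real^2)" by (simp add: axis_eq_axis)
  have le: "l $ 1 \<le> u $ 1" "l $ 2 \<le> u $ 2" using lu[of "axis 1 1"] lu[of "axis 2 1"] unfolding B by (auto simp: inner_axis)
  have "(\<lambda>(s, t). vec2 s t) -` box l u \<inter> space (lborel \<Otimes>\<^sub>M lborel) = {l$1<..<u$1} \<times> {l$2<..<u$2}"
    by (auto simp: mem_box_cart forall_2 space_pair_measure)
  then have "emeasure (distr (lborel \<Otimes>\<^sub>M lborel) borel (\<lambda>(s, t). vec2 s t)) (box l u) =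
      emeasure (lborel \<Otimes>\<^sub>M lborel) ({l$1<..<u$1} \<times> {l$2<..<u$2})"
    by (subst emeasure_distr) auto
  also have "\<dots> = ennreal (u$1 - l$1) * ennreal (u$2 - l$2)"
    using le by (simp add: lborel.emeasure_pair_measure_Times)
  also have "\<dots> = ennreal (\<Prod>b\<in>Basis. (u - l) \<bullet> b)"
    unfolding B using ne le by (simp add: ennreal_mult[symmetric] inner_axis)
  finally show "emeasure (distr (lborel \<Otimes>\<^sub>M lborel) borel (\<lambda>(s, t). vec2 s t)) (box l u) =
      ennreal (\<Prod>b\<in>Basis. (u - l) \<bullet> b)" .
qed simp

lemma borel_measurable_vec2_slice:
  assumes "borel_fun f" shows "borel_fun (\<lambda>t. f (vec2 s t))"
  using measurable_compose[OF measurable_Pair1'[of s borel borel] measurable_compose[OF vec2_measurable assms]] by simp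

lemma integral_lebesgue_on_borel:
  fixes f :: "'a::euclidean_space \<Rightarrow> real"
  assumes "borel_fun f" "S \<in> sets borel"
  shows "(LINT x|lebesgue_on S. f x) = (LINT x|lborel. indicator S x * f x)"
proof -
  have "(LINT x|lebesgue_on S. f x) = (LINT x|lebesgue. indicator S x * f x)"
    using assms(2) by (subst integral_restrict_space) auto
  also have "\<dots> = (LINT x|lborel. indicator S x * f x)"
    using assms by (intro integral_completion) auto
  finally show ?thesis .
qed

lemma AE_lebesgue_on_iff:
  "S \<in> sets lebesgue \<Longrightarrow> (AE x in lebesgue_on S. P x) \<longleftrightarrow> (AE x in lborel. x \<in> S \<longrightarrow> P x)"
  by (subst AE_restrict_space_iff) (auto simp: AE_completion_iff)

lemma AE_unit_interval_interior:
  "(AE x in leb_unit. P x) \<longleftrightarrow> (AE x in lborel. 0 < x \<and> x < 1 \<longrightarrow> P (x::real))"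
proof -
  have e: "AE x in lborel. x \<noteq> 0 \<and> x \<noteq> (1::real)"
    using AE_lborel_singleton[of 0] AE_lborel_singleton[of 1] by auto
  have "(AE x in lborel. x \<in> {0..1} \<longrightarrow> P x) \<longleftrightarrow> (AE x in lborel. 0 < x \<and> x < 1 \<longrightarrow> P x)"
  proof
    assume "AE x in lborel. x \<in> {0..1} \<longrightarrow> P x"
    then show "AE x in lborel. 0 < x \<and> x < 1 \<longrightarrow> P x" by eventually_elim auto
  next
    assume "AE x in lborel. 0 < x \<and> x < 1 \<longrightarrow> P x"
    with e show "AE x in lborel. x \<in> {0..1} \<longrightarrow> P x" by eventually_elim auto
  qed
  then show ?thesis by (simp add: AE_lebesgue_on_iff)
qed

lemma AE_coord_notin_finite:
  assumes "finite S"
  shows "AE y in lborel. (y::real^2) $ i \<notin> S"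
proof -
  have "AE y in lborel. (y::real^2) $ i \<noteq> c" for c
  proof -
    have "negligible {x::real^2. axis i 1 \<bullet> x = c}"
      by (rule negligible_hyperplane) (simp add: axis_eq_0_iff)
    moreover have "{x::real^2. axis i 1 \<bullet> x = c} = {x. x $ i = c}" by (auto simp: inner_axis')
    ultimately have "{x::real^2. x $ i = c} \<in> null_sets lebesgue" by (simp only: negligible_iff_null_sets)
    then have "AE y in lebesgue. (y::real^2) $ i \<noteq> c" by (auto dest: AE_not_in)
    then show ?thesis by (simp add: AE_completion_iff)
  qed
  then have "AE y in lborel. \<forall>c\<in>S. (y::real^2) $ i \<noteq> c" using assms by (intro AE_finite_allI) auto
  then show ?thesis by eventually_elim auto
qed

lemma integral_unit_box_iterated:
  fixes f :: "real^2 \<Rightarrow> real"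
  assumes f: "borel_fun f" and C: "\<And>y. y \<in> cbox 0 1 \<Longrightarrow> \<bar>f y\<bar> \<le> C"
  shows "(LINT y|leb_square. f y) =
         (LINT s|leb_unit. LINT t|leb_unit. f (vec2 s t))"
proof -
  let ?g = "\<lambda>(s, t). indicator {0..1} s * (indicator {0..1} t * f (vec2 s t))"
  have e: "AE y in lborel. (y::real^2) $ 1 \<notin> {0, 1} \<and> y $ 2 \<notin> {0, 1}"
    using AE_coord_notin_finite[of "{0,1}" 1] AE_coord_notin_finite[of "{0,1}" 2] by auto
  have "(LINT y|leb_square. f y) = (LINT y|lborel. indicator (box 0 1) y * f y)"
    using f by (intro integral_lebesgue_on_borel) auto
  also have "\<dots> = (LINT y|lborel. indicator (cbox 0 1) y * f y)"
  proof (rule integral_cong_AE)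
    show "AE y in lborel. indicator (box 0 1) y * f y = indicator (cbox 0 1) y * f y"
      using e by eventually_elim (auto simp: indicator_def mem_unit_box mem_unit_cbox)
  qed (use f in auto)
  also have "\<dots> = (LINT p|(lborel \<Otimes>\<^sub>M lborel). ?g p)"
    using f by (subst lborel_plane, subst integral_distr)
      (auto simp: case_prod_unfold indicator_def mem_unit_cbox intro!: Bochner_Integration.integral_cong)
  also have "\<dots> = (LINT s|lborel. LINT t|lborel. ?g (s, t))"
  proof (rule lborel_pair.integral_fst'[symmetric])
    have gm: "?g \<in> borel_measurable (lborel \<Otimes>\<^sub>M lborel)"
      using measurable_compose[OF vec2_measurable f] by (simp add: case_prod_unfold) measurable
    have "set_integrable (lborel \<Otimes>\<^sub>M lborel) ({0..1} \<times> {0..1}) (\<lambda>(s, t). f (vec2 s t))"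
      unfolding set_integrable_def
    proof (rule integrableI_bounded_set[of "{0..1} \<times> {0..1}" _ _ C])
      show "emeasure (lborel \<Otimes>\<^sub>M lborel) ({0..1::real} \<times> {0..1::real}) < \<infinity>"
        by (simp add: lborel.emeasure_pair_measure_Times)
      show "AE x in lborel \<Otimes>\<^sub>M lborel. x \<in> {0..1} \<times> {0..1} \<longrightarrow>
          norm (indicat_real ({0..1} \<times> {0..1}) x *\<^sub>R (case x of (s, t) \<Rightarrow> f (vec2 s t))) \<le> C"
        using C by (intro AE_I2) (auto simp: mem_unit_cbox)
      show "(\<lambda>x. indicat_real ({0..1} \<times> {0..1}) x *\<^sub>R (case x of (s, t) \<Rightarrow> f (vec2 s t))) \<in> borel_measurable (lborel \<Otimes>\<^sub>M lborel)"
        using measurable_compose[OF vec2_measurable f] by (simp add: case_prod_unfold) measurable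
    qed auto
    then show "integrable (lborel \<Otimes>\<^sub>M lborel) ?g"
      unfolding set_integrable_def by (rule Bochner_Integration.integrable_cong[THEN iffD1, rotated -1]) (auto simp: indicator_def)
  qed
  also have "\<dots> = (LINT s|lborel. indicator {0..1} s * (LINT t|lborel. indicator {0..1} t * f (vec2 s t)))"
    by simp
  also have "\<dots> = (LINT s|lborel. indicator {0..1} s * (LINT t|leb_unit. f (vec2 s t)))"
  proof -
    have "borel_fun (\<lambda>t. f (vec2 s t))" for s
      using f by (rule borel_measurable_vec2_slice)
    then show ?thesis by (simp add: integral_lebesgue_on_borel)
  qed
  also have "\<dots> = (LINT s|leb_unit. LINT t|leb_unit. f (vec2 s t))"
  proof (rule integral_lebesgue_on_borel[symmetric])
    have "borel_fun (\<lambda>t. f (vec2 s t))" for s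
      using f by (rule borel_measurable_vec2_slice)
    then have "(LINT t|leb_unit. f (vec2 s t)) = (LINT t|lborel. indicator {0..1} t * f (vec2 s t))" for s
      by (simp add: integral_lebesgue_on_borel)
    moreover have "borel_fun (\<lambda>s. LINT t|lborel. indicator {0..1} t * f (vec2 s t))"
    proof (rule lborel.borel_measurable_lebesgue_integral)
      have "(\<lambda>p. f (vec2 (fst p) (snd p))) \<in> borel_measurable (borel \<Otimes>\<^sub>M borel)"
        using measurable_compose[OF vec2_measurable f] by (simp add: case_prod_unfold)
      then have "(\<lambda>(s, t). indicator {0..1} t * f (vec2 s t)) \<in> borel_measurable (borel \<Otimes>\<^sub>M borel)"
        by (simp add: case_prod_unfold)
      then show "(\<lambda>(s, t). indicator {0..1} t * f (vec2 s t)) \<in> borel_measurable (borel \<Otimes>\<^sub>M lborel)"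
        by (subst measurable_cong_sets[OF sets_pair_measure_cong[OF refl sets_lborel] refl])
    qed
    ultimately show "borel_fun (\<lambda>s. LINT t|leb_unit. f (vec2 s t))" by simp
  qed auto
  finally show ?thesis .
qed

lemma AE_unit_box_iterated:
  assumes "AE y in leb_square. P y"
  shows "AE s in leb_unit. AE t in leb_unit. P (vec2 s t)"
proof -
  have "AE y in lborel. y \<in> box (0::real^2) 1 \<longrightarrow> P y" using assms by (simp add: AE_lebesgue_on_iff)
  then have "AE y in distr (lborel \<Otimes>\<^sub>M lborel) borel (\<lambda>(s, t). vec2 s t). y \<in> box (0::real^2) 1 \<longrightarrow> P y"
    by (simp only: lborel_plane[symmetric])
  then have "AE p in lborel \<Otimes>\<^sub>M lborel. (case p of (s, t) \<Rightarrow> vec2 s t) \<in> box 0 1 \<longrightarrow> P (case p of (s, t) \<Rightarrow> vec2 s t)"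
    by (rule AE_distrD[rotated]) simp
  then have "AE s in lborel. AE t in lborel. vec2 s t \<in> box 0 1 \<longrightarrow> P (vec2 s t)"
    by (drule_tac lborel_pair.AE_pair) simp
  then have "AE s in lborel. 0 < s \<and> s < 1 \<longrightarrow> (AE t in lborel. 0 < t \<and> t < 1 \<longrightarrow> P (vec2 s t))"
    by eventually_elim (auto simp: mem_unit_box elim!: eventually_mono)
  then show ?thesis by (simp add: AE_unit_interval_interior)
qed

lemma integral_unit_box_product:
  assumes "bmf f" "bmf g"
  shows "(LINT y|leb_square. f (y$1) * g (y$2)) =
         (LINT s|leb_unit. f s) * (LINT t|leb_unit. g t)"
proof -
  obtain C D where CD: "\<forall>x\<in>{0..1}. \<bar>f x\<bar> \<le> C" "\<forall>x\<in>{0..1}. \<bar>g x\<bar> \<le> D"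
    and [measurable]: "borel_fun f" "borel_fun g"
    using assms unfolding bmf_def by auto
  have "(LINT y|leb_square. f (y$1) * g (y$2)) =
     (LINT s|leb_unit. LINT t|leb_unit. f (vec2 s t $ 1) * g (vec2 s t $ 2))"
  proof (rule integral_unit_box_iterated[where f = "\<lambda>y. f (y$1) * g (y$2)" and C = "C * D"])
    show "\<bar>f (y$1) * g (y$2)\<bar> \<le> C * D" if "y \<in> cbox 0 1" for y :: "real^2"
      unfolding abs_mult using CD that by (intro mult_mono) (auto simp: mem_unit_cbox intro: order.trans[OF abs_ge_zero])
  qed measurable
  then show ?thesis by simp
qed

text \<open>
  The counterpart of \<open>bmf\<close> on the unit square.
\<close>

definition bms :: "(real^2 \<Rightarrow> real) \<Rightarrow> bool" where
  "bms f \<longleftrightarrow> borel_fun f \<and> (\<exists>C. \<forall>y\<in>cbox 0 1. \<bar>f y\<bar> \<le> C)"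

lemma bms_const: "bms (\<lambda>y. c)"
  unfolding bms_def by auto

lemma bms_add: assumes "bms f" "bms g" shows "bms (\<lambda>y. f y + g y)"
proof -
  obtain C D where "\<forall>y\<in>cbox 0 1. \<bar>f y\<bar> \<le> C" "\<forall>y\<in>cbox 0 1. \<bar>g y\<bar> \<le> D" using assms unfolding bms_def by blast
  then have "\<forall>y\<in>cbox 0 1. \<bar>f y + g y\<bar> \<le> C + D" by (auto intro!: order.trans[OF abs_triangle_ineq add_mono])
  then show ?thesis using assms unfolding bms_def by auto
qed

lemma bms_mult: assumes "bms f" "bms g" shows "bms (\<lambda>y. f y * g y)"
proof -
  obtain C D where "\<forall>y\<in>cbox 0 1. \<bar>f y\<bar> \<le> C" "\<forall>y\<in>cbox 0 1. \<bar>g y\<bar> \<le> D" using assms unfolding bms_def by blast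
  then have "\<bar>f y * g y\<bar> \<le> C * D" if "y \<in> cbox 0 1" for y
    unfolding abs_mult using that by (intro mult_mono) (auto intro: order.trans[OF abs_ge_zero])
  then show ?thesis using assms unfolding bms_def by auto
qed

lemma bms_diff: "bms f \<Longrightarrow> bms g \<Longrightarrow> bms (\<lambda>y. f y - g y)"
  using bms_add[OF _ bms_mult[OF bms_const[of "-1"]], of f g] by simp

lemma bms_sum: "finite A \<Longrightarrow> (\<And>i. i \<in> A \<Longrightarrow> bms (f i)) \<Longrightarrow> bms (\<lambda>y. \<Sum>i\<in>A. f i y)"
  by (induction A rule: finite_induct) (auto intro: bms_const bms_add)

lemma bms_coord: assumes "bmf f" shows "bms (\<lambda>y. f (y$i))"
proof -
  have "y$i \<in> {0..1}" if "y \<in> cbox 0 1" for y :: "real^2" using that exhaust_2[of i] by (auto simp: mem_unit_cbox)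
  then show ?thesis using assms measurable_compose[OF borel_measurable_vec_nth[of i], of f borel] unfolding bms_def bmf_def by blast
qed

lemma bms_integrable: assumes "bms f" shows "integrable leb_square f"
proof -
  obtain C where C: "\<forall>y\<in>cbox 0 1. \<bar>f y\<bar> \<le> C" and f: "borel_fun f" using assms unfolding bms_def by blast
  have "\<bar>f y\<bar> \<le> C" if "y \<in> box 0 1" for y using C that box_subset_cbox by blast
  then show ?thesis using f
    by (intro integrable_bounded_lebesgue_on[of _ _ C] measurable_restrict_space1 measurable_completion) auto
qed

section \<open>The symmetries of the unit square\<close>

declare transpose_matrix_vector [simp del]

definition flip :: "bool \<Rightarrow> real \<Rightarrow> real" where
  "flip a s = (if a then 1 - s else s)"

text \<open>
  The eight symmetries of the unit square: reflections of the coordinates, followed by their exchange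
  if \<open>sw\<close> holds. The bottom side is mapped to the side on which the coordinate with index \<open>2\<close>, or \<open>1\<close> if \<open>sw\<close>
  holds, is \<open>0\<close> or, if \<open>b\<close> holds, \<open>1\<close>; the flag \<open>a\<close> selects the direction in which that side is traversed.
\<close>

definition sqsym :: "bool \<Rightarrow> bool \<Rightarrow> bool \<Rightarrow> real^2 \<Rightarrow> real^2" where
  "sqsym sw a b y = (if sw then vec2 (flip b (y$2)) (flip a (y$1)) else vec2 (flip a (y$1)) (flip b (y$2)))"

definition sqsym_mat :: "bool \<Rightarrow> bool \<Rightarrow> bool \<Rightarrow> real^2^2" where
  "sqsym_mat sw a b = (let \<alpha> = (if a then -1 else 1); \<beta> = (if b then -1 else 1) in
     if sw then vector [vec2 0 \<beta>, vec2 \<alpha> 0] else vector [vec2 \<alpha> 0, vec2 0 \<beta>])"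

lemma sqsym_mat_vector:
  "sqsym_mat sw a b *v y = (if sw then vec2 ((if b then -1 else 1) * y$2) ((if a then -1 else 1) * y$1)
     else vec2 ((if a then -1 else 1) * y$1) ((if b then -1 else 1) * y$2))"
  by (auto simp: sqsym_mat_def vec2_eq_iff matrix_vector_mult_def sum_2 Let_def)

lemma transpose_sqsym_mat_vector:
  "transpose (sqsym_mat sw a b) *v y =
     (if sw then vec2 ((if a then -1 else 1) * y$2) ((if b then -1 else 1) * y$1)
      else vec2 ((if a then -1 else 1) * y$1) ((if b then -1 else 1) * y$2))"
  by (auto simp: sqsym_mat_def vec2_eq_iff matrix_vector_mult_def transpose_def sum_2 Let_def)

lemma sqsym_has_derivative: "(sqsym sw a b has_derivative (*v) (sqsym_mat sw a b)) (at y within S)"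
proof -
  have "sqsym sw a b = (\<lambda>y. sqsym sw a b 0 + sqsym_mat sw a b *v y)"
    by (auto simp: fun_eq_iff sqsym_def sqsym_mat_vector vec2_eq_iff flip_def)
  moreover have "((\<lambda>y. sqsym sw a b 0 + sqsym_mat sw a b *v y) has_derivative (*v) (sqsym_mat sw a b)) (at y within S)"
    by (auto intro!: derivative_eq_intros bounded_linear_imp_has_derivative[OF matrix_vector_mul_bounded_linear])
  ultimately show ?thesis by metis
qed

lemma det_sqsym_mat: "det (sqsym_mat sw a b) = (if sw then -1 else 1) * (if a then -1 else 1) * (if b then -1 else 1)"
  by (auto simp: det_2 sqsym_mat_def Let_def)

lemma sqsym_compose:
  "sqsym sw a b (sqsym sw' a' b' y) =
     (if sw' then (if sw then sqsym False (b \<noteq> a') (a \<noteq> b') y else sqsym True (b \<noteq> a') (a \<noteq> b') y)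
      else sqsym sw (a \<noteq> a') (b \<noteq> b') y)"
  by (auto simp: sqsym_def flip_def)

lemma sqsym_id: "sqsym False False False = id"
  by (auto simp: sqsym_def flip_def fun_eq_iff)

definition sqsym_inv :: "bool \<Rightarrow> bool \<Rightarrow> bool \<Rightarrow> real^2 \<Rightarrow> real^2" where
  "sqsym_inv sw a b = (if sw then sqsym True b a else sqsym False a b)"

lemma sqsym_inv1: "sqsym_inv sw a b (sqsym sw a b y) = y" and sqsym_inv2: "sqsym sw a b (sqsym_inv sw a b y) = y"
  by (auto simp: sqsym_inv_def sqsym_compose sqsym_id)

lemma sqsym_mem_cbox: "sqsym sw a b y \<in> cbox 0 1 \<longleftrightarrow> y \<in> cbox 0 1"
  by (auto simp: sqsym_def flip_def mem_unit_cbox)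

lemma sqsym_mem_box: "sqsym sw a b y \<in> box 0 1 \<longleftrightarrow> y \<in> box 0 1"
  by (auto simp: sqsym_def flip_def mem_unit_box)

lemma sqsym_inv_mem: "sqsym_inv sw a b y \<in> cbox 0 1 \<longleftrightarrow> y \<in> cbox 0 1" "sqsym_inv sw a b y \<in> box 0 1 \<longleftrightarrow> y \<in> box 0 1"
  by (auto simp: sqsym_inv_def sqsym_mem_cbox sqsym_mem_box)

lemma sqsym_image: "sqsym sw a b ` cbox 0 1 = cbox 0 1" "sqsym sw a b ` box 0 1 = box 0 1"
proof -
  have "y \<in> sqsym sw a b ` A" if "y \<in> A" "\<And>y. y \<in> A \<Longrightarrow> sqsym_inv sw a b y \<in> A" for y A
    using that sqsym_inv2[of sw a b y] by (metis imageI)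
  then show "sqsym sw a b ` cbox 0 1 = cbox 0 1" "sqsym sw a b ` box 0 1 = box 0 1"
    by (auto simp: sqsym_mem_cbox sqsym_mem_box sqsym_inv_mem)
qed

lemma inj_sqsym: "inj_on (sqsym sw a b) S"
  by (metis inj_on_inverseI sqsym_inv1)

text \<open>The translation part is forced by the signs, because the images of the corners lie in the square.\<close>

lemma coord_change_sqsym:
  assumes A: "coord_change A" and im: "A ` cbox 0 1 = cbox 0 1"
  obtains sw a b where "A = sqsym sw a b"
proof -
  obtain t \<alpha> \<beta> where ab: "\<alpha> \<in> {-1, 1}" "\<beta> \<in> {-1, 1}"
    and A': "A = (\<lambda>x. t + vec2 (\<alpha> * x$1) (\<beta> * x$2)) \<or> A = (\<lambda>x. t + vec2 (\<alpha> * x$2) (\<beta> * x$1))"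
    using A unfolding coord_change_def by blast
  have "A (vec2 0 0) \<in> cbox 0 1" "A (vec2 1 1) \<in> cbox 0 1" "A (vec2 1 0) \<in> cbox 0 1" "A (vec2 0 1) \<in> cbox 0 1"
    using im by (auto simp: mem_unit_cbox)
  then have t: "t $ 1 = (if \<alpha> = 1 then 0 else 1)" "t $ 2 = (if \<beta> = 1 then 0 else 1)"
    using A' ab by (auto simp: mem_unit_cbox)
  from A' show ?thesis
  proof
    assume "A = (\<lambda>x. t + vec2 (\<alpha> * x$1) (\<beta> * x$2))"
    then have "A = sqsym False (\<alpha> = -1) (\<beta> = -1)"
      using t ab by (auto simp: fun_eq_iff sqsym_def flip_def vec2_eq_iff)
    then show ?thesis by (rule that)
  next
    assume "A = (\<lambda>x. t + vec2 (\<alpha> * x$2) (\<beta> * x$1))"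
    then have "A = sqsym True (\<beta> = -1) (\<alpha> = -1)"
      using t ab by (auto simp: fun_eq_iff sqsym_def flip_def vec2_eq_iff)
    then show ?thesis by (rule that)
  qed
qed

section \<open>Spline fields on the unit square\<close>

lemma uniformly_subdivides_imp:
  assumes sub: "uniformly_subdivides {real j / real N | j. j \<le> N} {real j / real N' | j. j \<le> N'}"
    and N: "1 \<le> N" "1 \<le> N'"
  shows "\<exists>s\<ge>1. N' = s * N"
proof -
  let ?X = "{real j / real N | j. j \<le> N}" and ?Y = "{real j / real N' | j. j \<le> N'}"
  obtain s where s: "1 \<le> (s::nat)" and sb: "\<forall>a\<in>?X. \<forall>b\<in>?X. a < b \<and> ?X \<inter> {a<..<b} = {} \<longrightarrow>
     ?Y \<inter> {a..b} = {a + real i / real s * (b - a) | i. i \<le> s}"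
    using sub unfolding uniformly_subdivides_def by blast
  have X0: "0 \<in> ?X" by (auto intro: exI[of _ 0])
  have X1: "1 / real N \<in> ?X" using N by (auto intro!: exI[of _ 1])
  have gap: "?X \<inter> {0<..<1 / real N} = {}" using N by (auto simp: divide_simps)
  have Y: "?Y \<inter> {0..1 / real N} = {0 + real i / real s * (1 / real N - 0) | i. i \<le> s}"
    using sb X0 X1 gap N by auto
  have "0 + real 1 / real s * (1 / real N - 0) \<in> ?Y \<inter> {0..1 / real N}" unfolding Y using s by blast
  then have "1 / (real s * real N) \<in> ?Y" by simp
  then obtain j where "1 / (real s * real N) = real j / real N'" by blast
  then have j: "real j / real N' = 1 / (real s * real N)" by (rule sym)
  have pos: "0 < real s * real N" using s N by simp
  have j': "real j * (real s * real N) = real N'" using j pos N by (simp add: field_simps) (use s in simp)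
  have j1: "1 \<le> j" using j' N by (cases j) auto
  have "1 / real N' \<in> ?Y" using N by (auto intro!: exI[of _ 1])
  moreover have "1 / real N' \<le> 1 / real N"
  proof -
    have "1 / real N' \<le> real j / real N'" using j1 by (intro divide_right_mono) auto
    also have "\<dots> = 1 / (real s * real N)" by (fact j)
    also have "\<dots> \<le> 1 / real N" using s N by (intro divide_left_mono) auto
    finally show ?thesis .
  qed
  ultimately have "1 / real N' \<in> ?Y \<inter> {0..1 / real N}" by simp
  then obtain i where i: "1 / real N' = real i / real s * (1 / real N)" unfolding Y by auto
  have "real s * real N = real i * real N'" using i pos N by (simp add: field_simps)
  then have e1: "s * N = i * N'" by (simp only: of_nat_mult[symmetric] of_nat_eq_iff)
  have e2: "j * (s * N) = N'" using j' by (simp only: of_nat_mult[symmetric] of_nat_eq_iff)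
  have "i \<noteq> 0" using e1 s N by (intro notI) auto
  then have "N' \<le> s * N" using e1 by simp
  moreover have "s * N \<le> N'" using e2 j1 by (metis mult_le_mono1 mult_1)
  ultimately show ?thesis using s by (intro exI[of _ s]) auto
qed

definition cells :: "multipatch \<Rightarrow> nat \<Rightarrow> nat" where
  "cells M k = (SOME N. 1 \<le> N \<and> sdim M k = sdeg M + (N - 1) * smult M \<and>
     (\<forall>i\<le>sdim M k + sdeg M + 1. knot M k i = uknot (sdeg M) (smult M) N i) \<and> knots M k = {real j / real N | j. j \<le> N})"

text \<open>
  From here on the spline data of a fixed multipatch are abbreviated. On a patch, \<open>lam0\<close> and \<open>lam1\<close>
  are B-splines on uniformly spaced knots of constant multiplicity; the second family, of degree
  one less, has the same knots with the first and the last copy removed.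
\<close>

locale spline_patches =
  fixes M :: multipatch
  assumes splines: "multipatch_splines M"
begin

abbreviation "p \<equiv> sdeg M"
abbreviation "m \<equiv> smult M"
abbreviation "n \<equiv> sdim M"

lemma mp: "1 \<le> m" "m \<le> p"
  using splines unfolding multipatch_splines_def by auto

lemma cells:
  assumes "k \<in> patches M"
  shows "1 \<le> cells M k" "n k = p + (cells M k - 1) * m"
    "\<And>i. i \<le> n k + p + 1 \<Longrightarrow> knot M k i = uknot p m (cells M k) i"
    "knots M k = {real j / real (cells M k) | j. j \<le> cells M k}"
proof -
  have "clamped_knots p m (n k) (knot M k)" using splines assms unfolding multipatch_splines_def by auto
  from clamped_knots_unique[OF this mp(1)] obtain N where "1 \<le> N" "n k = p + (N - 1) * m"
    "\<And>i. i \<le> n k + p + 1 \<Longrightarrow> knot M k i = uknot p m N i" "knot M k ` {..n k + p + 1} = {real j / real N | j. j \<le> N}"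
    by blast
  then have "\<exists>N. 1 \<le> N \<and> n k = p + (N - 1) * m \<and>
     (\<forall>i\<le>n k + p + 1. knot M k i = uknot p m N i) \<and> knots M k = {real j / real N | j. j \<le> N}"
    unfolding knots_def by blast
  from someI_ex[OF this, folded cells_def]
  show "1 \<le> cells M k" "n k = p + (cells M k - 1) * m"
    "\<And>i. i \<le> n k + p + 1 \<Longrightarrow> knot M k i = uknot p m (cells M k) i"
    "knots M k = {real j / real (cells M k) | j. j \<le> cells M k}" by auto
qed

lemma n_gt: "k \<in> patches M \<Longrightarrow> p + 1 < n k"
  using splines unfolding multipatch_splines_def by auto

lemma lam0_ubs: "k \<in> patches M \<Longrightarrow> i \<le> n k \<Longrightarrow> lam0 M k i = ubs p m (cells M k) i"
  unfolding lam0_def by (intro ext bspline_cong) (use cells(3) in auto)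

lemma lam1_ubs:
  assumes "k \<in> patches M" "i < n k"
  shows "lam1 M k i = ubs (p - 1) m (cells M k) i"
proof
  fix x
  have "lam1 M k i x = bspline (\<lambda>l. knot M k (l + 1)) (p - 1) i x"
    unfolding lam1_def by (rule bspline_shift)
  also have "\<dots> = ubs (p - 1) m (cells M k) i x"
  proof (rule bspline_cong)
    fix l assume "i \<le> l" "l \<le> i + (p - 1) + 1"
    then have "knot M k (l + 1) = uknot p m (cells M k) (l + 1)" using cells(3)[OF assms(1), of "l+1"] assms(2) mp by auto
    also have "\<dots> = uknot (p - 1) m (cells M k) l" using mp by (auto simp: uknot_def)
    finally show "knot M k (l + 1) = uknot (p - 1) m (cells M k) l" .
  qed
  finally show "lam1 M k i x = ubs (p - 1) m (cells M k) i x" .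
qed

lemma n1: "k \<in> patches M \<Longrightarrow> n k - 1 = (p - 1) + (cells M k - 1) * m"
  using cells(2)[of k] mp by linarith

lemma lam1_index: "k \<in> patches M \<Longrightarrow> i < n k \<longleftrightarrow> i \<le> (p - 1) + (cells M k - 1) * m"
  using n1[of k] n_gt[of k] by linarith

lemma bmf_lam0: "k \<in> patches M \<Longrightarrow> i \<le> n k \<Longrightarrow> bmf (lam0 M k i)"
  unfolding bmf_def using ubs_bounded[of m p "cells M k" i] lam0_ubs[of k i] cells[of k] mp by auto

lemma bmf_lam1: "k \<in> patches M \<Longrightarrow> i < n k \<Longrightarrow> bmf (lam1 M k i)"
  unfolding bmf_def using ubs_bounded[of m "p-1" "cells M k" i] lam1_ubs[of k i] cells(1)[of k] mp lam1_index[of k i] by auto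

lemma lam0_0: "k \<in> patches M \<Longrightarrow> i \<le> n k \<Longrightarrow> lam0 M k i 0 = (if i = 0 then 1 else 0)"
  and lam0_1: "k \<in> patches M \<Longrightarrow> i \<le> n k \<Longrightarrow> lam0 M k i 1 = (if i = n k then 1 else 0)"
  using lam0_ubs[of k i] ubs_ends[OF mp(1) cells(1,2)] by auto

lemma lam0_piecewise_C1: "k \<in> patches M \<Longrightarrow> i \<le> n k \<Longrightarrow> \<exists>f'. piecewise_C1_unit (lam0 M k i) f'"
  using ubs_piecewise_C1[OF mp cells(1), of k i] lam0_ubs[of k i] cells(2)[of k] by auto

lemma lam1_right_continuous:
  assumes "k \<in> patches M" "i < n k" "0 \<le> x" "x < 1"
  shows "(lam1 M k i \<longlongrightarrow> lam1 M k i x) (at_right x)"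
  using ubs_right_continuous[of m "p-1" "cells M k" i x] assms lam1_ubs[OF assms(1,2)] cells(1)[OF assms(1)] mp
    lam1_index[OF assms(1)] by auto

lemma V1_spline_bmf: "k \<in> patches M \<Longrightarrow> f \<in> V1_spline M k \<Longrightarrow> bmf f"
  unfolding V1_spline_def by (rule lin_combs_bmf[of "{..<n k}" "lam1 M k"]) (auto intro: bmf_lam1)

text \<open>
  Splines are determined by their restriction to the unit interval, whereas the functions compared
  with them, polynomials for instance, are given on the whole line.
\<close>

definition V1_on :: "nat \<Rightarrow> (real \<Rightarrow> real) \<Rightarrow> bool" where
  "V1_on k f \<longleftrightarrow> (\<exists>g\<in>V1_spline M k. \<forall>x\<in>{0..1}. f x = g x)"

lemma V1_on_span:
  assumes k: "k \<in> patches M"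
    and f: "span_on_unit ((p - 1) + (cells M k - 1) * m) (ubs (p - 1) m (cells M k)) f"
  shows "V1_on k f"
proof -
  obtain c where c: "\<forall>x\<in>{0..1}. f x = (\<Sum>l\<le>(p - 1) + (cells M k - 1) * m. c l * ubs (p - 1) m (cells M k) l x)"
    using f unfolding span_on_unit_def by blast
  have "{..(p - 1) + (cells M k - 1) * m} = {..<n k}" using lam1_index[OF k] by auto
  then have "\<forall>x\<in>{0..1}. f x = (\<Sum>l<n k. c l * lam1 M k l x)" using c lam1_ubs[OF k] by simp
  moreover have "(\<lambda>x. \<Sum>l<n k. c l * lam1 M k l x) \<in> V1_spline M k"
    unfolding V1_spline_def lin_combs_def by (intro CollectI exI[of _ c]) simp
  ultimately show ?thesis unfolding V1_on_def by (rule rev_bexI[rotated])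
qed

lemma V1_poly:
  assumes k: "k \<in> patches M" and q: "degree q < p"
  shows "V1_on k (poly q)"
  using k q mp cells(1)[OF k] by (intro V1_on_span ubs_poly) auto

lemma V1_nested:
  assumes k: "k \<in> patches M" "l \<in> patches M" and sub: "uniformly_subdivides (knots M k) (knots M l)"
    and f: "f \<in> V1_spline M k"
  shows "V1_on l f"
proof -
  obtain s where s: "1 \<le> s" "cells M l = s * cells M k"
    using uniformly_subdivides_imp[of "cells M k" "cells M l"] sub cells[OF k(1)] cells[OF k(2)] by auto
  obtain c where c: "f = (\<lambda>x. \<Sum>i<n k. c i * lam1 M k i x)" using f unfolding V1_spline_def lin_combs_def by auto
  have "span_on_unit ((p - 1) + (cells M l - 1) * m) (ubs (p - 1) m (cells M l)) (\<lambda>x. \<Sum>i<n k. c i * lam1 M k i x)"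
  proof (rule span_on_unit_sum)
    fix i assume "i \<in> {..<n k}"
    then have i: "i < n k" by simp
    show "span_on_unit ((p - 1) + (cells M l - 1) * m) (ubs (p - 1) m (cells M l)) (lam1 M k i)"
      unfolding lam1_ubs[OF k(1) i] s(2)
      using mp cells(1)[OF k(1)] s(1) lam1_index[OF k(1)] i by (intro ubs_nested) auto
  qed simp
  then show ?thesis using V1_on_span[OF k(2)] c by simp
qed

lemma lam0_reflect:
  assumes "k \<in> patches M" "i \<le> n k" "0 < x" "x < 1" "x \<notin> uknot p m (cells M k) ` {..n k + p + 1}"
  shows "lam0 M k i (1 - x) = lam0 M k (n k - i) x"
proof -
  have "x \<notin> range (uknot p m (cells M k))"
  proof
    assume "x \<in> range (uknot p m (cells M k))"
    then obtain l where l: "x = uknot p m (cells M k) l" by auto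
    have "uknot p m (cells M k) l = 1" if "n k < l"
      using clamped_seq_uknot[OF mp(1) cells(1)[OF assms(1)], of p] that cells(2)[OF assms(1)] unfolding clamped_seq_def by auto
    then have "l \<le> n k" using l assms(4) by (metis not_le less_irrefl)
    then show False using l assms(5) by auto
  qed
  then show ?thesis
    using ubs_reflect[OF mp(1) cells(1)[OF assms(1)] cells(2)[OF assms(1)] assms(2) assms(3,4)] assms(1,2)
      lam0_ubs[of k i] lam0_ubs[of k "n k - i"] by simp
qed

lemma lam1_reflect:
  assumes "k \<in> patches M" "i < n k" "0 < x" "x < 1" "x \<notin> uknot (p - 1) m (cells M k) ` {..n k + p + 1}"
  shows "lam1 M k i (1 - x) = lam1 M k (n k - 1 - i) x"
proof -
  note n1 = n1[OF assms(1)]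
  have "x \<notin> range (uknot (p - 1) m (cells M k))"
  proof
    assume "x \<in> range (uknot (p - 1) m (cells M k))"
    then obtain l where l: "x = uknot (p - 1) m (cells M k) l" by auto
    have "uknot (p - 1) m (cells M k) l = 1" if "n k - 1 < l"
      using clamped_seq_uknot[OF mp(1) cells(1)[OF assms(1)], of "p - 1"] that n1 unfolding clamped_seq_def by auto
    then have "l \<le> n k - 1" using l assms(4) by (metis not_le less_irrefl)
    then show False using l assms(5) by auto
  qed
  then have "ubs (p - 1) m (cells M k) i (1 - x) = ubs (p - 1) m (cells M k) (n k - 1 - i) x"
    using assms n1 by (intro ubs_reflect[OF mp(1) cells(1)[OF assms(1)] n1]) auto
  then show ?thesis using assms(1,2) lam1_ubs[of k i] lam1_ubs[of k "n k - 1 - i"] by auto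
qed

lemma tensor_flip:
  assumes fin: "finite I" "finite J" and g: "g \<in> tensor_combs I f J h"
    and f: "bij_betw \<sigma> I I" "\<And>i x. i \<in> I \<Longrightarrow> 0 < x \<Longrightarrow> x < 1 \<Longrightarrow> x \<notin> S \<Longrightarrow> f (\<sigma> i) (flip a x) = f i x"
    and h: "bij_betw \<tau> J J" "\<And>j x. j \<in> J \<Longrightarrow> 0 < x \<Longrightarrow> x < 1 \<Longrightarrow> x \<notin> T \<Longrightarrow> h (\<tau> j) (flip b x) = h j x"
  shows "\<exists>g'\<in>tensor_combs I f J h. \<forall>y\<in>box 0 1. y$1 \<notin> S \<and> y$2 \<notin> T \<longrightarrow> g' y = g (vec2 (flip a (y$1)) (flip b (y$2)))"
proof -
  obtain c where c: "g = (\<lambda>x. \<Sum>i\<in>I. \<Sum>j\<in>J. c i j * f i (x$1) * h j (x$2))"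
    using g unfolding tensor_combs_def by auto
  let ?g = "\<lambda>x::real^2. \<Sum>i\<in>I. \<Sum>j\<in>J. c (\<sigma> i) (\<tau> j) * f i (x$1) * h j (x$2)"
  have "?g y = g (vec2 (flip a (y$1)) (flip b (y$2)))" if y: "y \<in> box 0 1" "y$1 \<notin> S" "y$2 \<notin> T" for y
  proof -
    have "g (vec2 (flip a (y$1)) (flip b (y$2))) = (\<Sum>i\<in>I. \<Sum>j\<in>J. c i j * f i (flip a (y$1)) * h j (flip b (y$2)))"
      unfolding c by simp
    also have "\<dots> = (\<Sum>i\<in>I. \<Sum>j\<in>J. c (\<sigma> i) j * f (\<sigma> i) (flip a (y$1)) * h j (flip b (y$2)))"
      by (rule sum.reindex_bij_betw[OF f(1), symmetric])
    also have "\<dots> = (\<Sum>i\<in>I. \<Sum>j\<in>J. c (\<sigma> i) (\<tau> j) * f (\<sigma> i) (flip a (y$1)) * h (\<tau> j) (flip b (y$2)))"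
      by (rule sum.cong[OF refl]) (rule sum.reindex_bij_betw[OF h(1), symmetric])
    also have "\<dots> = ?g y"
      using f(2) h(2) y by (intro sum.cong refl) (auto simp: mem_unit_box)
    finally show ?thesis by simp
  qed
  moreover have "?g \<in> tensor_combs I f J h"
    unfolding tensor_combs_def by (intro CollectI exI[of _ "\<lambda>i j. c (\<sigma> i) (\<tau> j)"]) simp
  ultimately show ?thesis by (intro bexI[of _ ?g]) auto
qed

lemma tensor_swap:
  assumes "g \<in> tensor_combs I f J h"
  shows "(\<lambda>y. g (vec2 (y$2) (y$1))) \<in> tensor_combs J h I f"
proof -
  obtain c where c: "g = (\<lambda>x. \<Sum>i\<in>I. \<Sum>j\<in>J. c i j * f i (x$1) * h j (x$2))"
    using assms unfolding tensor_combs_def by auto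
  have "(\<lambda>y. g (vec2 (y$2) (y$1))) = (\<lambda>x. \<Sum>j\<in>J. \<Sum>i\<in>I. c i j * h j (x$1) * f i (x$2))"
    unfolding c by (subst sum.swap) (simp add: mult_ac)
  then show ?thesis unfolding tensor_combs_def by (intro CollectI exI[of _ "\<lambda>j i. c i j"]) simp
qed

lemma tensor_cmult:
  assumes "g \<in> tensor_combs I f J h"
  shows "(\<lambda>y. \<alpha> * g y) \<in> tensor_combs I f J h"
proof -
  obtain c where c: "g = (\<lambda>x. \<Sum>i\<in>I. \<Sum>j\<in>J. c i j * f i (x$1) * h j (x$2))"
    using assms unfolding tensor_combs_def by auto
  have "(\<lambda>y. \<alpha> * g y) = (\<lambda>x. \<Sum>i\<in>I. \<Sum>j\<in>J. (\<alpha> * c i j) * f i (x$1) * h j (x$2))"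
    unfolding c by (simp add: sum_distrib_left mult.assoc)
  then show ?thesis unfolding tensor_combs_def by (intro CollectI exI[of _ "\<lambda>i j. \<alpha> * c i j"]) simp
qed

lemma tensor_add:
  assumes "g \<in> tensor_combs I f J h" "g' \<in> tensor_combs I f J h"
  shows "(\<lambda>y. g y + g' y) \<in> tensor_combs I f J h"
proof -
  obtain c d where "g = (\<lambda>x. \<Sum>i\<in>I. \<Sum>j\<in>J. c i j * f i (x$1) * h j (x$2))"
      "g' = (\<lambda>x. \<Sum>i\<in>I. \<Sum>j\<in>J. d i j * f i (x$1) * h j (x$2))"
    using assms unfolding tensor_combs_def by auto
  then have "(\<lambda>y. g y + g' y) = (\<lambda>x. \<Sum>i\<in>I. \<Sum>j\<in>J. (c i j + d i j) * f i (x$1) * h j (x$2))"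
    by (simp add: distrib_right sum.distrib)
  then show ?thesis unfolding tensor_combs_def by (intro CollectI exI[of _ "\<lambda>i j. c i j + d i j"]) simp
qed

lemma tensor_product:
  assumes "g \<in> lin_combs I f" "g' \<in> lin_combs J h"
  shows "(\<lambda>y. g (y$1) * g' (y$2)) \<in> tensor_combs I f J h"
proof -
  obtain c d where "g = (\<lambda>x. \<Sum>i\<in>I. c i * f i x)" "g' = (\<lambda>x. \<Sum>j\<in>J. d j * h j x)"
    using assms unfolding lin_combs_def by auto
  then have "(\<lambda>y. g (y$1) * g' (y$2)) = (\<lambda>x. \<Sum>i\<in>I. \<Sum>j\<in>J. (c i * d j) * f i (x$1) * h j (x$2))"
    by (simp add: sum_product mult_ac)
  then show ?thesis unfolding tensor_combs_def by (intro CollectI exI[of _ "\<lambda>i j. c i * d j"]) simp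
qed

text \<open>
  The covariant pull-back under a symmetry of the square. It exchanges and reflects the tensor factors,
  and reflection permutes B-splines on symmetric knots; at the knots the reflected functions may differ, which is why
  the equality holds almost everywhere.
\<close>

lemma V1_hat_sqsym:
  assumes k: "k \<in> patches M" and u: "u \<in> V1_hat M k"
  shows "\<exists>v\<in>V1_hat M k. AE y in leb_square. v y = transpose (sqsym_mat sw a b) *v u (sqsym sw a b y)"
proof -
  let ?S = "uknot (p - 1) m (cells M k) ` {..n k + p + 1}" and ?T = "uknot p m (cells M k) ` {..n k + p + 1}"
  define \<sigma> where "\<sigma> c i = (if c then n k - 1 - i else i)" for c i
  define \<tau> where "\<tau> c i = (if c then n k - i else i)" for c i
  have b1: "bij_betw (\<sigma> c) {..<n k} {..<n k}" for c
    by (rule bij_betw_byWitness[of _ "\<sigma> c"]) (auto simp: \<sigma>_def)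
  have b0: "bij_betw (\<tau> c) {..n k} {..n k}" for c
    by (rule bij_betw_byWitness[of _ "\<tau> c"]) (auto simp: \<tau>_def)
  have r1: "lam1 M k (\<sigma> c i) (flip c x) = lam1 M k i x"
    if "i \<in> {..<n k}" "0 < x" "x < 1" "x \<notin> ?S" for c i x
    using lam1_reflect[OF k, of "n k - 1 - i" x] that by (auto simp: \<sigma>_def flip_def)
  have r0: "lam0 M k (\<tau> c i) (flip c x) = lam0 M k i x"
    if "i \<in> {..n k}" "0 < x" "x < 1" "x \<notin> ?T" for c i x
    using lam0_reflect[OF k, of "n k - i" x] that by (auto simp: \<tau>_def flip_def)
  have u1: "(\<lambda>x. u x $ 1) \<in> tensor_combs {..<n k} (lam1 M k) {..n k} (lam0 M k)"
    and u2: "(\<lambda>x. u x $ 2) \<in> tensor_combs {..n k} (lam0 M k) {..<n k} (lam1 M k)"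
    using u unfolding V1_hat_def by auto
  define a1 b1' where "a1 = (if sw then b else a)" and "b1' = (if sw then a else b)"
  have "\<exists>g\<in>tensor_combs {..<n k} (lam1 M k) {..n k} (lam0 M k). \<forall>y\<in>box 0 1. y$1 \<notin> ?S \<and> y$2 \<notin> ?T \<longrightarrow>
      g y = u (vec2 (flip a1 (y$1)) (flip b1' (y$2))) $ 1"
    by (rule tensor_flip[where S = ?S and T = ?T and a = a1 and b = b1' and \<sigma> = "\<sigma> a1" and \<tau> = "\<tau> b1'"])
       ((rule finite_lessThan finite_atMost u1 b1 b0 r1 r0 | assumption)+)
  then obtain g1 where g1: "g1 \<in> tensor_combs {..<n k} (lam1 M k) {..n k} (lam0 M k)"
    "\<forall>y\<in>box 0 1. y$1 \<notin> ?S \<and> y$2 \<notin> ?T \<longrightarrow> g1 y = u (vec2 (flip a1 (y$1)) (flip b1' (y$2))) $ 1" by blast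
  have "\<exists>g\<in>tensor_combs {..n k} (lam0 M k) {..<n k} (lam1 M k). \<forall>y\<in>box 0 1. y$1 \<notin> ?T \<and> y$2 \<notin> ?S \<longrightarrow>
      g y = u (vec2 (flip a1 (y$1)) (flip b1' (y$2))) $ 2"
    by (rule tensor_flip[where S = ?T and T = ?S and a = a1 and b = b1' and \<sigma> = "\<tau> a1" and \<tau> = "\<sigma> b1'"])
       ((rule finite_lessThan finite_atMost u2 b1 b0 r1 r0 | assumption)+)
  then obtain g2 where g2: "g2 \<in> tensor_combs {..n k} (lam0 M k) {..<n k} (lam1 M k)"
    "\<forall>y\<in>box 0 1. y$1 \<notin> ?T \<and> y$2 \<notin> ?S \<longrightarrow> g2 y = u (vec2 (flip a1 (y$1)) (flip b1' (y$2))) $ 2" by blast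
  define \<alpha> \<beta> :: real where "\<alpha> = (if a then -1 else 1)" and "\<beta> = (if b then -1 else 1)"
  define v where "v y = (if sw then vec2 (\<alpha> * g2 (vec2 (y$2) (y$1))) (\<beta> * g1 (vec2 (y$2) (y$1)))
     else vec2 (\<alpha> * g1 y) (\<beta> * g2 y))" for y :: "real^2"
  have "v \<in> V1_hat M k"
    unfolding V1_hat_def v_def using g1(1) g2(1)
    by (cases sw) (auto intro!: tensor_cmult tensor_swap)
  moreover have "AE y in leb_square. v y = transpose (sqsym_mat sw a b) *v u (sqsym sw a b y)"
  proof -
    have fin: "finite ?S" "finite ?T" by auto
    have "AE y in lborel. (y::real^2)$1 \<notin> ?S \<union> ?T \<and> y$2 \<notin> ?S \<union> ?T"
      using AE_coord_notin_finite[of "?S \<union> ?T" 1] AE_coord_notin_finite[of "?S \<union> ?T" 2] fin by auto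
    then have "AE y in lborel. y \<in> box 0 1 \<longrightarrow> v y = transpose (sqsym_mat sw a b) *v u (sqsym sw a b y)"
    proof eventually_elim
      case (elim y)
      show ?case
      proof
        assume y: "y \<in> box 0 1"
        have y': "vec2 (y$2) (y$1) \<in> box 0 1" using y by (auto simp: mem_unit_box)
        show "v y = transpose (sqsym_mat sw a b) *v u (sqsym sw a b y)"
          using g1(2)[rule_format, OF y] g2(2)[rule_format, OF y] g1(2)[rule_format, OF y'] g2(2)[rule_format, OF y'] elim
          unfolding v_def transpose_sqsym_mat_vector sqsym_def a1_def b1'_def \<alpha>_def \<beta>_def by (cases sw) auto
      qed
    qed
    then show ?thesis by (simp add: AE_lebesgue_on_iff)
  qed
  ultimately show ?thesis by blast
qed

end

section \<open>Charts of the unit square\<close>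

lemma unit_box_ne: "box (0::real^2) 1 \<noteq> {}"
  using mem_unit_box[of "vec2 (1/2) (1/2)"] by auto

lemma closure_unit_box: "closure (box (0::real^2) 1) = cbox 0 1"
  using unit_box_ne by (rule closure_box)

lemma AE_lebesgue_on_negligible:
  assumes "S \<in> sets lebesgue"
  shows "(AE x in lebesgue_on S. P x) \<longleftrightarrow> negligible {x \<in> S. \<not> P (x::'a::euclidean_space)}"
proof
  assume "AE x in lebesgue_on S. P x"
  then have "AE x in lebesgue. x \<in> S \<longrightarrow> P x" using assms by (simp add: AE_restrict_space_iff)
  then obtain N where "N \<in> null_sets lebesgue" "{x. \<not> (x \<in> S \<longrightarrow> P x)} \<subseteq> N"
    unfolding eventually_ae_filter by auto
  then have "negligible N" "{x \<in> S. \<not> P x} \<subseteq> N" by (auto simp only: negligible_iff_null_sets)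
  then show "negligible {x \<in> S. \<not> P x}" by (rule negligible_subset)
next
  assume "negligible {x \<in> S. \<not> P x}"
  then have "{x \<in> S. \<not> P x} \<in> null_sets lebesgue" by (simp add: negligible_iff_null_sets)
  then have "AE x in lebesgue. x \<in> S \<longrightarrow> P x" by (rule AE_I') auto
  then show "AE x in lebesgue_on S. P x" using assms by (simp add: AE_restrict_space_iff)
qed

lemma AE_lebesgue_on_subset:
  assumes "AE x in lebesgue_on S. P (x::'a::euclidean_space)" "T \<subseteq> S" "S \<in> sets lebesgue" "T \<in> sets lebesgue"
  shows "AE x in lebesgue_on T. P x"
proof -
  have "negligible {x \<in> S. \<not> P x}" using assms by (simp add: AE_lebesgue_on_negligible)
  then have "negligible {x \<in> T. \<not> P x}" by (rule negligible_subset) (use assms in auto)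
  then show ?thesis using assms by (simp add: AE_lebesgue_on_negligible)
qed

lemma matrix_inv_eq:
  fixes A B :: "real^'n^'n"
  assumes "B ** A = mat 1" shows "matrix_inv A = B"
proof -
  have AB: "A ** B = mat 1" using assms by (simp add: matrix_left_right_inverse)
  have "A ** matrix_inv A = mat 1 \<and> matrix_inv A ** A = mat 1"
    unfolding matrix_inv_def by (rule someI[of _ B]) (use assms AB in simp)
  then have "matrix_inv A = (B ** A) ** matrix_inv A" using assms by simp
  also have "\<dots> = B" using \<open>A ** matrix_inv A = mat 1 \<and> _\<close> by (simp flip: matrix_mul_assoc)
  finally show ?thesis .
qed

lemma matrix_mult_comp: "(*v) A \<circ> (*v) B = (*v) (A ** (B :: real^2^2))"
  by (auto simp: fun_eq_iff matrix_vector_mul_assoc)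

lemma vec2_measurableI:
  fixes f :: "'a \<Rightarrow> real^2"
  assumes "\<And>i. (\<lambda>x. f x $ i) \<in> borel_measurable N"
  shows "f \<in> borel_measurable N"
  using assms by (subst borel_measurable_euclidean_space) (auto simp: Basis_vec_def inner_axis)

definition chart_deriv :: "(real^2 \<Rightarrow> real^2) \<Rightarrow> real^2 \<Rightarrow> real^2^2" where
  "chart_deriv E = (SOME f'. (\<forall>x\<in>cbox 0 1. (E has_derivative (*v) (f' x)) (at x within cbox 0 1)) \<and> continuous_on (cbox 0 1) f')"

text \<open>
  A patch map, or a patch map precomposed with a symmetry of the square, with its derivative \<open>D\<close> and
  inverse \<open>G\<close>.
\<close>

locale square_chart =
  fixes E :: "real^2 \<Rightarrow> real^2"
  assumes diffeo: "C1_diffeo_on (cbox 0 1) E"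
begin

abbreviation "D \<equiv> chart_deriv E"
abbreviation "G \<equiv> inv_into (cbox 0 1) E"

lemma inj: "inj_on E (cbox 0 1)"
  using diffeo unfolding C1_diffeo_on_def by blast

lemma D: "y \<in> cbox 0 1 \<Longrightarrow> (E has_derivative (*v) (D y)) (at y within cbox 0 1)" and D_cont: "continuous_on (cbox 0 1) D"
proof -
  have "\<exists>f'. (\<forall>x\<in>cbox 0 1. (E has_derivative (*v) (f' x)) (at x within cbox 0 1)) \<and> continuous_on (cbox 0 1) f'"
    using diffeo unfolding C1_diffeo_on_def C1_on_def by blast
  from someI_ex[OF this] show "y \<in> cbox 0 1 \<Longrightarrow> (E has_derivative (*v) (D y)) (at y within cbox 0 1)"
    "continuous_on (cbox 0 1) D" unfolding chart_deriv_def by blast+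
qed

lemma GE: "y \<in> cbox 0 1 \<Longrightarrow> G (E y) = y" using inj by simp

lemma G_mem: "x \<in> E ` cbox 0 1 \<Longrightarrow> G x \<in> cbox 0 1" by (rule inv_into_into)

lemma EG: "x \<in> E ` cbox 0 1 \<Longrightarrow> E (G x) = x" by (rule f_inv_into_f)

lemma cont: "continuous_on (cbox 0 1) E"
  by (rule has_derivative_continuous_on[where f' = "\<lambda>y. (*v) (D y)"]) (rule D)

lemma compact_image: "compact (E ` cbox 0 1)"
  by (intro compact_continuous_image cont compact_cbox)

lemma box_cbox: "y \<in> box (0::real^2) 1 \<Longrightarrow> y \<in> cbox 0 1"
  using box_subset_cbox by blast

lemma at_box: "y \<in> box (0::real^2) 1 \<Longrightarrow> at y within cbox 0 1 = at y"
  by (intro at_within_interior) (auto simp: interior_cbox)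

lemma D_at: "y \<in> box 0 1 \<Longrightarrow> (E has_derivative (*v) (D y)) (at y)"
  using D[of y] box_cbox[of y] at_box[of y] by simp

lemma jac: "y \<in> box 0 1 \<Longrightarrow> jacobian E (at y) = D y"
  unfolding jacobian_def frechet_derivative_at[OF D_at, symmetric] by (rule matrix_of_matrix_vector_mul)

lemma open_image: "open (E ` box 0 1)"
  using continuous_on_subset[OF cont] inj_on_subset[OF inj] by (intro invariance_of_domain) (auto simp: box_subset_cbox)

lemma closure_image: "closure (E ` box 0 1) = E ` cbox 0 1"
proof
  have "E ` box 0 1 \<subseteq> E ` cbox 0 1" using box_subset_cbox by blast
  then show "closure (E ` box 0 1) \<subseteq> E ` cbox 0 1"
    using compact_image by (simp add: closure_minimal compact_imp_closed)
  have "E ` closure (box 0 1) \<subseteq> closure (E ` box 0 1)"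
    by (rule image_closure_subset) (use cont closure_subset[of "E ` box 0 1"] in \<open>auto simp: closure_unit_box\<close>)
  then show "E ` cbox 0 1 \<subseteq> closure (E ` box 0 1)" by (simp add: closure_unit_box)
qed

lemma frontier_image: "frontier (E ` box 0 1) = E ` (cbox 0 1 - box 0 1)"
proof -
  have "frontier (E ` box 0 1) = E ` cbox 0 1 - E ` box 0 1"
    unfolding frontier_def closure_image using open_image by (simp add: interior_open)
  also have "\<dots> = E ` (cbox 0 1 - box 0 1)"
    using inj_on_image_set_diff[OF inj] box_subset_cbox by (metis Diff_subset)
  finally show ?thesis .
qed

lemma lmeasurable_image: "E ` box 0 1 \<in> lmeasurable" "E ` box 0 1 \<in> sets lebesgue"
proof -
  have "bounded (E ` box 0 1)"
    using compact_imp_bounded[OF compact_image] box_subset_cbox by (metis bounded_subset image_mono)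
  then show "E ` box 0 1 \<in> lmeasurable" using open_image by (rule lmeasurable_open)
  then show "E ` box 0 1 \<in> sets lebesgue" by auto
qed

text \<open>
  The chain rule in the open square; the identity extends to the boundary by continuity.
\<close>

lemma ex_inverse_deriv:
  "\<exists>G'. continuous_on (E ` cbox 0 1) G' \<and> (\<forall>x\<in>E ` cbox 0 1. (G has_derivative (*v) (G' x)) (at x within E ` cbox 0 1))
     \<and> (\<forall>y\<in>cbox 0 1. G' (E y) ** D y = mat 1)"
proof -
  obtain G' where G': "\<forall>x\<in>E ` cbox 0 1. (G has_derivative (*v) (G' x)) (at x within E ` cbox 0 1)"
    "continuous_on (E ` cbox 0 1) G'"
    using diffeo unfolding C1_diffeo_on_def C1_on_def by blast
  have inner: "G' (E y) ** D y = mat 1" if y: "y \<in> box 0 1" for y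
  proof -
    have yc: "y \<in> cbox 0 1" using y by (rule box_cbox)
    have "(G \<circ> E has_derivative (*v) (G' (E y)) \<circ> (*v) (D y)) (at y within cbox 0 1)"
      using D[OF yc] G'(1) yc by (intro diff_chain_within) auto
    then have "((\<lambda>y. y) has_derivative (*v) (G' (E y)) \<circ> (*v) (D y)) (at y within cbox 0 1)"
      by (rule has_derivative_transform[OF yc, rotated]) (simp add: GE)
    then have "((\<lambda>y. y) has_derivative (*v) (G' (E y)) \<circ> (*v) (D y)) (at y)" using at_box[OF y] by simp
    then have "(*v) (G' (E y)) \<circ> (*v) (D y) = (\<lambda>y. y)" using has_derivative_ident by (rule has_derivative_unique)
    then show ?thesis by (simp add: matrix_eq fun_eq_iff matrix_vector_mul_assoc)
  qed
  have "G' (E y) ** D y = mat 1" if "y \<in> cbox 0 1" for y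
  proof (rule continuous_constant_on_closure[of "box 0 1" "\<lambda>y. G' (E y) ** D y"])
    have "continuous_on (cbox 0 1) (\<lambda>y. G' (E y))"
      using continuous_on_compose2[OF G'(2) cont] by auto
    then show "continuous_on (closure (box 0 1)) (\<lambda>y. G' (E y) ** D y)"
      unfolding matrix_matrix_mult_def closure_unit_box by (intro continuous_intros D_cont)
  qed (use inner that closure_unit_box in auto)
  then show ?thesis using G' by blast
qed

lemma matrix_inv_D:
  assumes "y \<in> cbox 0 1"
  shows "matrix_inv (D y) ** D y = mat 1" "D y ** matrix_inv (D y) = mat 1" "det (D y) \<noteq> 0"
proof -
  obtain B where B: "B ** D y = mat 1" using ex_inverse_deriv assms by blast
  then show 1: "matrix_inv (D y) ** D y = mat 1" using matrix_inv_eq by metis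
  then show "D y ** matrix_inv (D y) = mat 1" by (simp add: matrix_left_right_inverse)
  have "det B * det (D y) = 1" using B det_mul[of B "D y"] by simp
  then show "det (D y) \<noteq> 0" by auto
qed

lemma transpose_D_inv:
  assumes "y \<in> cbox 0 1"
  shows "transpose (D y) *v (transpose (matrix_inv (D y)) *v w) = w" "transpose (matrix_inv (D y)) *v (transpose (D y) *v w) = w"
  by (simp_all only: matrix_vector_mul_assoc matrix_transpose_mul[symmetric] matrix_inv_D[OF assms] transpose_mat matrix_vector_mul_lid)

text \<open>
  The orientation: the determinant of the derivative has no zero on the connected square, so that its sign is
  constant. The value is taken at a corner.
\<close>

definition ori :: real where "ori = sgn (det (D (vec2 0 0)))"

lemma det_cont: "continuous_on (cbox 0 1) (\<lambda>y. det (D y))"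
  unfolding det_2 by (intro continuous_intros D_cont)

lemma ori: "ori \<in> {-1, 1}" "y \<in> cbox 0 1 \<Longrightarrow> \<bar>det (D y)\<bar> = ori * det (D y)" "y \<in> cbox 0 1 \<Longrightarrow> sgn (det (D y)) = ori"
proof -
  have z: "vec2 0 0 \<in> cbox 0 1" by (simp add: mem_unit_cbox)
  have same: "sgn (det (D y)) = ori" if y: "y \<in> cbox 0 1" for y
  proof (rule ccontr)
    assume ne: "sgn (det (D y)) \<noteq> ori"
    have "connected ((\<lambda>y. det (D y)) ` cbox 0 1)"
      by (intro connected_continuous_image det_cont convex_connected convex_box)
    moreover have "det (D y) \<in> (\<lambda>y. det (D y)) ` cbox 0 1" "det (D (vec2 0 0)) \<in> (\<lambda>y. det (D y)) ` cbox 0 1" using y z by auto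
    moreover have "min (det (D y)) (det (D (vec2 0 0))) \<le> 0" "0 \<le> max (det (D y)) (det (D (vec2 0 0)))"
      using ne matrix_inv_D(3)[OF y] matrix_inv_D(3)[OF z] unfolding ori_def sgn_if by (auto split: if_splits)
    ultimately have "0 \<in> (\<lambda>y. det (D y)) ` cbox 0 1"
      unfolding connected_iff_interval by (smt (verit))
    then show False using matrix_inv_D(3) by auto
  qed
  then show "y \<in> cbox 0 1 \<Longrightarrow> sgn (det (D y)) = ori" .
  show "ori \<in> {-1, 1}" using matrix_inv_D(3)[OF z] unfolding ori_def sgn_if by auto
  show "y \<in> cbox 0 1 \<Longrightarrow> \<bar>det (D y)\<bar> = ori * det (D y)" using same[of y] by (simp add: abs_sgn mult.commute)
qed

lemma E_differentiable: "S \<subseteq> cbox 0 1 \<Longrightarrow> E differentiable_on S"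
proof -
  assume "S \<subseteq> cbox 0 1"
  moreover have "E differentiable_on cbox 0 1" unfolding differentiable_on_def differentiable_def using D by blast
  ultimately show ?thesis using differentiable_on_subset by blast
qed

lemma negligible_image: "negligible S \<Longrightarrow> S \<subseteq> cbox 0 1 \<Longrightarrow> negligible (E ` S)"
  by (intro negligible_differentiable_image_negligible E_differentiable) auto

lemma AE_image: "(AE x in lebesgue_on (E ` box 0 1). P x) \<longleftrightarrow> (AE y in leb_square. P (E y))"
proof -
  have "G differentiable_on E ` cbox 0 1"
    using ex_inverse_deriv unfolding differentiable_on_def differentiable_def by blast
  then have Gd: "G differentiable_on {x \<in> E ` box 0 1. \<not> P x}"
    by (rule differentiable_on_subset) (use box_subset_cbox in auto)
  have a: "E ` {y \<in> box 0 1. \<not> P (E y)} = {x \<in> E ` box 0 1. \<not> P x}" by auto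
  have b: "G ` {x \<in> E ` box 0 1. \<not> P x} = {y \<in> box 0 1. \<not> P (E y)}"
    unfolding a[symmetric] image_image using GE box_cbox by (auto intro!: rev_image_eqI)
  have "negligible {x \<in> E ` box 0 1. \<not> P x} \<longleftrightarrow> negligible {y \<in> box 0 1. \<not> P (E y)}"
  proof
    assume "negligible {x \<in> E ` box 0 1. \<not> P x}"
    then have "negligible (G ` {x \<in> E ` box 0 1. \<not> P x})"
      using Gd by (intro negligible_differentiable_image_negligible) auto
    then show "negligible {y \<in> box 0 1. \<not> P (E y)}" unfolding b .
  next
    assume "negligible {y \<in> box 0 1. \<not> P (E y)}"
    then have "negligible (E ` {y \<in> box 0 1. \<not> P (E y)})" by (rule negligible_image) (use box_subset_cbox in auto)
    then show "negligible {x \<in> E ` box 0 1. \<not> P x}" unfolding a .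
  qed
  then show ?thesis using lmeasurable_image by (simp add: AE_lebesgue_on_negligible)
qed

lemma change_of_variables:
  fixes f :: "real^2 \<Rightarrow> real"
  assumes "integrable (lebesgue_on (E ` box 0 1)) f"
  shows "integrable leb_square (\<lambda>y. \<bar>det (D y)\<bar> * f (E y))"
    "(LINT x|lebesgue_on (E ` box 0 1). f x) = (LINT y|leb_square. \<bar>det (D y)\<bar> * f (E y))"
proof -
  have absI: "f absolutely_integrable_on E ` box 0 1"
    using assms lmeasurable_image(2) by (simp add: set_integrable_def integrable_restrict_space)
  then have v: "(\<lambda>x. vec (f x) :: real^1) absolutely_integrable_on E ` box 0 1"
    by (simp add: absolutely_integrable_on_1_iff)
  let ?b = "integral (E ` box 0 1) (\<lambda>x. vec (f x) :: real^1)"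
  have "(\<lambda>y. \<bar>det (matrix ((*v) (D y)))\<bar> *\<^sub>R (vec (f (E y)) :: real^1)) absolutely_integrable_on box 0 1 \<and>
      integral (box 0 1) (\<lambda>y. \<bar>det (matrix ((*v) (D y)))\<bar> *\<^sub>R (vec (f (E y)) :: real^1)) = ?b"
  proof (subst has_absolute_integral_change_of_variables[of "box 0 1" E "\<lambda>y. (*v) (D y)" "\<lambda>x. vec (f x) :: real^1" ?b])
    show "(E has_derivative (*v) (D y)) (at y within box 0 1)" if "y \<in> box 0 1" for y
      using D_at[OF that] by (rule has_derivative_at_withinI)
    show "inj_on E (box 0 1)" using inj inj_on_subset box_subset_cbox by blast
  qed (use v in auto)
  moreover have "(\<lambda>y. \<bar>det (matrix ((*v) (D y)))\<bar> *\<^sub>R (vec (f (E y)) :: real^1)) = (\<lambda>y. vec (\<bar>det (D y)\<bar> * f (E y)))"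
    by (auto simp: fun_eq_iff vec_eq_iff)
  ultimately have *: "(\<lambda>y. vec (\<bar>det (D y)\<bar> * f (E y)) :: real^1) absolutely_integrable_on box 0 1"
      "integral (box 0 1) (\<lambda>y. vec (\<bar>det (D y)\<bar> * f (E y)) :: real^1) = ?b" by auto
  from *(1) have a: "(\<lambda>y. \<bar>det (D y)\<bar> * f (E y)) absolutely_integrable_on box 0 1"
    by (simp add: absolutely_integrable_on_1_iff)
  then show i: "integrable leb_square (\<lambda>y. \<bar>det (D y)\<bar> * f (E y))"
    by (rule absolutely_integrable_imp_integrable) auto
  have "integral (box 0 1) (\<lambda>y. \<bar>det (D y)\<bar> * f (E y)) = integral (E ` box 0 1) f"
    using *(2) integral_on_1_eq[of "box 0 1" "\<lambda>y. vec (\<bar>det (D y)\<bar> * f (E y))"] integral_on_1_eq[of "E ` box 0 1" "\<lambda>x. vec (f x)"]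
    by simp
  then show "(LINT x|lebesgue_on (E ` box 0 1). f x) = (LINT y|leb_square. \<bar>det (D y)\<bar> * f (E y))"
    using assms i lmeasurable_image(2) by (simp add: lebesgue_integral_eq_integral)
qed

lemma pull_eq: "y \<in> box 0 1 \<Longrightarrow> pull E u y = transpose (D y) *v u (E y)"
  unfolding pull_def by (simp add: jac)

lemma push_eq: "y \<in> box 0 1 \<Longrightarrow> push (cbox 0 1) E v (E y) = transpose (matrix_inv (D y)) *v v y"
  unfolding push_def by (simp add: jac GE box_cbox)

lemma push_iff_pull:
  "ae_eq_on (E ` box 0 1) u (push (cbox 0 1) E v) \<longleftrightarrow> (AE y in leb_square. pull E u y = v y)"
proof -
  have "u (E y) = push (cbox 0 1) E v (E y) \<longleftrightarrow> pull E u y = v y" if y: "y \<in> box 0 1" for y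
    unfolding pull_eq[OF y] push_eq[OF y] using transpose_D_inv[OF box_cbox[OF y]] by metis
  note eq = this
  show ?thesis
    unfolding ae_eq_on_def AE_image by (intro AE_cong eq) simp
qed

text \<open>
  The inverse chart is continuous on the image only. Multiplication by the indicator function makes
  it measurable on the whole plane.
\<close>

lemma transport_measurable:
  assumes [measurable]: "borel_fun h"
  shows "borel_fun (\<lambda>x. indicator (E ` box 0 1) x * h (G x) :: real)"
proof -
  obtain G' where G': "\<forall>x\<in>E ` cbox 0 1. (G has_derivative (*v) (G' x)) (at x within E ` cbox 0 1)"
    using ex_inverse_deriv by blast
  have "continuous_on (E ` cbox 0 1) G"
    by (rule has_derivative_continuous_on[where f' = "\<lambda>x. (*v) (G' x)"]) (use G' in blast)
  then have c: "continuous_on (E ` box 0 1) G" by (rule continuous_on_subset) (use box_subset_cbox in auto)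
  have [measurable]: "E ` box 0 1 \<in> sets borel" using open_image by auto
  have [measurable]: "borel_fun (\<lambda>x. indicator (E ` box 0 1) x *\<^sub>R G x)"
    using c by (rule borel_measurable_continuous_on_indicator[rotated]) simp
  have "borel_fun (\<lambda>x. indicator (E ` box 0 1) x * h (indicator (E ` box 0 1) x *\<^sub>R G x))"
    by measurable
  moreover have "(\<lambda>x. indicator (E ` box 0 1) x * h (indicator (E ` box 0 1) x *\<^sub>R G x)) = (\<lambda>x. indicator (E ` box 0 1) x * h (G x) :: real)"
    by (auto simp: fun_eq_iff indicator_def)
  ultimately show ?thesis by simp
qed

text \<open>
  The field is the transposed derivative of the inverse chart applied to the logical field. That
  derivative is continuous on the compact image and therefore bounded.
\<close>

lemma field_on_image:
  assumes v: "\<And>i. borel_fun (\<lambda>y. v y $ i)" "\<And>i y. y \<in> cbox 0 1 \<Longrightarrow> \<bar>v y $ i\<bar> \<le> C"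
    and u: "AE y in leb_square. pull E u y = v y"
  shows "\<exists>g K. borel_fun g \<and> (\<forall>x. norm (g x) \<le> K) \<and> (\<forall>x. x \<notin> E ` box 0 1 \<longrightarrow> g x = 0) \<and>
    (AE x in lebesgue_on (E ` box 0 1). u x = g x)"
proof -
  obtain G' where G': "continuous_on (E ` cbox 0 1) G'" "\<forall>y\<in>cbox 0 1. G' (E y) ** D y = mat 1"
    using ex_inverse_deriv by blast
  let ?ind = "indicator (E ` box 0 1)"
  define g where "g x = (\<chi> i. \<Sum>j\<in>UNIV. (?ind x *\<^sub>R (G' x $ j $ i)) * (?ind x * v (G x) $ j))" for x
  have [measurable]: "E ` box 0 1 \<in> sets borel" using open_image by auto
  have "continuous_on (E ` box 0 1) (\<lambda>x. G' x $ j $ i)" for i j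
    using G'(1) by (intro continuous_intros) (rule continuous_on_subset, use box_subset_cbox in auto)
  then have m1: "borel_fun (\<lambda>x. ?ind x *\<^sub>R (G' x $ j $ i))" for i j
    by (intro borel_measurable_continuous_on_indicator) auto
  have m2: "borel_fun (\<lambda>x. ?ind x * v (G x) $ j)" for j
    using transport_measurable[OF v(1)] .
  have gm: "borel_fun g"
  proof (rule vec2_measurableI)
    show "borel_fun (\<lambda>x. g x $ i)" for i
      unfolding g_def vec_lambda_beta by (intro borel_measurable_sum borel_measurable_times m1 m2)
  qed
  have "bounded (G' ` (E ` cbox 0 1))" by (rule compact_imp_bounded[OF compact_continuous_image[OF G'(1) compact_image]])
  then obtain K where K: "\<And>x. x \<in> E ` cbox 0 1 \<Longrightarrow> norm (G' x) \<le> K" unfolding bounded_iff by auto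
  have C0: "0 \<le> C" using v(2)[of 0 1] by (auto simp: mem_unit_cbox intro: order.trans[OF abs_ge_zero])
  have K0: "0 \<le> K" using K[of "E 0"] by (force simp: mem_unit_cbox intro: order.trans[OF norm_ge_zero])
  have comp: "\<bar>g x $ i\<bar> \<le> 2 * (K * C)" for x i
  proof (cases "x \<in> E ` box 0 1")
    case True
    then have xc: "x \<in> E ` cbox 0 1" using box_subset_cbox by blast
    have "\<bar>G' x $ j $ i * v (G x) $ j\<bar> \<le> K * C" for j
    proof -
      have "\<bar>G' x $ j $ i\<bar> \<le> norm (G' x $ j)" by (rule component_le_norm_cart)
      also have "\<dots> \<le> norm (G' x)" by (rule Finite_Cartesian_Product.norm_nth_le)
      finally have "\<bar>G' x $ j $ i\<bar> \<le> K" using K[OF xc] by simp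
      then show ?thesis unfolding abs_mult using v(2)[OF G_mem[OF xc]] K0 by (intro mult_mono) auto
    qed
    from this[of 1] this[of 2] show ?thesis using True unfolding g_def by (simp add: sum_2)
  next
    case False
    then show ?thesis using C0 K0 unfolding g_def by simp
  qed
  have "norm (g x) \<le> 2 * (2 * (K * C))" for x
    using norm_le_l1_cart[of "g x"] comp[of x 1] comp[of x 2] by (simp add: sum_2)
  moreover have "g x = 0" if "x \<notin> E ` box 0 1" for x using that by (simp add: g_def vec_eq_iff)
  moreover have "AE x in lebesgue_on (E ` box 0 1). u x = g x"
    unfolding AE_image
  proof -
    have "u (E y) = g (E y)" if y: "y \<in> box 0 1" and uy: "pull E u y = v y" for y
    proof -
      have yc: "y \<in> cbox 0 1" using y by (rule box_cbox)
      have inv: "matrix_inv (D y) = G' (E y)" using G'(2) yc by (intro matrix_inv_eq) auto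
      have "u (E y) = transpose (matrix_inv (D y)) *v (transpose (D y) *v u (E y))" using transpose_D_inv(2)[OF yc] by simp
      also have "transpose (D y) *v u (E y) = v y" using uy pull_eq[OF y] by simp
      finally have "u (E y) = transpose (G' (E y)) *v v y" unfolding inv .
      moreover have "indicator (E ` box 0 1) (E y) = (1::real)" using y by auto
      ultimately show ?thesis unfolding g_def
        by (simp add: vec_eq_iff matrix_vector_mult_def transpose_def GE[OF yc])
    qed
    with u show "AE y in leb_square. u (E y) = g (E y)"
      by (auto simp: AE_lebesgue_on_iff elim: eventually_mono)
  qed
  ultimately show ?thesis using gm by blast
qed

end

text \<open>
  The derivative formula holds in the open square by uniqueness of derivatives, and on the
  boundary by continuity.
\<close>

lemma square_chart_sqsym:
  assumes "square_chart E"
  shows "square_chart (E \<circ> sqsym sw a b)"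
    and "y \<in> cbox 0 1 \<Longrightarrow> chart_deriv (E \<circ> sqsym sw a b) y = chart_deriv E (sqsym sw a b y) ** sqsym_mat sw a b"
    and "square_chart.ori (E \<circ> sqsym sw a b) = square_chart.ori E * det (sqsym_mat sw a b)"
proof -
  interpret square_chart E by (fact assms)
  let ?B = "sqsym sw a b" and ?B' = "sqsym_inv sw a b"
  have inj': "inj_on (E \<circ> ?B) (cbox 0 1)"
    using inj inj_sqsym by (intro comp_inj_on) (auto simp: sqsym_image)
  have im: "(E \<circ> ?B) ` cbox 0 1 = E ` cbox 0 1" by (simp only: image_comp[symmetric] sqsym_image)
  have der: "(E \<circ> ?B has_derivative (*v) (D (?B y) ** sqsym_mat sw a b)) (at y within cbox 0 1)" if "y \<in> cbox 0 1" for y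
  proof -
    have d: "(E has_derivative (*v) (D (?B y))) (at (?B y) within ?B ` cbox 0 1)"
      using D[of "?B y"] that by (simp only: sqsym_image sqsym_mem_cbox)
    show ?thesis using diff_chain_within[OF sqsym_has_derivative d] by (simp only: matrix_mult_comp)
  qed
  have Bc: "continuous_on (cbox 0 1) ?B"
    by (rule has_derivative_continuous_on[where f' = "\<lambda>_. (*v) (sqsym_mat sw a b)"]) (rule sqsym_has_derivative)
  have dcont: "continuous_on (cbox 0 1) (\<lambda>y. D (?B y) ** sqsym_mat sw a b)"
    unfolding matrix_matrix_mult_def
    by (intro continuous_intros continuous_on_compose2[OF D_cont Bc]) (simp_all add: sqsym_image)
  have inv: "inv_into (cbox 0 1) (E \<circ> ?B) x = ?B' (G x)" if x: "x \<in> E ` cbox 0 1" for x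
    using G_mem[OF x] EG[OF x] by (intro inv_into_f_eq[OF inj']) (auto simp: sqsym_inv_mem sqsym_inv2)
  obtain G' where G': "continuous_on (E ` cbox 0 1) G'" "\<forall>x\<in>E ` cbox 0 1. (G has_derivative (*v) (G' x)) (at x within E ` cbox 0 1)"
    using ex_inverse_deriv by blast
  obtain J where J: "\<And>y S. (?B' has_derivative (*v) J) (at y within S)"
  proof (cases sw)
    case True
    then show ?thesis using that[of "sqsym_mat True b a"] sqsym_has_derivative unfolding sqsym_inv_def by simp
  next
    case False
    then show ?thesis using that[of "sqsym_mat False a b"] sqsym_has_derivative unfolding sqsym_inv_def by simp
  qed
  have ider: "(inv_into (cbox 0 1) (E \<circ> ?B) has_derivative (*v) (J ** G' x)) (at x within E ` cbox 0 1)" if x: "x \<in> E ` cbox 0 1" for x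
  proof -
    have "(?B' \<circ> G has_derivative (*v) J \<circ> (*v) (G' x)) (at x within E ` cbox 0 1)"
      by (rule diff_chain_within[OF G'(2)[rule_format, OF x] J])
    then have "(?B' \<circ> G has_derivative (*v) (J ** G' x)) (at x within E ` cbox 0 1)"
      by (simp only: matrix_mult_comp)
    then show ?thesis by (rule has_derivative_transform[OF x, rotated]) (simp add: inv)
  qed
  have icont: "continuous_on (E ` cbox 0 1) (\<lambda>x. J ** G' x)"
    unfolding matrix_matrix_mult_def by (intro continuous_intros G'(1))
  show sc: "square_chart (E \<circ> ?B)"
    unfolding square_chart_def C1_diffeo_on_def C1_on_def im
  proof (intro conjI inj')
    show "\<exists>f'. (\<forall>x\<in>cbox 0 1. (E \<circ> ?B has_derivative (*v) (f' x)) (at x within cbox 0 1)) \<and> continuous_on (cbox 0 1) f'"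
      by (rule exI[of _ "\<lambda>y. D (?B y) ** sqsym_mat sw a b"]) (use der dcont in blast)
    show "\<exists>f'. (\<forall>x\<in>E ` cbox 0 1. (inv_into (cbox 0 1) (E \<circ> ?B) has_derivative (*v) (f' x)) (at x within E ` cbox 0 1))
        \<and> continuous_on (E ` cbox 0 1) f'"
      by (rule exI[of _ "\<lambda>x. J ** G' x"]) (use ider icont in blast)
  qed
  interpret EB: square_chart "E \<circ> ?B" by (fact sc)
  show eq: "chart_deriv (E \<circ> ?B) y = D (?B y) ** sqsym_mat sw a b" if y: "y \<in> cbox 0 1" for y
  proof (rule continuous_constant_on_closure[of "box 0 1" "\<lambda>y. chart_deriv (E \<circ> ?B) y - D (?B y) ** sqsym_mat sw a b" 0 y, unfolded right_minus_eq])
    show "continuous_on (closure (box 0 1)) (\<lambda>y. chart_deriv (E \<circ> ?B) y - D (?B y) ** sqsym_mat sw a b)"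
      unfolding closure_unit_box by (intro continuous_intros EB.D_cont dcont)
    show "chart_deriv (E \<circ> ?B) z = D (?B z) ** sqsym_mat sw a b" if z: "z \<in> box 0 1" for z
    proof -
      have "(E \<circ> ?B has_derivative (*v) (D (?B z) ** sqsym_mat sw a b)) (at z)" using der[OF box_cbox[OF z]] at_box[OF z] by simp
      from has_derivative_unique[OF EB.D_at[OF z] this] show ?thesis by (metis matrix_of_matrix_vector_mul)
    qed
  qed (use y closure_unit_box in auto)
  have z: "vec2 0 0 \<in> cbox 0 1" by (simp add: mem_unit_cbox)
  then have z2: "?B (vec2 0 0) \<in> cbox 0 1" by (simp only: sqsym_mem_cbox)
  have "EB.ori = sgn (det (D (?B (vec2 0 0))) * det (sqsym_mat sw a b))"
    unfolding EB.ori_def eq[OF z] det_mul ..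
  also have "\<dots> = ori * det (sqsym_mat sw a b)"
    using ori(3)[OF z2] by (simp add: sgn_mult det_sqsym_mat)
  finally show "EB.ori = ori * det (sqsym_mat sw a b)" .
qed

lemma ae_bounded_L2:
  fixes u g :: "real^2 \<Rightarrow> 'b::euclidean_space"
  assumes S: "S \<in> lmeasurable" and g: "borel_fun g" "\<And>x. norm (g x) \<le> K"
    and ae: "AE x in lebesgue_on S. u x = g x"
  shows "u \<in> L2_on S"
proof -
  have Ss: "S \<in> sets lebesgue" using S by auto
  have "(\<lambda>x. indicator S x *\<^sub>R g x) \<in> borel_measurable lebesgue"
    using g(1) Ss by (intro borel_measurable_scaleR measurable_completion borel_measurable_indicator) auto
  moreover have "AE x in lebesgue. indicator S x *\<^sub>R g x = indicator S x *\<^sub>R u x"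
    using ae Ss by (auto simp: AE_restrict_space_iff indicator_def elim!: eventually_mono)
  ultimately have "(\<lambda>x. indicator S x *\<^sub>R u x) \<in> borel_measurable lebesgue" by (rule borel_measurable_AE)
  then have um: "u \<in> borel_measurable (lebesgue_on S)"
    using Ss by (subst borel_measurable_restrict_space_iff) auto
  have gm: "g \<in> borel_measurable (lebesgue_on S)"
    using g(1) by (intro measurable_restrict_space1 measurable_completion) auto
  have "integrable (lebesgue_on S) (\<lambda>x. (norm (g x))\<^sup>2)"
    using g gm S by (intro integrable_bounded_lebesgue_on[of _ _ "K\<^sup>2"]) (auto intro: power_mono)
  then have "integrable (lebesgue_on S) (\<lambda>x. (norm (u x))\<^sup>2)"
    using um gm ae by (subst integrable_cong_AE[of _ _ "\<lambda>x. (norm (g x))\<^sup>2"]) auto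
  then show ?thesis using um unfolding L2_on_def by simp
qed

section \<open>Edges of a multipatch domain\<close>

abbreviation bottom :: "(real^2) set" where
  "bottom \<equiv> {y \<in> cbox 0 1. y $ 2 = 0}"

lemma sqsym_bottom:
  "sqsym False a b ` bottom = {x \<in> cbox 0 1. x $ 2 = (if b then 1 else 0)}"
  "sqsym True a b ` bottom = {x \<in> cbox 0 1. x $ 1 = (if b then 1 else 0)}"
proof -
  have "x \<in> sqsym False a b ` bottom" if "x \<in> cbox 0 1" "x $ 2 = (if b then 1 else 0)" for x
    using that by (intro image_eqI[of _ _ "vec2 (flip a (x$1)) 0"]) (auto simp: sqsym_def flip_def mem_unit_cbox vec2_eq_iff)
  then show "sqsym False a b ` bottom = {x \<in> cbox 0 1. x $ 2 = (if b then 1 else 0)}"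
    by (auto simp: sqsym_mem_cbox) (auto simp: sqsym_def flip_def)
  have "x \<in> sqsym True a b ` bottom" if "x \<in> cbox 0 1" "x $ 1 = (if b then 1 else 0)" for x
    using that by (intro image_eqI[of _ _ "vec2 (flip a (x$2)) 0"]) (auto simp: sqsym_def flip_def mem_unit_cbox vec2_eq_iff)
  then show "sqsym True a b ` bottom = {x \<in> cbox 0 1. x $ 1 = (if b then 1 else 0)}"
    by (auto simp: sqsym_mem_cbox) (auto simp: sqsym_def flip_def)
qed

lemma bottom_vec2: "vec2 s 0 \<in> cbox 0 1 \<longleftrightarrow> 0 \<le> s \<and> s \<le> 1" "vec2 s 0 \<in> bottom \<longleftrightarrow> 0 \<le> s \<and> s \<le> 1"
  by (auto simp: mem_unit_cbox)

lemma bottomE: assumes "y \<in> bottom" obtains s where "y = vec2 s 0" "0 \<le> s" "s \<le> 1"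
proof
  show "y = vec2 (y $ 1) 0" "0 \<le> y $ 1" "y $ 1 \<le> 1" using assms by (auto simp: vec2_eq_iff mem_unit_cbox)
qed

lemma continuous_on_vec2:
  assumes "continuous_on S f" "continuous_on S g"
  shows "continuous_on S (\<lambda>x. vec2 (f x) (g x))"
proof -
  have "continuous_on S (\<lambda>x. if i = 1 then f x else g x)" for i :: 2
    by (cases "i = 1") (auto simp: assms)
  moreover have "(\<lambda>x. vec2 (f x) (g x)) = (\<lambda>x. \<chi> i. if i = 1 then f x else g x)"
    by (auto simp: fun_eq_iff vec2_eq_iff)
  ultimately show ?thesis by (simp only: continuous_on_vec_lambda)
qed

abbreviation open_rect :: "(real^2) set" where "open_rect \<equiv> box (vec2 0 (-1)) (vec2 1 1)"

lemma mem_open_rect: "z \<in> open_rect \<longleftrightarrow> 0 < z$1 \<and> z$1 < 1 \<and> -1 < z$2 \<and> z$2 < 1"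
  by (auto simp: mem_box_cart forall_2)

lemma mem_edge_rect: "z \<in> edge_rect \<longleftrightarrow> 0 \<le> z$1 \<and> z$1 \<le> 1 \<and> -1 \<le> z$2 \<and> z$2 \<le> 1"
  by (auto simp: mem_box_cart forall_2)

lemma mem_minus_square: "z \<in> minus_square \<longleftrightarrow> 0 \<le> z$1 \<and> z$1 \<le> 1 \<and> -1 \<le> z$2 \<and> z$2 \<le> 0"
  by (auto simp: mem_box_cart forall_2)

locale mp_geometry =
  fixes M :: multipatch
  assumes domain: "multipatch_domain M" and emaps: "edge_maps M"
begin

abbreviation "leb_Dom \<equiv> lebesgue_on (Dom M)"
abbreviation "leb_patch k \<equiv> lebesgue_on (patch M k)"
abbreviation "side_chart k sw a b \<equiv> pmap M k \<circ> sqsym sw a b"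

lemma chart: "k \<in> patches M \<Longrightarrow> square_chart (pmap M k)"
  using domain unfolding multipatch_domain_def square_chart_def by blast

lemma chart_sqsym: "k \<in> patches M \<Longrightarrow> square_chart (side_chart k sw a b)"
  using chart square_chart_sqsym(1) by blast

lemma sqsym_patch: "(side_chart k sw a b) ` box 0 1 = patch M k"
  unfolding patch_def by (simp only: image_comp[symmetric] sqsym_image)

lemma open_patch: "k \<in> patches M \<Longrightarrow> open (patch M k)"
  unfolding patch_def by (rule square_chart.open_image[OF chart])

lemma closure_patch: "k \<in> patches M \<Longrightarrow> closure (patch M k) = pmap M k ` cbox 0 1"
  unfolding patch_def by (rule square_chart.closure_image[OF chart])

lemma closure_patch_sqsym: "k \<in> patches M \<Longrightarrow> closure (patch M k) = (side_chart k sw a b) ` cbox 0 1"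
  unfolding closure_patch by (simp only: image_comp[symmetric] sqsym_image)

lemma finite_patches: "finite (patches M)"
  unfolding patches_def by simp

lemma Dom_eq: "Dom M = interior (\<Union>k\<in>patches M. closure (patch M k))"
  using domain unfolding multipatch_domain_def by blast

lemma patch_disjoint: "k \<in> patches M \<Longrightarrow> l \<in> patches M \<Longrightarrow> k \<noteq> l \<Longrightarrow> patch M k \<inter> patch M l = {}"
  using domain unfolding multipatch_domain_def by blast

lemma patch_disjoint_closure: "k \<in> patches M \<Longrightarrow> l \<in> patches M \<Longrightarrow> k \<noteq> l \<Longrightarrow> patch M k \<inter> closure (patch M l) = {}"
  using patch_disjoint[of k l] open_patch[of k] by (simp add: open_Int_closure_eq_empty)

lemma patch_subset_Dom: "k \<in> patches M \<Longrightarrow> patch M k \<subseteq> Dom M"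
  unfolding Dom_eq using open_patch[of k] closure_subset by (intro interior_maximal) fast+

lemma Dom_lmeasurable: "Dom M \<in> lmeasurable" and open_Dom: "open (Dom M)" and Dom_sets: "Dom M \<in> sets lebesgue"
  using domain unfolding multipatch_domain_def by (auto intro: lmeasurable_open)

lemma patch_lmeasurable: "k \<in> patches M \<Longrightarrow> patch M k \<in> lmeasurable" "k \<in> patches M \<Longrightarrow> patch M k \<in> sets lebesgue"
  using square_chart.lmeasurable_image[OF chart] unfolding patch_def by auto

lemma negligible_skeleton: "negligible (Dom M - (\<Union>k\<in>patches M. patch M k))"
proof -
  have "Dom M - (\<Union>k\<in>patches M. patch M k) \<subseteq> (\<Union>k\<in>patches M. pmap M k ` (cbox 0 1 - box 0 1))"
  proof
    fix x assume x: "x \<in> Dom M - (\<Union>k\<in>patches M. patch M k)"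
    then have "x \<in> (\<Union>k\<in>patches M. closure (patch M k))" unfolding Dom_eq using interior_subset by blast
    then obtain k where k: "k \<in> patches M" "x \<in> pmap M k ` cbox 0 1" using closure_patch by auto
    then show "x \<in> (\<Union>k\<in>patches M. pmap M k ` (cbox 0 1 - box 0 1))" using x unfolding patch_def by blast
  qed
  moreover have "negligible (\<Union>k\<in>patches M. pmap M k ` (cbox 0 1 - box 0 1))"
    using finite_patches square_chart.negligible_image[OF chart] negligible_frontier_interval
    by (intro negligible_Union) auto
  ultimately show ?thesis using negligible_subset by blast
qed

text \<open>
  The patches exhaust the domain up to the images of the boundary of the square, which are null sets.
\<close>

lemma AE_Dom_iff: "(AE x in leb_Dom. P x) \<longleftrightarrow> (\<forall>k\<in>patches M. AE x in leb_patch k. P x)"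
proof
  assume "AE x in leb_Dom. P x"
  then show "\<forall>k\<in>patches M. AE x in leb_patch k. P x"
    using AE_lebesgue_on_subset[OF _ patch_subset_Dom Dom_sets patch_lmeasurable(2)] by blast
next
  assume "\<forall>k\<in>patches M. AE x in leb_patch k. P x"
  then have "\<forall>k\<in>patches M. negligible {x \<in> patch M k. \<not> P x}" using patch_lmeasurable(2) AE_lebesgue_on_negligible by blast
  then have "negligible (\<Union>k\<in>patches M. {x \<in> patch M k. \<not> P x})" using finite_patches by (intro negligible_Union) auto
  then have "negligible ((\<Union>k\<in>patches M. {x \<in> patch M k. \<not> P x}) \<union> (Dom M - (\<Union>k\<in>patches M. patch M k)))"
    using negligible_skeleton by (rule negligible_Un)
  then have "negligible {x \<in> Dom M. \<not> P x}" by (rule negligible_subset) auto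
  then show "AE x in leb_Dom. P x" using Dom_sets by (simp add: AE_lebesgue_on_negligible)
qed

text \<open>
  The side of patch \<open>k\<close> selected by \<open>sw\<close> and \<open>b\<close>; the direction of traversal is immaterial for it.
\<close>

definition side_edge :: "nat \<Rightarrow> bool \<Rightarrow> bool \<Rightarrow> (real^2) set" where
  "side_edge k sw b = (side_chart k sw False b) ` bottom"

lemma side_edge_sqsym: "(side_chart k sw a b) ` bottom = side_edge k sw b"
  unfolding side_edge_def image_comp[symmetric] by (cases sw) (simp_all only: sqsym_bottom)

lemma patch_edges_eq: "patch_edges M k = {side_edge k sw b | sw b. True}"
proof (intro set_eqI iffI)
  fix e assume "e \<in> patch_edges M k"
  then obtain i c where e: "e = pmap M k ` {x \<in> cbox 0 1. x $ i = c}" "c \<in> {0, 1::real}" unfolding patch_edges_def by blast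
  have "{x \<in> cbox 0 1. x $ i = c} = sqsym (i = 1) False (c = 1) ` bottom"
  proof (cases "i = 1")
    case True
    then show ?thesis using e(2) sqsym_bottom(2)[of False "c = 1"] by auto
  next
    case False
    then have "i = 2" using exhaust_2[of i] by blast
    then show ?thesis using e(2) sqsym_bottom(1)[of False "c = 1"] by auto
  qed
  then have "e = side_edge k (i = 1) (c = 1)"
    unfolding side_edge_def image_comp[symmetric] e(1) by (simp only:)
  then show "e \<in> {side_edge k sw b | sw b. True}" by blast
next
  fix e assume "e \<in> {side_edge k sw b | sw b. True}"
  then obtain sw b where e: "e = pmap M k ` sqsym sw False b ` bottom" unfolding side_edge_def image_comp by blast
  show "e \<in> patch_edges M k"
  proof (cases sw)
    case True
    have "e = pmap M k ` {x \<in> cbox 0 1. x $ 1 = (if b then 1 else 0)}" unfolding e using True by (simp only: sqsym_bottom)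
    then show ?thesis unfolding patch_edges_def by (cases b) auto
  next
    case False
    have "e = pmap M k ` {x \<in> cbox 0 1. x $ 2 = (if b then 1 else 0)}" unfolding e using False by (simp only: sqsym_bottom)
    then show ?thesis unfolding patch_edges_def by (cases b) auto
  qed
qed

lemma side_edge_point:
  assumes k: "k \<in> patches M" and s: "0 < s" "s < 1"
    and x: "(side_chart k sw a b) (vec2 s 0) \<in> side_edge k sw' b'"
  shows "sw' = sw \<and> b' = b"
proof -
  obtain y where y: "y \<in> bottom" "pmap M k (sqsym sw a b (vec2 s 0)) = pmap M k (sqsym sw' False b' y)"
    using x unfolding side_edge_def by auto
  have "sqsym sw a b (vec2 s 0) = sqsym sw' False b' y"
  proof (rule inj_onD[OF square_chart.inj[OF chart[OF k]] y(2)])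
    show "sqsym sw a b (vec2 s 0) \<in> cbox 0 1" "sqsym sw' False b' y \<in> cbox 0 1"
      unfolding sqsym_mem_cbox using s y(1) by (auto simp: mem_unit_cbox)
  qed
  then show ?thesis using s y(1)
    by (auto simp: sqsym_def flip_def vec2_eq_iff split: if_splits)
qed

lemma side_edge_inj: "k \<in> patches M \<Longrightarrow> side_edge k sw b = side_edge k sw' b' \<Longrightarrow> sw' = sw \<and> b' = b"
proof -
  assume k: "k \<in> patches M" and eq: "side_edge k sw b = side_edge k sw' b'"
  have "(side_chart k sw False b) (vec2 (1/2) 0) \<in> side_edge k sw b"
    unfolding side_edge_def by (intro imageI) (simp add: mem_unit_cbox)
  then show ?thesis using side_edge_point[OF k, of "1/2"] eq by simp
qed

text \<open>
  Geometric conformity: the intersection of the two closures contains a point that is not a vertex, so it is a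
  common edge, and the only edge of patch \<open>k\<close> through that point is the given side.
\<close>

lemma shared_edge:
  assumes k: "k \<in> patches M" and l: "l \<in> patches M" "l \<noteq> k" and s: "0 < s" "s < 1"
    and x: "(side_chart k sw a b) (vec2 s 0) \<in> closure (patch M l)"
  shows "side_edge k sw b \<in> patch_edges M l" "closure (patch M k) \<inter> closure (patch M l) = side_edge k sw b"
proof -
  let ?x = "(side_chart k sw a b) (vec2 s 0)" and ?I = "closure (patch M k) \<inter> closure (patch M l)"
  have yc: "sqsym sw a b (vec2 s 0) \<in> cbox 0 1" unfolding sqsym_mem_cbox using s by (simp add: mem_unit_cbox)
  then have xI: "?x \<in> ?I" using x closure_patch[OF k] by auto
  have "?I = {} \<or> (\<exists>v \<in> patch_vertices M k \<inter> patch_vertices M l. ?I = {v}) \<or> ?I \<in> patch_edges M k \<inter> patch_edges M l"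
    using domain k l unfolding multipatch_domain_def Let_def by metis
  moreover have "?x \<notin> patch_vertices M k"
  proof
    assume "?x \<in> patch_vertices M k"
    then obtain y where y: "\<forall>i. y $ i \<in> {0,1::real}" "pmap M k (sqsym sw a b (vec2 s 0)) = pmap M k y"
      unfolding patch_vertices_def by auto
    have "0 \<le> y $ i \<and> y $ i \<le> 1" for i using y(1)[rule_format, of i] by auto
    then have "y \<in> cbox 0 1" by (simp add: mem_unit_cbox)
    then have "sqsym sw a b (vec2 s 0) = y" using inj_onD[OF square_chart.inj[OF chart[OF k]] y(2) yc] by blast
    then have "sqsym sw a b (vec2 s 0) $ i \<in> {0, 1}" for i using y(1) by blast
    from this[of 1] this[of 2] show False using s by (auto simp: sqsym_def flip_def split: if_splits)
  qed
  ultimately have "?I \<in> patch_edges M k \<inter> patch_edges M l" using xI by (elim disjE bexE) auto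
  then have I: "?I \<in> patch_edges M k" "?I \<in> patch_edges M l" by blast+
  then obtain sw' b' where "?I = side_edge k sw' b'" unfolding patch_edges_eq by blast
  moreover have "sw' = sw \<and> b' = b" using side_edge_point[OF k s] xI calculation by blast
  ultimately show "?I = side_edge k sw b" by blast
  then show "side_edge k sw b \<in> patch_edges M l" using I(2) by simp
qed

lemma edge_patches_eq:
  assumes e: "e \<in> edges M"
  shows "edge_patches M e = {k \<in> patches M. e \<in> patch_edges M k}"
proof (intro set_eqI iffI)
  fix k assume "k \<in> {k \<in> patches M. e \<in> patch_edges M k}"
  then obtain sw b where k: "k \<in> patches M" and e: "e = side_edge k sw b" unfolding patch_edges_eq by blast
  have "bottom \<subseteq> cbox 0 1 - box 0 1" by (auto simp: mem_unit_box)
  then have "e \<subseteq> frontier ((side_chart k sw False b) ` box 0 1)"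
    unfolding e side_edge_def square_chart.frontier_image[OF chart_sqsym[OF k]] by (rule image_mono)
  then show "k \<in> edge_patches M e" using k unfolding edge_patches_def sqsym_patch by blast
next
  fix k assume "k \<in> edge_patches M e"
  then have k: "k \<in> patches M" "e \<subseteq> frontier (patch M k)" unfolding edge_patches_def by auto
  obtain l where l: "l \<in> patches M" "e \<in> patch_edges M l" using e unfolding edges_def by blast
  show "k \<in> {k \<in> patches M. e \<in> patch_edges M k}"
  proof (cases "k = l")
    case False
    obtain sw b where e: "e = side_edge l sw b" using l unfolding patch_edges_eq by blast
    have "(side_chart l sw False b) (vec2 (1/2) 0) \<in> e"
      unfolding e side_edge_def by (intro imageI) (simp add: mem_unit_cbox)
    then have "(side_chart l sw False b) (vec2 (1/2) 0) \<in> closure (patch M k)" using k unfolding frontier_def by blast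
    then have "e \<in> patch_edges M k" using shared_edge(1)[OF l(1) k(1) False, of "1/2"] unfolding e by simp
    then show ?thesis using k by simp
  qed (use l in simp)
qed

text \<open>
  Two patches glued along a common edge cover a neighbourhood of every inner point of the edge,
  by invariance of domain for the map that is given by one chart above the edge and by the other,
  reparametrised along the edge, below it.
\<close>

lemma glue_two_patches:
  assumes k: "k \<in> patches M" and l: "l \<in> patches M" "l \<noteq> k" and e: "side_edge k sw b \<in> patch_edges M l"
    and s: "0 < s" "s < 1"
  shows "(side_chart k sw a b) (vec2 s 0) \<in> interior (closure (patch M k) \<union> closure (patch M l))"
proof -
  obtain sw' b' where e': "side_edge k sw b = side_edge l sw' b'" using e unfolding patch_edges_eq by blast
  define E where "E = side_chart k sw a b"
  define E' where "E' = side_chart l sw' False b'"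
  interpret E: square_chart E unfolding E_def by (rule chart_sqsym[OF k])
  interpret E': square_chart E' unfolding E'_def by (rule chart_sqsym[OF l(1)])
  have eE: "E ` bottom = E' ` bottom" unfolding E_def E'_def side_edge_sqsym e' ..
  have cl: "closure (patch M k) = E ` cbox 0 1" "closure (patch M l) = E' ` cbox 0 1"
    unfolding E_def E'_def using closure_patch_sqsym k l by auto
  have I: "E ` cbox 0 1 \<inter> E' ` cbox 0 1 = E ` bottom"
  proof -
    have "(side_chart k sw a b) (vec2 (1/2) 0) \<in> E ` bottom" unfolding E_def by (intro imageI) (simp add: mem_unit_cbox)
    then have "(side_chart k sw a b) (vec2 (1/2) 0) \<in> closure (patch M l)" unfolding cl eE by auto
    then have "closure (patch M k) \<inter> closure (patch M l) = side_edge k sw b"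
      by (intro shared_edge(2)[OF k l(1,2), of "1/2" sw a b]) simp_all
    then show ?thesis unfolding cl unfolding E_def side_edge_sqsym .
  qed
  define h where "h x = E'.G (E (vec2 x 0)) $ 1" for x
  have hb: "E'.G (E (vec2 x 0)) \<in> bottom" if "0 \<le> x" "x \<le> 1" for x
  proof -
    have "E (vec2 x 0) \<in> E' ` bottom" using that unfolding eE[symmetric] by (intro imageI) (simp add: mem_unit_cbox)
    then obtain y where "y \<in> bottom" "E (vec2 x 0) = E' y" by blast
    then show ?thesis using E'.GE[of y] by auto
  qed
  have h: "0 \<le> h x" "h x \<le> 1" "E' (vec2 (h x) 0) = E (vec2 x 0)" if "0 \<le> x" "x \<le> 1" for x
  proof -
    show "0 \<le> h x" "h x \<le> 1" using hb[OF that] unfolding h_def by (auto simp: mem_unit_cbox)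
    have "vec2 (h x) 0 = E'.G (E (vec2 x 0))" using hb[OF that] unfolding h_def by (auto simp: vec2_eq_iff)
    moreover have "E (vec2 x 0) \<in> E' ` cbox 0 1" using I that bottom_vec2 by (metis (no_types, lifting) IntE imageI)
    ultimately show "E' (vec2 (h x) 0) = E (vec2 x 0)" using E'.EG by simp
  qed
  have h_inj: "x = x'" if "h x = h x'" "0 \<le> x" "x \<le> 1" "0 \<le> x'" "x' \<le> 1" for x x'
  proof -
    have "E (vec2 x 0) = E (vec2 x' 0)" using h(3)[of x] h(3)[of x'] that by simp
    moreover have "vec2 x 0 \<in> cbox 0 1" "vec2 x' 0 \<in> cbox 0 1" using that by (auto simp: mem_unit_cbox)
    ultimately have "vec2 x 0 = vec2 x' 0" by (rule inj_onD[OF E.inj])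
    then show ?thesis by (auto simp: vec2_eq_iff)
  qed
  have "continuous_on (E' ` cbox 0 1) E'.G"
    using continuous_on_inv[OF E'.cont compact_cbox, of E'.G] E'.GE by simp
  moreover have "continuous_on {0..1} (\<lambda>x. E (vec2 x 0))"
    by (rule continuous_on_compose2[OF E.cont]) (auto intro!: continuous_on_vec2 continuous_intros simp: mem_unit_cbox)
  moreover have "(\<lambda>x. E (vec2 x 0)) ` {0..1} \<subseteq> E' ` cbox 0 1"
    using I by (auto simp: bottom_vec2)
  ultimately have hc: "continuous_on {0..1} h" unfolding h_def[abs_def]
    by (intro continuous_intros continuous_on_compose2[of "E' ` cbox 0 1" E'.G "{0..1}" "\<lambda>x. E (vec2 x 0)"])
  define \<Gamma> where "\<Gamma> z = (if 0 \<le> z$2 then E z else E' (vec2 (h (z$1)) (- z$2)))" for z :: "real^2"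
  let ?P = "{z. (0::real) \<le> z$(2::2)}" and ?N = "{z. z$(2::2) \<le> (0::real)}"
  have P: "closed (edge_rect \<inter> ?P)" and N: "closed (edge_rect \<inter> ?N)"
    by (intro closed_Int closed_cbox closed_Collect_le continuous_intros)+
  have "continuous_on ((edge_rect \<inter> ?P) \<union> (edge_rect \<inter> ?N)) \<Gamma>"
    unfolding \<Gamma>_def
  proof (rule continuous_on_cases[OF P N])
    show "continuous_on (edge_rect \<inter> ?P) E"
      by (rule continuous_on_subset[OF E.cont]) (auto simp: mem_edge_rect mem_unit_cbox)
    show "continuous_on (edge_rect \<inter> ?N) (\<lambda>z. E' (vec2 (h (z$1)) (- z$2)))"
      by (rule continuous_on_compose2[OF E'.cont])
         (auto intro!: continuous_on_vec2 continuous_intros continuous_on_compose2[OF hc] simp: mem_edge_rect mem_unit_cbox h)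
    show "\<forall>z. z \<in> edge_rect \<inter> ?P \<and> \<not> 0 \<le> z$2 \<or> z \<in> edge_rect \<inter> ?N \<and> 0 \<le> z$2 \<longrightarrow> E z = E' (vec2 (h (z$1)) (- z$2))"
    proof (intro allI impI)
      fix z :: "real^2" assume "z \<in> edge_rect \<inter> ?P \<and> \<not> 0 \<le> z$2 \<or> z \<in> edge_rect \<inter> ?N \<and> 0 \<le> z$2"
      then have z: "z$2 = 0" "0 \<le> z$1" "z$1 \<le> 1" by (auto simp: mem_edge_rect)
      then have "z = vec2 (z$1) 0" by (auto simp: vec2_eq_iff)
      then show "E z = E' (vec2 (h (z$1)) (- z$2))" using h(3)[OF z(2,3)] z(1) by simp
    qed
  qed
  then have cont: "continuous_on open_rect \<Gamma>"
    by (rule continuous_on_subset) (auto simp: mem_open_rect mem_edge_rect)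
  have inE: "E z \<in> E ` cbox 0 1" if "z \<in> open_rect" "0 \<le> z$2" for z using that by (intro imageI) (auto simp: mem_open_rect mem_unit_cbox)
  have inE': "vec2 (h (z$1)) (- z$2) \<in> cbox 0 1" if "z \<in> open_rect" "\<not> 0 \<le> z$2" for z
    using that h[of "z$1"] by (auto simp: mem_open_rect mem_unit_cbox)
  have cross: False if z: "z \<in> open_rect" "0 \<le> z$2" and w: "w \<in> open_rect" "\<not> 0 \<le> w$2" and eq: "E z = E' (vec2 (h (w$1)) (- w$2))" for z w
  proof -
    have "E z \<in> E' ` bottom" using I inE[OF z] inE'[OF w] unfolding eq eE[symmetric] by blast
    then obtain y where y: "y \<in> bottom" "E' (vec2 (h (w$1)) (- w$2)) = E' y" unfolding eq by blast
    then have "y \<in> cbox 0 1" by simp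
    from inj_onD[OF E'.inj y(2) inE'[OF w] this] have "vec2 (h (w$1)) (- w$2) = y" .
    then show False using y(1) w(2) by auto
  qed
  have "inj_on \<Gamma> open_rect"
  proof (rule inj_onI)
    fix z w assume z: "z \<in> open_rect" and w: "w \<in> open_rect" and eq: "\<Gamma> z = \<Gamma> w"
    consider "0 \<le> z$2" "0 \<le> w$2" | "0 \<le> z$2" "\<not> 0 \<le> w$2" | "\<not> 0 \<le> z$2" "0 \<le> w$2" | "\<not> 0 \<le> z$2" "\<not> 0 \<le> w$2" by blast
    then show "z = w"
    proof cases
      case 1
      then have "E z = E w" using eq unfolding \<Gamma>_def by simp
      moreover have "z \<in> cbox 0 1" "w \<in> cbox 0 1" using 1 z w by (auto simp: mem_open_rect mem_unit_cbox)
      ultimately show ?thesis by (rule inj_onD[OF E.inj])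
    next
      case 2
      then show ?thesis using cross[OF z _ w] eq unfolding \<Gamma>_def by auto
    next
      case 3
      then show ?thesis using cross[OF w _ z] eq unfolding \<Gamma>_def by auto
    next
      case 4
      then have "E' (vec2 (h (z$1)) (- z$2)) = E' (vec2 (h (w$1)) (- w$2))" using eq unfolding \<Gamma>_def by simp
      from inj_onD[OF E'.inj this inE'[OF z 4(1)] inE'[OF w 4(2)]]
      have "vec2 (h (z$1)) (- z$2) = vec2 (h (w$1)) (- w$2)" .
      then have "h (z$1) = h (w$1)" "z$2 = w$2" by (auto simp: vec2_eq_iff)
      then show ?thesis using h_inj[of "z$1" "w$1"] z w by (auto simp: vec2_eq_iff mem_open_rect)
    qed
  qed
  with cont have "open (\<Gamma> ` open_rect)" by (intro invariance_of_domain) auto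
  moreover have "\<Gamma> ` open_rect \<subseteq> closure (patch M k) \<union> closure (patch M l)"
    unfolding cl \<Gamma>_def using inE inE' by auto
  moreover have "E (vec2 s 0) \<in> \<Gamma> ` open_rect"
    using s by (intro image_eqI[of _ _ "vec2 s 0"]) (auto simp: \<Gamma>_def mem_open_rect)
  ultimately show ?thesis unfolding E_def by (meson interiorI)
qed

text \<open>
  Two patches with the common edge already cover a neighbourhood of its midpoint, which leaves no room for the
  interior of a third patch.
\<close>

lemma edge_patches_card_le:
  assumes e: "e \<in> edges M"
  shows "card (edge_patches M e) \<le> 2"
proof (rule ccontr)
  assume "\<not> card (edge_patches M e) \<le> 2"
  then have "3 \<le> card (edge_patches M e)" by simp
  then obtain T where T: "T \<subseteq> edge_patches M e" "card T = 3" by (meson obtain_subset_with_card_n)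
  then obtain k l j where klj: "T = {k, l, j}" "k \<noteq> l" "k \<noteq> j" "l \<noteq> j" by (auto simp: card_Suc_eq numeral_3_eq_3)
  have mem: "k \<in> patches M" "l \<in> patches M" "j \<in> patches M" "e \<in> patch_edges M k" "e \<in> patch_edges M l" "e \<in> patch_edges M j"
    using T(1) klj(1) unfolding edge_patches_eq[OF e] by auto
  obtain sw b where e': "e = side_edge k sw b" using mem(4) unfolding patch_edges_eq by blast
  let ?x = "(side_chart k sw False b) (vec2 (1/2) 0)"
  let ?U = "interior (closure (patch M k) \<union> closure (patch M l))"
  have xU: "?x \<in> ?U" using mem klj e' by (intro glue_two_patches) auto
  have xe: "?x \<in> e" unfolding e' side_edge_def by (intro imageI) (simp add: mem_unit_cbox)
  have "e \<subseteq> frontier (patch M j)" using T(1) klj(1) unfolding edge_patches_def by blast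
  then have "?x \<in> closure (patch M j)" using xe unfolding frontier_def by blast
  then have "patch M j \<inter> ?U \<noteq> {}" using xU by (metis IntI empty_iff open_Int_closure_eq_empty open_interior inf_commute)
  then have "patch M j \<inter> (closure (patch M k) \<union> closure (patch M l)) \<noteq> {}" using interior_subset by blast
  then show False using patch_disjoint_closure[of j k] patch_disjoint_closure[of j l] mem klj by blast
qed

text \<open>
  An edge of only one patch lies on the boundary of the domain: otherwise a neighbourhood of an
  inner point would be contained in the closed patch, and the inverse chart would map it onto an
  open set that contains a boundary point of the unit square.
\<close>

lemma boundary_edge_notin_Dom:
  assumes k: "k \<in> patches M" and ne: "\<not> interior_edge M (side_edge k sw b)" and s: "0 < s" "s < 1"
  shows "(side_chart k sw a b) (vec2 s 0) \<notin> Dom M"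
proof
  let ?e = "side_edge k sw b" and ?E = "side_chart k sw a b"
  assume x: "?E (vec2 s 0) \<in> Dom M"
  interpret E: square_chart ?E by (rule chart_sqsym[OF k])
  have e: "?e \<in> edges M" "?e \<in> patch_edges M k" using k unfolding edges_def patch_edges_eq by blast+
  then have ke: "k \<in> edge_patches M ?e" using k edge_patches_eq by blast
  have fin: "finite (edge_patches M ?e)" unfolding edge_patches_def using finite_patches by auto
  have "card (edge_patches M ?e) \<noteq> 2" using ne e unfolding interior_edge_def by blast
  moreover have "card (edge_patches M ?e) \<noteq> 0" using ke fin by auto
  ultimately have "card (edge_patches M ?e) = 1" using edge_patches_card_le[OF e(1)] by linarith
  then have single: "edge_patches M ?e = {k}" using ke by (metis card_1_singletonE singletonD)
  have others: "?E (vec2 s 0) \<notin> closure (patch M l)" if l: "l \<in> patches M" "l \<noteq> k" for l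
  proof
    assume "?E (vec2 s 0) \<in> closure (patch M l)"
    then have "?e \<in> patch_edges M l" by (rule shared_edge(1)[OF k l s])
    then have "l \<in> edge_patches M ?e" using l edge_patches_eq[OF e(1)] by blast
    then show False using single l by simp
  qed
  define U where "U = Dom M - (\<Union>l\<in>patches M - {k}. closure (patch M l))"
  have U: "open U" unfolding U_def using open_Dom finite_patches by (intro open_Diff closed_UN) auto
  have xU: "?E (vec2 s 0) \<in> U" unfolding U_def using x others by blast
  have Uk: "U \<subseteq> ?E ` cbox 0 1"
  proof
    fix z assume z: "z \<in> U"
    then have "z \<in> (\<Union>l\<in>patches M. closure (patch M l))" unfolding U_def Dom_eq using interior_subset by blast
    then have "z \<in> closure (patch M k)" using z unfolding U_def by blast
    then show "z \<in> ?E ` cbox 0 1" using closure_patch_sqsym[OF k] by simp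
  qed
  have "continuous_on (?E ` cbox 0 1) E.G"
    using continuous_on_inv[OF E.cont compact_cbox, of E.G] E.GE by simp
  then have "open (E.G ` U)"
    using Uk U inj_on_inv_into[of U ?E "cbox 0 1"] by (intro invariance_of_domain) (auto intro: continuous_on_subset)
  moreover have "E.G ` U \<subseteq> cbox 0 1" using Uk E.G_mem by blast
  ultimately have "E.G ` U \<subseteq> box 0 1" using interior_maximal interior_cbox by metis
  moreover have "E.G (?E (vec2 s 0)) = vec2 s 0" using s by (intro E.GE) (simp add: mem_unit_cbox)
  ultimately have "vec2 s 0 \<in> box 0 1" using xU by (metis image_subset_iff)
  then show False by (simp add: mem_unit_box)
qed

end

text \<open>
  An interior edge with its two charts: \<open>Ep\<close> and \<open>Em\<close> are the edge map on the fine and, reflected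
  to the unit square, on the coarse side.
\<close>

definition reflect_perp :: "real^2 \<Rightarrow> real^2" where
  "reflect_perp z = vec2 (z$1) (- z$2)"

lemma reflect_perp_nth [simp]: "reflect_perp z $ 1 = z $ 1" "reflect_perp z $ 2 = - z $ 2"
  by (auto simp: reflect_perp_def)

lemma reflect_perp_twice [simp]: "reflect_perp (reflect_perp z) = z"
  by (simp add: vec2_eq_iff)

locale edge_setting = mp_geometry +
  fixes e :: "(real^2) set" and sm am bm sp ap bp :: bool and km kp :: nat and Em Ep :: "real^2 \<Rightarrow> real^2"
  defines "km \<equiv> kcoarse M e" and "kp \<equiv> kfine M e"
    and "Em \<equiv> pmap M km \<circ> sqsym sm am bm" and "Ep \<equiv> pmap M kp \<circ> sqsym sp ap bp"
  assumes int: "interior_edge M e" and split_edge: "edge_patches M e = {km, kp}"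
    and Em_eq: "\<And>y. y \<in> cbox 0 1 \<Longrightarrow> emap M e (reflect_perp y) = Em y"
    and Ep_eq: "\<And>y. y \<in> cbox 0 1 \<Longrightarrow> emap M e y = Ep y"

context mp_geometry
begin

text \<open>
  On each half of the rectangle the edge map is a patch map composed with an affine coordinate
  change, and after reflection of the lower half this change is a symmetry of the unit square.
\<close>

lemma ex_edge_setting:
  assumes int: "interior_edge M e" and sp: "multipatch_splines M"
  shows "\<exists>sm am bm sp ap bp. edge_setting M e sm am bm sp ap bp"
proof -
  have em: "(\<exists>A. coord_change A \<and> A ` minus_square = cbox 0 1 \<and> (\<forall>x\<in>minus_square. emap M e x = pmap M (kcoarse M e) (A x)))"
     "(\<exists>A. coord_change A \<and> A ` plus_square = cbox 0 1 \<and> (\<forall>x\<in>plus_square. emap M e x = pmap M (kfine M e) (A x)))"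
    using emaps int unfolding edge_maps_def by blast+
  obtain A where A: "coord_change A" "A ` minus_square = cbox 0 1" "\<forall>x\<in>minus_square. emap M e x = pmap M (kcoarse M e) (A x)"
    using em(1) by blast
  obtain A' where A': "coord_change A'" "A' ` plus_square = cbox 0 1" "\<forall>x\<in>plus_square. emap M e x = pmap M (kfine M e) (A' x)"
    using em(2) by blast
  have rp: "reflect_perp ` cbox 0 1 = minus_square"
  proof (intro set_eqI iffI)
    fix z assume "z \<in> minus_square"
    then have "reflect_perp z \<in> cbox 0 1" by (auto simp: mem_unit_cbox mem_minus_square)
    then show "z \<in> reflect_perp ` cbox 0 1" by (metis imageI reflect_perp_twice)
  qed (auto simp: mem_unit_cbox mem_minus_square)
  have "coord_change (A \<circ> reflect_perp)"
  proof -
    obtain t a b where ab: "a \<in> {-1, 1}" "b \<in> {-1, 1}"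
      and "A = (\<lambda>x. t + vec2 (a * x$1) (b * x$2)) \<or> A = (\<lambda>x. t + vec2 (a * x$2) (b * x$1))"
      using A(1) unfolding coord_change_def by blast
    moreover have "(\<lambda>x. t + vec2 (a * x$1) (b * x$2)) \<circ> reflect_perp = (\<lambda>x. t + vec2 (a * x$1) ((- b) * x$2))"
      "(\<lambda>x. t + vec2 (a * x$2) (b * x$1)) \<circ> reflect_perp = (\<lambda>x. t + vec2 ((- a) * x$2) (b * x$1))"
      by (auto simp: fun_eq_iff)
    ultimately have "A \<circ> reflect_perp = (\<lambda>x. t + vec2 (a * x$1) ((- b) * x$2)) \<or> A \<circ> reflect_perp = (\<lambda>x. t + vec2 ((- a) * x$2) (b * x$1))"
      by (elim disjE) (simp_all only: refl disj_assoc simp_thms)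
    then show ?thesis
    proof
      assume "A \<circ> reflect_perp = (\<lambda>x. t + vec2 (a * x$1) ((- b) * x$2))"
      then show ?thesis unfolding coord_change_def using ab by (intro exI[of _ t] exI[of _ a] exI[of _ "- b"]) auto
    next
      assume "A \<circ> reflect_perp = (\<lambda>x. t + vec2 ((- a) * x$2) (b * x$1))"
      then show ?thesis unfolding coord_change_def using ab by (intro exI[of _ t] exI[of _ "- a"] exI[of _ b]) auto
    qed
  qed
  moreover have "(A \<circ> reflect_perp) ` cbox 0 1 = cbox 0 1" using A(2) rp by (simp only: image_comp[symmetric])
  ultimately obtain sm am bm where m: "A \<circ> reflect_perp = sqsym sm am bm" by (rule coord_change_sqsym)
  obtain s a b where p: "A' = sqsym s a b" using A'(1,2) by (rule coord_change_sqsym)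
  have "edge_patches M e = {kcoarse M e, kfine M e}" using sp int unfolding multipatch_splines_def by blast
  moreover have "emap M e (reflect_perp y) = (side_chart (kcoarse M e) sm am bm) y" if "y \<in> cbox 0 1" for y
  proof -
    have "reflect_perp y \<in> minus_square" using that rp by blast
    then have "emap M e (reflect_perp y) = pmap M (kcoarse M e) ((A \<circ> reflect_perp) y)" using A(3) by simp
    then show ?thesis unfolding m by simp
  qed
  moreover have "emap M e y = (side_chart (kfine M e) s a b) y" if "y \<in> cbox 0 1" for y
    using A'(3) that unfolding p by simp
  ultimately have "edge_setting M e sm am bm s a b"
    using int mp_geometry_axioms unfolding edge_setting_def edge_setting_axioms_def by blast
  then show ?thesis by blast
qed

end

context edge_setting
begin

lemma km: "km \<in> patches M" and kp: "kp \<in> patches M" and kne: "km \<noteq> kp"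
proof -
  have "card {km, kp} = 2" using int split_edge unfolding interior_edge_def by simp
  then show "km \<noteq> kp" by auto
  show "km \<in> patches M" "kp \<in> patches M" using split_edge unfolding edge_patches_def by auto
qed

lemma Em_chart: "square_chart Em" and Ep_chart: "square_chart Ep"
  unfolding Em_def Ep_def using chart_sqsym km kp by auto

sublocale m: square_chart Em by (rule Em_chart)
sublocale p: square_chart Ep by (rule Ep_chart)

lemma Em_patch: "Em ` box 0 1 = patch M km" and Ep_patch: "Ep ` box 0 1 = patch M kp"
  unfolding Em_def Ep_def by (rule sqsym_patch)+

lemma emap_inj: "inj_on (emap M e) edge_rect" and emap_cont: "continuous_on edge_rect (emap M e)"
  and emap_bottom: "emap M e ` {x \<in> edge_rect. x $ 2 = 0} = e"
proof -
  obtain H where "homeomorphism edge_rect (closure (edge_dom M e)) (emap M e) H"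
    using emaps int unfolding edge_maps_def by blast
  then show "inj_on (emap M e) edge_rect" "continuous_on edge_rect (emap M e)"
    unfolding homeomorphism_def by (auto intro: inj_on_inverseI)
  show "emap M e ` {x \<in> edge_rect. x $ 2 = 0} = e" using emaps int unfolding edge_maps_def by blast
qed

lemma bottom_agree: "0 \<le> s \<Longrightarrow> s \<le> 1 \<Longrightarrow> Em (vec2 s 0) = Ep (vec2 s 0)"
  using Em_eq[of "vec2 s 0"] Ep_eq[of "vec2 s 0"] by (auto simp: mem_unit_cbox reflect_perp_def)

lemma e_Ep: "e = Ep ` bottom" and e_Em: "e = Em ` bottom"
proof -
  have b: "{x \<in> edge_rect. x $ 2 = 0} = bottom" by (auto simp: mem_edge_rect mem_unit_cbox)
  have "e = emap M e ` bottom" using emap_bottom unfolding b by (rule sym)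
  also have "\<dots> = Ep ` bottom" using Ep_eq by (intro image_cong) auto
  finally show "e = Ep ` bottom" .
  moreover have "Em ` bottom = Ep ` bottom"
  proof (intro image_cong refl)
    fix y assume "y \<in> bottom"
    then show "Em y = Ep y" by (elim bottomE) (simp add: bottom_agree)
  qed
  ultimately show "e = Em ` bottom" by simp
qed

lemma e_side: "e = side_edge km sm bm" "e = side_edge kp sp bp"
  using e_Em e_Ep unfolding Em_def Ep_def side_edge_sqsym by auto

lemma open_emap: "open (emap M e ` U)" if "open U" "U \<subseteq> open_rect" for U
proof (rule invariance_of_domain)
  have "U \<subseteq> edge_rect" using that(2) by (auto simp: mem_open_rect mem_edge_rect)
  then show "continuous_on U (emap M e)" "inj_on (emap M e) U"
    using emap_cont emap_inj continuous_on_subset inj_on_subset by blast+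
qed (rule that(1))

lemma emap_Dom: "emap M e ` open_rect \<subseteq> Dom M"
proof -
  have "emap M e z \<in> closure (patch M km) \<union> closure (patch M kp)" if z: "z \<in> open_rect" for z
  proof (cases "0 \<le> z$2")
    case True
    then have "z \<in> cbox 0 1" using z by (auto simp: mem_open_rect mem_unit_cbox)
    then have "emap M e z \<in> Ep ` cbox 0 1" using Ep_eq by auto
    then show ?thesis using closure_patch_sqsym[OF kp] unfolding Ep_def by blast
  next
    case False
    then have "reflect_perp z \<in> cbox 0 1" using z by (auto simp: mem_open_rect mem_unit_cbox)
    then have "emap M e z \<in> Em ` cbox 0 1" using Em_eq[of "reflect_perp z"] by auto
    then show ?thesis using closure_patch_sqsym[OF km] unfolding Em_def by blast
  qed
  then have "emap M e ` open_rect \<subseteq> (\<Union>k\<in>patches M. closure (patch M k))" using km kp by blast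
  then show ?thesis unfolding Dom_eq using open_emap[of open_rect] by (intro interior_maximal) auto
qed

lemma edge_point_Dom: "0 < s \<Longrightarrow> s < 1 \<Longrightarrow> Ep (vec2 s 0) \<in> Dom M"
proof -
  assume s: "0 < s" "s < 1"
  then have "emap M e (vec2 s 0) \<in> Dom M" by (intro subsetD[OF emap_Dom] imageI) (simp add: mem_open_rect)
  moreover have "vec2 s 0 \<in> cbox 0 1" using s by (simp add: mem_unit_cbox)
  ultimately show ?thesis using Ep_eq by simp
qed

lemma patch_edge_dom:
  "patch M km \<subseteq> edge_dom M e" "patch M kp \<subseteq> edge_dom M e"
  "k \<in> patches M \<Longrightarrow> k \<noteq> km \<Longrightarrow> k \<noteq> kp \<Longrightarrow> patch M k \<inter> edge_dom M e = {}"
proof -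
  show "patch M km \<subseteq> edge_dom M e" "patch M kp \<subseteq> edge_dom M e"
    unfolding edge_dom_def km_def[symmetric] kp_def[symmetric]
    using open_patch[OF km] open_patch[OF kp] closure_subset by (intro interior_maximal; fast)+
  assume "k \<in> patches M" "k \<noteq> km" "k \<noteq> kp"
  then have "patch M k \<inter> (closure (patch M km) \<union> closure (patch M kp)) = {}"
    using patch_disjoint_closure km kp by blast
  then show "patch M k \<inter> edge_dom M e = {}"
    unfolding edge_dom_def km_def[symmetric] kp_def[symmetric] using interior_subset by blast
qed

text \<open>
  By geometric conformity, a patch whose closure contains an inner point of \<open>e\<close> has \<open>e\<close> as a
  side, so it is one of the two patches of \<open>e\<close>; and the sides of a single patch meet in vertices only.
\<close>

lemma edge_point_other:
  assumes s: "0 < s" "s < 1" and e': "e' \<in> edges M" "Ep (vec2 s 0) \<in> e'"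
  shows "e' = e"
proof -
  obtain l where l: "l \<in> patches M" "e' \<in> patch_edges M l" using e'(1) unfolding edges_def by blast
  then obtain sw b where e'eq: "e' = side_edge l sw b" unfolding patch_edges_eq by blast
  have "e' \<subseteq> closure (patch M l)"
    unfolding e'eq side_edge_def closure_patch_sqsym[OF l(1), of sw False b] by (intro image_mono) auto
  then have xl: "Ep (vec2 s 0) \<in> closure (patch M l)" using e'(2) by blast
  have e_edges: "e \<in> edges M" using int unfolding interior_edge_def by blast
  have "l \<in> {km, kp}"
  proof (rule ccontr)
    assume "l \<notin> {km, kp}"
    then have "e \<in> patch_edges M l" using shared_edge(1)[OF kp l(1) _ s] xl e_side unfolding Ep_def by force
    then show False using \<open>l \<notin> {km, kp}\<close> l(1) split_edge edge_patches_eq[OF e_edges] by blast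
  qed
  then show ?thesis
  proof
    assume "l = km"
    then show ?thesis using side_edge_point[OF km s, of sm am bm sw b] e'(2) e'eq e_side bottom_agree[of s] s unfolding Em_def by auto
  next
    assume "l \<in> {kp}"
    then show ?thesis using side_edge_point[OF kp s, of sp ap bp sw b] e'(2) e'eq e_side unfolding Ep_def by auto
  qed
qed

text \<open>
  The two charts have opposite orientation. Otherwise, to first order, both would map onto the
  same side of the tangent to the edge, although together they cover a neighbourhood of the point.
\<close>

lemma opposite_orientation: "m.ori = - p.ori"
proof (rule ccontr)
  assume "m.ori \<noteq> - p.ori"
  then have same: "m.ori = p.ori" using m.ori(1) p.ori(1) by auto
  define \<sigma> where "\<sigma> = p.ori"
  have \<sigma>: "\<sigma> \<in> {-1, 1}" unfolding \<sigma>_def using p.ori(1) by auto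
  let ?z0 = "vec2 (1/2) 0"
  have z0: "?z0 \<in> cbox 0 1" by (simp add: mem_unit_cbox)
  define x0 where "x0 = Ep ?z0"
  have x0': "x0 = Em ?z0" unfolding x0_def using bottom_agree[of "1/2"] by simp
  define P where "P = p.D ?z0"
  define Q where "Q = m.D ?z0"
  define v where "v = column 1 P"
  define qp where "qp = column 2 P"
  define qm where "qm = column 2 Q"
  have v': "column 1 Q = v"
  proof -
    let ?g = "\<lambda>s. vec2 s 0"
    have gd: "(?g has_derivative (\<lambda>s. vec2 s 0)) (at (1/2) within {0..1})"
    proof -
      have "(\<lambda>s. vec2 s 0) = (\<lambda>s. s *\<^sub>R axis 1 (1::real))" by (auto simp: fun_eq_iff vec2_eq_iff axis_def)
      then show ?thesis by (auto intro!: derivative_eq_intros)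
    qed
    have sub: "?g ` {0..1} \<subseteq> cbox 0 1" by (auto simp: mem_unit_cbox)
    have "(Ep \<circ> ?g has_derivative (*v) P \<circ> (\<lambda>s. vec2 s 0)) (at (1/2) within {0..1})"
      unfolding P_def by (rule diff_chain_within[OF gd has_derivative_subset[OF p.D[OF z0] sub]])
    moreover have "(Em \<circ> ?g has_derivative (*v) Q \<circ> (\<lambda>s. vec2 s 0)) (at (1/2) within {0..1})"
      unfolding Q_def by (rule diff_chain_within[OF gd has_derivative_subset[OF m.D[OF z0] sub]])
    then have "(Ep \<circ> ?g has_derivative (*v) Q \<circ> (\<lambda>s. vec2 s 0)) (at (1/2) within {0..1})"
      by (rule has_derivative_transform[rotated 2]) (auto simp: bottom_agree)
    moreover have "at (1/2::real) within {0..1} = at (1/2)" by (rule at_within_interior) simp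
    ultimately have "(*v) P \<circ> (\<lambda>s. vec2 s 0) = (*v) Q \<circ> (\<lambda>s. vec2 s 0)" using has_derivative_unique by metis
    then have "P *v vec2 1 0 = Q *v vec2 1 0" by (metis comp_apply)
    then show ?thesis unfolding v_def by (auto simp: vec2_eq_iff column_def matrix_vector_mult_def sum_2)
  qed
  have Pmul: "P *v h = h$1 *\<^sub>R v + h$2 *\<^sub>R qp" and Qmul: "Q *v h = h$1 *\<^sub>R v + h$2 *\<^sub>R qm" for h
    unfolding v'[symmetric] unfolding v_def qp_def qm_def using v'
    by (auto simp: vec2_eq_iff column_def matrix_vector_mult_def sum_2 v_def mult.commute)
  \<comment> \<open>\<open>L\<close> vanishes on the tangent \<open>v\<close>; if the orientations agree, it is positive on both transversal derivatives.\<close>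
  define L where "L w = \<sigma> * (v$1 * w$2 - v$2 * w$1)" for w :: "real^2"
  have Lq: "0 < L qp" "0 < L qm"
  proof -
    have "L qp = \<sigma> * det P" unfolding L_def v_def qp_def by (simp add: det_2 column_def mult.commute)
    also have "\<dots> = \<bar>det P\<bar>" using p.ori(2)[OF z0] unfolding P_def \<sigma>_def by simp
    finally show "0 < L qp" using p.matrix_inv_D(3)[OF z0] unfolding P_def by simp
    have "L qm = \<sigma> * det Q" unfolding L_def v'[symmetric] qm_def by (simp add: det_2 column_def mult.commute)
    also have "\<dots> = \<bar>det Q\<bar>" using m.ori(2)[OF z0] same unfolding Q_def \<sigma>_def by simp
    finally show "0 < L qm" using m.matrix_inv_D(3)[OF z0] unfolding Q_def by simp
  qed
  have Llin: "L (a *\<^sub>R w + b *\<^sub>R w' + w'') = a * L w + b * L w' + L w''" for a b w w' w''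
    unfolding L_def by (simp add: algebra_simps)
  have Lv: "L v = 0" unfolding L_def by simp
  have v0: "v \<noteq> 0" using Lq(1) unfolding L_def by auto
  define N where "N = norm v"
  have N: "0 < N" unfolding N_def using v0 by simp
  have N2: "N\<^sup>2 = v$1 * v$1 + v$2 * v$2" unfolding N_def by (simp add: power2_norm_eq_inner inner_vec_def sum_2)
  have Lbound: "\<bar>L w\<bar> \<le> N * norm w" for w
  proof -
    have "L w = vec2 (- \<sigma> * v$2) (\<sigma> * v$1) \<bullet> w" unfolding L_def by (simp add: inner_vec_def sum_2 algebra_simps)
    moreover have "norm (vec2 (- \<sigma> * v$2) (\<sigma> * v$1)) = N"
      using \<sigma> unfolding N_def norm_eq_sqrt_inner by (auto simp: inner_vec_def sum_2 add.commute)
    ultimately show ?thesis using Cauchy_Schwarz_ineq2 by metis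
  qed
  define c where "c = min (L qp) (L qm)"
  have c: "0 < c" "c \<le> L qp" "c \<le> L qm" unfolding c_def using Lq by auto
  define R where "R = max \<bar>qp \<bullet> v\<bar> \<bar>qm \<bullet> v\<bar>"
  have R: "\<bar>qp \<bullet> v\<bar> \<le> R" "\<bar>qm \<bullet> v\<bar> \<le> R" "0 \<le> R" unfolding R_def by auto
  \<comment> \<open>A point that is mapped onto the normal on the negative side of the tangent has distance below \<open>K * norm \<rho>\<close> to the base point, where \<open>\<rho>\<close> is the remainder
    of the linearisation; for small \<open>\<epsilon>\<close> this contradicts \<open>norm \<rho> \<le> \<epsilon> * distance\<close>.\<close>
  define K where "K = N / c + (R / c + 1) / N"
  have K: "0 < K" unfolding K_def using N c R by (intro add_pos_pos divide_pos_pos add_nonneg_pos divide_nonneg_pos) auto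
  define \<epsilon> where "\<epsilon> = 1 / (2 * K)"
  have \<epsilon>: "0 < \<epsilon>" "\<epsilon> * K < 1" unfolding \<epsilon>_def using K by auto
  obtain \<delta>1 where \<delta>1: "0 < \<delta>1" "\<And>y. y \<in> cbox 0 1 \<Longrightarrow> norm (y - ?z0) < \<delta>1 \<Longrightarrow>
      norm (Ep y - x0 - P *v (y - ?z0)) \<le> \<epsilon> * norm (y - ?z0)"
    using p.D[OF z0] \<epsilon>(1) unfolding has_derivative_within_alt P_def x0_def by blast
  obtain \<delta>2 where \<delta>2: "0 < \<delta>2" "\<And>y. y \<in> cbox 0 1 \<Longrightarrow> norm (y - ?z0) < \<delta>2 \<Longrightarrow>
      norm (Em y - x0 - Q *v (y - ?z0)) \<le> \<epsilon> * norm (y - ?z0)"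
    using m.D[OF z0] \<epsilon>(1) unfolding has_derivative_within_alt Q_def x0' by blast
  define W where "W = open_rect \<inter> ball ?z0 (min \<delta>1 \<delta>2)"
  have "open (emap M e ` W)" unfolding W_def by (intro open_emap) auto
  moreover have "x0 \<in> emap M e ` W"
    unfolding x0_def Ep_eq[OF z0, symmetric] W_def using \<delta>1(1) \<delta>2(1) by (intro imageI) (auto simp: mem_open_rect)
  ultimately obtain \<eta> where \<eta>: "0 < \<eta>" "ball x0 \<eta> \<subseteq> emap M e ` W" unfolding open_contains_ball by blast
  \<comment> \<open>A normal vector on the negative side; \<open>x0 + \<tau> *\<^sub>R w\<close> is covered by one of the two charts, which is absurd.\<close>
  define w where "w = vec2 (\<sigma> * v$2) (- \<sigma> * v$1)"
  define \<tau> where "\<tau> = \<eta> / (2 * (norm w + 1))"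
  have \<tau>: "0 < \<tau>" unfolding \<tau>_def using \<eta> by (auto intro!: divide_pos_pos add_nonneg_pos)
  have "norm (\<tau> *\<^sub>R w) < \<eta>"
  proof -
    have "norm (\<tau> *\<^sub>R w) = \<tau> * norm w" using \<tau> by simp
    also have "\<dots> \<le> \<tau> * (norm w + 1)" using \<tau> by simp
    also have "\<dots> = \<eta> / 2"
    proof -
      have "norm w + 1 \<noteq> 0" using norm_ge_zero[of w] by linarith
      then show ?thesis unfolding \<tau>_def by (simp only: times_divide_eq_left mult_divide_mult_cancel_right mult.commute[of 2]) (simp add: field_simps)
    qed
    finally show ?thesis using \<eta> by simp
  qed
  then have "x0 + \<tau> *\<^sub>R w \<in> ball x0 \<eta>" by (simp add: dist_norm)
  then obtain z where z: "z \<in> W" "emap M e z = x0 + \<tau> *\<^sub>R w" using \<eta>(2) by (metis imageE subsetD)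
  have Lw: "L w = - (N\<^sup>2)" unfolding L_def w_def N2 using \<sigma> by (auto simp: algebra_simps)
  have wv: "w \<bullet> v = 0" unfolding w_def by (simp add: inner_vec_def sum_2)
  have main: False if y: "y \<in> cbox 0 1" "norm (y - ?z0) = norm (z - ?z0)"
      and F: "F y = x0 + \<tau> *\<^sub>R w" and A: "norm (F y - x0 - A *v (y - ?z0)) \<le> \<epsilon> * norm (y - ?z0)"
      and Amul: "\<And>h. A *v h = h$1 *\<^sub>R v + h$2 *\<^sub>R q" and q: "c \<le> L q" "\<bar>q \<bullet> v\<bar> \<le> R" for F y A q
  proof -
    define a where "a = y$1 - 1/2"
    define t where "t = y$2"
    have t: "0 \<le> t" unfolding t_def using y(1) by (simp add: mem_unit_cbox)
    define \<rho> where "\<rho> = F y - x0 - A *v (y - ?z0)"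
    have eq: "\<tau> *\<^sub>R w = a *\<^sub>R v + t *\<^sub>R q + \<rho>" unfolding \<rho>_def Amul F a_def t_def by simp
    have "norm (y - ?z0) \<le> \<bar>a\<bar> + t"
      using norm_le_l1_cart[of "y - ?z0"] t unfolding a_def t_def by (simp add: sum_2)
    then have \<rho>: "norm \<rho> \<le> \<epsilon> * (\<bar>a\<bar> + t)"
      using A \<epsilon>(1) unfolding \<rho>_def by (meson mult_left_mono order.strict_implies_order order_trans)
    have "L (\<tau> *\<^sub>R w) = \<tau> * L w" unfolding L_def by (simp add: algebra_simps)
    then have e1: "- (\<tau> * N\<^sup>2) = t * L q + L \<rho>" using Llin[of a v t q \<rho>] Lv Lw eq by simp
    have "t * c \<le> t * L q" using q t by (intro mult_left_mono)
    moreover have "- L \<rho> \<le> N * norm \<rho>" using Lbound[of \<rho>] by linarith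
    moreover have "0 < \<tau> * N\<^sup>2" using \<tau> N by simp
    ultimately have tc: "t * c < N * norm \<rho>" using e1 by linarith
    have "0 = a * N\<^sup>2 + t * (q \<bullet> v) + \<rho> \<bullet> v"
      using arg_cong[OF eq, of "\<lambda>x. x \<bullet> v"] wv unfolding N_def by (simp add: inner_add_left power2_norm_eq_inner)
    moreover have "\<bar>\<rho> \<bullet> v\<bar> \<le> norm \<rho> * N" unfolding N_def by (rule Cauchy_Schwarz_ineq2)
    moreover have "\<bar>t * (q \<bullet> v)\<bar> \<le> t * R" unfolding abs_mult using q t by (simp add: mult_left_mono)
    ultimately have "\<bar>a * N\<^sup>2\<bar> \<le> t * R + norm \<rho> * N" by linarith
    moreover have "t * R \<le> (N * norm \<rho> / c) * R"
      using tc c R by (intro mult_right_mono) (auto simp: field_simps)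
    ultimately have "\<bar>a\<bar> * N\<^sup>2 \<le> (R / c + 1) * (N * norm \<rho>)" using N by (simp add: abs_mult algebra_simps)
    then have "(\<bar>a\<bar> * N) * N \<le> ((R / c + 1) * norm \<rho>) * N" by (simp only: power2_eq_square mult_ac)
    then have "\<bar>a\<bar> * N \<le> (R / c + 1) * norm \<rho>" using N by (simp only: mult_le_cancel_right_pos)
    then have "\<bar>a\<bar> \<le> (R / c + 1) / N * norm \<rho>" using N by (simp add: field_simps)
    moreover have "t < N / c * norm \<rho>" using tc c by (simp add: field_simps)
    ultimately have "\<bar>a\<bar> + t < K * norm \<rho>" unfolding K_def by (simp add: algebra_simps)
    also have "\<dots> \<le> K * (\<epsilon> * (\<bar>a\<bar> + t))" using \<rho> K by (intro mult_left_mono) auto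
    also have "\<dots> = (\<epsilon> * K) * (\<bar>a\<bar> + t)" by simp
    also have "\<dots> \<le> 1 * (\<bar>a\<bar> + t)" using \<epsilon>(2) t by (intro mult_right_mono) auto
    finally show False by simp
  qed
  have zW: "z \<in> open_rect" "norm (z - ?z0) < \<delta>1" "norm (z - ?z0) < \<delta>2"
    using z(1) unfolding W_def by (auto simp: dist_norm norm_minus_commute)
  show False
  proof (cases "0 \<le> z$2")
    case True
    then have zc: "z \<in> cbox 0 1" using zW(1) by (auto simp: mem_open_rect mem_unit_cbox)
    show False
      by (rule main[where F = Ep and A = P and q = qp, OF zc refl _ \<delta>1(2)[OF zc zW(2)] Pmul c(2) R(1)])
         (use z(2) Ep_eq[OF zc] in simp)
  next
    case False
    then have zc: "reflect_perp z \<in> cbox 0 1" using zW(1) by (auto simp: mem_open_rect mem_unit_cbox)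
    have nz: "norm (reflect_perp z - ?z0) = norm (z - ?z0)"
      by (simp add: norm_eq_sqrt_inner inner_vec_def sum_2)
    then have "norm (reflect_perp z - ?z0) < \<delta>2" using zW(3) by simp
    from main[where F = Em and A = Q and q = qm, OF zc nz _ \<delta>2(2)[OF zc this] Qmul c(3) R(2)]
    show False using z(2) Em_eq[OF zc] by simp
  qed
qed

end

section \<open>Logical representatives and tangential traces\<close>

lemma square_chart_id: "square_chart id"
proof -
  have i: "inv_into (cbox 0 1) (id :: real^2 \<Rightarrow> real^2) x = x" if "x \<in> cbox 0 1" for x
    using that by (intro inv_into_f_eq) auto
  have d: "(id has_derivative (*v) (mat 1 :: real^2^2)) (at x within S)" for x S
    by (auto simp: id_def matrix_vector_mul_lid intro!: derivative_eq_intros)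
  have "(inv_into (cbox 0 1) (id :: real^2 \<Rightarrow> real^2) has_derivative (*v) (mat 1 :: real^2^2)) (at x within cbox 0 1)"
    if "x \<in> cbox 0 1" for x
    by (rule has_derivative_transform[OF that _ d]) (simp add: i)
  with d show ?thesis unfolding square_chart_def C1_diffeo_on_def C1_on_def image_id
    by (auto intro!: exI[of _ "\<lambda>_. mat 1 :: real^2^2"])
qed

lemma square_chart_sqsym_self: "square_chart (sqsym sw a b)"
  using square_chart_sqsym(1)[OF square_chart_id, of sw a b] by (simp add: o_def)

lemma AE_sqsym: "(AE x in leb_square. P x) \<longleftrightarrow> (AE y in leb_square. P (sqsym sw a b y))"
  using square_chart.AE_image[OF square_chart_sqsym_self, where P = P] by (simp only: sqsym_image)

lemma AE_box_iff: "(AE y in leb_square. P y) \<longleftrightarrow> (AE y in lebesgue. y \<in> box 0 1 \<longrightarrow> P (y :: real^2))"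
  by (subst AE_restrict_space_iff) auto

lemma pull_sqsym:
  assumes "square_chart E" "y \<in> box 0 1"
  shows "pull (E \<circ> sqsym sw a b) u y = transpose (sqsym_mat sw a b) *v pull E u (sqsym sw a b y)"
proof -
  have yc: "y \<in> cbox 0 1" using assms(2) box_subset_cbox by blast
  have "pull (E \<circ> sqsym sw a b) u y = transpose (chart_deriv (E \<circ> sqsym sw a b) y) *v u (E (sqsym sw a b y))"
    using square_chart.pull_eq[OF square_chart_sqsym(1)[OF assms(1)] assms(2)] by simp
  also have "\<dots> = transpose (sqsym_mat sw a b) *v (transpose (chart_deriv E (sqsym sw a b y)) *v u (E (sqsym sw a b y)))"
    unfolding square_chart_sqsym(2)[OF assms(1) yc] matrix_transpose_mul by (simp only: matrix_vector_mul_assoc)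
  finally show ?thesis
    using square_chart.pull_eq[OF assms(1), of "sqsym sw a b y"] assms(2) by (simp only: sqsym_mem_box)
qed

definition bottom_trace :: "(real^2 \<Rightarrow> real^2) \<Rightarrow> real \<Rightarrow> real" where
  "bottom_trace v s = v (vec2 s 0) $ 1"

text \<open>
  B-splines of degree zero are continuous from the right only. This suffices to pass from equality
  almost everywhere to equality on \<open>{0..<1}\<close>, and to find an interval on which a jump persists.
\<close>

definition right_cont :: "(real \<Rightarrow> real) \<Rightarrow> bool" where
  "right_cont f \<longleftrightarrow> (\<forall>x\<in>{0..<1}. (f \<longlongrightarrow> f x) (at_right x))"

lemma right_cont_diff: "right_cont f \<Longrightarrow> right_cont g \<Longrightarrow> right_cont (\<lambda>x. f x - g x)"
  unfolding right_cont_def by (auto intro: tendsto_diff)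

lemma right_cont_positive:
  assumes f: "right_cont f" and s: "0 \<le> s" "s < 1" and pos: "0 < f s"
  obtains \<delta> where "s < \<delta>" "\<delta> \<le> 1" "\<And>x. s \<le> x \<Longrightarrow> x < \<delta> \<Longrightarrow> f s / 2 < f x"
proof -
  have "(f \<longlongrightarrow> f s) (at_right s)" using f s unfolding right_cont_def by simp
  then have "\<forall>\<^sub>F x in at_right s. f s / 2 < f x" using pos by (intro order_tendstoD) auto
  then obtain b where "s < b" "\<And>x. s < x \<Longrightarrow> x < b \<Longrightarrow> f s / 2 < f x" unfolding eventually_at_right_field by blast
  then show ?thesis using s pos by (intro that[of "min b 1"]) (auto simp: le_less)
qed

lemma right_cont_AE_zero:
  assumes f: "right_cont f" and ae: "AE x in leb_unit. f x = 0" and s: "0 \<le> s" "s < 1"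
  shows "f s = 0"
proof (rule ccontr)
  assume ne: "f s \<noteq> 0"
  define g where "g x = sgn (f s) * f x" for x
  have g: "right_cont g" using f unfolding right_cont_def g_def by (auto intro: tendsto_mult_left)
  have "0 < g s" using ne unfolding g_def by (auto simp: sgn_if)
  from right_cont_positive[OF g s this] obtain \<delta> where \<delta>: "s < \<delta>" "\<delta> \<le> 1" "\<And>x. s \<le> x \<Longrightarrow> x < \<delta> \<Longrightarrow> g s / 2 < g x" by blast
  have "negligible {x \<in> {0..1}. \<not> f x = 0}" using ae by (simp add: AE_lebesgue_on_negligible)
  moreover have "{s<..<\<delta>} \<subseteq> {x \<in> {0..1}. \<not> f x = 0}"
  proof
    fix x assume x: "x \<in> {s<..<\<delta>}"
    then have "0 < g x" using \<delta>(3)[of x] \<open>0 < g s\<close> by auto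
    then have "f x \<noteq> 0" unfolding g_def by auto
    then show "x \<in> {x \<in> {0..1}. \<not> f x = 0}" using x s \<delta>(2) by auto
  qed
  ultimately have "negligible {s<..<\<delta>}" using negligible_subset by blast
  moreover have "\<not> negligible {s<..<\<delta>}" using \<delta>(1) by (intro open_not_negligible) auto
  ultimately show False by blast
qed

text \<open>
  Traces are determined by equivalence classes, because the first component is continuous in the second variable.
\<close>

lemma trace_unique:
  fixes f g :: "real^2 \<Rightarrow> real"
  assumes f: "\<And>s. continuous_on {0..1} (\<lambda>t. f (vec2 s t))" and g: "\<And>s. continuous_on {0..1} (\<lambda>t. g (vec2 s t))"
    and ae: "AE y in leb_square. f y = g y"
  shows "AE s in leb_unit. f (vec2 s 0) = g (vec2 s 0)"
proof -
  have "f (vec2 s 0) = g (vec2 s 0)" if t: "AE t in leb_unit. f (vec2 s t) = g (vec2 s t)" for s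
  proof -
    define h where "h t = f (vec2 s t) - g (vec2 s t)" for t
    have c: "continuous_on {0..1} h" unfolding h_def[abs_def] by (intro continuous_intros f g)
    have "(h \<longlongrightarrow> h x) (at_right x)" if "x \<in> {0..<1}" for x
    proof -
      have "(h \<longlongrightarrow> h x) (at x within {0..1})" using c that unfolding continuous_on_def by auto
      then have "(h \<longlongrightarrow> h x) (at x within {x..1})" by (rule tendsto_within_subset) (use that in auto)
      then show ?thesis using that by (simp add: at_within_Icc_at_right)
    qed
    then have rc: "right_cont h" unfolding right_cont_def by blast
    have "AE t in leb_unit. h t = 0" using t unfolding h_def by eventually_elim simp
    from right_cont_AE_zero[OF rc this, of 0] have "h 0 = 0" by simp
    then show ?thesis unfolding h_def by simp
  qed
  with AE_unit_box_iterated[OF ae] show ?thesis by (rule eventually_mono)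
qed

locale mp_splines = spline_patches + mp_geometry
begin

text \<open>
  Membership in the broken space, patch by patch and in an arbitrary one of the eight charts of the patch.
  The chart with an edge as its bottom side is the one in which the operator of this edge is simple.
\<close>

definition rep :: "nat \<Rightarrow> (real^2 \<Rightarrow> real^2) \<Rightarrow> (real^2 \<Rightarrow> real^2) \<Rightarrow> (real^2 \<Rightarrow> real^2) \<Rightarrow> bool" where
  "rep k S u v \<longleftrightarrow> v \<in> V1_hat M k \<and> (AE y in leb_square. pull (pmap M k \<circ> S) u y = v y)"

lemma tensor_bms:
  assumes "finite I" "finite J" "\<And>i. i \<in> I \<Longrightarrow> bmf (f i)" "\<And>j. j \<in> J \<Longrightarrow> bmf (h j)" and g: "g \<in> tensor_combs I f J h"
  shows "bms g"
proof -
  obtain c where c: "g = (\<lambda>x. \<Sum>i\<in>I. \<Sum>j\<in>J. c i j * f i (x$1) * h j (x$2))"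
    using g unfolding tensor_combs_def by auto
  show ?thesis unfolding c by (intro bms_sum bms_mult bms_const bms_coord assms)
qed

lemma V1_hat_bms:
  assumes k: "k \<in> patches M" and v: "v \<in> V1_hat M k"
  shows "bms (\<lambda>y. v y $ i)"
proof -
  have t: "(\<lambda>y. v y $ 1) \<in> tensor_combs {..<n k} (lam1 M k) {..n k} (lam0 M k)"
    "(\<lambda>y. v y $ 2) \<in> tensor_combs {..n k} (lam0 M k) {..<n k} (lam1 M k)" using v unfolding V1_hat_def by auto
  have b: "bmf (lam1 M k i)" if "i \<in> {..<n k}" for i using bmf_lam1[OF k] that by simp
  have b': "bmf (lam0 M k i)" if "i \<in> {..n k}" for i using bmf_lam0[OF k] that by simp
  show ?thesis using tensor_bms[OF finite_lessThan finite_atMost b b' t(1)]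
    tensor_bms[OF finite_atMost finite_lessThan b' b t(2)] exhaust_2[of i] by auto
qed

lemma V1_hat_borel:
  assumes k: "k \<in> patches M" and v: "v \<in> V1_hat M k"
  shows "borel_fun (\<lambda>y. v y $ i)" "\<exists>C. \<forall>i. \<forall>y\<in>cbox 0 1. \<bar>v y $ i\<bar> \<le> C"
proof -
  note * = V1_hat_bms[OF k v, unfolded bms_def]
  show "borel_fun (\<lambda>y. v y $ i)" using * by blast
  obtain C K where "\<forall>y\<in>cbox 0 1. \<bar>v y $ 1\<bar> \<le> C" "\<forall>y\<in>cbox 0 1. \<bar>v y $ 2\<bar> \<le> K" using * by blast
  then have "\<forall>i. \<forall>y\<in>cbox 0 1. \<bar>v y $ i\<bar> \<le> max C K" by (auto simp: forall_2 intro: max.coboundedI1 max.coboundedI2)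
  then show "\<exists>C. \<forall>i. \<forall>y\<in>cbox 0 1. \<bar>v y $ i\<bar> \<le> C" by blast
qed

lemma V1_hat_lincomb:
  assumes "u \<in> V1_hat M k" "v \<in> V1_hat M k"
  shows "(\<lambda>x. a *\<^sub>R u x + b *\<^sub>R v x) \<in> V1_hat M k"
  using assms unfolding V1_hat_def by (auto intro!: tensor_add tensor_cmult)

lemma rep_lincomb:
  assumes "rep k S u u'" "rep k S v v'"
  shows "rep k S (\<lambda>x. a *\<^sub>R u x + b *\<^sub>R v x) (\<lambda>x. a *\<^sub>R u' x + b *\<^sub>R v' x)"
proof -
  have "pull (pmap M k \<circ> S) (\<lambda>x. a *\<^sub>R u x + b *\<^sub>R v x) y =
     a *\<^sub>R pull (pmap M k \<circ> S) u y + b *\<^sub>R pull (pmap M k \<circ> S) v y" for y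
    unfolding pull_def by (simp only: matrix_vector_right_distrib scaleR_matrix_vector_assoc[symmetric] matrix_vector_mult_scaleR)
  moreover have "AE y in leb_square. pull (pmap M k \<circ> S) u y = u' y \<and> pull (pmap M k \<circ> S) v y = v' y"
    using assms unfolding rep_def by auto
  ultimately show ?thesis using assms V1_hat_lincomb unfolding rep_def by (auto elim: eventually_mono)
qed

lemma rep_change:
  assumes k: "k \<in> patches M" and r: "rep k (sqsym sw a b) u v"
  shows "\<exists>v'. rep k (sqsym sw a b \<circ> sqsym sw' a' b') u v' \<and>
    (AE y in leb_square. v' y = transpose (sqsym_mat sw' a' b') *v v (sqsym sw' a' b' y))"
proof -
  have v: "v \<in> V1_hat M k" using r unfolding rep_def by blast
  obtain v' where v': "v' \<in> V1_hat M k"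
    "AE y in leb_square. v' y = transpose (sqsym_mat sw' a' b') *v v (sqsym sw' a' b' y)"
    using V1_hat_sqsym[OF k v] by blast
  have "AE y in leb_square. pull (side_chart k sw a b) u y = v y" using r unfolding rep_def by blast
  then have "AE y in leb_square. pull (side_chart k sw a b) u (sqsym sw' a' b' y) = v (sqsym sw' a' b' y)"
    by (rule AE_sqsym[THEN iffD1])
  then have "AE y in lebesgue. y \<in> box 0 1 \<longrightarrow> pull (pmap M k \<circ> (sqsym sw a b \<circ> sqsym sw' a' b')) u y = v' y"
    using v'(2) unfolding AE_box_iff
  proof eventually_elim
    case (elim y)
    then show ?case using pull_sqsym[OF chart_sqsym[OF k, of sw a b], of y sw' a' b' u] by (simp add: o_assoc)
  qed
  then show ?thesis using v' unfolding rep_def AE_box_iff by blast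
qed

lemma rep_to:
  assumes k: "k \<in> patches M" and r: "rep k (sqsym sw a b) u v"
  shows "\<exists>v'. rep k (sqsym sw' a' b') u v'"
proof -
  have eq: "sqsym sw a b \<circ> (if sw then sqsym True b a else sqsym False a b) \<circ> sqsym sw' a' b' = sqsym sw' a' b'"
    using sqsym_inv2[unfolded sqsym_inv_def] by (auto simp: fun_eq_iff)
  obtain v1 where "rep k (sqsym sw a b \<circ> (if sw then sqsym True b a else sqsym False a b)) u v1"
    using rep_change[OF k r, of sw "if sw then b else a" "if sw then a else b"] by (cases sw) auto
  moreover have "sqsym sw a b \<circ> (if sw then sqsym True b a else sqsym False a b) = sqsym False False False"
    using sqsym_inv2[unfolded sqsym_inv_def] by (auto simp: fun_eq_iff sqsym_id)
  ultimately have "rep k (sqsym False False False) u v1" by simp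
  from rep_change[OF k this, of sw' a' b'] show ?thesis by (auto simp: sqsym_id)
qed

lemma rep_id: "rep k (sqsym False False False) u v \<longleftrightarrow> v \<in> V1_hat M k \<and> (AE y in leb_square. pull (pmap M k) u y = v y)"
  unfolding rep_def sqsym_id by simp

lemma ex_bounded_field:
  assumes k: "k \<in> patches M" and r: "rep k (sqsym False False False) u v"
  shows "\<exists>g K. borel_fun g \<and> (\<forall>x. norm (g x) \<le> K) \<and> (\<forall>x. x \<notin> patch M k \<longrightarrow> g x = 0) \<and>
    (AE x in leb_patch k. u x = g x)"
proof -
  have v: "v \<in> V1_hat M k" "AE y in leb_square. pull (pmap M k) u y = v y" using r unfolding rep_id by auto
  obtain C where "\<forall>i. \<forall>y\<in>cbox 0 1. \<bar>v y $ i\<bar> \<le> C" using V1_hat_borel(2)[OF k v(1)] by blast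
  then show ?thesis
    unfolding patch_def using V1_hat_borel(1)[OF k v(1)] v(2) by (intro square_chart.field_on_image[OF chart[OF k]]) auto
qed

lemma V1_pw_iff: "u \<in> V1_pw M \<longleftrightarrow> (\<forall>k\<in>patches M. \<exists>v. rep k (sqsym False False False) u v)"
proof
  assume "u \<in> V1_pw M"
  then show "\<forall>k\<in>patches M. \<exists>v. rep k (sqsym False False False) u v"
    unfolding V1_pw_def rep_id patch_def using square_chart.push_iff_pull[OF chart] by blast
next
  assume r: "\<forall>k\<in>patches M. \<exists>v. rep k (sqsym False False False) u v"
  let ?Q = "\<lambda>k g K. borel_fun g \<and> (\<forall>x. norm (g x) \<le> K) \<and> (\<forall>x. x \<notin> patch M k \<longrightarrow> g x = 0) \<and>
    (AE x in leb_patch k. u x = g x)"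
  have "\<forall>k\<in>patches M. \<exists>g. \<exists>K. ?Q k g K" using r ex_bounded_field by blast
  from bchoice[OF this] obtain g where "\<forall>k\<in>patches M. \<exists>K. ?Q k (g k) K" ..
  from bchoice[OF this] obtain K where g: "\<And>k. k \<in> patches M \<Longrightarrow> g k \<in> borel_measurable borel"
     "\<And>k x. k \<in> patches M \<Longrightarrow> norm (g k x) \<le> K k" "\<And>k x. k \<in> patches M \<Longrightarrow> x \<notin> patch M k \<Longrightarrow> g k x = 0"
     "\<And>k. k \<in> patches M \<Longrightarrow> AE x in leb_patch k. u x = g k x" by blast
  have single: "(\<Sum>l\<in>patches M. g l x) = g k x" if k: "k \<in> patches M" and x: "x \<in> patch M k" for k x
  proof -
    have "g l x = 0" if "l \<in> patches M - {k}" for l using g(3) patch_disjoint[of k l] k x that by blast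
    then show ?thesis using sum.remove[OF finite_patches k, of "\<lambda>l. g l x"] by simp
  qed
  have "u \<in> L2_on (Dom M)"
  proof (rule ae_bounded_L2[OF Dom_lmeasurable])
    show "borel_fun (\<lambda>x. \<Sum>k\<in>patches M. g k x)" using g(1) by (intro borel_measurable_sum)
    show "norm (\<Sum>k\<in>patches M. g k x) \<le> (\<Sum>k\<in>patches M. K k)" for x using g(2) by (intro sum_norm_le)
    show "AE x in leb_Dom. u x = (\<Sum>k\<in>patches M. g k x)"
      unfolding AE_Dom_iff
    proof
      fix k assume k: "k \<in> patches M"
      have "AE x in lebesgue. x \<in> patch M k \<longrightarrow> u x = g k x"
        using g(4)[OF k] patch_lmeasurable(2)[OF k] by (simp add: AE_restrict_space_iff)
      then have "AE x in lebesgue. x \<in> patch M k \<longrightarrow> u x = (\<Sum>k\<in>patches M. g k x)"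
        by eventually_elim (use single[OF k] in simp)
      then show "AE x in leb_patch k. u x = (\<Sum>k\<in>patches M. g k x)"
        using patch_lmeasurable(2)[OF k] by (simp add: AE_restrict_space_iff)
    qed
  qed
  moreover have "\<forall>k\<in>patches M. \<exists>v\<in>V1_hat M k. ae_eq_on (patch M k) u (push (cbox 0 1) (pmap M k) v)"
    using r unfolding rep_id patch_def using square_chart.push_iff_pull[OF chart] by blast
  ultimately show "u \<in> V1_pw M" unfolding V1_pw_def by blast
qed

lemma ex_rep: "u \<in> V1_pw M \<Longrightarrow> k \<in> patches M \<Longrightarrow> \<exists>v. rep k (sqsym sw a b) u v"
  using V1_pw_iff rep_to by blast

lemma V1_pw_lincomb: "u \<in> V1_pw M \<Longrightarrow> v \<in> V1_pw M \<Longrightarrow> (\<lambda>x. a *\<^sub>R u x + b *\<^sub>R v x) \<in> V1_pw M"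
  unfolding V1_pw_iff using rep_lincomb by blast

lemma AE_patch_pull:
  assumes k: "k \<in> patches M"
  shows "(AE x in leb_patch k. u x = w x) \<longleftrightarrow>
    (AE y in leb_square. pull (side_chart k sw a b) u y = pull (side_chart k sw a b) w y)"
proof -
  interpret E: square_chart "side_chart k sw a b" by (rule chart_sqsym[OF k])
  let ?E = "side_chart k sw a b"
  have eq: "u (?E y) = w (?E y) \<longleftrightarrow> pull ?E u y = pull ?E w y" if "y \<in> box 0 1" for y
    unfolding E.pull_eq[OF that] using E.transpose_D_inv(2)[OF E.box_cbox[OF that]] by metis
  have "(AE x in leb_patch k. u x = w x) \<longleftrightarrow> (AE y in leb_square. u (?E y) = w (?E y))"
    using E.AE_image[of "\<lambda>x. u x = w x"] unfolding sqsym_patch .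
  also have "\<dots> \<longleftrightarrow> (AE y in leb_square. pull ?E u y = pull ?E w y)"
    by (intro AE_cong eq) simp
  finally show ?thesis .
qed

lemma rep_AE_cong:
  assumes k: "k \<in> patches M" and "rep k (sqsym sw a b) u v" "rep k (sqsym sw a b) w v'"
    and "AE x in leb_patch k. u x = w x"
  shows "AE y in leb_square. v y = v' y"
proof -
  have "AE y in leb_square. pull (side_chart k sw a b) u y = v y"
    "AE y in leb_square. pull (side_chart k sw a b) w y = v' y"
    "AE y in leb_square. pull (side_chart k sw a b) u y = pull (side_chart k sw a b) w y"
    using assms AE_patch_pull[OF k] unfolding rep_def by blast+
  then show ?thesis by eventually_elim simp
qed

lemma lam0_cont: "k \<in> patches M \<Longrightarrow> i \<le> n k \<Longrightarrow> continuous_on {0..1} (lam0 M k i)"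
  using lam0_piecewise_C1 unfolding piecewise_C1_unit_def by blast

lemma V1_hat_cont:
  assumes k: "k \<in> patches M" and v: "v \<in> V1_hat M k"
  shows "continuous_on {0..1} (\<lambda>t. v (vec2 s t) $ 1)"
proof -
  obtain c where c: "\<And>x. v x $ 1 = (\<Sum>i<n k. \<Sum>j\<le>n k. c i j * lam1 M k i (x$1) * lam0 M k j (x$2))"
    using v unfolding V1_hat_def tensor_combs_def by (auto dest: fun_cong)
  show ?thesis unfolding c using lam0_cont[OF k] by (simp, intro continuous_intros) auto
qed

lemma V1_hat_trace:
  assumes k: "k \<in> patches M" and v: "v \<in> V1_hat M k"
  shows "bottom_trace v \<in> V1_spline M k"
proof -
  obtain c where c: "\<And>x. v x $ 1 = (\<Sum>i<n k. \<Sum>j\<le>n k. c i j * lam1 M k i (x$1) * lam0 M k j (x$2))"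
    using v unfolding V1_hat_def tensor_combs_def by (auto dest: fun_cong)
  have "(\<Sum>j\<le>n k. c i j * lam1 M k i s * lam0 M k j 0) = c i 0 * lam1 M k i s" for i s
  proof -
    have "(\<Sum>j\<le>n k. c i j * lam1 M k i s * lam0 M k j 0) = (\<Sum>j\<le>n k. if j = 0 then c i j * lam1 M k i s else 0)"
      using lam0_0[OF k] by (intro sum.cong) auto
    then show ?thesis by simp
  qed
  then have "bottom_trace v = (\<lambda>s. \<Sum>i<n k. c i 0 * lam1 M k i s)" unfolding bottom_trace_def c by simp
  then show ?thesis unfolding V1_spline_def lin_combs_def by (intro CollectI exI[of _ "\<lambda>i. c i 0"]) simp
qed

lemma V1_spline_right_cont: "k \<in> patches M \<Longrightarrow> f \<in> V1_spline M k \<Longrightarrow> right_cont f"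
  unfolding V1_spline_def lin_combs_def right_cont_def
  by (auto intro!: tendsto_intros lam1_right_continuous)

lemma V1_spline_eq:
  assumes "k \<in> patches M" "l \<in> patches M" "f \<in> V1_spline M k" "g \<in> V1_spline M l"
    and "AE x in leb_unit. f x = g x" "0 \<le> s" "s < 1"
  shows "f s = g s"
proof -
  have "right_cont (\<lambda>x. f x - g x)" using assms by (intro right_cont_diff V1_spline_right_cont)
  moreover have "AE x in leb_unit. f x - g x = 0" using assms(5) by eventually_elim simp
  ultimately show ?thesis using right_cont_AE_zero[of "\<lambda>x. f x - g x" s] assms by simp
qed

lemma trace_AE_eq:
  assumes k: "k \<in> patches M" and v: "v \<in> V1_hat M k" "v' \<in> V1_hat M k"
    and ae: "AE y in leb_square. v y = v' y" and s: "0 \<le> s" "s < 1"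
  shows "bottom_trace v s = bottom_trace v' s"
proof -
  have "AE y in leb_square. v y $ 1 = v' y $ 1" using ae by eventually_elim simp
  from trace_unique[OF V1_hat_cont[OF k v(1)] V1_hat_cont[OF k v(2)] this]
  have "AE x in leb_unit. bottom_trace v x = bottom_trace v' x" unfolding bottom_trace_def .
  then show ?thesis using V1_spline_eq[OF k k V1_hat_trace[OF k v(1)] V1_hat_trace[OF k v(2)]] s by blast
qed

end

section \<open>The edge operator in logical coordinates\<close>

lemma negligible_reflect: "negligible S \<Longrightarrow> negligible (reflect_perp ` S)"
proof -
  assume "negligible S"
  moreover have rp: "reflect_perp = (*v) (sqsym_mat False False True)"
    by (auto simp: fun_eq_iff vec2_eq_iff sqsym_mat_vector)
  have "reflect_perp differentiable_on S"
    unfolding rp by (intro differentiable_at_imp_differentiable_on bounded_linear_imp_differentiable matrix_vector_mul_bounded_linear)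
  ultimately show ?thesis by (intro negligible_differentiable_image_negligible) auto
qed

lemma AE_edge_rect:
  "(AE y in lebesgue_on edge_rect. P y) \<longleftrightarrow>
   (AE y in leb_square. P y) \<and> (AE z in leb_square. P (reflect_perp z))"
proof -
  let ?X = "{y \<in> edge_rect. \<not> P y}" and ?Y = "{y \<in> box 0 1. \<not> P y}" and ?Z = "{z \<in> box 0 1. \<not> P (reflect_perp z)}"
  have "negligible ?X \<longleftrightarrow> negligible ?Y \<and> negligible ?Z"
  proof (intro iffI conjI)
    assume X: "negligible ?X"
    show "negligible ?Y" by (rule negligible_subset[OF X]) (auto simp: mem_unit_box mem_edge_rect)
    show "negligible ?Z"
    proof (rule negligible_subset[OF negligible_reflect[OF X]])
      show "?Z \<subseteq> reflect_perp ` ?X"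
      proof
        fix z assume "z \<in> ?Z"
        then have "reflect_perp z \<in> ?X" by (auto simp: mem_unit_box mem_edge_rect)
        then show "z \<in> reflect_perp ` ?X" by (intro image_eqI[of _ _ "reflect_perp z"]) simp_all
      qed
    qed
  next
    assume YZ: "negligible ?Y \<and> negligible ?Z"
    have hyp: "negligible {y::real^2. y $ i = c}" for i c
      using negligible_hyperplane[of "axis i (1::real) :: real^2" c] by (simp add: inner_axis' axis_eq_0_iff)
    have "negligible (?Y \<union> reflect_perp ` ?Z \<union> {y. y$1 = 0} \<union> {y. y$1 = 1} \<union> {y. y$2 = 0} \<union> {y. y$2 = 1} \<union> {y. y$2 = -1})"
      using YZ negligible_reflect by (intro negligible_Un hyp) auto
    then show "negligible ?X"
    proof (rule negligible_subset)
      show "?X \<subseteq> ?Y \<union> reflect_perp ` ?Z \<union> {y. y$1 = 0} \<union> {y. y$1 = 1} \<union> {y. y$2 = 0} \<union> {y. y$2 = 1} \<union> {y. y$2 = -1}"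
      proof
        fix y assume y: "y \<in> ?X"
        consider "y$1 = 0 \<or> y$1 = 1 \<or> y$2 = 0 \<or> y$2 = 1 \<or> y$2 = -1" | "y \<in> box 0 1" | "reflect_perp y \<in> box 0 1"
          using y by (force simp: mem_unit_box mem_edge_rect)
        then show "y \<in> ?Y \<union> reflect_perp ` ?Z \<union> {y. y$1 = 0} \<union> {y. y$1 = 1} \<union> {y. y$2 = 0} \<union> {y. y$2 = 1} \<union> {y. y$2 = -1}"
        proof cases
          case 3
          then have "reflect_perp y \<in> ?Z" using y by simp
          then have "y \<in> reflect_perp ` ?Z" by (intro image_eqI[of _ _ "reflect_perp y"]) simp_all
          then show ?thesis by blast
        qed (use y in auto)
      qed
    qed
  qed
  then show ?thesis by (simp add: AE_lebesgue_on_negligible)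
qed

locale spline_edge = mp_splines + edge_setting +
  fixes r :: nat and \<gamma> :: "nat \<Rightarrow> nat \<Rightarrow> real"
  assumes r: "r \<le> sdeg M" and corr: "correction_coeffs M r \<gamma>"
begin

abbreviation "P \<equiv> edge_op M r \<gamma> e"

lemma emap_deriv_plus: "y \<in> box 0 1 \<Longrightarrow> jacobian (emap M e) (at y) = p.D y"
proof -
  assume y: "y \<in> box 0 1"
  have "(emap M e has_derivative (*v) (p.D y)) (at y)"
    by (rule has_derivative_transform_within_open[OF p.D_at[OF y] open_box y]) (simp add: Ep_eq p.box_cbox)
  from frechet_derivative_at[OF this] show ?thesis
    unfolding jacobian_def by (metis matrix_of_matrix_vector_mul)
qed

lemma emap_deriv_minus: "z \<in> box 0 1 \<Longrightarrow> jacobian (emap M e) (at (reflect_perp z)) = m.D z ** sqsym_mat False False True"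
proof -
  assume z: "z \<in> box 0 1"
  have rp: "reflect_perp = (*v) (sqsym_mat False False True)"
    by (auto simp: fun_eq_iff vec2_eq_iff sqsym_mat_vector)
  have rd: "(reflect_perp has_derivative (*v) (sqsym_mat False False True)) (at y)" for y
    unfolding rp by (rule bounded_linear_imp_has_derivative) (rule matrix_vector_mul_bounded_linear)
  have "(Em \<circ> reflect_perp has_derivative (*v) (m.D z) \<circ> (*v) (sqsym_mat False False True)) (at (reflect_perp z))"
    using m.D_at[OF z] by (intro diff_chain_at rd) simp
  then have d: "(Em \<circ> reflect_perp has_derivative (*v) (m.D z ** sqsym_mat False False True)) (at (reflect_perp z))"
    by (simp only: matrix_mult_comp)
  have cr: "continuous_on UNIV reflect_perp"
    by (rule has_derivative_continuous_on[where f' = "\<lambda>_. (*v) (sqsym_mat False False True)"]) (use rd in simp)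
  have "open (reflect_perp -` box 0 1)" using cr open_box by (rule open_vimage[rotated])
  moreover have "reflect_perp z \<in> reflect_perp -` box 0 1" using z by simp
  ultimately have "(emap M e has_derivative (*v) (m.D z ** sqsym_mat False False True)) (at (reflect_perp z))"
  proof (rule has_derivative_transform_within_open[OF d])
    fix y assume "y \<in> reflect_perp -` box 0 1"
    then have "reflect_perp y \<in> cbox 0 1" using p.box_cbox by blast
    from Em_eq[OF this] show "(Em \<circ> reflect_perp) y = emap M e y" by simp
  qed
  from frechet_derivative_at[OF this] show ?thesis
    unfolding jacobian_def by (metis matrix_of_matrix_vector_mul)
qed

lemma pull_emap_plus: "y \<in> box 0 1 \<Longrightarrow> pull (emap M e) u y = pull Ep u y"
  unfolding p.pull_eq unfolding pull_def by (simp add: emap_deriv_plus Ep_eq p.box_cbox)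

lemma pull_emap_minus: "z \<in> box 0 1 \<Longrightarrow> pull (emap M e) u (reflect_perp z) = vec2 (pull Em u z $ 1) (- pull Em u z $ 2)"
proof -
  assume z: "z \<in> box 0 1"
  have "pull (emap M e) u (reflect_perp z) = transpose (m.D z ** sqsym_mat False False True) *v u (Em z)"
    unfolding pull_def emap_deriv_minus[OF z] using Em_eq[of z] p.box_cbox[OF z] by simp
  also have "\<dots> = transpose (sqsym_mat False False True) *v (transpose (m.D z) *v u (Em z))"
    unfolding matrix_transpose_mul by (simp only: matrix_vector_mul_assoc)
  also have "transpose (m.D z) *v u (Em z) = pull Em u z" using m.pull_eq[OF z] by simp
  finally show ?thesis unfolding transpose_sqsym_mat_vector by simp
qed

text \<open>The field on the rectangle of the edge map whose pushforward is the image under the edge operator.\<close>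

definition edge_field :: "(real^2 \<Rightarrow> real^2) \<Rightarrow> real^2 \<Rightarrow> real^2" where
  "edge_field u y = vec2 (edge_op_hat M r \<gamma> e (\<lambda>z. pull (emap M e) u z $ 1) y) (pull (emap M e) u y $ 2)"

lemma edge_op_in: "x \<in> edge_dom M e \<Longrightarrow> P u x = push edge_rect (emap M e) (edge_field u) x"
  using int unfolding edge_op_def Let_def edge_field_def[abs_def] by simp

lemma edge_op_out: "x \<notin> edge_dom M e \<Longrightarrow> P u x = u x"
  unfolding edge_op_def Let_def by simp

lemma pull_edge_op_plus:
  assumes y: "y \<in> box 0 1"
  shows "pull Ep (P u) y = edge_field u y"
proof -
  have yc: "y \<in> cbox 0 1" using y by (rule p.box_cbox)
  have "Ep y \<in> edge_dom M e" using y patch_edge_dom(2) Ep_patch by blast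
  then have "P u (Ep y) = push edge_rect (emap M e) (edge_field u) (Ep y)" by (rule edge_op_in)
  moreover have "inv_into edge_rect (emap M e) (Ep y) = y"
    using yc Ep_eq[OF yc] by (intro inv_into_f_eq[OF emap_inj]) (auto simp: mem_unit_cbox mem_edge_rect)
  ultimately have "P u (Ep y) = transpose (matrix_inv (p.D y)) *v edge_field u y"
    unfolding push_def Let_def by (simp add: emap_deriv_plus[OF y])
  then show ?thesis unfolding p.pull_eq[OF y] using p.transpose_D_inv(1)[OF yc] by simp
qed

lemma pull_edge_op_minus:
  assumes z: "z \<in> box 0 1"
  shows "pull Em (P u) z = vec2 (edge_field u (reflect_perp z) $ 1) (- edge_field u (reflect_perp z) $ 2)"
proof -
  let ?R = "sqsym_mat False False True" and ?w = "edge_field u (reflect_perp z)"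
  have zc: "z \<in> cbox 0 1" using z by (rule p.box_cbox)
  have "Em z \<in> edge_dom M e" using z patch_edge_dom(1) Em_patch by blast
  then have "P u (Em z) = push edge_rect (emap M e) (edge_field u) (Em z)" by (rule edge_op_in)
  moreover have "inv_into edge_rect (emap M e) (Em z) = reflect_perp z"
    using zc Em_eq[OF zc] by (intro inv_into_f_eq[OF emap_inj]) (auto simp: mem_unit_cbox mem_edge_rect)
  ultimately have Pu: "P u (Em z) = transpose (matrix_inv (m.D z ** ?R)) *v ?w"
    unfolding push_def Let_def by (simp add: emap_deriv_minus[OF z])
  have RR: "?R ** ?R = mat 1"
    unfolding matrix_eq by (auto simp: matrix_vector_mul_assoc[symmetric] sqsym_mat_vector vec2_eq_iff matrix_vector_mul_lid)
  have "(?R ** matrix_inv (m.D z)) ** (m.D z ** ?R) = ?R ** (matrix_inv (m.D z) ** m.D z) ** ?R"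
    by (simp only: matrix_mul_assoc)
  then have "(?R ** matrix_inv (m.D z)) ** (m.D z ** ?R) = mat 1"
    by (simp only: m.matrix_inv_D(1)[OF zc] matrix_mul_rid RR)
  then have "matrix_inv (m.D z ** ?R) = ?R ** matrix_inv (m.D z)" by (rule matrix_inv_eq)
  then have "P u (Em z) = transpose (matrix_inv (m.D z)) *v (transpose ?R *v ?w)"
    unfolding Pu by (simp only: matrix_transpose_mul matrix_vector_mul_assoc)
  then have "pull Em (P u) z = transpose ?R *v ?w" unfolding m.pull_eq[OF z] using m.transpose_D_inv(1)[OF zc] by simp
  then show ?thesis unfolding transpose_sqsym_mat_vector by simp
qed

lemma pull_edge_op_other:
  assumes "k \<in> patches M" "k \<noteq> km" "k \<noteq> kp" "x \<in> patch M k"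
  shows "P u x = u x"
  using edge_op_out patch_edge_dom(3)[of k] assms by blast

definition lsum :: "nat \<Rightarrow> (nat \<Rightarrow> nat \<Rightarrow> real) \<Rightarrow> real^2 \<Rightarrow> real" where
  "lsum k c y = (\<Sum>i<n k. \<Sum>j\<le>n k. c i j * (lam1 M k i (y$1) * lam0 M k j (y$2)))"

definition lsum_trace :: "nat \<Rightarrow> (nat \<Rightarrow> nat \<Rightarrow> real) \<Rightarrow> real \<Rightarrow> real" where
  "lsum_trace k c s = (\<Sum>i<n k. c i 0 * lam1 M k i s)"

text \<open>
  The profile across the edge of the correction: it has trace one on the edge, trace zero on the
  opposite edge, and vanishing moments.
\<close>

definition chi :: "nat \<Rightarrow> real \<Rightarrow> real" where
  "chi k t = lam0 M k 0 t - (\<Sum>j=1..r. \<gamma> km j * lam0 M k j t)"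

lemma edge_comb_plus: "y \<in> box 0 1 \<Longrightarrow> edge_comb M e a b y = lsum kp b y"
  and edge_comb_minus: "z \<in> box 0 1 \<Longrightarrow> edge_comb M e a b (reflect_perp z) = lsum km a z"
  by (auto simp: edge_comb_def lsum_def lam_minus_def lam_plus_def mem_unit_box km_def kp_def intro!: sum.cong)

definition RB :: "(nat \<Rightarrow> nat \<Rightarrow> real) \<Rightarrow> real \<Rightarrow> real" where
  "RB b s = (\<Sum>i<n kp. b i 0 * L2_proj_coarse M e (lam1 M kp i) s)"

lemma lsum_split: "lsum k c y = lsum_trace k c (y$1) * lam0 M k 0 (y$2) +
    (\<Sum>i<n k. \<Sum>j<n k. c i (Suc j) * (lam1 M k i (y$1) * lam0 M k (Suc j) (y$2)))"
  unfolding lsum_def lsum_trace_def sum.atMost_shift sum.distrib sum_distrib_right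
  by (simp add: mult.assoc)

lemma edge_image_plus_side:
  assumes y: "y \<in> box 0 1"
  shows "edge_image_comb M r \<gamma> e a b y = lsum kp b y + (lsum_trace km a (y$1) - RB b (y$1)) / 2 * chi kp (y$2)
     - (lsum_trace kp b (y$1) - RB b (y$1)) * lam0 M kp 0 (y$2)"
proof -
  have y2: "0 < y$2" "y$2 < 1" using y by (auto simp: mem_unit_box)
  have lm: "lam_minus M e j (y$2) = 0" and lp: "lam_plus M e j (y$2) = lam0 M kp j (y$2)" for j
    using y2 by (auto simp: lam_minus_def lam_plus_def kp_def)
  have bar: "lam_bar M e (y$2) = lam0 M kp 0 (y$2) / 2" unfolding lam_bar_def lm lp by simp
  have cor: "Defs.corr M r \<gamma> e (y$2) = - (\<Sum>j=1..r. \<gamma> km j * lam0 M kp j (y$2)) / 2"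
    unfolding Defs.corr_def lm lp km_def by (simp add: sum_negf)
  have pl: "lam_bar M e (y$2) + Defs.corr M r \<gamma> e (y$2) = chi kp (y$2) / 2"
    and mi: "lam_bar M e (y$2) - Defs.corr M r \<gamma> e (y$2) = lam0 M kp 0 (y$2) - chi kp (y$2) / 2"
    unfolding bar cor chi_def by (simp_all add: field_simps)
  have 1: "(\<Sum>j\<le>n km. a i j * edge_image_minus M r \<gamma> e i j y) = a i 0 * lam1 M km i (y$1) * (chi kp (y$2) / 2)" for i
    unfolding sum.atMost_shift edge_image_minus_def lm pl km_def[symmetric] by simp
  have 2: "(\<Sum>j\<le>n kp. b i j * edge_image_plus M r \<gamma> e i j y) =
     b i 0 * L2_proj_coarse M e (lam1 M kp i) (y$1) * (lam0 M kp 0 (y$2) - chi kp (y$2) / 2) +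
     (\<Sum>j<n kp. b i (Suc j) * (lam1 M kp i (y$1) * lam0 M kp (Suc j) (y$2)))" for i
    unfolding sum.atMost_shift edge_image_plus_def lp mi kp_def[symmetric] by simp
  have "edge_image_comb M r \<gamma> e a b y = lsum_trace km a (y$1) * (chi kp (y$2) / 2) +
     (RB b (y$1) * (lam0 M kp 0 (y$2) - chi kp (y$2) / 2) +
      (\<Sum>i<n kp. \<Sum>j<n kp. b i (Suc j) * (lam1 M kp i (y$1) * lam0 M kp (Suc j) (y$2))))"
    unfolding edge_image_comb_def km_def[symmetric] kp_def[symmetric] 1 2 sum.distrib sum_distrib_right[symmetric]
      lsum_trace_def RB_def ..
  then show ?thesis unfolding lsum_split by (simp add: field_simps)
qed

lemma edge_image_minus_side:
  assumes z: "z \<in> box 0 1"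
  shows "edge_image_comb M r \<gamma> e a b (reflect_perp z) =
     lsum km a z - (lsum_trace km a (z$1) - RB b (z$1)) / 2 * chi km (z$2)"
proof -
  have z2: "0 < z$2" "z$2 < 1" using z by (auto simp: mem_unit_box)
  have lm: "lam_minus M e j (- z$2) = lam0 M km j (z$2)" and lp: "lam_plus M e j (- z$2) = 0" for j
    using z2 by (auto simp: lam_minus_def lam_plus_def km_def)
  have bar: "lam_bar M e (- z$2) = lam0 M km 0 (z$2) / 2" unfolding lam_bar_def lm lp by simp
  have cor: "Defs.corr M r \<gamma> e (- z$2) = (\<Sum>j=1..r. \<gamma> km j * lam0 M km j (z$2)) / 2"
    unfolding Defs.corr_def lm lp km_def by simp
  have mi: "lam_bar M e (- z$2) - Defs.corr M r \<gamma> e (- z$2) = chi km (z$2) / 2"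
    and pl: "lam_bar M e (- z$2) + Defs.corr M r \<gamma> e (- z$2) = lam0 M km 0 (z$2) - chi km (z$2) / 2"
    unfolding bar cor chi_def by (simp_all add: field_simps)
  have 1: "(\<Sum>j\<le>n km. a i j * edge_image_minus M r \<gamma> e i j (reflect_perp z)) =
     a i 0 * lam1 M km i (z$1) * (lam0 M km 0 (z$2) - chi km (z$2) / 2) +
     (\<Sum>j<n km. a i (Suc j) * (lam1 M km i (z$1) * lam0 M km (Suc j) (z$2)))" for i
    unfolding sum.atMost_shift edge_image_minus_def reflect_perp_nth lm pl km_def[symmetric] by simp
  have 2: "(\<Sum>j\<le>n kp. b i j * edge_image_plus M r \<gamma> e i j (reflect_perp z)) =
     b i 0 * L2_proj_coarse M e (lam1 M kp i) (z$1) * (chi km (z$2) / 2)" for i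
    unfolding sum.atMost_shift edge_image_plus_def reflect_perp_nth lp mi kp_def[symmetric] by simp
  have "edge_image_comb M r \<gamma> e a b (reflect_perp z) =
     (lsum_trace km a (z$1) * (lam0 M km 0 (z$2) - chi km (z$2) / 2) +
      (\<Sum>i<n km. \<Sum>j<n km. a i (Suc j) * (lam1 M km i (z$1) * lam0 M km (Suc j) (z$2)))) +
     RB b (z$1) * (chi km (z$2) / 2)"
    unfolding edge_image_comb_def km_def[symmetric] kp_def[symmetric] 1 2 sum.distrib sum_distrib_right[symmetric]
      lsum_trace_def RB_def ..
  then show ?thesis unfolding lsum_split by (simp add: field_simps)
qed

lemma RB_proj: "proj_onto (V1_spline M km) (lsum_trace kp b) (RB b)"
proof -
  have b: "bmf (lam1 M km i)" if "i \<in> {..<n km}" for i using bmf_lam1[OF km] that by simp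
  have "proj_onto (V1_spline M km) (lam1 M kp i) (L2_proj_coarse M e (lam1 M kp i))" if "i \<in> {..<n kp}" for i
  proof -
    have "\<exists>g. proj_onto (V1_spline M km) (lam1 M kp i) g"
      unfolding V1_spline_def using proj_onto_exists[of "n km" "lam1 M km" "lam1 M kp i"] bmf_lam1[OF km] bmf_lam1[OF kp] that by auto
    from someI_ex[OF this] show ?thesis unfolding L2_proj_coarse_def proj_onto_def km_def[symmetric] .
  qed
  then show ?thesis unfolding lsum_trace_def[abs_def] RB_def[abs_def]
    using bmf_lam1[OF kp] bmf_lam1[OF km] by (intro proj_onto_sum[OF V1_spline_def]) auto
qed

lemma V1_hat_of_lsum: "k \<in> patches M \<Longrightarrow> v \<in> V1_hat M k \<Longrightarrow> (\<lambda>y. vec2 (lsum k c y) (v y $ 2)) \<in> V1_hat M k"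
  unfolding V1_hat_def tensor_combs_def lsum_def by (auto simp: mult.assoc)

lemma lsum_trace_eq:
  assumes k: "k \<in> patches M"
  shows "bottom_trace (\<lambda>y. vec2 (lsum k c y) (w y)) s = lsum_trace k c s"
proof -
  have "(\<Sum>j\<le>n k. c i j * (lam1 M k i s * lam0 M k j 0)) = c i 0 * lam1 M k i s" for i
  proof -
    have "(\<Sum>j\<le>n k. c i j * (lam1 M k i s * lam0 M k j 0)) = (\<Sum>j\<le>n k. if j = 0 then c i j * lam1 M k i s else 0)"
      using lam0_0[OF k] by (intro sum.cong) auto
    then show ?thesis by simp
  qed
  then show ?thesis unfolding bottom_trace_def lsum_trace_def lsum_def by simp
qed

text \<open>
  In charts with the edge as bottom side, only the tangential component changes. Let \<open>A\<close> and \<open>B\<close> be the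
  coarse and the fine trace and \<open>R\<close> the projection of \<open>B\<close>. The coarse component is corrected
  by \<open>- (A - R) / 2 \<otimes> chi\<close>, the fine one by \<open>(A - R) / 2 \<otimes> chi - (B - R) \<otimes> lam0\<close>,
  which makes both traces equal to \<open>(A + R) / 2\<close>. The coefficients chosen by the operator need not be those of a given
  representation, so the representatives are built from the chosen coefficients.
\<close>

lemma edge_op_local:
  assumes u: "u \<in> V1_pw M"
  shows "\<exists>vm vp R. rep km (sqsym sm am bm) u vm \<and> rep kp (sqsym sp ap bp) u vp \<and>
     proj_onto (V1_spline M km) (bottom_trace vp) R \<and>
     (AE z in leb_square. pull Em (P u) z =
        vm z - vec2 ((bottom_trace vm (z$1) - R (z$1)) / 2 * chi km (z$2)) 0) \<and>
     (AE y in leb_square. pull Ep (P u) y =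
        vp y + vec2 ((bottom_trace vm (y$1) - R (y$1)) / 2 * chi kp (y$2)
          - (bottom_trace vp (y$1) - R (y$1)) * lam0 M kp 0 (y$2)) 0)"
proof -
  obtain wm where wm: "rep km (sqsym sm am bm) u wm" using ex_rep[OF u km] by blast
  obtain wp where wp: "rep kp (sqsym sp ap bp) u wp" using ex_rep[OF u kp] by blast
  have wmV: "wm \<in> V1_hat M km" and wpV: "wp \<in> V1_hat M kp" using wm wp unfolding rep_def by auto
  have wmE: "AE z in leb_square. pull Em u z = wm z" and wpE: "AE y in leb_square. pull Ep u y = wp y"
    using wm wp unfolding rep_def Em_def Ep_def by auto
  have ex: "\<exists>c. \<forall>y. v y $ 1 = lsum k c y" if "v \<in> V1_hat M k" for v k
    using that unfolding V1_hat_def tensor_combs_def lsum_def by (auto simp: mult.assoc dest: fun_cong)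
  define g where "g = (\<lambda>z. pull (emap M e) u z $ 1)"
  obtain a0 where a0: "\<And>y. wm y $ 1 = lsum km a0 y" using ex[OF wmV] by blast
  obtain b0 where b0: "\<And>y. wp y $ 1 = lsum kp b0 y" using ex[OF wpV] by blast
  have "ae_eq_on edge_rect g (edge_comb M e a0 b0)"
    unfolding ae_eq_on_def AE_edge_rect g_def AE_box_iff
  proof
    show "AE y in lebesgue. y \<in> box 0 1 \<longrightarrow> pull (emap M e) u y $ 1 = edge_comb M e a0 b0 y"
      using wpE unfolding AE_box_iff by eventually_elim (simp add: pull_emap_plus edge_comb_plus b0)
    show "AE z in lebesgue. z \<in> box 0 1 \<longrightarrow> pull (emap M e) u (reflect_perp z) $ 1 = edge_comb M e a0 b0 (reflect_perp z)"
      using wmE unfolding AE_box_iff by eventually_elim (simp add: pull_emap_minus edge_comb_minus a0)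
  qed
  then have some: "\<exists>ab. case ab of (a, b) \<Rightarrow> ae_eq_on edge_rect g (edge_comb M e a b)" by auto
  define ab where "ab = (SOME (a, b). ae_eq_on edge_rect g (edge_comb M e a b))"
  obtain a b where ab': "ab = (a, b)" by (cases ab)
  have abE: "ae_eq_on edge_rect g (edge_comb M e a b)"
    using someI_ex[OF some] unfolding ab_def[symmetric] ab' by simp
  have op: "edge_op_hat M r \<gamma> e g = edge_image_comb M r \<gamma> e a b"
    unfolding edge_op_hat_def Let_def ab_def[symmetric] ab' by simp
  define vm where "vm y = vec2 (lsum km a y) (wm y $ 2)" for y
  define vp where "vp y = vec2 (lsum kp b y) (wp y $ 2)" for y
  have gp: "AE y in leb_square. g y = edge_comb M e a b y"
    and gm: "AE z in leb_square. g (reflect_perp z) = edge_comb M e a b (reflect_perp z)"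
    using abE unfolding ae_eq_on_def AE_edge_rect by auto
  have tm: "bottom_trace vm s = lsum_trace km a s" and tp: "bottom_trace vp s = lsum_trace kp b s" for s
    unfolding vm_def vp_def using lsum_trace_eq km kp by auto
  have "rep km (sqsym sm am bm) u vm"
    unfolding rep_def Em_def[symmetric] AE_box_iff
  proof
    show "vm \<in> V1_hat M km" unfolding vm_def[abs_def] by (rule V1_hat_of_lsum[OF km wmV])
    show "AE z in lebesgue. z \<in> box 0 1 \<longrightarrow> pull Em u z = vm z"
      using wmE gm unfolding AE_box_iff
      by eventually_elim (auto simp: vm_def vec2_eq_iff g_def pull_emap_minus edge_comb_minus)
  qed
  moreover have "rep kp (sqsym sp ap bp) u vp"
    unfolding rep_def Ep_def[symmetric] AE_box_iff
  proof
    show "vp \<in> V1_hat M kp" unfolding vp_def[abs_def] by (rule V1_hat_of_lsum[OF kp wpV])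
    show "AE z in lebesgue. z \<in> box 0 1 \<longrightarrow> pull Ep u z = vp z"
      using wpE gp unfolding AE_box_iff
      by eventually_elim (auto simp: vp_def vec2_eq_iff g_def pull_emap_plus edge_comb_plus)
  qed
  moreover have "bottom_trace vp = lsum_trace kp b" using tp by blast
  then have "proj_onto (V1_spline M km) (bottom_trace vp) (RB b)" using RB_proj by simp
  moreover have "AE z in leb_square. pull Em (P u) z =
        vm z - vec2 ((bottom_trace vm (z$1) - RB b (z$1)) / 2 * chi km (z$2)) 0"
    using wmE unfolding AE_box_iff
  proof eventually_elim
    case (elim z)
    show ?case
    proof
      assume z: "z \<in> box 0 1"
      show "pull Em (P u) z = vm z - vec2 ((bottom_trace vm (z$1) - RB b (z$1)) / 2 * chi km (z$2)) 0"
        unfolding pull_edge_op_minus[OF z] edge_field_def g_def[symmetric] op edge_image_minus_side[OF z] tm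
          pull_emap_minus[OF z] vec2_eq_iff vm_def using elim z by simp
    qed
  qed
  moreover have "AE y in leb_square. pull Ep (P u) y =
        vp y + vec2 ((bottom_trace vm (y$1) - RB b (y$1)) / 2 * chi kp (y$2)
          - (bottom_trace vp (y$1) - RB b (y$1)) * lam0 M kp 0 (y$2)) 0"
    using wpE unfolding AE_box_iff
  proof eventually_elim
    case (elim y)
    show ?case
    proof
      assume y: "y \<in> box 0 1"
      show "pull Ep (P u) y = vp y + vec2 ((bottom_trace vm (y$1) - RB b (y$1)) / 2 * chi kp (y$2)
          - (bottom_trace vp (y$1) - RB b (y$1)) * lam0 M kp 0 (y$2)) 0"
        unfolding pull_edge_op_plus[OF y] edge_field_def g_def[symmetric] op edge_image_plus_side[OF y] tm tp
          pull_emap_plus[OF y] vec2_eq_iff vp_def using elim y by simp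
    qed
  qed
  ultimately show ?thesis by blast
qed

end

section \<open>Properties of a single edge operator\<close>

lemma AE_lebesgue_measurable:
  fixes f g :: "'a::euclidean_space \<Rightarrow> 'b::euclidean_space"
  assumes ae: "AE x in lebesgue_on S. f x = g x" and g: "g \<in> borel_measurable (lebesgue_on S)" and Ss: "S \<in> sets lebesgue"
  shows "f \<in> borel_measurable (lebesgue_on S)"
proof -
  have "(\<lambda>x. indicator S x *\<^sub>R g x) \<in> borel_measurable lebesgue"
    using g Ss by (subst (asm) borel_measurable_restrict_space_iff) auto
  moreover have "AE x in lebesgue. indicator S x *\<^sub>R g x = indicator S x *\<^sub>R f x"
    using ae Ss by (auto simp: AE_restrict_space_iff indicator_def elim!: eventually_mono)
  ultimately have "(\<lambda>x. indicator S x *\<^sub>R f x) \<in> borel_measurable lebesgue" by (rule borel_measurable_AE)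
  then show ?thesis using Ss by (subst borel_measurable_restrict_space_iff) auto
qed

lemma integral_cong_AE_lebesgue_on:
  fixes f g :: "'a::euclidean_space \<Rightarrow> real"
  assumes "AE x in lebesgue_on S. f x = g x" "g \<in> borel_measurable (lebesgue_on S)" "S \<in> sets lebesgue"
  shows "(LINT x|lebesgue_on S. f x) = (LINT x|lebesgue_on S. g x)"
  using assms AE_lebesgue_measurable[OF assms] by (intro integral_cong_AE) auto

lemma borel_imp_lebesgue_on: "borel_fun f \<Longrightarrow> f \<in> borel_measurable (lebesgue_on S)"
  by (intro measurable_restrict_space1 measurable_completion) auto

lemma integral_sqsym:
  fixes f :: "real^2 \<Rightarrow> real"
  assumes "integrable leb_square f"
  shows "(LINT x|leb_square. f x) = (LINT y|leb_square. f (sqsym sw a b y))"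
proof -
  interpret square_chart "sqsym sw a b" by (rule square_chart_sqsym_self)
  have det1: "\<bar>det (D y)\<bar> = 1" if "y \<in> box 0 1" for y
  proof -
    have "(*v) (D y) = (*v) (sqsym_mat sw a b)"
      using D_at[OF that] sqsym_has_derivative by (rule has_derivative_unique)
    then have "D y = sqsym_mat sw a b" by (metis matrix_of_matrix_vector_mul)
    then show ?thesis by (simp add: det_sqsym_mat)
  qed
  have "(LINT x|leb_square. f x) = (LINT y|leb_square. \<bar>det (D y)\<bar> * f (sqsym sw a b y))"
    using change_of_variables(2)[of f] assms by (simp only: sqsym_image)
  also have "\<dots> = (LINT y|leb_square. f (sqsym sw a b y))"
    by (rule Bochner_Integration.integral_cong) (auto simp: det1)
  finally show ?thesis .
qed

lemma proj_onto_lincomb: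
  assumes V: "V = lin_combs I f" "finite I" "\<And>i. i \<in> I \<Longrightarrow> bmf (f i)"
    and p: "proj_onto V h g" "proj_onto V h' g'" and h: "bmf h" "bmf h'"
  shows "proj_onto V (\<lambda>x. a * h x + b * h' x) (\<lambda>x. a * g x + b * g' x)"
  unfolding proj_onto_def
proof (intro conjI ballI)
  show "(\<lambda>x. a * g x + b * g' x) \<in> V" using p unfolding V(1) proj_onto_def by (intro lin_combs_add lin_combs_cmult) auto
  fix s assume s: "s \<in> V"
  have sb: "bmf s" using lin_combs_bmf[of I f s] V s by blast
  have gb: "bmf g" "bmf g'" using lin_combs_bmf[of I f g] lin_combs_bmf[of I f g'] V p unfolding proj_onto_def by blast+
  have "ip01 (\<lambda>x. a * g x + b * g' x) s = a * ip01 g s + b * ip01 g' s"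
    using ip01_add_left[OF bmf_cmult[OF gb(1)] bmf_cmult[OF gb(2)] sb] by (simp only: ip01_cmult_left)
  also have "\<dots> = a * ip01 h s + b * ip01 h' s" using p s unfolding proj_onto_def by simp
  also have "\<dots> = ip01 (\<lambda>x. a * h x + b * h' x) s"
    using ip01_add_left[OF bmf_cmult[OF h(1)] bmf_cmult[OF h(2)] sb] by (simp only: ip01_cmult_left)
  finally show "ip01 (\<lambda>x. a * g x + b * g' x) s = ip01 (\<lambda>x. a * h x + b * h' x) s" .
qed

lemma AE_unit_interval_eqI: "(\<And>s. 0 \<le> s \<Longrightarrow> s < 1 \<Longrightarrow> Q s) \<Longrightarrow> AE s in leb_unit. Q (s::real)"
  by (simp add: AE_unit_interval_interior)

lemma ex_sqsym_factor: "\<exists>s' a' b'. sqsym sw a b = sqsym s1 a1 b1 \<circ> sqsym s' a' b'"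
proof -
  have c: "\<exists>s' a' b'. sqsym t c d \<circ> sqsym sw a b = sqsym s' a' b'" for t c d
    by (cases sw; cases t) (simp only: fun_eq_iff o_apply sqsym_compose if_True if_False, blast)+
  have "\<exists>s' a' b'. sqsym_inv s1 a1 b1 \<circ> sqsym sw a b = sqsym s' a' b'"
    unfolding sqsym_inv_def using c by (cases s1) auto
  then obtain s' a' b' where "sqsym_inv s1 a1 b1 \<circ> sqsym sw a b = sqsym s' a' b'" by blast
  then have "sqsym s1 a1 b1 (sqsym s' a' b' x) = sqsym s1 a1 b1 (sqsym_inv s1 a1 b1 (sqsym sw a b x))" for x
    by (metis o_apply)
  then have "sqsym sw a b = sqsym s1 a1 b1 \<circ> sqsym s' a' b'" by (simp add: fun_eq_iff sqsym_inv2)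
  then show ?thesis by blast
qed

context mp_splines
begin

text \<open>
  A correction of the tangential component, in a chart in which the edge is the bottom side:
  it does not change the tangential trace on the opposite side, nor any moment of order below \<open>r\<close>.
\<close>

definition edge_correction :: "nat \<Rightarrow> nat \<Rightarrow> (real^2 \<Rightarrow> real) \<Rightarrow> bool" where
  "edge_correction r k c \<longleftrightarrow> (\<lambda>y. vec2 (c y) 0) \<in> V1_hat M k \<and> (\<forall>s. c (vec2 s 1) = 0) \<and>
     (\<forall>f g. degree f < r \<longrightarrow> degree g < r \<longrightarrow>
        (LINT y|leb_square. c y * (poly f (y$1) * poly g (y$2))) = 0)"

text \<open>
  Pulled back to the chart of the edge, a test polynomial remains a polynomial of the same degrees in each
  variable, up to signs and an exchange of the variables, and is integrated against the correction.
\<close>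

lemma moment_of_correction:
  assumes k: "k \<in> patches M" and c: "edge_correction r k c"
    and ru: "rep k (sqsym sw a b) u v" and rw: "rep k (sqsym sw a b) w (\<lambda>y. v y + vec2 (c y) 0)"
    and q: "q \<in> vec_polys r"
  shows "(LINT x|leb_square. pull (pmap M k) w x \<bullet> q x) = (LINT x|leb_square. pull (pmap M k) u x \<bullet> q x)"
proof -
  let ?S = "sqsym sw a b" and ?m = "leb_square"
  obtain cf where cf: "\<And>x. q x = (\<chi> l. \<Sum>i<r. \<Sum>j<r. cf l i j * (x$1)^i * (x$2)^j)"
    using q unfolding vec_polys_def by auto
  obtain u0 where u0: "rep k (sqsym False False False) u u0" using rep_to[OF k ru] by blast
  obtain w0 where w0: "rep k (sqsym False False False) w w0" using rep_to[OF k rw] by blast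
  have u0': "u0 \<in> V1_hat M k" "AE y in ?m. pull (pmap M k) u y = u0 y" and w0': "w0 \<in> V1_hat M k" "AE y in ?m. pull (pmap M k) w y = w0 y"
    using u0 w0 unfolding rep_id by auto
  have q2: "bms (\<lambda>x. q x $ l)" for l
    unfolding cf vec_lambda_beta by (intro bms_sum bms_mult bms_const bms_coord bmf_power finite_lessThan)
  have inner2: "x \<bullet> y = x$1 * y$1 + x$2 * y$2" for x y :: "real^2" by (simp add: inner_vec_def sum_2)
  have int: "borel_fun (\<lambda>x. v' x \<bullet> q x)" "integrable ?m (\<lambda>x. v' x \<bullet> q x)" if v': "v' \<in> V1_hat M k" for v'
  proof -
    have b: "bms (\<lambda>x. v' x \<bullet> q x)" unfolding inner2 by (intro bms_add bms_mult V1_hat_bms[OF k v'] q2)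
    then show "borel_fun (\<lambda>x. v' x \<bullet> q x)" unfolding bms_def by blast
    show "integrable ?m (\<lambda>x. v' x \<bullet> q x)" by (rule bms_integrable[OF b])
  qed
  have "(LINT x|?m. pull (pmap M k) w x \<bullet> q x) = (LINT x|?m. w0 x \<bullet> q x)"
    using w0'(2) int(1)[OF w0'(1)] by (intro integral_cong_AE_lebesgue_on borel_imp_lebesgue_on) (auto elim: eventually_mono)
  moreover have "(LINT x|?m. pull (pmap M k) u x \<bullet> q x) = (LINT x|?m. u0 x \<bullet> q x)"
    using u0'(2) int(1)[OF u0'(1)] by (intro integral_cong_AE_lebesgue_on borel_imp_lebesgue_on) (auto elim: eventually_mono)
  moreover have "(LINT x|?m. w0 x \<bullet> q x) - (LINT x|?m. u0 x \<bullet> q x) = (LINT x|?m. (w0 x - u0 x) \<bullet> q x)"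
    using int(2)[OF w0'(1)] int(2)[OF u0'(1)] by (simp add: inner_diff_left)
  moreover have "(LINT x|?m. (w0 x - u0 x) \<bullet> q x) = (LINT y|?m. (w0 (?S y) - u0 (?S y)) \<bullet> q (?S y))"
  proof (rule integral_sqsym)
    show "integrable ?m (\<lambda>x. (w0 x - u0 x) \<bullet> q x)"
      using int(2)[OF w0'(1)] int(2)[OF u0'(1)] by (simp add: inner_diff_left)
  qed
  moreover have "(LINT y|?m. (w0 (?S y) - u0 (?S y)) \<bullet> q (?S y)) = 0"
  proof -
    define fp where "fp t i = (if t then [:1, -1::real:] else [:0, 1:]) ^ i" for t :: bool and i :: nat
    have fp: "flip t x ^ i = poly (fp t i) x" for t i x unfolding fp_def flip_def by (simp add: algebra_simps)
    have fpd: "degree (fp t i) < r" if "i < r" for t i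
    proof -
      have "degree (fp t i) \<le> 1 * i" unfolding fp_def by (rule order.trans[OF degree_power_le]) auto
      then show ?thesis using that by simp
    qed
    define \<alpha> \<beta> :: real where "\<alpha> = (if a then -1 else 1)" and "\<beta> = (if b then -1 else 1)"
    have ab: "\<alpha> * \<alpha> = 1" "\<beta> * \<beta> = 1" unfolding \<alpha>_def \<beta>_def by auto
    let ?qc = "\<lambda>y. (transpose (sqsym_mat sw a b) *v q (?S y)) $ 1"
    have "AE y in ?m. transpose (sqsym_mat sw a b) *v (w0 (?S y) - u0 (?S y)) = vec2 (c y) 0"
      using w0'(2)[THEN AE_sqsym[of _ sw a b, THEN iffD1]] u0'(2)[THEN AE_sqsym[of _ sw a b, THEN iffD1]]
        ru[unfolded rep_def, THEN conjunct2] rw[unfolded rep_def, THEN conjunct2]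
      unfolding AE_box_iff
    proof eventually_elim
      case (elim y)
      show ?case
      proof
        assume y: "y \<in> box 0 1"
        have "transpose (sqsym_mat sw a b) *v (w0 (?S y) - u0 (?S y)) =
           transpose (sqsym_mat sw a b) *v pull (pmap M k) w (?S y) - transpose (sqsym_mat sw a b) *v pull (pmap M k) u (?S y)"
          using elim y by (simp add: matrix_vector_mult_diff_distrib)
        also have "\<dots> = pull (pmap M k \<circ> ?S) w y - pull (pmap M k \<circ> ?S) u y"
          unfolding pull_sqsym[OF chart[OF k] y] ..
        also have "\<dots> = vec2 (c y) 0" using elim y by simp
        finally show "transpose (sqsym_mat sw a b) *v (w0 (?S y) - u0 (?S y)) = vec2 (c y) 0" .
      qed
    qed
    then have ae: "AE y in ?m. (w0 (?S y) - u0 (?S y)) \<bullet> q (?S y) = c y * ?qc y"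
      unfolding AE_box_iff
    proof eventually_elim
      case (elim y)
      show ?case
      proof
        assume "y \<in> box 0 1"
        then have "c y * ?qc y = (transpose (sqsym_mat sw a b) *v (w0 (?S y) - u0 (?S y))) \<bullet> (transpose (sqsym_mat sw a b) *v q (?S y))"
          using elim by (simp add: inner2)
        also have "\<dots> = (w0 (?S y) - u0 (?S y)) \<bullet> q (?S y)"
          unfolding transpose_sqsym_mat_vector inner2 by (auto simp: algebra_simps)
        finally show "(w0 (?S y) - u0 (?S y)) \<bullet> q (?S y) = c y * ?qc y" by simp
      qed
    qed
    have qc: "?qc y = (\<Sum>i<r. \<Sum>j<r. if sw then \<alpha> * cf 2 i j * (poly (fp a j) (y$1) * poly (fp b i) (y$2))
        else \<alpha> * cf 1 i j * (poly (fp a i) (y$1) * poly (fp b j) (y$2)))" for y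
      unfolding transpose_sqsym_mat_vector cf sqsym_def \<alpha>_def[symmetric] fp[symmetric]
      by (cases sw) (simp_all add: sum_distrib_left mult_ac)
    have "bms c" using V1_hat_bms[OF k, of "\<lambda>y. vec2 (c y) 0" 1] c unfolding edge_correction_def by simp
    then have b: "bms (\<lambda>y. c y * (poly f (y$1) * poly g (y$2)))" for f g by (intro bms_mult bms_coord bmf_poly)
    have trm: "borel_fun (\<lambda>y. c y * (poly f (y$1) * poly g (y$2)))"
      "integrable ?m (\<lambda>y. c y * (poly f (y$1) * poly g (y$2)))" for f g
      using b[of f g] bms_integrable[OF b[of f g]] unfolding bms_def by blast+
    have zero: "(LINT y|?m. c y * (poly f (y$1) * poly g (y$2))) = 0" if "degree f < r" "degree g < r" for f g
      using c that unfolding edge_correction_def by blast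
    have ceq: "c y * ?qc y = (\<Sum>i<r. \<Sum>j<r. (if sw then \<alpha> * cf 2 i j else \<alpha> * cf 1 i j) *
        (c y * (poly (fp a (if sw then j else i)) (y$1) * poly (fp b (if sw then i else j)) (y$2))))" for y
      unfolding qc sum_distrib_left by (intro sum.cong refl) (simp add: mult_ac)
    have "(LINT y|?m. (w0 (?S y) - u0 (?S y)) \<bullet> q (?S y)) = (LINT y|?m. c y * ?qc y)"
    proof (rule integral_cong_AE_lebesgue_on[OF ae])
      show "(\<lambda>y. c y * ?qc y) \<in> borel_measurable ?m"
        unfolding ceq by (intro borel_imp_lebesgue_on borel_measurable_sum borel_measurable_times borel_measurable_const trm(1))
    qed simp
    also have "\<dots> = (\<Sum>i<r. \<Sum>j<r. (if sw then \<alpha> * cf 2 i j else \<alpha> * cf 1 i j) *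
        (LINT y|?m. c y * (poly (fp a (if sw then j else i)) (y$1) * poly (fp b (if sw then i else j)) (y$2))))"
      unfolding ceq by (subst Bochner_Integration.integral_sum, intro Bochner_Integration.integrable_sum integrable_mult_right trm(2),
         intro sum.cong refl, subst Bochner_Integration.integral_sum, intro integrable_mult_right trm(2), simp)
    also have "\<dots> = 0" using zero fpd by (intro sum.neutral ballI) (auto split: if_splits)
    finally show ?thesis .
  qed
  ultimately show ?thesis by linarith
qed

end

context spline_edge
begin

lemma rn: "k \<in> patches M \<Longrightarrow> r < n k"
  using n_gt[of k] r by linarith

lemma chi_lin: "k \<in> patches M \<Longrightarrow> chi k \<in> lin_combs {..n k} (lam0 M k)"
  unfolding chi_def[abs_def] using rn[of k]
  by (intro lin_combs_diff lin_combs_sum lin_combs_base) auto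

lemma chi_bmf: "k \<in> patches M \<Longrightarrow> bmf (chi k)"
  by (rule lin_combs_bmf[OF finite_atMost _ chi_lin]) (auto intro: bmf_lam0)

text \<open>
  At \<open>1\<close> only the B-spline with index \<open>n k\<close> is nonzero, and \<open>r < n k\<close>.
\<close>

lemma chi_ends: "k \<in> patches M \<Longrightarrow> chi k 0 = 1" "k \<in> patches M \<Longrightarrow> chi k 1 = 0"
proof -
  assume k: "k \<in> patches M"
  have "(\<Sum>j=1..r. \<gamma> km j * lam0 M k j 0) = 0" "(\<Sum>j=1..r. \<gamma> km j * lam0 M k j 1) = 0"
    using lam0_0[OF k] lam0_1[OF k] rn[OF k] by (intro sum.neutral; auto)+
  then show "chi k 0 = 1" "chi k 1 = 0" unfolding chi_def using lam0_0[OF k] lam0_1[OF k] rn[OF k] by auto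
qed

lemma gamma_agree: "j \<in> {1..r} \<Longrightarrow> \<gamma> kp j = \<gamma> km j"
proof -
  assume j: "j \<in> {1..r}"
  have v: "sqsym s a b (vec2 0 0) \<in> {x. \<forall>i. x $ i \<in> {0, 1}}" for s a b
    by (auto simp: sqsym_def flip_def forall_2)
  have "Em (vec2 0 0) \<in> patch_vertices M km" unfolding Em_def patch_vertices_def o_def using v by blast
  moreover have "Em (vec2 0 0) \<in> patch_vertices M kp"
    unfolding bottom_agree[of 0, simplified] unfolding Ep_def patch_vertices_def o_def using v by blast
  ultimately have "patch_vertices M kp \<inter> patch_vertices M km \<noteq> {}" by blast
  then show ?thesis using corr km kp j unfolding correction_coeffs_def by blast
qed

text \<open>
  This is the linear system for the correction coefficients.
\<close>

lemma chi_moment: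
  assumes k: "k \<in> {km, kp}" and q: "degree q < r"
  shows "ip01 (chi k) (poly q) = 0"
proof -
  have kP: "k \<in> patches M" using k km kp by blast
  have lb: "bmf (lam0 M k j)" if "j \<le> r" for j using bmf_lam0[OF kP, of j] rn[OF kP] that by simp
  have "ip01 (chi k) (poly q) = ip01 (lam0 M k 0) (poly q) - ip01 (\<lambda>x. \<Sum>j=1..r. \<gamma> km j * lam0 M k j x) (poly q)"
    unfolding chi_def by (intro ip01_diff_left bmf_sum bmf_cmult lb bmf_poly) auto
  also have "ip01 (\<lambda>x. \<Sum>j=1..r. \<gamma> km j * lam0 M k j x) (poly q) = (\<Sum>j=1..r. \<gamma> km j * ip01 (lam0 M k j) (poly q))"
    by (intro ip01_sum_left lb bmf_poly) auto
  also have "\<dots> = (\<Sum>j=1..r. \<gamma> k j * ip01 (lam0 M k j) (poly q))"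
    using k gamma_agree by (intro sum.cong) auto
  also have "\<dots> = ip01 (lam0 M k 0) (poly q)"
    using corr kP q unfolding correction_coeffs_def by blast
  finally show ?thesis by simp
qed

lemma km_fine: "uniformly_subdivides (knots M km) (knots M kp)"
  using splines int unfolding multipatch_splines_def km_def kp_def by blast

lemma product_in_V1_hat:
  assumes "k \<in> patches M" "f \<in> V1_spline M k" "g \<in> lin_combs {..n k} (lam0 M k)"
  shows "(\<lambda>y. f (y$1) * g (y$2)) \<in> tensor_combs {..<n k} (lam1 M k) {..n k} (lam0 M k)"
  using assms unfolding V1_spline_def by (intro tensor_product)

lemma zero_tensor: "(\<lambda>y. 0) \<in> tensor_combs I f J h"
  unfolding tensor_combs_def by (intro CollectI exI[of _ "\<lambda>i j. 0"]) simp

lemma product_moment: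
  assumes "bmf f" "bmf g" "ip01 f (poly q) = 0 \<or> ip01 g (poly q') = 0"
  shows "(LINT y|leb_square. f (y$1) * g (y$2) * (poly q (y$1) * poly q' (y$2))) = 0"
proof -
  have "(LINT y|leb_square. f (y$1) * g (y$2) * (poly q (y$1) * poly q' (y$2))) =
     (LINT y|leb_square. (f (y$1) * poly q (y$1)) * (g (y$2) * poly q' (y$2)))"
    by (intro Bochner_Integration.integral_cong refl) simp
  also have "\<dots> = ip01 f (poly q) * ip01 g (poly q')"
    using integral_unit_box_product[of "\<lambda>x. f x * poly q x" "\<lambda>x. g x * poly q' x"] assms by (simp add: bmf_mult bmf_poly)
  finally show ?thesis using assms(3) by auto
qed

lemma edge_correction_product:
  assumes k: "k \<in> {km, kp}" and f: "f \<in> V1_spline M k"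
  shows "edge_correction r k (\<lambda>y. f (y$1) * chi k (y$2))"
proof -
  have kP: "k \<in> patches M" using k km kp by blast
  show ?thesis unfolding edge_correction_def
  proof (intro conjI allI impI)
    show "(\<lambda>y. vec2 (f (y $ 1) * chi k (y $ 2)) 0) \<in> V1_hat M k"
      unfolding V1_hat_def using product_in_V1_hat[OF kP f chi_lin[OF kP]] zero_tensor by simp
    show "f (vec2 s 1 $ 1) * chi k (vec2 s 1 $ 2) = 0" for s using chi_ends(2)[OF kP] by simp
    show "(LINT y|leb_square. f (y $ 1) * chi k (y $ 2) * (poly q (y $ 1) * poly q' (y $ 2))) = 0"
      if "degree q < r" "degree q' < r" for q q' :: "real poly"
      by (rule product_moment) (use chi_moment[OF k that(2)] V1_spline_bmf[OF kP f] chi_bmf[OF kP] in auto)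
  qed
qed

text \<open>
  Used for \<open>f = B - R\<close>, the part of the fine trace that is orthogonal to the coarse space. The moments vanish because
  of the first factor: the coarse space contains the polynomials of degree below \<open>p\<close>.
\<close>

lemma edge_correction_lam0:
  assumes f: "f \<in> V1_spline M kp" and z: "\<And>q. degree q < r \<Longrightarrow> ip01 f (poly q) = 0"
  shows "edge_correction r kp (\<lambda>y. f (y$1) * lam0 M kp 0 (y$2))"
  unfolding edge_correction_def
proof (intro conjI allI impI)
  have l: "lam0 M kp 0 \<in> lin_combs {..n kp} (lam0 M kp)" by (rule lin_combs_base) auto
  show "(\<lambda>y. vec2 (f (y $ 1) * lam0 M kp 0 (y $ 2)) 0) \<in> V1_hat M kp"
    unfolding V1_hat_def using product_in_V1_hat[OF kp f l] zero_tensor by simp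
  show "f (vec2 s 1 $ 1) * lam0 M kp 0 (vec2 s 1 $ 2) = 0" for s using lam0_1[OF kp, of 0] n_gt[OF kp] by simp
  show "(LINT y|leb_square. f (y $ 1) * lam0 M kp 0 (y $ 2) * (poly q (y $ 1) * poly q' (y $ 2))) = 0"
    if "degree q < r" "degree q' < r" for q q'
    by (rule product_moment) (use z[OF that(1)] V1_spline_bmf[OF kp f] bmf_lam0[OF kp] in auto)
qed

lemma edge_correction_lincomb:
  assumes k: "k \<in> patches M" and c: "edge_correction r k c" "edge_correction r k d"
  shows "edge_correction r k (\<lambda>y. \<alpha> * c y + \<beta> * d y)"
proof -
  have V: "(\<lambda>y. vec2 (c y) 0) \<in> V1_hat M k" "(\<lambda>y. vec2 (d y) 0) \<in> V1_hat M k" using c unfolding edge_correction_def by auto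
  have I: "integrable leb_square (\<lambda>y. c y * (poly f (y$1) * poly g (y$2)))"
    if V: "(\<lambda>y. vec2 (c y) 0) \<in> V1_hat M k" for c f g
    using V1_hat_bms[OF k V, of 1] by (intro bms_integrable bms_mult bms_coord bmf_poly) simp
  show ?thesis unfolding edge_correction_def
  proof (intro conjI allI impI)
    have "(\<lambda>y. vec2 (\<alpha> * c y + \<beta> * d y) 0) = (\<lambda>y. \<alpha> *\<^sub>R vec2 (c y) 0 + \<beta> *\<^sub>R vec2 (d y) 0)"
      by (auto simp: fun_eq_iff vec2_eq_iff)
    then show "(\<lambda>y. vec2 (\<alpha> * c y + \<beta> * d y) 0) \<in> V1_hat M k" using V1_hat_lincomb[OF V] by simp
    show "\<alpha> * c (vec2 s 1) + \<beta> * d (vec2 s 1) = 0" for s using c unfolding edge_correction_def by simp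
    show "(LINT y|leb_square. (\<alpha> * c y + \<beta> * d y) * (poly f (y $ 1) * poly g (y $ 2))) = 0"
      if "degree f < r" "degree g < r" for f g
    proof -
      have "(LINT y|leb_square. (\<alpha> * c y + \<beta> * d y) * (poly f (y $ 1) * poly g (y $ 2))) =
        (LINT y|leb_square. \<alpha> * (c y * (poly f (y$1) * poly g (y$2))) + \<beta> * (d y * (poly f (y$1) * poly g (y$2))))"
        by (intro Bochner_Integration.integral_cong refl) (simp add: algebra_simps)
      also have "\<dots> = 0" using I[OF V(1)] I[OF V(2)] c that unfolding edge_correction_def by simp
      finally show ?thesis .
    qed
  qed
qed

text \<open>
  The edge operator as a correction in each of its two patches. Both corrections are determined
  by the two traces and the projection of the fine trace.
\<close>

lemma edge_op_corrections:
  assumes u: "u \<in> V1_pw M"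
  shows "\<exists>vm vp R cm cp. rep km (sqsym sm am bm) u vm \<and> rep kp (sqsym sp ap bp) u vp \<and>
     proj_onto (V1_spline M km) (bottom_trace vp) R \<and>
     edge_correction r km cm \<and> rep km (sqsym sm am bm) (P u) (\<lambda>y. vm y + vec2 (cm y) 0) \<and>
     edge_correction r kp cp \<and> rep kp (sqsym sp ap bp) (P u) (\<lambda>y. vp y + vec2 (cp y) 0) \<and>
     (\<forall>y\<in>cbox 0 1. cm y = - (bottom_trace vm (y$1) - R (y$1)) / 2 * chi km (y$2)) \<and>
     (\<forall>y\<in>cbox 0 1. cp y = (bottom_trace vm (y$1) - R (y$1)) / 2 * chi kp (y$2)
          - (bottom_trace vp (y$1) - R (y$1)) * lam0 M kp 0 (y$2))"
proof -
  from edge_op_local[OF u] obtain vm vp R where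
    vm: "rep km (sqsym sm am bm) u vm" and vp: "rep kp (sqsym sp ap bp) u vp" and
    R: "proj_onto (V1_spline M km) (bottom_trace vp) R" and
    am: "AE z in leb_square. pull Em (P u) z = vm z - vec2 ((bottom_trace vm (z$1) - R (z$1)) / 2 * chi km (z$2)) 0" and
    ap: "AE y in leb_square. pull Ep (P u) y = vp y + vec2 ((bottom_trace vm (y$1) - R (y$1)) / 2 * chi kp (y$2)
          - (bottom_trace vp (y$1) - R (y$1)) * lam0 M kp 0 (y$2)) 0" by blast
  have vmV: "vm \<in> V1_hat M km" and vpV: "vp \<in> V1_hat M kp" using vm vp unfolding rep_def by auto
  have tm: "bottom_trace vm \<in> V1_spline M km" and tp: "bottom_trace vp \<in> V1_spline M kp"
    using V1_hat_trace km kp vmV vpV by auto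
  have RV: "R \<in> V1_spline M km" using R unfolding proj_onto_def by blast
  have Rb: "bmf R" and tpb: "bmf (bottom_trace vp)"
    using V1_spline_bmf km kp RV tm tp by blast+
  obtain t' where t': "t' \<in> V1_spline M kp" "\<forall>x\<in>{0..1}. bottom_trace vm x = t' x"
    using V1_nested[OF km kp km_fine tm] unfolding V1_on_def by blast
  obtain R' where R': "R' \<in> V1_spline M kp" "\<forall>x\<in>{0..1}. R x = R' x"
    using V1_nested[OF km kp km_fine RV] unfolding V1_on_def by blast
  have R'b: "bmf R'" using V1_spline_bmf[OF kp R'(1)] .
  define dm where "dm x = bottom_trace vm x - R x" for x
  define dp where "dp x = t' x - R' x" for x
  define \<rho> where "\<rho> x = bottom_trace vp x - R' x" for x
  have dmV: "dm \<in> V1_spline M km" and dpV: "dp \<in> V1_spline M kp" and \<rho>V: "\<rho> \<in> V1_spline M kp"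
    unfolding dm_def[abs_def] dp_def[abs_def] \<rho>_def[abs_def] using tm RV t' R' tp unfolding V1_spline_def
    by (auto intro: lin_combs_diff)
  have \<rho>0: "ip01 \<rho> (poly q) = 0" if q: "degree q < r" for q
  proof -
    have "degree q < sdeg M" using q r by simp
    then obtain g where g: "g \<in> V1_spline M km" "\<forall>x\<in>{0..1}. poly q x = g x"
      using V1_poly[OF km] unfolding V1_on_def by blast
    have "ip01 \<rho> (poly q) = ip01 (bottom_trace vp) (poly q) - ip01 R' (poly q)"
      unfolding \<rho>_def by (intro ip01_diff_left tpb R'b bmf_poly)
    also have "ip01 (bottom_trace vp) (poly q) = ip01 (bottom_trace vp) g"
      using g by (intro Bochner_Integration.integral_cong) auto
    also have "ip01 R' (poly q) = ip01 R g" using g R' by (intro Bochner_Integration.integral_cong) auto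
    finally show ?thesis using R g unfolding proj_onto_def by simp
  qed
  define cm where "cm y = (- 1 / 2) * (dm (y$1) * chi km (y$2)) + 0 * (dm (y$1) * chi km (y$2))" for y :: "real^2"
  define cp where "cp y = (1 / 2) * (dp (y$1) * chi kp (y$2)) + (- 1) * (\<rho> (y$1) * lam0 M kp 0 (y$2))" for y :: "real^2"
  have ecm: "edge_correction r km cm" unfolding cm_def[abs_def]
    by (intro edge_correction_lincomb km edge_correction_product dmV) auto
  have ecp: "edge_correction r kp cp" unfolding cp_def[abs_def]
    by (intro edge_correction_lincomb kp edge_correction_product edge_correction_lam0 dpV \<rho>V \<rho>0) auto
  have cmE: "\<forall>y\<in>cbox 0 1. cm y = - (bottom_trace vm (y$1) - R (y$1)) / 2 * chi km (y$2)"
    unfolding cm_def dm_def by (simp add: algebra_simps)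
  have cpE: "\<forall>y\<in>cbox 0 1. cp y = (bottom_trace vm (y$1) - R (y$1)) / 2 * chi kp (y$2)
          - (bottom_trace vp (y$1) - R (y$1)) * lam0 M kp 0 (y$2)"
    unfolding cp_def dp_def \<rho>_def using t'(2) R'(2) by (auto simp: mem_unit_cbox)
  have add: "(\<lambda>y. v y + vec2 (c y) 0) \<in> V1_hat M k" if "v \<in> V1_hat M k" "edge_correction r k c" for v c k
    using V1_hat_lincomb[of v k "\<lambda>y. vec2 (c y) 0" 1 1] that unfolding edge_correction_def by simp
  have "rep km (sqsym sm am bm) (P u) (\<lambda>y. vm y + vec2 (cm y) 0)"
    unfolding rep_def Em_def[symmetric] AE_box_iff
  proof
    show "AE y in lebesgue. y \<in> box 0 1 \<longrightarrow> pull Em (P u) y = vm y + vec2 (cm y) 0"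
      using am unfolding AE_box_iff
    proof eventually_elim
      case (elim y)
      show ?case
      proof
        assume y: "y \<in> box 0 1"
        then have yc: "y \<in> cbox 0 1" using box_subset_cbox by blast
        then show "pull Em (P u) y = vm y + vec2 (cm y) 0" using elim y unfolding cmE[rule_format, OF yc] by (simp add: vec2_eq_iff field_simps)
      qed
    qed
  qed (rule add[OF vmV ecm])
  moreover have "rep kp (sqsym sp ap bp) (P u) (\<lambda>y. vp y + vec2 (cp y) 0)"
    unfolding rep_def Ep_def[symmetric] AE_box_iff
  proof
    show "AE y in lebesgue. y \<in> box 0 1 \<longrightarrow> pull Ep (P u) y = vp y + vec2 (cp y) 0"
      using ap unfolding AE_box_iff
    proof eventually_elim
      case (elim y)
      show ?case
      proof
        assume y: "y \<in> box 0 1"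
        then have yc: "y \<in> cbox 0 1" using box_subset_cbox by blast
        then show "pull Ep (P u) y = vp y + vec2 (cp y) 0" using elim y cpE[rule_format, OF yc] by (simp add: vec2_eq_iff)
      qed
    qed
  qed (rule add[OF vpV ecp])
  ultimately show ?thesis using vm vp R ecm ecp cmE cpE by blast
qed

end

context spline_edge
begin

definition conforming :: "(real^2 \<Rightarrow> real^2) \<Rightarrow> bool" where
  "conforming u \<longleftrightarrow> (\<forall>vm vp. rep km (sqsym sm am bm) u vm \<longrightarrow> rep kp (sqsym sp ap bp) u vp \<longrightarrow>
     (\<forall>s\<in>{0..<1}. bottom_trace vm s = bottom_trace vp s))"

lemma rep_trace_unique:
  assumes k: "k \<in> patches M" and v: "rep k (sqsym sw a b) u v" "rep k (sqsym sw a b) u v'" and s: "s \<in> {0..<1}"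
  shows "bottom_trace v s = bottom_trace v' s"
  using rep_AE_cong[OF k v] v s by (intro trace_AE_eq[OF k]) (auto simp: rep_def)

lemma conformingI:
  assumes "rep km (sqsym sm am bm) u vm" "rep kp (sqsym sp ap bp) u vp"
    "\<And>s. s \<in> {0..<1} \<Longrightarrow> bottom_trace vm s = bottom_trace vp s"
  shows "conforming u"
  unfolding conforming_def using rep_trace_unique[OF km assms(1)] rep_trace_unique[OF kp assms(2)] assms(3) by metis

lemma edge_op_V1_pw:
  assumes u: "u \<in> V1_pw M"
  shows "P u \<in> V1_pw M"
  unfolding V1_pw_iff
proof
  fix k assume k: "k \<in> patches M"
  from edge_op_corrections[OF u] obtain wm wp where
    w: "rep km (sqsym sm am bm) (P u) wm" "rep kp (sqsym sp ap bp) (P u) wp" by blast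
  show "\<exists>v. rep k (sqsym False False False) (P u) v"
  proof (cases "k = km \<or> k = kp")
    case True
    then show ?thesis using rep_to[OF km w(1)] rep_to[OF kp w(2)] by blast
  next
    case False
    obtain v where v: "rep k (sqsym False False False) u v" using ex_rep[OF u k] by blast
    have "pull (pmap M k) (P u) y = pull (pmap M k) u y" if "y \<in> box 0 1" for y
      using pull_edge_op_other[OF k, of "pmap M k y"] False that unfolding pull_def patch_def by simp
    then have "rep k (sqsym False False False) (P u) v"
      using v unfolding rep_id AE_box_iff by (auto elim!: eventually_mono)
    then show ?thesis by blast
  qed
qed

lemma edge_op_conforming:
  assumes u: "u \<in> V1_pw M"
  shows "conforming (P u)"
proof -
  from edge_op_corrections[OF u] obtain vm vp R cm cp where
     w: "rep km (sqsym sm am bm) (P u) (\<lambda>y. vm y + vec2 (cm y) 0)" "rep kp (sqsym sp ap bp) (P u) (\<lambda>y. vp y + vec2 (cp y) 0)"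
    and c: "\<forall>y\<in>cbox 0 1. cm y = - (bottom_trace vm (y$1) - R (y$1)) / 2 * chi km (y$2)"
     "\<forall>y\<in>cbox 0 1. cp y = (bottom_trace vm (y$1) - R (y$1)) / 2 * chi kp (y$2) - (bottom_trace vp (y$1) - R (y$1)) * lam0 M kp 0 (y$2)"
    by blast
  show ?thesis
  proof (rule conformingI[OF w])
    fix s :: real assume "s \<in> {0..<1}"
    then have s: "vec2 s 0 \<in> cbox 0 1" by (simp add: mem_unit_cbox)
    show "bottom_trace (\<lambda>y. vm y + vec2 (cm y) 0) s = bottom_trace (\<lambda>y. vp y + vec2 (cp y) 0) s"
      using c(1)[rule_format, OF s] c(2)[rule_format, OF s] chi_ends(1)[OF km] chi_ends(1)[OF kp] lam0_0[OF kp, of 0]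
      unfolding bottom_trace_def by (simp add: field_simps)
  qed
qed

lemma AE_Dom_from_charts:
  assumes "AE y in leb_square. pull Em u y = pull Em w y"
    and "AE y in leb_square. pull Ep u y = pull Ep w y"
    and "\<And>k x. k \<in> patches M \<Longrightarrow> k \<noteq> km \<Longrightarrow> k \<noteq> kp \<Longrightarrow> AE x in leb_patch k. u x = w x"
  shows "AE x in leb_Dom. u x = w x"
  unfolding AE_Dom_iff
proof
  fix k assume k: "k \<in> patches M"
  consider "k = km" | "k = kp" | "k \<noteq> km" "k \<noteq> kp" by blast
  then show "AE x in leb_patch k. u x = w x"
  proof cases
    case 1
    then show ?thesis using AE_patch_pull[OF km] assms(1) unfolding Em_def by blast
  next
    case 2
    then show ?thesis using AE_patch_pull[OF kp] assms(2) unfolding Ep_def by blast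
  qed (use assms(3) k in blast)
qed

lemma AE_patch_other:
  assumes "k \<in> patches M" "k \<noteq> km" "k \<noteq> kp"
  shows "AE x in leb_patch k. P u x = u x"
  using pull_edge_op_other[OF assms] patch_lmeasurable(2)[OF assms(1)] by (intro AE_I2) simp

text \<open>
  If the traces agree then the fine trace belongs to the coarse space and equals its projection, so both corrections vanish.
\<close>

lemma edge_op_fixes:
  assumes u: "u \<in> V1_pw M" and conf: "conforming u"
  shows "AE x in leb_Dom. P u x = u x"
proof -
  from edge_op_corrections[OF u] obtain vm vp R cm cp where
     v: "rep km (sqsym sm am bm) u vm" "rep kp (sqsym sp ap bp) u vp" and
     R: "proj_onto (V1_spline M km) (bottom_trace vp) R" and
     w: "rep km (sqsym sm am bm) (P u) (\<lambda>y. vm y + vec2 (cm y) 0)" "rep kp (sqsym sp ap bp) (P u) (\<lambda>y. vp y + vec2 (cp y) 0)"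
    and c: "\<forall>y\<in>cbox 0 1. cm y = - (bottom_trace vm (y$1) - R (y$1)) / 2 * chi km (y$2)"
     "\<forall>y\<in>cbox 0 1. cp y = (bottom_trace vm (y$1) - R (y$1)) / 2 * chi kp (y$2) - (bottom_trace vp (y$1) - R (y$1)) * lam0 M kp 0 (y$2)"
    by blast
  have V: "vm \<in> V1_hat M km" "vp \<in> V1_hat M kp" using v unfolding rep_def by auto
  have tm: "bottom_trace vm \<in> V1_spline M km" and tp: "bottom_trace vp \<in> V1_spline M kp"
    using V1_hat_trace km kp V by auto
  have eq: "bottom_trace vm s = bottom_trace vp s" if "s \<in> {0..<1}" for s
    using conf v that unfolding conforming_def by blast
  have RV: "R \<in> V1_spline M km" using R unfolding proj_onto_def by blast
  have tb: "bmf (bottom_trace vm)" "bmf (bottom_trace vp)"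
    using V1_spline_bmf[OF km tm] V1_spline_bmf[OF kp tp] by auto
  have b1: "bmf (lam1 M km i)" if "i \<in> {..<n km}" for i using bmf_lam1[OF km] that by simp
  have ae: "AE s in leb_unit. bottom_trace vp s = bottom_trace vm s"
    using eq by (intro AE_unit_interval_eqI) auto
  have "AE s in leb_unit. R s = bottom_trace vm s"
    by (rule proj_onto_unique[OF V1_spline_def finite_lessThan b1 tb(2,1) ae R proj_onto_self[OF tm]])
  from V1_spline_eq[OF km km RV tm this]
  have RE: "R s = bottom_trace vm s" if "s \<in> {0..<1}" for s
    using that by (simp only: atLeastLessThan_iff)
  have zero: "cm y = 0" "cp y = 0" if "y \<in> box 0 1" for y
  proof -
    have y: "y \<in> cbox 0 1" "y $ 1 \<in> {0..<1}" using that by (auto simp: mem_unit_box mem_unit_cbox)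
    show "cm y = 0" "cp y = 0" using c(1)[rule_format, OF y(1)] c(2)[rule_format, OF y(1)] RE[OF y(2)] eq[OF y(2)] by auto
  qed
  have z2: "vec2 0 0 = 0" by (simp add: vec2_eq_iff)
  show ?thesis
  proof (rule AE_Dom_from_charts)
    show "AE y in leb_square. pull Em (P u) y = pull Em u y"
      using v(1)[unfolded rep_def, THEN conjunct2] w(1)[unfolded rep_def, THEN conjunct2] unfolding AE_box_iff Em_def[symmetric]
      by eventually_elim (simp add: zero z2)
    show "AE y in leb_square. pull Ep (P u) y = pull Ep u y"
      using v(2)[unfolded rep_def, THEN conjunct2] w(2)[unfolded rep_def, THEN conjunct2] unfolding AE_box_iff Ep_def[symmetric]
      by eventually_elim (simp add: zero z2)
  qed (rule AE_patch_other)
qed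

lemma pull_lincomb: "pull E (\<lambda>x. a *\<^sub>R u x + b *\<^sub>R v x) y = a *\<^sub>R pull E u y + b *\<^sub>R pull E v y"
  unfolding pull_def by (simp only: matrix_vector_right_distrib scaleR_matrix_vector_assoc[symmetric] matrix_vector_mult_scaleR)

text \<open>
  Almost everywhere equal fields have almost everywhere equal traces, and projections of such traces agree almost
  everywhere; in particular the operator respects equivalence classes.
\<close>

lemma edge_op_linear:
  assumes u: "u \<in> V1_pw M" and v: "v \<in> V1_pw M" and w: "w \<in> V1_pw M"
    and eq: "AE x in leb_Dom. w x = \<alpha> *\<^sub>R u x + \<beta> *\<^sub>R v x"
  shows "AE x in leb_Dom. P w x = \<alpha> *\<^sub>R P u x + \<beta> *\<^sub>R P v x"
proof -
  from edge_op_local[OF u] obtain um up Ru where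
    um: "rep km (sqsym sm am bm) u um" and up: "rep kp (sqsym sp ap bp) u up" and
    Ru: "proj_onto (V1_spline M km) (bottom_trace up) Ru" and
    uam: "AE z in leb_square. pull Em (P u) z = um z - vec2 ((bottom_trace um (z$1) - Ru (z$1)) / 2 * chi km (z$2)) 0" and
    uap: "AE y in leb_square. pull Ep (P u) y = up y + vec2 ((bottom_trace um (y$1) - Ru (y$1)) / 2 * chi kp (y$2)
          - (bottom_trace up (y$1) - Ru (y$1)) * lam0 M kp 0 (y$2)) 0" by blast
  from edge_op_local[OF v] obtain vm vp Rv where
    vm: "rep km (sqsym sm am bm) v vm" and vp: "rep kp (sqsym sp ap bp) v vp" and
    Rv: "proj_onto (V1_spline M km) (bottom_trace vp) Rv" and
    vam: "AE z in leb_square. pull Em (P v) z = vm z - vec2 ((bottom_trace vm (z$1) - Rv (z$1)) / 2 * chi km (z$2)) 0" and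
    vap: "AE y in leb_square. pull Ep (P v) y = vp y + vec2 ((bottom_trace vm (y$1) - Rv (y$1)) / 2 * chi kp (y$2)
          - (bottom_trace vp (y$1) - Rv (y$1)) * lam0 M kp 0 (y$2)) 0" by blast
  from edge_op_local[OF w] obtain wm wp Rw where
    wm: "rep km (sqsym sm am bm) w wm" and wp: "rep kp (sqsym sp ap bp) w wp" and
    Rw: "proj_onto (V1_spline M km) (bottom_trace wp) Rw" and
    wam: "AE z in leb_square. pull Em (P w) z = wm z - vec2 ((bottom_trace wm (z$1) - Rw (z$1)) / 2 * chi km (z$2)) 0" and
    wap: "AE y in leb_square. pull Ep (P w) y = wp y + vec2 ((bottom_trace wm (y$1) - Rw (y$1)) / 2 * chi kp (y$2)
          - (bottom_trace wp (y$1) - Rw (y$1)) * lam0 M kp 0 (y$2)) 0" by blast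
  note lm = rep_lincomb[OF um vm, of \<alpha> \<beta>] and lp = rep_lincomb[OF up vp, of \<alpha> \<beta>]
  have em: "AE y in leb_square. wm y = \<alpha> *\<^sub>R um y + \<beta> *\<^sub>R vm y"
    using rep_AE_cong[OF km wm lm] eq km unfolding AE_Dom_iff by blast
  have ep: "AE y in leb_square. wp y = \<alpha> *\<^sub>R up y + \<beta> *\<^sub>R vp y"
    using rep_AE_cong[OF kp wp lp] eq kp unfolding AE_Dom_iff by blast
  have tl: "bottom_trace (\<lambda>x. \<alpha> *\<^sub>R f x + \<beta> *\<^sub>R g x) s = \<alpha> * bottom_trace f s + \<beta> * bottom_trace g s" for f g s
    unfolding bottom_trace_def by simp
  have tm: "bottom_trace wm s = \<alpha> * bottom_trace um s + \<beta> * bottom_trace vm s" if "s \<in> {0..<1}" for s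
    using trace_AE_eq[OF km _ _ em, of s] wm lm that unfolding rep_def tl by auto
  have tp: "bottom_trace wp s = \<alpha> * bottom_trace up s + \<beta> * bottom_trace vp s" if "s \<in> {0..<1}" for s
    using trace_AE_eq[OF kp _ _ ep, of s] wp lp that unfolding rep_def tl by auto
  have V: "up \<in> V1_hat M kp" "vp \<in> V1_hat M kp" "wp \<in> V1_hat M kp" using up vp wp unfolding rep_def by auto
  have tb: "bmf (bottom_trace up)" "bmf (bottom_trace vp)" "bmf (bottom_trace wp)"
    using V1_spline_bmf[OF kp] V1_hat_trace[OF kp] V by blast+
  have b1: "bmf (lam1 M km i)" if "i \<in> {..<n km}" for i using bmf_lam1[OF km] that by simp
  have Rl: "proj_onto (V1_spline M km) (\<lambda>x. \<alpha> * bottom_trace up x + \<beta> * bottom_trace vp x) (\<lambda>x. \<alpha> * Ru x + \<beta> * Rv x)"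
    by (rule proj_onto_lincomb[OF V1_spline_def finite_lessThan b1 Ru Rv tb(1,2)])
  have "AE s in leb_unit. Rw s = \<alpha> * Ru s + \<beta> * Rv s"
    by (rule proj_onto_unique[OF V1_spline_def finite_lessThan b1 tb(3) _ _ Rw Rl])
       (auto intro!: bmf_add bmf_cmult tb AE_unit_interval_eqI tp)
  from V1_spline_eq[OF km km _ _ this] Rw Rl
  have RE: "Rw s = \<alpha> * Ru s + \<beta> * Rv s" if "s \<in> {0..<1}" for s
    using that unfolding proj_onto_def by (simp only: atLeastLessThan_iff)
  show ?thesis
  proof (rule AE_Dom_from_charts)
    show "AE y in leb_square. pull Em (P w) y = pull Em (\<lambda>x. \<alpha> *\<^sub>R P u x + \<beta> *\<^sub>R P v x) y"
      unfolding pull_lincomb AE_box_iff using uam vam wam em unfolding AE_box_iff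
    proof eventually_elim
      case (elim y)
      show ?case
      proof
        assume y: "y \<in> box 0 1"
        then have "y $ 1 \<in> {0..<1}" by (auto simp: mem_unit_box)
        with elim y show "pull Em (P w) y = \<alpha> *\<^sub>R pull Em (P u) y + \<beta> *\<^sub>R pull Em (P v) y"
          by (simp add: vec2_eq_iff tm RE) (simp add: field_simps)
      qed
    qed
    show "AE y in leb_square. pull Ep (P w) y = pull Ep (\<lambda>x. \<alpha> *\<^sub>R P u x + \<beta> *\<^sub>R P v x) y"
      unfolding pull_lincomb AE_box_iff using uap vap wap ep unfolding AE_box_iff
    proof eventually_elim
      case (elim y)
      show ?case
      proof
        assume y: "y \<in> box 0 1"
        then have "y $ 1 \<in> {0..<1}" by (auto simp: mem_unit_box)
        with elim y show "pull Ep (P w) y = \<alpha> *\<^sub>R pull Ep (P u) y + \<beta> *\<^sub>R pull Ep (P v) y"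
          by (simp add: vec2_eq_iff tm tp RE) (simp add: field_simps)
      qed
    qed
    fix k assume k: "k \<in> patches M" "k \<noteq> km" "k \<noteq> kp"
    have "AE x in leb_patch k. w x = \<alpha> *\<^sub>R u x + \<beta> *\<^sub>R v x" using eq k unfolding AE_Dom_iff by blast
    with AE_patch_other[OF k, of u] AE_patch_other[OF k, of v] AE_patch_other[OF k, of w]
    show "AE x in leb_patch k. P w x = \<alpha> *\<^sub>R P u x + \<beta> *\<^sub>R P v x" by eventually_elim simp
  qed
qed

lemma edge_op_moments:
  assumes u: "u \<in> V1_pw M" and k: "k \<in> patches M" and q: "q \<in> vec_polys r"
  shows "(LINT x|leb_square. pull (pmap M k) (P u) x \<bullet> q x) = (LINT x|leb_square. pull (pmap M k) u x \<bullet> q x)"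
proof -
  from edge_op_corrections[OF u] obtain vm vp cm cp where
     v: "rep km (sqsym sm am bm) u vm" "rep kp (sqsym sp ap bp) u vp" and
     w: "edge_correction r km cm" "rep km (sqsym sm am bm) (P u) (\<lambda>y. vm y + vec2 (cm y) 0)"
       "edge_correction r kp cp" "rep kp (sqsym sp ap bp) (P u) (\<lambda>y. vp y + vec2 (cp y) 0)" by blast
  consider "k = km" | "k = kp" | "k \<noteq> km" "k \<noteq> kp" by blast
  then show ?thesis
  proof cases
    case 1
    show ?thesis unfolding 1 by (rule moment_of_correction[OF km w(1) v(1) w(2) q])
  next
    case 2
    show ?thesis unfolding 2 by (rule moment_of_correction[OF kp w(3) v(2) w(4) q])
  next
    case 3
    have "pull (pmap M k) (P u) y = pull (pmap M k) u y" if "y \<in> box 0 1" for y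
      using pull_edge_op_other[OF k 3, of "pmap M k y"] that unfolding pull_def patch_def by simp
    then show ?thesis by (intro Bochner_Integration.integral_cong) auto
  qed
qed

text \<open>
  A correction leaves the traces on the other three sides alone: on the two adjacent sides the
  tangential component is the one that is not corrected, and on the opposite side the correction
  vanishes.
\<close>

lemma correction_other_trace:
  assumes k: "k \<in> patches M" and c: "edge_correction r k c"
    and ru: "rep k (sqsym s1 a1 b1) u v" and rw: "rep k (sqsym s1 a1 b1) w (\<lambda>y. v y + vec2 (c y) 0)"
    and ne: "side_edge k sw b \<noteq> side_edge k s1 b1"
    and vu: "rep k (sqsym sw a b) u vu" and vw: "rep k (sqsym sw a b) w vw" and s: "s \<in> {0..<1}"
  shows "bottom_trace vw s = bottom_trace vu s"
proof -
  obtain s' a' b' where T: "sqsym sw a b = sqsym s1 a1 b1 \<circ> sqsym s' a' b'" using ex_sqsym_factor by blast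
  obtain u1 where u1: "rep k (sqsym sw a b) u u1"
    "AE y in leb_square. u1 y = transpose (sqsym_mat s' a' b') *v v (sqsym s' a' b' y)"
    using rep_change[OF k ru, of s' a' b'] unfolding T by blast
  obtain w1 where w1: "rep k (sqsym sw a b) w w1"
    "AE y in leb_square. w1 y = transpose (sqsym_mat s' a' b') *v (v (sqsym s' a' b' y) + vec2 (c (sqsym s' a' b' y)) 0)"
    using rep_change[OF k rw, of s' a' b'] unfolding T by blast
  have V: "u1 \<in> V1_hat M k" "w1 \<in> V1_hat M k" using u1 w1 unfolding rep_def by auto
  define d where "d y = (if s' then 0 else (if a' then -1 else 1) * c (vec2 (flip a' (y$1)) (1 - y$2)))" for y :: "real^2"
  have b': "b'" if "\<not> s'"
  proof (rule ccontr)
    assume "\<not> b'"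
    have "sqsym s' a' b' ` bottom = bottom" using that \<open>\<not> b'\<close> sqsym_bottom(1)[of a' False] by simp
    then have "side_edge k sw b = side_edge k s1 b1"
      unfolding side_edge_sqsym[of k sw a b, symmetric] T side_edge_sqsym[of k s1 a1 b1, symmetric] by (simp only: image_comp[symmetric])
    then show False using ne by simp
  qed
  have "AE y in leb_square. w1 y $ 1 = u1 y $ 1 + d y"
    using u1(2) w1(2)
  proof eventually_elim
    case (elim y)
    have "w1 y $ 1 - u1 y $ 1 = d y"
    proof (cases s')
      case True
      then show ?thesis unfolding elim d_def transpose_sqsym_mat_vector by simp
    next
      case False
      then have "sqsym s' a' b' y = vec2 (flip a' (y$1)) (1 - y$2)" using b' by (simp add: sqsym_def flip_def)
      then show ?thesis using False unfolding elim d_def transpose_sqsym_mat_vector by (simp add: algebra_simps)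
    qed
    then show ?case by simp
  qed
  moreover have "continuous_on {0..1} (\<lambda>t. w1 (vec2 x t) $ 1)" for x by (rule V1_hat_cont[OF k V(2)])
  moreover have "continuous_on {0..1} (\<lambda>t. u1 (vec2 x t) $ 1 + d (vec2 x t))" for x
  proof (intro continuous_on_add V1_hat_cont[OF k V(1)])
    have "continuous_on {0..1} (\<lambda>t. c (vec2 y t))" for y
      using V1_hat_cont[OF k, of "\<lambda>y. vec2 (c y) 0" y] c unfolding edge_correction_def by simp
    then have "continuous_on {0..1} (\<lambda>t. c (vec2 y (1 - t)))" for y
      by (rule continuous_on_compose2[of _ "\<lambda>t. c (vec2 y t)"]) (auto intro!: continuous_intros)
    then show "continuous_on {0..1} (\<lambda>t. d (vec2 x t))" unfolding d_def by (cases s') (auto intro!: continuous_intros)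
  qed
  ultimately have "AE x in leb_unit. w1 (vec2 x 0) $ 1 = u1 (vec2 x 0) $ 1 + d (vec2 x 0)"
    by (intro trace_unique[of "\<lambda>y. w1 y $ 1" "\<lambda>y. u1 y $ 1 + d y"])
  moreover have "d (vec2 x 0) = 0" for x unfolding d_def using c unfolding edge_correction_def by simp
  ultimately have "AE x in leb_unit. bottom_trace w1 x = bottom_trace u1 x" unfolding bottom_trace_def by simp
  from V1_spline_eq[OF k k V1_hat_trace[OF k V(2)] V1_hat_trace[OF k V(1)] this]
  have "bottom_trace w1 s = bottom_trace u1 s" using s by (simp only: atLeastLessThan_iff)
  then show ?thesis using rep_trace_unique[OF k vu u1(1) s] rep_trace_unique[OF k vw w1(1) s] by simp
qed

lemma edge_op_other_trace:
  assumes u: "u \<in> V1_pw M" and k: "k \<in> patches M" and ne: "side_edge k sw b \<noteq> e"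
    and vu: "rep k (sqsym sw a b) u vu" and vw: "rep k (sqsym sw a b) (P u) vw" and s: "s \<in> {0..<1}"
  shows "bottom_trace vw s = bottom_trace vu s"
proof -
  from edge_op_corrections[OF u] obtain vm vp cm cp where
     v: "rep km (sqsym sm am bm) u vm" "rep kp (sqsym sp ap bp) u vp" and
     w: "edge_correction r km cm" "rep km (sqsym sm am bm) (P u) (\<lambda>y. vm y + vec2 (cm y) 0)"
       "edge_correction r kp cp" "rep kp (sqsym sp ap bp) (P u) (\<lambda>y. vp y + vec2 (cp y) 0)" by blast
  consider "k = km" | "k = kp" | "k \<noteq> km" "k \<noteq> kp" by blast
  then show ?thesis
  proof cases
    case 1
    show ?thesis using correction_other_trace[OF km w(1) v(1) w(2)] ne vu vw s e_side(1) unfolding 1 by blast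
  next
    case 2
    show ?thesis using correction_other_trace[OF kp w(3) v(2) w(4)] ne vu vw s e_side(2) unfolding 2 by blast
  next
    case 3
    have "AE y in leb_square. vw y = vu y"
      by (rule rep_AE_cong[OF k vw vu AE_patch_other[OF k 3]])
    then show ?thesis using vu vw s unfolding rep_def by (intro trace_AE_eq[OF k]) auto
  qed
qed

end

section \<open>Test functions\<close>

text \<open>
  The smooth function \<open>exp (- 1 / t)\<close> for \<open>t > 0\<close>, with powers of \<open>1 / t\<close> in front so that the family is closed under
  differentiation.
\<close>

definition flat_exp :: "nat \<Rightarrow> real \<Rightarrow> real" where
  "flat_exp n t = (if t > 0 then (1 / t) ^ n * exp (- (1 / t)) else 0)"

lemma flat_exp_tendsto_0: "(flat_exp n \<longlongrightarrow> 0) (at_right 0)"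
proof -
  have "((\<lambda>x. x ^ n / exp x) \<longlongrightarrow> (0::real)) at_top" by (rule tendsto_power_div_exp_0)
  then have "((\<lambda>t. (inverse t) ^ n / exp (inverse t)) \<longlongrightarrow> (0::real)) (at_right 0)"
    by (rule filterlim_compose[OF _ filterlim_inverse_at_top_right])
  then show ?thesis
    by (rule Lim_transform_eventually)
       (auto simp: flat_exp_def exp_minus field_simps eventually_at_right_field intro!: exI[of _ 1])
qed

lemma flat_exp_deriv: "(flat_exp n has_real_derivative (flat_exp (n + 2) t - real n * flat_exp (n + 1) t)) (at t)"
proof -
  consider "t > 0" | "t < 0" | "t = 0" by linarith
  then show ?thesis
  proof cases
    case 1
    have "((\<lambda>t. (1 / t) ^ n * exp (- (1 / t))) has_real_derivative (flat_exp (n + 2) t - real n * flat_exp (n + 1) t)) (at t)"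
    proof -
      define z where "z = 1 / t"
      have z: "((\<lambda>t. 1 / t) has_real_derivative - (z\<^sup>2)) (at t)"
        using 1 unfolding z_def by (auto intro!: derivative_eq_intros simp: power2_eq_square)
      have e: "((\<lambda>t. exp (- (1 / t))) has_real_derivative exp (- z) * z\<^sup>2) (at t)"
        using DERIV_chain2[OF DERIV_exp DERIV_minus[OF z]] by (simp add: z_def)
      have "((\<lambda>t. (1 / t) ^ n * exp (- (1 / t))) has_real_derivative
          (real n * (- (z\<^sup>2) * z ^ (n - Suc 0))) * exp (- (1 / t)) + exp (- z) * z\<^sup>2 * (1 / t) ^ n) (at t)"
        using DERIV_mult[OF DERIV_power[OF z, of n] e] by (simp add: z_def mult_ac)
      moreover have "(real n * (- (z\<^sup>2) * z ^ (n - Suc 0))) * exp (- (1 / t)) + exp (- z) * z\<^sup>2 * (1 / t) ^ n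
          = flat_exp (n + 2) t - real n * flat_exp (n + 1) t"
        using 1 unfolding flat_exp_def z_def[symmetric] by (cases n) (simp_all add: algebra_simps power2_eq_square)
      ultimately show ?thesis by simp
    qed
    then show ?thesis
      by (rule has_field_derivative_transform_within_open[of _ _ _ "{0<..}"]) (use 1 in \<open>auto simp: flat_exp_def\<close>)
  next
    case 2
    have "((\<lambda>t. 0) has_real_derivative (flat_exp (n + 2) t - real n * flat_exp (n + 1) t)) (at t)"
      using 2 by (simp add: flat_exp_def)
    then show ?thesis
      by (rule has_field_derivative_transform_within_open[of _ _ _ "{..<0}"]) (use 2 in \<open>auto simp: flat_exp_def\<close>)
  next
    case 3
    have r: "((\<lambda>h. flat_exp n h / h) \<longlongrightarrow> 0) (at_right 0)"
      using flat_exp_tendsto_0[of "n+1"]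
      by (rule Lim_transform_eventually) (auto simp: flat_exp_def eventually_at_right_field intro!: exI[of _ 1])
    have l: "((\<lambda>h. flat_exp n h / h) \<longlongrightarrow> 0) (at_left 0)"
      by (rule Lim_transform_eventually[of "\<lambda>_. 0"])
         (auto simp: flat_exp_def eventually_at_left_field intro!: exI[of _ "-1"])
    have "((\<lambda>h. flat_exp n h / h) \<longlongrightarrow> 0) (at 0)" using l r by (simp add: filterlim_split_at)
    moreover have "flat_exp j 0 = 0" for j by (simp add: flat_exp_def)
    ultimately show ?thesis unfolding 3 by (simp add: DERIV_def)
  qed
qed

lemma flat_exp_bounds: "0 \<le> flat_exp 0 t" "flat_exp 0 t \<le> 1" "1/2 \<le> t \<Longrightarrow> exp (-2) \<le> flat_exp 0 t"
  by (auto simp: flat_exp_def field_simps)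

lemma partial_deriv_eq: "(f has_derivative f') (at x) \<Longrightarrow> partial_deriv i f x = f' (axis i 1)"
  unfolding partial_deriv_def by (simp add: frechet_derivative_at[symmetric])

lemma Ck_fun_continuous: "Ck_fun k f \<Longrightarrow> continuous_on UNIV f"
proof (cases k)
  case (Suc j)
  assume "Ck_fun k f"
  then have "f differentiable at x" for x using Suc by simp
  then show ?thesis by (intro continuous_at_imp_continuous_on ballI) (rule differentiable_imp_continuous_within)
qed simp

lemma Ck_fun_mono: "Ck_fun (Suc k) f \<Longrightarrow> Ck_fun k f"
proof (induction k arbitrary: f)
  case 0
  then show ?case using Ck_fun_continuous[OF 0] by simp
next
  case (Suc k)
  then show ?case by (metis Ck_fun.simps(2))
qed

lemma Ck_fun_const: "Ck_fun k (\<lambda>x. c)"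
proof (induction k arbitrary: c)
  case (Suc k)
  have "partial_deriv i (\<lambda>x. c) = (\<lambda>x. 0)" for i
    by (intro ext) (subst partial_deriv_eq[OF has_derivative_const], simp)
  then show ?case using Suc by simp
qed simp

lemma Ck_fun_add: "Ck_fun k f \<Longrightarrow> Ck_fun k g \<Longrightarrow> Ck_fun k (\<lambda>x. f x + g x)"
proof (induction k arbitrary: f g)
  case (Suc k)
  have d: "f differentiable at x" "g differentiable at x" for x using Suc.prems by auto
  have "partial_deriv i (\<lambda>x. f x + g x) = (\<lambda>x. partial_deriv i f x + partial_deriv i g x)" for i
    using has_derivative_add[OF d(1)[THEN frechet_derivative_works[THEN iffD1]] d(2)[THEN frechet_derivative_works[THEN iffD1]]]
    by (intro ext) (subst partial_deriv_eq, assumption, simp add: partial_deriv_def)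
  then show ?case using Suc d by auto
qed (auto intro: continuous_on_add)

lemma Ck_fun_mult: "Ck_fun k f \<Longrightarrow> Ck_fun k g \<Longrightarrow> Ck_fun k (\<lambda>x. f x * g x)"
proof (induction k arbitrary: f g)
  case (Suc k)
  have d: "f differentiable at x" "g differentiable at x" for x using Suc.prems by auto
  have "partial_deriv i (\<lambda>x. f x * g x) = (\<lambda>x. f x * partial_deriv i g x + partial_deriv i f x * g x)" for i
    using has_derivative_mult[OF d(1)[THEN frechet_derivative_works[THEN iffD1]] d(2)[THEN frechet_derivative_works[THEN iffD1]]]
    by (intro ext) (subst partial_deriv_eq, assumption, simp add: partial_deriv_def)
  moreover have "Ck_fun k f" "Ck_fun k g" using Suc.prems Ck_fun_mono by blast+
  moreover have "Ck_fun k (partial_deriv i f)" "Ck_fun k (partial_deriv i g)" for i using Suc.prems by auto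
  ultimately have "Ck_fun k (partial_deriv i (\<lambda>x. f x * g x))" for i using Suc.IH Ck_fun_add by simp
  then show ?case using d by auto
qed (auto intro: continuous_on_mult)

lemma Ck_fun_flat_exp: "Ck_fun k (\<lambda>x. flat_exp n (c * x $ i + d))"
proof (induction k arbitrary: n)
  case 0
  have "continuous_on UNIV (flat_exp n)"
    using flat_exp_deriv by (intro continuous_at_imp_continuous_on ballI DERIV_isCont) blast
  then show ?case by (auto intro!: continuous_on_compose2[of UNIV "flat_exp n"] continuous_intros)
next
  case (Suc k)
  have der: "((\<lambda>x::real^2. flat_exp n (c * x $ i + d)) has_derivative
      (\<lambda>h. (flat_exp (n + 2) (c * x $ i + d) - real n * flat_exp (n + 1) (c * x $ i + d)) * (c * h $ i))) (at x)" for x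
  proof -
    have "((\<lambda>x::real^2. c * x $ i + d) has_derivative (\<lambda>h. c * h $ i)) (at x)"
      by (auto intro!: derivative_eq_intros bounded_linear_imp_has_derivative bounded_linear_vec_nth)
    from has_derivative_compose[OF this flat_exp_deriv[unfolded has_field_derivative_def]] show ?thesis by (simp add: mult_ac)
  qed
  have "partial_deriv j (\<lambda>x. flat_exp n (c * x $ i + d)) =
     (\<lambda>x. (flat_exp (n + 2) (c * x $ i + d) + (- real n) * flat_exp (n + 1) (c * x $ i + d)) * (c * axis j 1 $ i))" for j
    by (intro ext) (subst partial_deriv_eq[OF der], simp)
  moreover have "Ck_fun k (\<lambda>x. (flat_exp (n + 2) (c * x $ i + d) + (- real n) * flat_exp (n + 1) (c * x $ i + d)) * (c * axis j 1 $ i))" for j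
    by (intro Ck_fun_mult Ck_fun_add Ck_fun_const Suc)
  moreover have "(\<lambda>x::real^2. flat_exp n (c * x $ i + d)) differentiable at x" for x
    using der unfolding differentiable_def by blast
  ultimately show ?case by simp
qed

text \<open>
  A product of one-sided cutoffs, positive exactly in the open square of half side \<open>\<epsilon>\<close> around \<open>a\<close>.
\<close>

definition bump :: "real^2 \<Rightarrow> real \<Rightarrow> real^2 \<Rightarrow> real" where
  "bump a \<epsilon> x = (flat_exp 0 ((1 / \<epsilon>) * x $ 1 + (1 - a $ 1 / \<epsilon>)) * flat_exp 0 ((- 1 / \<epsilon>) * x $ 1 + (1 + a $ 1 / \<epsilon>))) *
     (flat_exp 0 ((1 / \<epsilon>) * x $ 2 + (1 - a $ 2 / \<epsilon>)) * flat_exp 0 ((- 1 / \<epsilon>) * x $ 2 + (1 + a $ 2 / \<epsilon>)))"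

abbreviation cube :: "real^2 \<Rightarrow> real \<Rightarrow> (real^2) set" where
  "cube a \<epsilon> \<equiv> cbox (vec2 (a$1 - \<epsilon>) (a$2 - \<epsilon>)) (vec2 (a$1 + \<epsilon>) (a$2 + \<epsilon>))"

lemma mem_cube: "x \<in> cube a \<epsilon> \<longleftrightarrow> \<bar>x$1 - a$1\<bar> \<le> \<epsilon> \<and> \<bar>x$2 - a$2\<bar> \<le> \<epsilon>"
  by (auto simp: mem_box_cart forall_2)

lemma Ck_fun_bump: "Ck_fun k (bump a \<epsilon>)"
  unfolding bump_def[abs_def] by (intro Ck_fun_mult Ck_fun_flat_exp)

lemma bump_bounds: "0 \<le> bump a \<epsilon> x" "bump a \<epsilon> x \<le> 1"
proof -
  have m: "x * y \<le> 1" if "0 \<le> x" "x \<le> 1" "0 \<le> y" "y \<le> (1::real)" for x y using that mult_le_one by blast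
  show "0 \<le> bump a \<epsilon> x" unfolding bump_def by (intro mult_nonneg_nonneg flat_exp_bounds)
  show "bump a \<epsilon> x \<le> 1" unfolding bump_def by (intro m mult_nonneg_nonneg flat_exp_bounds)
qed

lemma bump_arg:
  assumes "0 < (\<epsilon>::real)"
  shows "(1 / \<epsilon>) * x + (1 - a / \<epsilon>) = (\<epsilon> + (x - a)) / \<epsilon>" "(- 1 / \<epsilon>) * x + (1 + a / \<epsilon>) = (\<epsilon> - (x - a)) / \<epsilon>"
  using assms by (simp_all add: field_simps)

lemma bump_support: assumes "0 < \<epsilon>" shows "bump a \<epsilon> x \<noteq> 0 \<Longrightarrow> x \<in> cube a \<epsilon>"
proof -
  assume ne: "bump a \<epsilon> x \<noteq> 0"
  have pos: "0 < t" if "flat_exp 0 t \<noteq> 0" for t using that unfolding flat_exp_def by (auto split: if_splits)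
  have "flat_exp 0 ((1 / \<epsilon>) * x $ 1 + (1 - a $ 1 / \<epsilon>)) \<noteq> 0" "flat_exp 0 ((- 1 / \<epsilon>) * x $ 1 + (1 + a $ 1 / \<epsilon>)) \<noteq> 0"
     "flat_exp 0 ((1 / \<epsilon>) * x $ 2 + (1 - a $ 2 / \<epsilon>)) \<noteq> 0" "flat_exp 0 ((- 1 / \<epsilon>) * x $ 2 + (1 + a $ 2 / \<epsilon>)) \<noteq> 0"
    using ne unfolding bump_def by auto
  from this[THEN pos] show ?thesis
    using assms unfolding mem_cube bump_arg[OF assms] zero_less_divide_iff by auto
qed

lemma bump_lower: assumes "0 < \<epsilon>" "x \<in> cube a (\<epsilon> / 2)" shows "exp (-8) \<le> bump a \<epsilon> x"
proof -
  have *: "1/2 \<le> (1 / \<epsilon>) * x $ i + (1 - a $ i / \<epsilon>)" "1/2 \<le> (- 1 / \<epsilon>) * x $ i + (1 + a $ i / \<epsilon>)" if "\<bar>x$i - a$i\<bar> \<le> \<epsilon> / 2" for i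
    unfolding bump_arg[OF assms(1)] pos_le_divide_eq[OF assms(1)] using that by linarith+
  have c: "\<bar>x$1 - a$1\<bar> \<le> \<epsilon> / 2" "\<bar>x$2 - a$2\<bar> \<le> \<epsilon> / 2" using assms(2) unfolding mem_cube by auto
  have "(exp (-2) * exp (-2)) * (exp (-2) * exp (-2)) \<le> bump a \<epsilon> x"
    unfolding bump_def by (intro mult_mono flat_exp_bounds(3) * c mult_nonneg_nonneg flat_exp_bounds(1)) auto
  then show ?thesis by (simp flip: exp_add)
qed

lemma bump_test: assumes "0 < \<epsilon>" "cube a \<epsilon> \<subseteq> S" shows "bump a \<epsilon> \<in> test_functions S"
proof -
  have "closure {x. bump a \<epsilon> x \<noteq> 0} \<subseteq> cube a \<epsilon>"
    using bump_support[OF assms(1)] by (intro closure_minimal closed_cbox) auto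
  moreover from this have "compact (closure {x. bump a \<epsilon> x \<noteq> 0})"
    using bounded_subset[OF bounded_cbox] by (simp add: compact_eq_bounded_closed)
  ultimately show ?thesis using Ck_fun_bump assms(2) unfolding test_functions_def by blast
qed

definition grad :: "(real^2 \<Rightarrow> real) \<Rightarrow> real^2 \<Rightarrow> real^2" where
  "grad \<phi> x = vec2 (partial_deriv 1 \<phi> x) (partial_deriv 2 \<phi> x)"

lemma Ck_grad:
  assumes "\<forall>k. Ck_fun k \<phi>"
  shows "(\<phi> has_derivative (\<lambda>h. grad \<phi> x \<bullet> h)) (at x)" "continuous_on UNIV (\<lambda>x. grad \<phi> x $ i)" "continuous_on UNIV \<phi>"
proof -
  have 1: "Ck_fun 1 \<phi>" using assms by blast
  have d: "(\<phi> has_derivative frechet_derivative \<phi> (at x)) (at x)"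
    using 1 by (auto simp: frechet_derivative_works[symmetric])
  have "frechet_derivative \<phi> (at x) h = grad \<phi> x \<bullet> h" for h
  proof -
    have "h = h$1 *\<^sub>R axis 1 1 + h$2 *\<^sub>R axis 2 1" by (simp add: vec2_eq_iff axis_def)
    then have "frechet_derivative \<phi> (at x) h = frechet_derivative \<phi> (at x) (h$1 *\<^sub>R axis 1 1 + h$2 *\<^sub>R axis 2 1)" by simp
    also have "\<dots> = h$1 * frechet_derivative \<phi> (at x) (axis 1 1) + h$2 * frechet_derivative \<phi> (at x) (axis 2 1)"
      using has_derivative_linear[OF d] by (simp add: linear_add linear_scale)
    finally show ?thesis by (simp add: grad_def partial_deriv_def inner_vec_def sum_2 mult.commute)
  qed
  then have "frechet_derivative \<phi> (at x) = (\<lambda>h. grad \<phi> x \<bullet> h)" by blast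
  then show "(\<phi> has_derivative (\<lambda>h. grad \<phi> x \<bullet> h)) (at x)" using d by simp
  have "continuous_on UNIV (partial_deriv i \<phi>)" for i using 1 by simp
  then show "continuous_on UNIV (\<lambda>x. grad \<phi> x $ i)" using exhaust_2[of i] unfolding grad_def by auto
  show "continuous_on UNIV \<phi>" using 1 Ck_fun_continuous by blast
qed

section \<open>Integration by parts on a patch\<close>

lemma integral_flip:
  fixes h :: "real \<Rightarrow> real"
  assumes h: "borel_fun h"
  shows "(LINT s|leb_unit. h (flip a s)) = (LINT s|leb_unit. h s)"
proof (cases a)
  case True
  have h': "borel_fun (\<lambda>s. h (1 - s))" using measurable_compose[OF _ h, of "\<lambda>s. 1 - s" borel] by simp
  have "(LINT s|leb_unit. h s) = (LINT s|lborel. indicator {0..1} s * h s)"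
    using h by (intro integral_lebesgue_on_borel) auto
  also have "\<dots> = (LINT s|lborel. indicator {0..1} (1 + (-1) * s) * h (1 + (-1) * s))"
    by (subst lborel_integral_real_affine[of "-1" _ 1]) simp_all
  also have "\<dots> = (LINT s|lborel. indicator {0..1} s * h (1 - s))"
    by (intro Bochner_Integration.integral_cong) (auto simp: indicator_def)
  also have "\<dots> = (LINT s|leb_unit. h (1 - s))"
    using h' by (intro integral_lebesgue_on_borel[symmetric]) auto
  finally show ?thesis using True by (simp add: flip_def)
qed (simp add: flip_def)

lemma bms_swap: assumes "bms f" shows "bms (\<lambda>y. f (vec2 (y$2) (y$1)))"
proof -
  have "borel_fun (\<lambda>y::real^2. vec2 (y$2) (y$1))"
  proof (rule vec2_measurableI)
    show "borel_fun (\<lambda>y::real^2. vec2 (y$2) (y$1) $ i)" for i using exhaust_2[of i] by auto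
  qed
  from measurable_compose[OF this, of f borel] have "borel_fun (\<lambda>y::real^2. f (vec2 (y$2) (y$1)))" using assms unfolding bms_def by simp
  moreover have "vec2 (y$2) (y$1) \<in> cbox 0 1" if "y \<in> cbox 0 1" for y :: "real^2"
    using that by (simp add: mem_unit_cbox)
  ultimately show ?thesis using assms unfolding bms_def by blast
qed

text \<open>
  Exactly what integration by parts in the second variable requires; neither the tensor-product fields nor their
  products with test functions have more regularity.
\<close>

definition slice_C1 :: "(real^2 \<Rightarrow> real) \<Rightarrow> (real^2 \<Rightarrow> real) \<Rightarrow> bool" where
  "slice_C1 H H' \<longleftrightarrow> bms H \<and> bms H' \<and>
     (\<forall>s\<in>{0<..<1}. continuous_on {0..1} (\<lambda>t. H (vec2 s t)) \<and>
        (\<exists>S. finite S \<and> (\<forall>t\<in>{0<..<1} - S. ((\<lambda>t. H (vec2 s t)) has_real_derivative H' (vec2 s t)) (at t))))"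

lemma slice_C1_continuous: "slice_C1 H H' \<Longrightarrow> s \<in> {0<..<1} \<Longrightarrow> continuous_on {0..1} (\<lambda>t. H (vec2 s t))"
  unfolding slice_C1_def by blast

lemma slice_C1_mult:
  assumes "slice_C1 F F'" "slice_C1 H H'"
  shows "slice_C1 (\<lambda>y. F y * H y) (\<lambda>y. F y * H' y + F' y * H y)"
proof -
  have "continuous_on {0..1} (\<lambda>t. F (vec2 s t) * H (vec2 s t)) \<and>
        (\<exists>S. finite S \<and> (\<forall>t\<in>{0<..<1} - S. ((\<lambda>t. F (vec2 s t) * H (vec2 s t)) has_real_derivative F (vec2 s t) * H' (vec2 s t) + F' (vec2 s t) * H (vec2 s t)) (at t)))"
    if s: "s \<in> {0<..<1}" for s
  proof
    show "continuous_on {0..1} (\<lambda>t. F (vec2 s t) * H (vec2 s t))"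
      by (intro continuous_on_mult slice_C1_continuous[OF assms(1) s] slice_C1_continuous[OF assms(2) s])
    obtain S where S: "finite S" "\<forall>t\<in>{0<..<1} - S. ((\<lambda>t. F (vec2 s t)) has_real_derivative F' (vec2 s t)) (at t)"
      using assms(1) s unfolding slice_C1_def by blast
    obtain T where T: "finite T" "\<forall>t\<in>{0<..<1} - T. ((\<lambda>t. H (vec2 s t)) has_real_derivative H' (vec2 s t)) (at t)"
      using assms(2) s unfolding slice_C1_def by blast
    show "\<exists>S. finite S \<and> (\<forall>t\<in>{0<..<1} - S. ((\<lambda>t. F (vec2 s t) * H (vec2 s t)) has_real_derivative F (vec2 s t) * H' (vec2 s t) + F' (vec2 s t) * H (vec2 s t)) (at t))"
    proof (intro exI[of _ "S \<union> T"] conjI ballI)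
      fix t assume "t \<in> {0<..<1} - (S \<union> T)"
      then have "((\<lambda>t. F (vec2 s t)) has_real_derivative F' (vec2 s t)) (at t)" "((\<lambda>t. H (vec2 s t)) has_real_derivative H' (vec2 s t)) (at t)"
        using S(2) T(2) by auto
      from DERIV_mult'[OF this] show "((\<lambda>t. F (vec2 s t) * H (vec2 s t)) has_real_derivative F (vec2 s t) * H' (vec2 s t) + F' (vec2 s t) * H (vec2 s t)) (at t)" .
    qed (use S T in simp)
  qed
  moreover have "bms (\<lambda>y. F y * H y)" "bms (\<lambda>y. F y * H' y + F' y * H y)"
    using assms unfolding slice_C1_def by (intro bms_add bms_mult; blast)+
  ultimately show ?thesis unfolding slice_C1_def by blast
qed

lemma slice_C1_integral:
  assumes H: "slice_C1 H H'"
  shows "(LINT y|leb_square. H' y) = (LINT s|leb_unit. H (vec2 s 1) - H (vec2 s 0))"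
proof -
  obtain C where C: "\<And>y. y \<in> cbox 0 1 \<Longrightarrow> \<bar>H' y\<bar> \<le> C" using H unfolding slice_C1_def bms_def by blast
  have [measurable]: "borel_fun H" "borel_fun H'" using H unfolding slice_C1_def bms_def by auto
  have inner: "(LINT t|leb_unit. H' (vec2 s t)) = H (vec2 s 1) - H (vec2 s 0)" if s: "s \<in> {0<..<1}" for s
  proof -
    obtain S where S: "finite S" "\<And>t. t \<in> {0<..<1} - S \<Longrightarrow> ((\<lambda>t. H (vec2 s t)) has_real_derivative H' (vec2 s t)) (at t)"
      using H s unfolding slice_C1_def by blast
    have "continuous_on {0..1} (\<lambda>t. H (vec2 s t))" using H s unfolding slice_C1_def by blast
    then have i: "((\<lambda>t. H' (vec2 s t)) has_integral (H (vec2 s 1) - H (vec2 s 0))) {0..1}"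
      using S by (intro fundamental_theorem_of_calculus_interior_strong[of S])
        (auto simp: has_real_derivative_iff_has_vector_derivative[symmetric])
    have "bmf (\<lambda>t. H' (vec2 s t))"
      unfolding bmf_def using borel_measurable_vec2_slice[of H' s] C s by (auto simp: mem_unit_cbox intro!: exI[of _ C])
    then have "integrable leb_unit (\<lambda>t. H' (vec2 s t))" by (rule bmf_integrable)
    then show ?thesis using i by (simp add: lebesgue_integral_eq_integral integral_unique)
  qed
  have c: "borel_fun (\<lambda>s. H (vec2 s c))" for c
    using measurable_compose[OF measurable_Pair2'[of c borel borel] measurable_compose[OF vec2_measurable, of H]] by simp
  have "(LINT y|leb_square. H' y) = (LINT s|leb_unit. LINT t|leb_unit. H' (vec2 s t))"
    using C by (intro integral_unit_box_iterated) auto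
  also have "\<dots> = (LINT s|leb_unit. H (vec2 s 1) - H (vec2 s 0))"
  proof (rule integral_cong_AE_lebesgue_on)
    show "AE s in leb_unit. (LINT t|leb_unit. H' (vec2 s t)) = H (vec2 s 1) - H (vec2 s 0)"
      unfolding AE_unit_interval_interior using inner by simp
    show "(\<lambda>s. H (vec2 s 1) - H (vec2 s 0)) \<in> borel_measurable leb_unit"
      by (intro measurable_restrict_space1 measurable_completion) (use c in simp)
  qed simp
  finally show ?thesis .
qed

text \<open>
  The integrand of the weak curl is \<open>cross2\<close> of the field and the gradient of the test function.
  Both are pulled back by the transposed derivative, which multiplies \<open>cross2\<close> by the Jacobian determinant;
  hence the pulled back integrand is again that of a weak curl, in logical coordinates.
\<close>

definition cross2 :: "real^2 \<Rightarrow> real^2 \<Rightarrow> real" where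
  "cross2 x z = x $ 1 * z $ 2 - x $ 2 * z $ 1"

lemma cross2_transpose: "cross2 (transpose A *v x) (transpose A *v z) = det A * cross2 x z"
  unfolding cross2_def by (simp add: det_2 matrix_vector_mult_def transpose_def sum_2 algebra_simps)

context square_chart
begin

text \<open>
  Cut off outside the closed square in order to be measurable: nothing is known about the chart outside.
\<close>

definition test_pull :: "(real^2 \<Rightarrow> real) \<Rightarrow> real^2 \<Rightarrow> real" where
  "test_pull \<phi> y = indicator (cbox 0 1) y * \<phi> (E y)"

definition grad_pull :: "(real^2 \<Rightarrow> real) \<Rightarrow> real^2 \<Rightarrow> real^2" where
  "grad_pull \<phi> y = indicator (cbox 0 1) y *\<^sub>R (transpose (D y) *v grad \<phi> (E y))"

lemma test_pull_deriv:
  assumes "\<forall>k. Ck_fun k \<phi>" and y: "y \<in> box 0 1"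
  shows "(test_pull \<phi> has_derivative (\<lambda>h. grad_pull \<phi> y \<bullet> h)) (at y)"
proof -
  have "((\<lambda>y. \<phi> (E y)) has_derivative (\<lambda>h. grad \<phi> (E y) \<bullet> (D y *v h))) (at y)"
    using has_derivative_compose[OF D_at[OF y] Ck_grad(1)[OF assms(1), of "E y"]] .
  moreover have "grad \<phi> (E y) \<bullet> (D y *v h) = grad_pull \<phi> y \<bullet> h" for h
    using box_cbox[OF y] dot_lmul_matrix[of "grad \<phi> (E y)" "D y" h] by (simp add: grad_pull_def transpose_matrix_vector)
  ultimately have "((\<lambda>y. \<phi> (E y)) has_derivative (\<lambda>h. grad_pull \<phi> y \<bullet> h)) (at y)" by simp
  then show ?thesis
    by (rule has_derivative_transform_within_open[of _ _ _ _ "box 0 1"])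
       (use y box_cbox in \<open>auto simp: test_pull_def open_box\<close>)
qed

lemma test_pull_continuous: "\<forall>k. Ck_fun k \<phi> \<Longrightarrow> continuous_on (cbox 0 1) (test_pull \<phi>)"
proof -
  assume "\<forall>k. Ck_fun k \<phi>"
  then have "continuous_on (cbox 0 1) (\<lambda>y. \<phi> (E y))" by (intro continuous_on_compose2[OF Ck_grad(3) cont]) auto
  then show ?thesis by (rule continuous_on_eq) (simp add: test_pull_def)
qed

lemma grad_pull_continuous: "\<forall>k. Ck_fun k \<phi> \<Longrightarrow> continuous_on (cbox 0 1) (\<lambda>y. grad_pull \<phi> y $ i)"
proof -
  assume phi: "\<forall>k. Ck_fun k \<phi>"
  have g: "continuous_on (cbox 0 1) (\<lambda>y. grad \<phi> (E y) $ j)" for j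
    by (intro continuous_on_compose2[OF Ck_grad(2)[OF phi] cont]) auto
  have d: "continuous_on (cbox 0 1) (\<lambda>y. D y $ j $ i)" for j by (intro continuous_on_component D_cont)
  have "continuous_on (cbox 0 1) (\<lambda>y. (transpose (D y) *v grad \<phi> (E y)) $ i)"
    unfolding matrix_vector_mult_def transpose_def vec_lambda_beta
    by (intro continuous_on_sum continuous_on_mult g d)
  then show ?thesis by (rule continuous_on_eq) (simp add: grad_pull_def)
qed

lemma bms_cbox:
  assumes f: "continuous_on (cbox 0 1) f" and z: "\<And>y. y \<notin> cbox 0 1 \<Longrightarrow> f y = 0"
  shows "bms f"
proof -
  have "borel_fun (\<lambda>y. indicator (cbox 0 1) y *\<^sub>R f y)"
    using f by (intro borel_measurable_continuous_on_indicator) auto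
  moreover have "(\<lambda>y. indicator (cbox 0 1) y *\<^sub>R f y) = f" using z by (auto simp: indicator_def fun_eq_iff)
  moreover have "bounded (f ` cbox 0 1)" using f by (intro compact_imp_bounded compact_continuous_image) auto
  ultimately show ?thesis unfolding bms_def bounded_iff by auto
qed

lemma test_pull_slice:
  assumes phi: "\<forall>k. Ck_fun k \<phi>"
  shows "slice_C1 (test_pull \<phi>) (\<lambda>y. grad_pull \<phi> y $ 2)"
    and "slice_C1 (\<lambda>y. test_pull \<phi> (vec2 (y$2) (y$1))) (\<lambda>y. grad_pull \<phi> (vec2 (y$2) (y$1)) $ 1)"
proof -
  have m: "bms (test_pull \<phi>)" "bms (\<lambda>y. grad_pull \<phi> y $ i)" for i
    using bms_cbox[OF test_pull_continuous[OF phi]] bms_cbox[OF grad_pull_continuous[OF phi], of i]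
    by (simp_all add: test_pull_def[abs_def] grad_pull_def[abs_def])
  have v: "((\<lambda>t. vec2 s t) has_derivative (\<lambda>h. vec2 0 h)) (at t)" "((\<lambda>t. vec2 t s) has_derivative (\<lambda>h. vec2 h 0)) (at t)" for s t
  proof -
    have 1: "vec2 s t = s *\<^sub>R axis 1 1 + t *\<^sub>R axis 2 1" for s t by (simp add: vec2_eq_iff axis_def)
    show "((\<lambda>t. vec2 s t) has_derivative (\<lambda>h. vec2 0 h)) (at t)" "((\<lambda>t. vec2 t s) has_derivative (\<lambda>h. vec2 h 0)) (at t)"
      unfolding 1 by (auto intro!: derivative_eq_intros)
  qed
  have d2: "((\<lambda>t. test_pull \<phi> (vec2 s t)) has_real_derivative grad_pull \<phi> (vec2 s t) $ 2) (at t)"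
    and d1: "((\<lambda>t. test_pull \<phi> (vec2 t s)) has_real_derivative grad_pull \<phi> (vec2 t s) $ 1) (at t)"
    if "s \<in> {0<..<1}" "t \<in> {0<..<1}" for s t
  proof -
    have i: "vec2 s t \<in> box 0 1" "vec2 t s \<in> box 0 1" using that by (auto simp: mem_unit_box)
    show "((\<lambda>t. test_pull \<phi> (vec2 s t)) has_real_derivative grad_pull \<phi> (vec2 s t) $ 2) (at t)"
      using has_derivative_compose[OF v(1) test_pull_deriv[OF phi i(1)]]
      unfolding has_field_derivative_def by (simp add: inner_vec_def sum_2 mult_commute_abs)
    show "((\<lambda>t. test_pull \<phi> (vec2 t s)) has_real_derivative grad_pull \<phi> (vec2 t s) $ 1) (at t)"
      using has_derivative_compose[OF v(2) test_pull_deriv[OF phi i(2)]]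
      unfolding has_field_derivative_def by (simp add: inner_vec_def sum_2 mult_commute_abs)
  qed
  have c: "continuous_on {0..1} (\<lambda>t. test_pull \<phi> (vec2 s t))" "continuous_on {0..1} (\<lambda>t. test_pull \<phi> (vec2 t s))"
    if "s \<in> {0<..<1}" for s
    using that by (auto intro!: continuous_on_compose2[OF test_pull_continuous[OF phi]] continuous_on_vec2 continuous_intros simp: mem_unit_cbox)
  show "slice_C1 (test_pull \<phi>) (\<lambda>y. grad_pull \<phi> y $ 2)"
    unfolding slice_C1_def using m c(1) d2 by (blast intro: finite.emptyI)
  show "slice_C1 (\<lambda>y. test_pull \<phi> (vec2 (y$2) (y$1))) (\<lambda>y. grad_pull \<phi> (vec2 (y$2) (y$1)) $ 1)"
    unfolding slice_C1_def vector_2 using bms_swap[OF m(1)] bms_swap[OF m(2)[of 1]] c(2) d1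
    by (blast intro: finite.emptyI)
qed

end

lemma slice_C1_integrable:
  assumes H: "slice_C1 H H'"
  shows "integrable leb_square H'" "c \<in> {0..1} \<Longrightarrow> integrable leb_unit (\<lambda>s. H (vec2 s c))"
proof -
  obtain C where C: "\<And>y. y \<in> cbox 0 1 \<Longrightarrow> \<bar>H y\<bar> \<le> C" and m: "borel_fun H" using H unfolding slice_C1_def bms_def by blast
  show "integrable leb_square H'" using H unfolding slice_C1_def by (blast intro: bms_integrable)
  have "borel_fun (\<lambda>s. H (vec2 s c))"
    using measurable_compose[OF measurable_Pair2'[of c borel borel] measurable_compose[OF vec2_measurable m]] by simp
  then have "bmf (\<lambda>s. H (vec2 s c))" if "c \<in> {0..1}"
    unfolding bmf_def using C that by (auto simp: mem_unit_cbox intro!: exI[of _ C])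
  then show "c \<in> {0..1} \<Longrightarrow> integrable leb_unit (\<lambda>s. H (vec2 s c))" by (rule bmf_integrable)
qed

text \<open>
  The component of \<open>v\<close> tangential to the side given by \<open>sw\<close> and \<open>b\<close>.
\<close>

definition side_val :: "(real^2 \<Rightarrow> real^2) \<Rightarrow> bool \<Rightarrow> bool \<Rightarrow> real \<Rightarrow> real" where
  "side_val v sw b s = (if sw then v (vec2 (flip b 0) s) $ 2 else v (vec2 s (flip b 0)) $ 1)"

context mp_splines
begin

lemma tensor_slice_C1:
  assumes "finite I" "finite J" and f: "\<And>i. i \<in> I \<Longrightarrow> bmf (f i)" and h: "\<And>j. j \<in> J \<Longrightarrow> bmf (h j)" "\<And>j. j \<in> J \<Longrightarrow> \<exists>h'. piecewise_C1_unit (h j) h'"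
    and g: "g \<in> tensor_combs I f J h"
  shows "\<exists>g'. slice_C1 g g'"
proof -
  obtain c where c: "\<And>x. g x = (\<Sum>i\<in>I. \<Sum>j\<in>J. c i j * f i (x$1) * h j (x$2))"
    using g unfolding tensor_combs_def by auto
  have "\<forall>j\<in>J. \<exists>h'. piecewise_C1_unit (h j) h'" using h(2) by blast
  from bchoice[OF this] obtain h' where h': "\<And>j. j \<in> J \<Longrightarrow> piecewise_C1_unit (h j) (h' j)" by blast
  have bh': "bmf (h' j)" if "j \<in> J" for j using h'[OF that] unfolding piecewise_C1_unit_def bmf_def by blast
  define g' where "g' x = (\<Sum>i\<in>I. \<Sum>j\<in>J. c i j * f i (x$1) * h' j (x$2))" for x :: "real^2"
  have g': "g' \<in> tensor_combs I f J h'" unfolding tensor_combs_def g'_def[abs_def] by blast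
  have "bms g" by (rule tensor_bms[OF assms(1,2) f h(1) g])
  moreover have "bms g'" by (rule tensor_bms[OF assms(1,2) f bh' g'])
  moreover have "continuous_on {0..1} (\<lambda>t. g (vec2 s t))" for s
    unfolding c using h' unfolding piecewise_C1_unit_def by (simp, intro continuous_intros) auto
  moreover have "\<exists>S. finite S \<and> (\<forall>t\<in>{0<..<1} - S. ((\<lambda>t. g (vec2 s t)) has_real_derivative g' (vec2 s t)) (at t))" for s
  proof -
    have "\<forall>j\<in>J. \<exists>S. finite S \<and> (\<forall>x\<in>{0<..<1} - S. (h j has_real_derivative h' j x) (at x))"
      using h' unfolding piecewise_C1_unit_def by blast
    from bchoice[OF this] obtain S where S: "\<And>j. j \<in> J \<Longrightarrow> finite (S j)"
      "\<And>j x. j \<in> J \<Longrightarrow> x \<in> {0<..<1} - S j \<Longrightarrow> (h j has_real_derivative h' j x) (at x)" by blast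
    have "((\<lambda>t. g (vec2 s t)) has_real_derivative g' (vec2 s t)) (at t)" if t: "t \<in> {0<..<1} - (\<Union>j\<in>J. S j)" for t
    proof -
      have "((\<lambda>t. \<Sum>i\<in>I. \<Sum>j\<in>J. c i j * f i s * h j t) has_real_derivative (\<Sum>i\<in>I. \<Sum>j\<in>J. c i j * f i s * h' j t)) (at t)"
        using S(2) t by (intro DERIV_sum DERIV_cmult) auto
      then show ?thesis unfolding c g'_def by simp
    qed
    then show ?thesis using S(1) assms(2) by (intro exI[of _ "\<Union>j\<in>J. S j"]) auto
  qed
  ultimately show ?thesis unfolding slice_C1_def by blast
qed

lemma V1_hat_slices:
  assumes k: "k \<in> patches M" and v: "v \<in> V1_hat M k"
  shows "\<exists>g. slice_C1 (\<lambda>y. v y $ 1) g" "\<exists>g. slice_C1 (\<lambda>y. v (vec2 (y$2) (y$1)) $ 2) g"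
proof -
  have t: "(\<lambda>y. v y $ 1) \<in> tensor_combs {..<n k} (lam1 M k) {..n k} (lam0 M k)"
    "(\<lambda>y. v (vec2 (y$2) (y$1)) $ 2) \<in> tensor_combs {..<n k} (lam1 M k) {..n k} (lam0 M k)"
    using v tensor_swap[of "\<lambda>y. v y $ 2"] unfolding V1_hat_def by auto
  note * = tensor_slice_C1[OF finite_lessThan finite_atMost bmf_lam1[OF k] bmf_lam0[OF k] lam0_piecewise_C1[OF k]]
  show "\<exists>g. slice_C1 (\<lambda>y. v y $ 1) g" by (rule *[OF _ _ _ t(1)]) auto
  show "\<exists>g. slice_C1 (\<lambda>y. v (vec2 (y$2) (y$1)) $ 2) g" by (rule *[OF _ _ _ t(2)]) auto
qed

text \<open>
  Integration by parts on the unit square, for the pull-back of a test function to any chart. The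
  tensor-product form of the fields allows it to be carried out in one variable at a time.
\<close>

lemma V1_hat_by_parts:
  assumes k: "k \<in> patches M" and v: "v \<in> V1_hat M k" and E: "square_chart E"
  shows "\<exists>\<omega> C. borel_fun \<omega> \<and> (\<forall>y\<in>cbox 0 1. \<bar>\<omega> y\<bar> \<le> C) \<and> (\<forall>\<phi>. (\<forall>j. Ck_fun j \<phi>) \<longrightarrow>
     (LINT y|leb_square. cross2 (v y) (square_chart.grad_pull E \<phi> y)) =
     (LINT y|leb_square. \<omega> y * square_chart.test_pull E \<phi> y) -
     (\<Sum>sw\<in>UNIV. \<Sum>b\<in>UNIV. det (sqsym_mat sw False b) *
        (LINT s|leb_unit. side_val v sw b s * square_chart.test_pull E \<phi> (sqsym sw False b (vec2 s 0)))))"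
  (is "\<exists>\<omega> C. _ \<and> _ \<and> (\<forall>\<phi>. _ \<longrightarrow> ?parts \<omega> \<phi>)")
proof -
  interpret E: square_chart E by (fact E)
  let ?sw = "\<lambda>y::real^2. vec2 (y$2) (y$1)"
  obtain g1 where g1: "slice_C1 (\<lambda>y. v y $ 1) g1" using V1_hat_slices(1)[OF k v] by blast
  obtain g2 where g2: "slice_C1 (\<lambda>y. v (?sw y) $ 2) g2" using V1_hat_slices(2)[OF k v] by blast
  have sqs: "sqsym True False False y = ?sw y" for y by (simp add: sqsym_def flip_def)
  define \<omega> where "\<omega> y = g2 (?sw y) - g1 y" for y
  have w: "bms \<omega>" unfolding \<omega>_def[abs_def] using g1 bms_swap[of g2] g2 unfolding slice_C1_def by (intro bms_diff) auto
  then obtain C where "borel_fun \<omega>" "\<forall>y\<in>cbox 0 1. \<bar>\<omega> y\<bar> \<le> C" unfolding bms_def by blast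
  moreover have "?parts \<omega> \<phi>" if phi: "\<forall>j. Ck_fun j \<phi>" for \<phi>
  proof -
    let ?\<psi> = "E.test_pull \<phi>" and ?d = "E.grad_pull \<phi>"
    let ?A = "\<lambda>y. v y $ 1 * ?d y $ 2 + g1 y * ?\<psi> y"
    let ?B = "\<lambda>y. v (?sw y) $ 2 * ?d (?sw y) $ 1 + g2 y * ?\<psi> (?sw y)"
    let ?B' = "\<lambda>y. v y $ 2 * ?d y $ 1 + g2 (?sw y) * ?\<psi> y"
    note s1 = slice_C1_mult[OF g1 E.test_pull_slice(1)[OF phi]] and s2 = slice_C1_mult[OF g2 E.test_pull_slice(2)[OF phi]]
    note i1 = slice_C1_integrable[OF s1] and i2 = slice_C1_integrable[OF s2]
    have I1: "(LINT y|leb_square. ?A y) =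
        (LINT s|leb_unit. v (vec2 s 1) $ 1 * ?\<psi> (vec2 s 1)) - (LINT s|leb_unit. v (vec2 s 0) $ 1 * ?\<psi> (vec2 s 0))"
      unfolding slice_C1_integral[OF s1] using i1(2)[of 1] i1(2)[of 0] by (intro Bochner_Integration.integral_diff) auto
    have "(LINT y|leb_square. ?B y) =
        (LINT s|leb_unit. v (vec2 1 s) $ 2 * ?\<psi> (vec2 1 s)) - (LINT s|leb_unit. v (vec2 0 s) $ 2 * ?\<psi> (vec2 0 s))"
      unfolding slice_C1_integral[OF s2] using i2(2)[of 1] i2(2)[of 0] by (simp add: Bochner_Integration.integral_diff)
    moreover have "(LINT y|leb_square. ?B y) = (LINT y|leb_square. ?B' y)"
      using integral_sqsym[OF i2(1), of True False False] unfolding sqs by simp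
    ultimately have I2: "(LINT y|leb_square. ?B' y) =
        (LINT s|leb_unit. v (vec2 1 s) $ 2 * ?\<psi> (vec2 1 s)) - (LINT s|leb_unit. v (vec2 0 s) $ 2 * ?\<psi> (vec2 0 s))" by simp
    have i3: "integrable leb_square (\<lambda>y. \<omega> y * ?\<psi> y)"
      using E.test_pull_slice(1)[OF phi] unfolding slice_C1_def by (intro bms_integrable bms_mult w) blast
    have "bms ?B" using s2 unfolding slice_C1_def by blast
    from bms_integrable[OF bms_swap[OF this]] have i2': "integrable leb_square ?B'" by simp
    have "(LINT y|leb_square. cross2 (v y) (?d y)) = (LINT y|leb_square. (?A y - ?B' y) + \<omega> y * ?\<psi> y)"
      by (intro Bochner_Integration.integral_cong) (simp_all add: cross2_def \<omega>_def algebra_simps)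
    also have "\<dots> = (LINT y|leb_square. ?A y) - (LINT y|leb_square. ?B' y) + (LINT y|leb_square. \<omega> y * ?\<psi> y)"
      using i1(1) i2' i3 by (simp add: Bochner_Integration.integral_diff Bochner_Integration.integral_add)
    finally show ?thesis unfolding I1 I2 by (simp add: UNIV_bool det_sqsym_mat side_val_def sqsym_def flip_def)
  qed
  ultimately show ?thesis by blast
qed


text \<open>
  The contribution of a side, given by its patch \<open>k\<close> and its flags \<open>sw\<close> and \<open>b\<close>, to the integration by parts on the patch.
\<close>

definition side_term :: "(nat \<Rightarrow> real^2 \<Rightarrow> real^2) \<Rightarrow> (real^2 \<Rightarrow> real) \<Rightarrow> nat \<times> bool \<times> bool \<Rightarrow> real" where
  "side_term v \<phi> = (\<lambda>(k, sw, b). square_chart.ori (side_chart k sw False b) *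
     (LINT s|leb_unit. side_val (v k) sw b s * \<phi> ((side_chart k sw False b) (vec2 s 0))))"

text \<open>
  The change of variables turns the integrals over the patch into integrals over the square, with a factor \<open>ori\<close>;
  the weak curl on the patch is the logical one divided by the Jacobian determinant.
\<close>

lemma patch_by_parts:
  assumes k: "k \<in> patches M" and r: "rep k (sqsym False False False) u v"
  shows "\<exists>w K. borel_fun w \<and> (\<forall>x. \<bar>w x\<bar> \<le> K) \<and> (\<forall>x. x \<notin> patch M k \<longrightarrow> w x = 0) \<and> (\<forall>\<phi>. (\<forall>j. Ck_fun j \<phi>) \<longrightarrow>
     integrable (leb_patch k) (\<lambda>x. cross2 (u x) (grad \<phi> x)) \<and>
     integrable (leb_patch k) (\<lambda>x. w x * \<phi> x) \<and>
     (LINT x|leb_patch k. cross2 (u x) (grad \<phi> x)) =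
     (LINT x|leb_patch k. w x * \<phi> x) -
     (\<Sum>sw\<in>UNIV. \<Sum>b\<in>UNIV. side_term (\<lambda>_. v) \<phi> (k, sw, b)))"
  (is "\<exists>w K. _ \<and> _ \<and> _ \<and> (\<forall>\<phi>. _ \<longrightarrow> ?parts w \<phi>)")
proof -
  interpret E: square_chart "pmap M k" by (rule chart[OF k])
  have v: "v \<in> V1_hat M k" and uv: "AE y in leb_square. pull (pmap M k) u y = v y" using r unfolding rep_id by auto
  have P: "pmap M k ` box 0 1 = patch M k" by (simp add: patch_def)
  note vm = V1_hat_borel(1)[OF k v]
  obtain g K where g: "borel_fun g" "\<And>x. norm (g x) \<le> K" "AE x in leb_patch k. u x = g x"
    using ex_bounded_field[OF k r] by blast
  obtain \<omega> B where \<omega>: "borel_fun \<omega>" "\<And>y. y \<in> cbox 0 1 \<Longrightarrow> \<bar>\<omega> y\<bar> \<le> B"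
    and parts: "\<And>\<phi>. (\<forall>j. Ck_fun j \<phi>) \<Longrightarrow>
     (LINT y|leb_square. cross2 (v y) (E.grad_pull \<phi> y)) =
     (LINT y|leb_square. \<omega> y * E.test_pull \<phi> y) -
     (\<Sum>sw\<in>UNIV. \<Sum>b\<in>UNIV. det (sqsym_mat sw False b) *
        (LINT s|leb_unit. side_val v sw b s * E.test_pull \<phi> (sqsym sw False b (vec2 s 0))))"
    using V1_hat_by_parts[OF k v E.square_chart_axioms] by blast
  define d where "d y = indicator (cbox 0 1) y * inverse (det (E.D y))" for y
  have "continuous_on (cbox 0 1) (\<lambda>y. inverse (det (E.D y)))" using E.matrix_inv_D(3) by (intro continuous_on_inverse E.det_cont) auto
  then have "continuous_on (cbox 0 1) d" by (rule continuous_on_eq) (simp add: d_def)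
  then have "bms d" by (rule E.bms_cbox) (simp add: d_def)
  then obtain R where dm: "borel_fun d" and R: "\<And>y. y \<in> cbox 0 1 \<Longrightarrow> \<bar>d y\<bar> \<le> R" unfolding bms_def by blast
  define w where "w x = indicator (patch M k) x * (\<omega> (E.G x) * d (E.G x))" for x
  have wm: "borel_fun w"
    using E.transport_measurable[of "\<lambda>y. \<omega> y * d y"] \<omega>(1) dm unfolding w_def[abs_def] P by simp
  have B0: "0 \<le> B" using \<omega>(2)[of 0] by (auto simp: mem_unit_cbox intro: order.trans[OF abs_ge_zero])
  have wb: "\<bar>w x\<bar> \<le> B * R" for x
  proof (cases "x \<in> patch M k")
    case True
    then have "E.G x \<in> cbox 0 1" using E.G_mem[of x] P box_subset_cbox by blast
    then show ?thesis using True \<omega>(2)[of "E.G x"] R[of "E.G x"] B0 unfolding w_def by (simp add: abs_mult mult_mono)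
  next
    case False
    then show ?thesis using B0 order.trans[OF abs_ge_zero R[of 0]] unfolding w_def by (simp add: mem_unit_cbox)
  qed
  have wE: "w (pmap M k y) = \<omega> y * d y" if "y \<in> box 0 1" for y
    using that P E.GE[OF E.box_cbox[OF that]] unfolding w_def by (auto simp: indicator_def)
  have "?parts w \<phi>" if phi: "\<forall>j. Ck_fun j \<phi>" for \<phi>
  proof -
    have sub: "patch M k \<subseteq> pmap M k ` cbox 0 1" using P box_subset_cbox by blast
    have bdd: "\<exists>b. \<forall>x\<in>patch M k. \<bar>f x\<bar> \<le> b" if "continuous_on UNIV f" for f :: "real^2 \<Rightarrow> real"
    proof -
      have "bounded (f ` (pmap M k ` cbox 0 1))"
        by (intro compact_imp_bounded compact_continuous_image[OF continuous_on_subset[OF that] E.compact_image]) auto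
      then show ?thesis using sub unfolding bounded_iff by (force simp: subset_iff)
    qed
    obtain b where b: "\<And>x. x \<in> patch M k \<Longrightarrow> \<bar>\<phi> x\<bar> \<le> b" using bdd[OF Ck_grad(3)[OF phi]] by blast
    obtain b1 where b1: "\<And>x. x \<in> patch M k \<Longrightarrow> \<bar>grad \<phi> x $ 1\<bar> \<le> b1" using bdd[OF Ck_grad(2)[OF phi]] by blast
    obtain b2 where b2: "\<And>x. x \<in> patch M k \<Longrightarrow> \<bar>grad \<phi> x $ 2\<bar> \<le> b2" using bdd[OF Ck_grad(2)[OF phi]] by blast
    have gm: "borel_fun (\<lambda>x. grad \<phi> x $ i)" for i by (rule borel_measurable_continuous_onI[OF Ck_grad(2)[OF phi]])
    have pm: "borel_fun \<phi>" by (rule borel_measurable_continuous_onI[OF Ck_grad(3)[OF phi]])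
    have gi: "borel_fun (\<lambda>x. g x $ i)" for i using measurable_compose[OF g(1) borel_measurable_vec_nth] .
    have cgm: "borel_fun (\<lambda>x. cross2 (g x) (grad \<phi> x))"
      unfolding cross2_def by (intro borel_measurable_diff borel_measurable_times gi gm)
    have gb: "\<bar>g x $ i\<bar> \<le> K" for x i using component_le_norm_cart[of "g x" i] g(2)[of x] by linarith
    have K0: "0 \<le> K" using gb[of 0 1] by linarith
    have cgb: "\<bar>cross2 (g x) (grad \<phi> x)\<bar> \<le> K * b2 + K * b1" if "x \<in> patch M k" for x
    proof -
      have "\<bar>g x $ 1 * grad \<phi> x $ 2\<bar> \<le> K * b2" "\<bar>g x $ 2 * grad \<phi> x $ 1\<bar> \<le> K * b1"
        unfolding abs_mult using gb b1[OF that] b2[OF that] K0 by (intro mult_mono; simp)+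
      then show ?thesis unfolding cross2_def by linarith
    qed
    have cae: "AE x in leb_patch k. cross2 (u x) (grad \<phi> x) = cross2 (g x) (grad \<phi> x)"
      using g(3) by (rule eventually_mono) simp
    have cgi: "integrable (leb_patch k) (\<lambda>x. cross2 (g x) (grad \<phi> x))"
      using patch_lmeasurable(1)[OF k] cgb by (intro integrable_bounded_lebesgue_on borel_imp_lebesgue_on cgm)
    have "(\<lambda>x. cross2 (u x) (grad \<phi> x)) \<in> borel_measurable (leb_patch k)"
      by (rule AE_lebesgue_measurable[OF cae borel_imp_lebesgue_on[OF cgm] patch_lmeasurable(2)[OF k]])
    from integrable_cong_AE[OF this borel_imp_lebesgue_on[OF cgm] cae] cgi
    have ci: "integrable (leb_patch k) (\<lambda>x. cross2 (u x) (grad \<phi> x))" by blast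
    have "\<bar>w x * \<phi> x\<bar> \<le> (B * R) * b" if "x \<in> patch M k" for x
      unfolding abs_mult using wb[of x] b[OF that] order.trans[OF abs_ge_zero wb] by (intro mult_mono) auto
    then have wi: "integrable (leb_patch k) (\<lambda>x. w x * \<phi> x)"
      using patch_lmeasurable(1)[OF k] wm pm by (intro integrable_bounded_lebesgue_on borel_imp_lebesgue_on) auto
    have "(LINT x|leb_patch k. cross2 (u x) (grad \<phi> x)) =
        (LINT y|leb_square. \<bar>det (E.D y)\<bar> * cross2 (u (pmap M k y)) (grad \<phi> (pmap M k y)))"
      using E.change_of_variables(2) ci unfolding P by blast
    also have "\<dots> = (LINT y|leb_square. E.ori * cross2 (v y) (E.grad_pull \<phi> y))"
    proof (rule integral_cong_AE_lebesgue_on)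
      show "AE y in leb_square. \<bar>det (E.D y)\<bar> * cross2 (u (pmap M k y)) (grad \<phi> (pmap M k y)) = E.ori * cross2 (v y) (E.grad_pull \<phi> y)"
        using uv unfolding AE_box_iff
      proof eventually_elim
        case (elim y)
        show ?case
        proof
          assume y: "y \<in> box 0 1"
          then have yc: "y \<in> cbox 0 1" by (rule E.box_cbox)
          have "v y = transpose (E.D y) *v u (pmap M k y)" using elim y E.pull_eq[OF y] by simp
          then have "cross2 (v y) (E.grad_pull \<phi> y) = det (E.D y) * cross2 (u (pmap M k y)) (grad \<phi> (pmap M k y))"
            using yc unfolding E.grad_pull_def by (simp add: cross2_transpose)
          then show "\<bar>det (E.D y)\<bar> * cross2 (u (pmap M k y)) (grad \<phi> (pmap M k y)) = E.ori * cross2 (v y) (E.grad_pull \<phi> y)"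
            using E.ori(2)[OF yc] by simp
        qed
      qed
      have "borel_fun (\<lambda>y. E.grad_pull \<phi> y $ i)" for i
        using E.bms_cbox[OF E.grad_pull_continuous[OF phi], of i] unfolding bms_def by (simp add: E.grad_pull_def)
      then show "(\<lambda>y. E.ori * cross2 (v y) (E.grad_pull \<phi> y)) \<in> borel_measurable leb_square"
        using vm unfolding cross2_def by (intro borel_imp_lebesgue_on) simp
    qed simp
    also have "\<dots> = E.ori * (LINT y|leb_square. cross2 (v y) (E.grad_pull \<phi> y))" by simp
    finally have L: "(LINT x|leb_patch k. cross2 (u x) (grad \<phi> x)) =
        E.ori * (LINT y|leb_square. cross2 (v y) (E.grad_pull \<phi> y))" .
    have "(LINT x|leb_patch k. w x * \<phi> x) =
        (LINT y|leb_square. \<bar>det (E.D y)\<bar> * (w (pmap M k y) * \<phi> (pmap M k y)))"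
      using E.change_of_variables(2) wi unfolding P by blast
    also have "\<dots> = (LINT y|leb_square. E.ori * (\<omega> y * E.test_pull \<phi> y))"
    proof (rule Bochner_Integration.integral_cong)
      fix y :: "real^2" assume "y \<in> space leb_square"
      then have y: "y \<in> box 0 1" by simp
      then have yc: "y \<in> cbox 0 1" by (rule E.box_cbox)
      show "\<bar>det (E.D y)\<bar> * (w (pmap M k y) * \<phi> (pmap M k y)) = E.ori * (\<omega> y * E.test_pull \<phi> y)"
        using yc E.matrix_inv_D(3)[OF yc] unfolding wE[OF y] E.ori(2)[OF yc] E.test_pull_def d_def by (simp add: field_simps)
    qed simp
    also have "\<dots> = E.ori * (LINT y|leb_square. \<omega> y * E.test_pull \<phi> y)" by simp
    finally have R: "(LINT x|leb_patch k. w x * \<phi> x) = E.ori * (LINT y|leb_square. \<omega> y * E.test_pull \<phi> y)" .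
    have S: "(LINT s|leb_unit. side_val v sw b s * E.test_pull \<phi> (sqsym sw False b (vec2 s 0))) =
        (LINT s|leb_unit. side_val v sw b s * \<phi> ((side_chart k sw False b) (vec2 s 0)))" for sw b
      by (intro Bochner_Integration.integral_cong) (auto simp: E.test_pull_def sqsym_mem_cbox bottom_vec2)
    show ?thesis
    proof (intro conjI ci wi, goal_cases)
      case 1
      show ?case
        unfolding L R parts[OF phi] S side_term_def prod.case square_chart_sqsym(3)[OF E.square_chart_axioms]
          right_diff_distrib sum_distrib_left mult.assoc ..
    qed
  qed
  moreover have "w x = 0" if "x \<notin> patch M k" for x using that by (simp add: w_def)
  ultimately show ?thesis using wm wb by blast
qed

end

section \<open>The distributional curl of a broken field\<close>

context mp_splines
begin

lemma V1_hat_cont_second: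
  assumes k: "k \<in> patches M" and v: "v \<in> V1_hat M k"
  shows "continuous_on {0..1} (\<lambda>t. v (vec2 t s) $ 2)"
proof -
  obtain c where c: "\<And>x. v x $ 2 = (\<Sum>i\<le>n k. \<Sum>j<n k. c i j * lam0 M k i (x$1) * lam1 M k j (x$2))"
    using v unfolding V1_hat_def tensor_combs_def by (auto dest: fun_cong)
  show ?thesis unfolding c using lam0_cont[OF k] by (simp, intro continuous_intros) auto
qed

lemma side_point_flip: "sqsym sw a b (vec2 s 0) = sqsym sw False b (vec2 (flip a s) 0)"
  by (simp add: sqsym_def flip_def)

text \<open>
  The trace in a chart with this side as bottom side is the restriction of the tangential component, with the
  sign of the direction of traversal.
\<close>

lemma bottom_trace_side:
  assumes k: "k \<in> patches M" and v: "rep k (sqsym False False False) u v" and v': "rep k (sqsym sw a b) u v'"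
  shows "AE s in leb_unit. bottom_trace v' s = (if a then -1 else 1) * side_val v sw b (flip a s)"
proof -
  have vV: "v \<in> V1_hat M k" "v' \<in> V1_hat M k" using v v' unfolding rep_def by auto
  have i: "sqsym False False False \<circ> sqsym sw a b = sqsym sw a b" by (simp add: sqsym_id)
  obtain v'' where v'': "rep k (sqsym sw a b) u v''"
    "AE y in leb_square. v'' y = transpose (sqsym_mat sw a b) *v v (sqsym sw a b y)"
    using rep_change[OF k v, of sw a b] unfolding i by blast
  have "AE y in leb_square. v' y = v'' y" by (rule rep_AE_cong[OF k v' v''(1)]) simp
  then have ae: "AE y in leb_square. v' y $ 1 = (transpose (sqsym_mat sw a b) *v v (sqsym sw a b y)) $ 1"
    using v''(2) by eventually_elim simp
  have fl: "continuous_on {0..1} (flip b)" "flip b ` {0..1} \<subseteq> {0..1}" by (cases b; auto simp: flip_def[abs_def] intro!: continuous_intros)+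
  have c: "continuous_on {0..1} (\<lambda>t. (transpose (sqsym_mat sw a b) *v v (sqsym sw a b (vec2 s t))) $ 1)" for s
    using continuous_on_compose2[OF V1_hat_cont[OF k vV(1)] fl, of "flip a s"]
      continuous_on_compose2[OF V1_hat_cont_second[OF k vV(1)] fl, of "flip a s"]
    by (cases sw) (auto simp: transpose_sqsym_mat_vector sqsym_def intro!: continuous_on_minus)
  have "AE s in leb_unit. v' (vec2 s 0) $ 1 = (transpose (sqsym_mat sw a b) *v v (sqsym sw a b (vec2 s 0))) $ 1"
    by (rule trace_unique[OF V1_hat_cont[OF k vV(2)] c ae])
  then show ?thesis
    by (rule eventually_mono)
      (auto simp: bottom_trace_def side_val_def transpose_sqsym_mat_vector sqsym_def)
qed

lemma side_val_borel:
  assumes k: "k \<in> patches M" and v: "v \<in> V1_hat M k"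
  shows "borel_fun (side_val v sw b)"
  using borel_measurable_vec2_slice[OF V1_hat_borel(1)[OF k v, of 2], of "flip b 0"]
    measurable_compose[OF measurable_Pair2'[of "flip b 0" borel borel] measurable_compose[OF vec2_measurable V1_hat_borel(1)[OF k v, of 1]]]
  unfolding side_val_def[abs_def] by (cases sw) simp_all

text \<open>
  The contribution of a side to the integration by parts does not depend on how the side is
  parametrised: reversing the parametrisation changes the sign both of the tangential trace and
  of the orientation of the chart.
\<close>

lemma side_integral_rep:
  assumes k: "k \<in> patches M" and v: "rep k (sqsym False False False) u v" and v': "rep k (sqsym sw a b) u v'"
    and phi: "continuous_on UNIV \<phi>"
  shows "square_chart.ori (side_chart k sw False b) *
      (LINT s|leb_unit. side_val v sw b s * \<phi> ((side_chart k sw False b) (vec2 s 0))) =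
    square_chart.ori (side_chart k sw a b) *
      (LINT s|leb_unit. bottom_trace v' s * \<phi> ((side_chart k sw a b) (vec2 s 0)))"
proof -
  let ?\<sigma> = "if a then -1 else 1 :: real" and ?E = "side_chart k sw False b"
  interpret E: square_chart ?E by (rule chart_sqsym[OF k])
  define p where "p s = indicator {0..1} s *\<^sub>R \<phi> (?E (vec2 s 0))" for s :: real
  have "continuous_on {0..1} (\<lambda>s. ?E (vec2 s 0))"
    by (intro continuous_on_compose2[OF E.cont] continuous_on_vec2 continuous_intros) (auto simp: bottom_vec2)
  then have "continuous_on {0..1} (\<lambda>s. \<phi> (?E (vec2 s 0)))" by (intro continuous_on_compose2[OF phi]) auto
  then have pm: "borel_fun p" unfolding p_def[abs_def] by (intro borel_measurable_continuous_on_indicator) auto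
  have vV: "v \<in> V1_hat M k" using v unfolding rep_def by auto
  define h where "h s = side_val v sw b s * p s" for s
  have hm: "borel_fun h" unfolding h_def[abs_def] using side_val_borel[OF k vV] pm by simp
  have fm: "borel_fun (\<lambda>s. h (flip a s))"
    using measurable_compose[OF _ hm, of "flip a" borel] by (simp add: flip_def[abs_def])
  have pt: "(side_chart k sw a b) (vec2 s 0) = ?E (vec2 (flip a s) 0)" for s
    using side_point_flip[of sw a b s] by simp
  have "(LINT s|leb_unit. bottom_trace v' s * \<phi> ((side_chart k sw a b) (vec2 s 0))) =
      (LINT s|leb_unit. ?\<sigma> * h (flip a s))"
  proof (rule integral_cong_AE_lebesgue_on)
    show "AE s in leb_unit. bottom_trace v' s * \<phi> ((side_chart k sw a b) (vec2 s 0)) = ?\<sigma> * h (flip a s)"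
      using bottom_trace_side[OF k v v'] unfolding AE_unit_interval_interior
    proof eventually_elim
      case (elim s)
      show ?case
      proof
        assume s: "0 < s \<and> s < 1"
        then have "p (flip a s) = \<phi> (?E (vec2 (flip a s) 0))" by (simp add: p_def flip_def)
        then show "bottom_trace v' s * \<phi> ((side_chart k sw a b) (vec2 s 0)) = ?\<sigma> * h (flip a s)"
          unfolding pt h_def using elim s by simp
      qed
    qed
    show "(\<lambda>s. ?\<sigma> * h (flip a s)) \<in> borel_measurable leb_unit"
      by (intro measurable_restrict_space1 measurable_completion) (use fm in simp)
  qed simp
  also have "\<dots> = ?\<sigma> * (LINT s|leb_unit. h s)" using integral_flip[OF hm, of a] by simp
  also have "(LINT s|leb_unit. h s) = (LINT s|leb_unit. side_val v sw b s * \<phi> (?E (vec2 s 0)))"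
    by (intro Bochner_Integration.integral_cong) (auto simp: h_def p_def)
  finally have *: "(LINT s|leb_unit. bottom_trace v' s * \<phi> ((side_chart k sw a b) (vec2 s 0))) =
     ?\<sigma> * (LINT s|leb_unit. side_val v sw b s * \<phi> (?E (vec2 s 0)))" .
  have "square_chart.ori (side_chart k sw a b) = square_chart.ori ?E * ?\<sigma>"
    unfolding square_chart_sqsym(3)[OF chart[OF k]] by (simp add: det_sqsym_mat)
  then show ?thesis unfolding * by simp
qed

lemma Dom_integral:
  fixes f :: "real^2 \<Rightarrow> real"
  assumes "\<And>k. k \<in> patches M \<Longrightarrow> integrable (leb_patch k) f"
  shows "(LINT x|leb_Dom. f x) = (\<Sum>k\<in>patches M. LINT x|leb_patch k. f x)"
proof -
  have i: "integrable lebesgue (\<lambda>x. indicator (patch M k) x * f x)" if "k \<in> patches M" for k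
    using assms[OF that] patch_lmeasurable(2)[OF that] by (simp add: integrable_restrict_space)
  have single: "(\<Sum>l\<in>patches M. indicator (patch M l) x * f x) = f x" if k: "k \<in> patches M" and x: "x \<in> patch M k" for k x
  proof -
    have "indicator (patch M l) x * f x = 0" if "l \<in> patches M - {k}" for l
      using patch_disjoint[of k l] k x that by (auto simp: indicator_def)
    then have "(\<Sum>l\<in>patches M - {k}. indicator (patch M l) x * f x) = 0" by (rule sum.neutral[OF ballI])
    then show ?thesis using sum.remove[OF finite_patches k, of "\<lambda>l. indicator (patch M l) x * f x"] x by simp
  qed
  have "AE x in leb_Dom. f x = (\<Sum>k\<in>patches M. indicator (patch M k) x * f x)"
    unfolding AE_Dom_iff using single patch_lmeasurable(2) by (auto simp: AE_restrict_space_iff)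
  then have "AE x in lebesgue. x \<in> Dom M \<longrightarrow> f x = (\<Sum>k\<in>patches M. indicator (patch M k) x * f x)"
    using Dom_sets by (simp add: AE_restrict_space_iff)
  then have ae: "AE x in lebesgue. indicator (Dom M) x * f x = (\<Sum>k\<in>patches M. indicator (patch M k) x * f x)"
  proof eventually_elim
    case (elim x)
    show ?case
    proof (cases "x \<in> Dom M")
      case False
      then have "x \<notin> patch M k" if "k \<in> patches M" for k using patch_subset_Dom[OF that] by blast
      then show ?thesis using False by simp
    qed (use elim in simp)
  qed
  have rm: "(\<lambda>x. \<Sum>k\<in>patches M. indicator (patch M k) x * f x) \<in> borel_measurable lebesgue"
    using borel_measurable_integrable[OF i] by (intro borel_measurable_sum)
  have lm: "(\<lambda>x. indicator (Dom M) x * f x) \<in> borel_measurable lebesgue"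
    by (rule borel_measurable_AE[OF rm]) (use ae in \<open>auto elim: eventually_mono\<close>)
  have "(LINT x|leb_Dom. f x) = (LINT x|lebesgue. indicator (Dom M) x * f x)"
    using Dom_sets by (subst integral_restrict_space) auto
  also have "\<dots> = (LINT x|lebesgue. (\<Sum>k\<in>patches M. indicator (patch M k) x * f x))" by (rule integral_cong_AE[OF lm rm ae])
  also have "\<dots> = (\<Sum>k\<in>patches M. LINT x|lebesgue. indicator (patch M k) x * f x)" using i by (rule Bochner_Integration.integral_sum)
  also have "\<dots> = (\<Sum>k\<in>patches M. LINT x|leb_patch k. f x)"
    using patch_lmeasurable(2) by (intro sum.cong refl) (subst integral_restrict_space, auto)
  finally show ?thesis .
qed

lemma Dom_by_parts:
  assumes v: "\<And>k. k \<in> patches M \<Longrightarrow> rep k (sqsym False False False) u (v k)"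
  shows "\<exists>w K. borel_fun w \<and> (\<forall>x. \<bar>w x\<bar> \<le> K) \<and> (\<forall>\<phi>. (\<forall>j. Ck_fun j \<phi>) \<longrightarrow>
     (LINT x|leb_Dom. cross2 (u x) (grad \<phi> x)) =
     (LINT x|leb_Dom. w x * \<phi> x) - (\<Sum>x\<in>patches M \<times> UNIV. side_term v \<phi> x))"
proof -
  let ?S = "\<lambda>k \<phi>. \<Sum>sw\<in>UNIV. \<Sum>b\<in>UNIV. side_term v \<phi> (k, sw, b)"
  let ?Q = "\<lambda>k w K. borel_fun w \<and> (\<forall>x. \<bar>w x\<bar> \<le> K) \<and> (\<forall>x. x \<notin> patch M k \<longrightarrow> w x = 0) \<and> (\<forall>\<phi>. (\<forall>j. Ck_fun j \<phi>) \<longrightarrow>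
     integrable (leb_patch k) (\<lambda>x. cross2 (u x) (grad \<phi> x)) \<and>
     integrable (leb_patch k) (\<lambda>x. w x * \<phi> x) \<and>
     (LINT x|leb_patch k. cross2 (u x) (grad \<phi> x)) =
     (LINT x|leb_patch k. w x * \<phi> x) - ?S k \<phi>)"
  have "side_term (\<lambda>_. v k) \<phi> (k, sw, b) = side_term v \<phi> (k, sw, b)" for k \<phi> sw b by (simp add: side_term_def)
  then have "\<forall>k\<in>patches M. \<exists>w. \<exists>K. ?Q k w K" using patch_by_parts[OF _ v] by simp
  from bchoice[OF this] obtain w where w1: "\<forall>k\<in>patches M. \<exists>K. ?Q k (w k) K" ..
  from bchoice[OF this] obtain K where w: "\<And>k. k \<in> patches M \<Longrightarrow> w k \<in> borel_measurable borel"
     "\<And>k x. k \<in> patches M \<Longrightarrow> \<bar>w k x\<bar> \<le> K k" "\<And>k x. k \<in> patches M \<Longrightarrow> x \<notin> patch M k \<Longrightarrow> w k x = 0"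
    and i: "\<And>k \<phi>. k \<in> patches M \<Longrightarrow> \<forall>j. Ck_fun j \<phi> \<Longrightarrow> integrable (leb_patch k) (\<lambda>x. cross2 (u x) (grad \<phi> x))"
     "\<And>k \<phi>. k \<in> patches M \<Longrightarrow> \<forall>j. Ck_fun j \<phi> \<Longrightarrow> integrable (leb_patch k) (\<lambda>x. w k x * \<phi> x)"
    and eq: "\<And>k \<phi>. k \<in> patches M \<Longrightarrow> \<forall>j. Ck_fun j \<phi> \<Longrightarrow> (LINT x|leb_patch k. cross2 (u x) (grad \<phi> x)) =
     (LINT x|leb_patch k. w k x * \<phi> x) - ?S k \<phi>" by blast
  define W where "W x = (\<Sum>k\<in>patches M. w k x)" for x
  have WW: "W x = w k x" if k: "k \<in> patches M" and x: "x \<in> patch M k" for k x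
  proof -
    have "w l x = 0" if "l \<in> patches M - {k}" for l using w(3) patch_disjoint[of k l] k x that by blast
    then show ?thesis unfolding W_def using sum.remove[OF finite_patches k, of "\<lambda>l. w l x"] by simp
  qed
  have "borel_fun W" unfolding W_def[abs_def] using w(1) by (intro borel_measurable_sum)
  moreover have "\<bar>W x\<bar> \<le> (\<Sum>k\<in>patches M. K k)" for x
    unfolding W_def using w(2) by (intro order.trans[OF sum_abs] sum_mono)
  moreover have "(LINT x|leb_Dom. cross2 (u x) (grad \<phi> x)) =
     (LINT x|leb_Dom. W x * \<phi> x) - (\<Sum>x\<in>patches M \<times> UNIV. side_term v \<phi> x)" if phi: "\<forall>j. Ck_fun j \<phi>" for \<phi>
  proof -
    have iW: "integrable (leb_patch k) (\<lambda>x. W x * \<phi> x)"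
      and eW: "(LINT x|leb_patch k. W x * \<phi> x) = (LINT x|leb_patch k. w k x * \<phi> x)" if k: "k \<in> patches M" for k
    proof -
      have c: "W x * \<phi> x = w k x * \<phi> x" if "x \<in> space (leb_patch k)" for x using that WW[OF k] by simp
      show "integrable (leb_patch k) (\<lambda>x. W x * \<phi> x)"
        using i(2)[OF k phi] by (subst Bochner_Integration.integrable_cong[OF refl c])
      show "(LINT x|leb_patch k. W x * \<phi> x) = (LINT x|leb_patch k. w k x * \<phi> x)"
        using c by (intro Bochner_Integration.integral_cong refl)
    qed
    have S: "(\<Sum>x\<in>patches M \<times> UNIV. side_term v \<phi> x) = (\<Sum>k\<in>patches M. ?S k \<phi>)"
      unfolding UNIV_Times_UNIV[symmetric] sum.cartesian_product by (intro sum.cong) auto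
    have D1: "(LINT x|leb_Dom. cross2 (u x) (grad \<phi> x)) = (\<Sum>k\<in>patches M. LINT x|leb_patch k. cross2 (u x) (grad \<phi> x))"
      using i(1) phi by (intro Dom_integral) blast
    have D2: "(LINT x|leb_Dom. W x * \<phi> x) = (\<Sum>k\<in>patches M. LINT x|leb_patch k. W x * \<phi> x)"
      using iW by (intro Dom_integral) blast
    have "(LINT x|leb_Dom. cross2 (u x) (grad \<phi> x)) = (\<Sum>k\<in>patches M. (LINT x|leb_patch k. W x * \<phi> x) - ?S k \<phi>)"
      unfolding D1 by (intro sum.cong refl) (simp only: eq[OF _ phi] eW)
    then show ?thesis unfolding D2 S sum_subtractf .
  qed
  ultimately show ?thesis by blast
qed

lemma side_term_zero:
  assumes "\<And>s. 0 < s \<Longrightarrow> s < 1 \<Longrightarrow> \<phi> ((side_chart k sw False b) (vec2 s 0)) = 0"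
  shows "side_term v \<phi> (k, sw, b) = 0"
proof -
  have "(LINT s|leb_unit. side_val (v k) sw b s * \<phi> ((side_chart k sw False b) (vec2 s 0))) = (LINT s|leb_unit. 0)"
    by (rule integral_cong_AE_lebesgue_on) (use assms in \<open>auto simp: AE_unit_interval_interior\<close>)
  then show ?thesis unfolding side_term_def by simp
qed

end

locale edge_splines = mp_splines + edge_setting
begin

lemma edge_sides: "{x \<in> patches M \<times> UNIV. (case x of (k, sw, b) \<Rightarrow> side_edge k sw b) = e} = {(km, sm, bm), (kp, sp, bp)}"
proof -
  have "(k, sw, b) = (km, sm, bm) \<or> (k, sw, b) = (kp, sp, bp)" if k: "k \<in> patches M" and s: "side_edge k sw b = e" for k sw b
  proof -
    have "k \<in> edge_patches M e"
      using k s int edge_patches_eq[of e] patch_edges_eq[of k] unfolding interior_edge_def by blast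
    then have "k = km \<or> k = kp" using split_edge by blast
    then show ?thesis
    proof
      assume e: "k = km"
      then show ?thesis using side_edge_inj[OF k, of sm bm sw b] s e_side(1) by simp
    next
      assume e: "k = kp"
      then show ?thesis using side_edge_inj[OF k, of sp bp sw b] s e_side(2) by simp
    qed
  qed
  then show ?thesis using km kp e_side by auto
qed

text \<open>
  The two patches of the edge contribute with opposite signs, because their charts have opposite orientation.
  So the edge contributes the jump of the tangential trace.
\<close>

lemma edge_side_terms:
  assumes v: "\<And>k. k \<in> patches M \<Longrightarrow> rep k (sqsym False False False) u (v k)"
    and vm: "rep km (sqsym sm am bm) u vm" and vp: "rep kp (sqsym sp ap bp) u vp" and phi: "continuous_on UNIV \<phi>"
  shows "(\<Sum>x\<in>{x \<in> patches M \<times> UNIV. (case x of (k, sw, b) \<Rightarrow> side_edge k sw b) = e}. side_term v \<phi> x) =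
    p.ori * (LINT s|leb_unit. (bottom_trace vp s - bottom_trace vm s) * \<phi> (Ep (vec2 s 0)))"
proof -
  have ne: "(km, sm, bm) \<noteq> (kp, sp, bp)" using kne by simp
  have m: "side_term v \<phi> (km, sm, bm) = m.ori * (LINT s|leb_unit. bottom_trace vm s * \<phi> (Em (vec2 s 0)))"
    unfolding side_term_def prod.case side_integral_rep[OF km v[OF km] vm phi] Em_def ..
  have p: "side_term v \<phi> (kp, sp, bp) = p.ori * (LINT s|leb_unit. bottom_trace vp s * \<phi> (Ep (vec2 s 0)))"
    unfolding side_term_def prod.case side_integral_rep[OF kp v[OF kp] vp phi] Ep_def ..
  have "(LINT s|leb_unit. bottom_trace vm s * \<phi> (Em (vec2 s 0))) = (LINT s|leb_unit. bottom_trace vm s * \<phi> (Ep (vec2 s 0)))"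
    by (intro Bochner_Integration.integral_cong) (auto simp: bottom_agree)
  note m = m[unfolded this]
  define q where "q s = indicator {0..1} s *\<^sub>R \<phi> (Ep (vec2 s 0))" for s :: real
  have "continuous_on {0..1} (\<lambda>s. Ep (vec2 s 0))"
    by (intro continuous_on_compose2[OF p.cont] continuous_on_vec2 continuous_intros) (auto simp: bottom_vec2)
  then have qc: "continuous_on {0..1} (\<lambda>s. \<phi> (Ep (vec2 s 0)))" by (intro continuous_on_compose2[OF phi]) auto
  then have "borel_fun q" unfolding q_def[abs_def] by (intro borel_measurable_continuous_on_indicator) auto
  moreover have "\<exists>C. \<forall>x\<in>{0..1}. \<bar>q x\<bar> \<le> C"
    using compact_imp_bounded[OF compact_continuous_image[OF qc compact_Icc]] unfolding bounded_iff q_def by auto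
  ultimately have q: "bmf q" unfolding bmf_def by blast
  have i: "integrable leb_unit (\<lambda>s. f s * \<phi> (Ep (vec2 s 0)))" if "f \<in> V1_spline M k" "k \<in> patches M" for f k
  proof -
    have "integrable leb_unit (\<lambda>s. f s * q s)" using V1_spline_bmf[OF that(2,1)] q by (intro bmf_integrable bmf_mult)
    then show ?thesis by (subst (asm) Bochner_Integration.integrable_cong[of _ _ _ "\<lambda>s. f s * \<phi> (Ep (vec2 s 0))"]) (auto simp: q_def)
  qed
  have "bottom_trace vm \<in> V1_spline M km" "bottom_trace vp \<in> V1_spline M kp"
    using V1_hat_trace km kp vm vp unfolding rep_def by auto
  note i = i[OF this(1) km] i[OF this(2) kp]
  have eq: "(LINT s|leb_unit. (bottom_trace vp s - bottom_trace vm s) * \<phi> (Ep (vec2 s 0))) =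
      (LINT s|leb_unit. bottom_trace vp s * \<phi> (Ep (vec2 s 0))) - (LINT s|leb_unit. bottom_trace vm s * \<phi> (Ep (vec2 s 0)))"
    unfolding left_diff_distrib by (rule Bochner_Integration.integral_diff[OF i(2,1)])
  have "p.ori * (LINT s|leb_unit. (bottom_trace vp s - bottom_trace vm s) * \<phi> (Ep (vec2 s 0))) =
      side_term v \<phi> (km, sm, bm) + side_term v \<phi> (kp, sp, bp)"
    unfolding eq m p opposite_orientation right_diff_distrib by simp
  moreover have "(\<Sum>x\<in>{(km, sm, bm), (kp, sp, bp)}. side_term v \<phi> x) = side_term v \<phi> (km, sm, bm) + side_term v \<phi> (kp, sp, bp)"
    by (subst sum.insert) (use ne in auto)
  ultimately show ?thesis unfolding edge_sides by simp
qed

end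

section \<open>Conforming fields\<close>

text \<open>
  Bumps of size \<open>\<epsilon>\<close> have square integral of order \<open>\<epsilon>\<^sup>2\<close>, so by the Cauchy--Schwarz inequality their integrals against a square
  integrable function are \<open>o(\<epsilon>)\<close>. A jump across a curve, in contrast, produces a term of exact order \<open>\<epsilon>\<close>.
\<close>

lemma L2_bump_small:
  fixes W :: "real^2 \<Rightarrow> real"
  assumes W: "W \<in> L2_on S" and S: "S \<in> sets lebesgue" and sub: "cube x0 \<epsilon>0 \<subseteq> S" and pos: "0 < \<epsilon>0" "0 < \<kappa>"
  shows "\<exists>\<epsilon>. 0 < \<epsilon> \<and> \<epsilon> \<le> \<epsilon>0 \<and> \<bar>LINT x|lebesgue_on S. W x * bump x0 \<epsilon> x\<bar> < \<kappa> * \<epsilon>"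
proof -
  define \<delta> where "\<delta> n = \<epsilon>0 / real (Suc n)" for n
  have \<delta>: "0 < \<delta> n" "\<delta> n \<le> \<epsilon>0" for n using pos by (auto simp: \<delta>_def field_simps)
  have d0: "\<delta> \<longlonglongrightarrow> 0" unfolding \<delta>_def[abs_def] by (rule lim_const_over_n[THEN LIMSEQ_Suc])
  have cm: "cube x0 \<epsilon> \<in> sets lebesgue" for \<epsilon> by simp
  have im: "(\<lambda>x. indicator (cube x0 \<epsilon>) x :: real) \<in> borel_measurable (lebesgue_on S)" for \<epsilon>
    by (intro measurable_restrict_space1 borel_measurable_indicator cm)
  have Wm: "W \<in> borel_measurable (lebesgue_on S)" and Wi: "integrable (lebesgue_on S) (\<lambda>x. (W x)\<^sup>2)"
    using W unfolding L2_on_def by auto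
  have "(\<lambda>n. LINT x|lebesgue_on S. indicator (cube x0 (\<delta> n)) x * (W x)\<^sup>2) \<longlonglongrightarrow> (LINT x|lebesgue_on S. 0)"
  proof (rule integral_dominated_convergence[where w = "\<lambda>x. (W x)\<^sup>2"])
    show "AE x in lebesgue_on S. (\<lambda>n. indicator (cube x0 (\<delta> n)) x * (W x)\<^sup>2) \<longlonglongrightarrow> 0"
    proof -
      have "(\<lambda>n. indicator (cube x0 (\<delta> n)) x * (W x)\<^sup>2) \<longlonglongrightarrow> 0" if "x \<noteq> x0" for x
      proof -
        have "x$1 \<noteq> x0$1 \<or> x$2 \<noteq> x0$2" using that by (auto simp: vec2_eq_iff)
        then obtain i where "x$i \<noteq> x0$i" "i = 1 \<or> i = 2" by blast
        then have i: "0 < \<bar>x$i - x0$i\<bar>" "i = 1 \<or> i = 2" by auto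
        have "\<forall>\<^sub>F n in sequentially. \<delta> n < \<bar>x$i - x0$i\<bar>" using order_tendstoD(2)[OF d0 i(1)] .
        then have "\<forall>\<^sub>F n in sequentially. indicator (cube x0 (\<delta> n)) x * (W x)\<^sup>2 = 0"
        proof eventually_elim
          case (elim n)
          then have "x \<notin> cube x0 (\<delta> n)" using i(2) unfolding mem_cube by auto
          then show ?case by simp
        qed
        then show ?thesis by (rule tendsto_eventually)
      qed
      moreover have "AE x in lebesgue_on S. x \<noteq> x0"
        using S by (simp add: AE_lebesgue_on_negligible) (rule negligible_subset[of "{x0}"]; auto)
      ultimately show ?thesis by (auto elim: eventually_mono)
    qed
    show "(\<lambda>x. indicator (cube x0 (\<delta> n)) x * (W x)\<^sup>2) \<in> borel_measurable (lebesgue_on S)" for n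
      using im Wm by (intro borel_measurable_times borel_measurable_power)
    show "AE x in lebesgue_on S. norm (indicator (cube x0 (\<delta> n)) x * (W x)\<^sup>2) \<le> (W x)\<^sup>2" for n
      by (intro AE_I2) (auto simp: indicator_def)
  qed (use Wi in auto)
  then have "(\<lambda>n. LINT x|lebesgue_on S. indicator (cube x0 (\<delta> n)) x * (W x)\<^sup>2) \<longlonglongrightarrow> 0" by simp
  then have "\<forall>\<^sub>F n in sequentially. (LINT x|lebesgue_on S. indicator (cube x0 (\<delta> n)) x * (W x)\<^sup>2) < \<kappa>\<^sup>2 / 4"
    using pos by (intro order_tendstoD) auto
  then obtain N where N: "(LINT x|lebesgue_on S. indicator (cube x0 (\<delta> N)) x * (W x)\<^sup>2) < \<kappa>\<^sup>2 / 4"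
    using eventually_happens'[OF sequentially_bot] by blast
  define \<epsilon> where "\<epsilon> = \<delta> N"
  have \<epsilon>: "0 < \<epsilon>" "\<epsilon> \<le> \<epsilon>0" using \<delta> by (auto simp: \<epsilon>_def)
  let ?i = "\<lambda>x. indicator (cube x0 \<epsilon>) x :: real"
  let ?I = "LINT x|lebesgue_on S. ?i x * (W x)\<^sup>2"
  have I: "?I < \<kappa>\<^sup>2 / 4" using N by (simp add: \<epsilon>_def)
  have csub: "cube x0 \<epsilon> \<subseteq> S" using sub \<epsilon> by (auto simp: mem_cube)
  have i1: "integrable (lebesgue_on S) (\<lambda>x. ?i x * (W x)\<^sup>2)"
    by (rule Bochner_Integration.integrable_bound[OF Wi])
      (use im Wm in \<open>auto simp: indicator_def intro!: borel_measurable_times borel_measurable_power\<close>)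
  have "emeasure (lebesgue_on S) (cube x0 \<epsilon>) < \<infinity>"
    using S csub cm emeasure_bounded_finite[OF bounded_cbox] by (simp add: emeasure_restrict_space Int_absorb2)
  then have i2: "integrable (lebesgue_on S) ?i"
    using S csub cm by (intro integrable_real_indicator) (auto simp: sets_restrict_space_iff)
  have "(LINT x|lebesgue_on S. ?i x) = measure lebesgue (cube x0 \<epsilon>)"
    using S csub cm by (simp add: measure_restrict_space Int_absorb2)
  also have "\<dots> = measure lborel (cube x0 \<epsilon>)" by (rule measure_completion) simp
  also have "\<dots> = 4 * \<epsilon>\<^sup>2"
    using \<epsilon> by (subst content_cbox_cart) (auto simp: interval_ne_empty_cart forall_2 UNIV_2 power2_eq_square)
  finally have m: "(LINT x|lebesgue_on S. ?i x) = 4 * \<epsilon>\<^sup>2" .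
  \<comment> \<open>The weight in \<open>2 * \<bar>W\<bar> \<le> a * W\<^sup>2 + 1 / a\<close> that gives both terms a share of \<open>\<kappa> * \<epsilon> / 2\<close>.\<close>
  define a where "a = 4 * \<epsilon> / \<kappa>"
  have a: "0 < a" using \<epsilon> pos by (simp add: a_def)
  have "\<bar>LINT x|lebesgue_on S. W x * bump x0 \<epsilon> x\<bar> \<le> (LINT x|lebesgue_on S. \<bar>W x * bump x0 \<epsilon> x\<bar>)"
    by (rule integral_abs_bound)
  also have "\<dots> \<le> (LINT x|lebesgue_on S. a / 2 * (?i x * (W x)\<^sup>2) + 1 / (2 * a) * ?i x)"
  proof (rule integral_mono')
    show "integrable (lebesgue_on S) (\<lambda>x. a / 2 * (?i x * (W x)\<^sup>2) + 1 / (2 * a) * ?i x)" using i1 i2 by simp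
    show "0 \<le> a / 2 * (?i x * (W x)\<^sup>2) + 1 / (2 * a) * ?i x" for x using a by simp
    show "\<bar>W x * bump x0 \<epsilon> x\<bar> \<le> a / 2 * (?i x * (W x)\<^sup>2) + 1 / (2 * a) * ?i x" for x
    proof (cases "bump x0 \<epsilon> x = 0")
      case False
      then have x: "?i x = 1" using bump_support[OF \<epsilon>(1)] by simp
      have "0 \<le> (a * \<bar>W x\<bar> - 1)\<^sup>2" by simp
      then have "\<bar>W x\<bar> * (2 * a) \<le> a\<^sup>2 * (W x)\<^sup>2 + 1" by (simp add: power2_eq_square algebra_simps)
      then have "\<bar>W x\<bar> \<le> (a\<^sup>2 * (W x)\<^sup>2 + 1) / (2 * a)" using a by (simp add: pos_le_divide_eq)
      also have "\<dots> = a / 2 * (W x)\<^sup>2 + 1 / (2 * a)" using a by (simp add: field_simps power2_eq_square)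
      finally have "\<bar>W x\<bar> \<le> a / 2 * (W x)\<^sup>2 + 1 / (2 * a)" .
      moreover have "\<bar>W x * bump x0 \<epsilon> x\<bar> \<le> \<bar>W x\<bar>"
        unfolding abs_mult using bump_bounds[of x0 \<epsilon> x] by (simp add: mult_left_le)
      ultimately show ?thesis using x by simp
    qed (use a in simp)
  qed
  also have "\<dots> = a / 2 * ?I + 1 / (2 * a) * (4 * \<epsilon>\<^sup>2)" using i1 i2 m by simp
  also have "\<dots> < a / 2 * (\<kappa>\<^sup>2 / 4) + 1 / (2 * a) * (4 * \<epsilon>\<^sup>2)" using I a by simp
  also have "\<dots> = \<kappa> * \<epsilon>" using pos \<epsilon> by (simp add: a_def field_simps power2_eq_square)
  finally show ?thesis using \<epsilon> by blast
qed

lemma (in square_chart) lipschitz: "\<exists>L>0. \<forall>x\<in>cbox 0 1. \<forall>y\<in>cbox 0 1. norm (E x - E y) \<le> L * norm (x - y)"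
proof -
  have "bounded (D ` cbox 0 1)" by (rule compact_imp_bounded[OF compact_continuous_image[OF D_cont compact_cbox]])
  then obtain B where B: "\<And>y. y \<in> cbox 0 1 \<Longrightarrow> norm (D y) \<le> B" unfolding bounded_iff by auto
  have "norm (E x - E y) \<le> (4 * \<bar>B\<bar> + 1) * norm (x - y)" if "x \<in> cbox 0 1" "y \<in> cbox 0 1" for x y
  proof (rule differentiable_bound[OF convex_box(1) D _ that])
    fix z :: "real^2" assume z: "z \<in> cbox 0 1"
    have "\<bar>D z $ i $ j\<bar> \<le> \<bar>B\<bar>" for i j
      using component_le_norm_cart[of "D z $ i" j] Finite_Cartesian_Product.norm_nth_le[of "D z" i] B[OF z] by linarith
    then have "onorm ((*v) (D z)) \<le> real CARD(2) * real CARD(2) * \<bar>B\<bar>" by (rule onorm_le_matrix_component)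
    then show "onorm ((*v) (D z)) \<le> 4 * \<bar>B\<bar> + 1" by simp
  qed
  then show ?thesis by (intro exI[of _ "4 * \<bar>B\<bar> + 1"]) (auto intro: add_nonneg_pos)
qed

context mp_splines
begin

lemma finite_edges: "finite (edges M)"
proof -
  have "patch_edges M k = (\<lambda>(sw, b). side_edge k sw b) ` UNIV" for k unfolding patch_edges_eq by auto
  then have "finite (patch_edges M k)" for k by simp
  then show ?thesis unfolding edges_def using finite_patches by blast
qed

lemma closed_edge: "f \<in> edges M \<Longrightarrow> closed f"
proof -
  assume "f \<in> edges M"
  then obtain k sw b where k: "k \<in> patches M" and f: "f = side_edge k sw b" unfolding edges_def patch_edges_eq by blast
  interpret E: square_chart "side_chart k sw False b" by (rule chart_sqsym[OF k])
  have "bottom = cbox (0::real^2) 1 \<inter> {y. y $ 2 = 0}" by auto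
  moreover have "closed {y::real^2. y $ 2 = 0}" by (intro closed_Collect_eq continuous_intros)
  ultimately have "compact bottom" using compact_Int_closed[OF compact_cbox] by metis
  then show ?thesis unfolding f side_edge_def
    by (intro compact_imp_closed compact_continuous_image continuous_on_subset[OF E.cont]) auto
qed

lemma side_edge_in_edges: "k \<in> patches M \<Longrightarrow> side_edge k sw b \<in> edges M"
  unfolding edges_def patch_edges_eq by blast

text \<open>
  The quantification over all pairs of charts makes this a property of the edge; it does not depend on a choice of charts.
\<close>

definition jump_free :: "(real^2) set \<Rightarrow> (real^2 \<Rightarrow> real^2) \<Rightarrow> bool" where
  "jump_free e u \<longleftrightarrow> (\<forall>sm am bm sp ap bp vm vp. edge_setting M e sm am bm sp ap bp \<longrightarrow>
     rep (kcoarse M e) (sqsym sm am bm) u vm \<longrightarrow> rep (kfine M e) (sqsym sp ap bp) u vp \<longrightarrow>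
     (\<forall>s\<in>{0..<1}. bottom_trace vm s = bottom_trace vp s))"

end

context edge_splines
begin

lemma jump_free_edge_terms:
  assumes u: "u \<in> V1_pw M" and v: "\<And>k. k \<in> patches M \<Longrightarrow> rep k (sqsym False False False) u (v k)"
    and jf: "jump_free e u" and phi: "continuous_on UNIV \<phi>"
  shows "(\<Sum>x\<in>{x \<in> patches M \<times> UNIV. (case x of (k, sw, b) \<Rightarrow> side_edge k sw b) = e}. side_term v \<phi> x) = 0"
proof -
  obtain vm where vm: "rep km (sqsym sm am bm) u vm" using ex_rep[OF u km] by blast
  obtain vp where vp: "rep kp (sqsym sp ap bp) u vp" using ex_rep[OF u kp] by blast
  have eq: "bottom_trace vm s = bottom_trace vp s" if "s \<in> {0..<1}" for s
    using jf vm vp that edge_setting_axioms unfolding jump_free_def km_def kp_def by blast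
  have "(LINT s|leb_unit. (bottom_trace vp s - bottom_trace vm s) * \<phi> (Ep (vec2 s 0))) = (LINT s|leb_unit. 0)"
    by (rule integral_cong_AE_lebesgue_on) (use eq in \<open>auto simp: AE_unit_interval_interior\<close>)
  then have "p.ori * (LINT s|leb_unit. (bottom_trace vp s - bottom_trace vm s) * \<phi> (Ep (vec2 s 0))) = 0" by simp
  with edge_side_terms[OF v vm vp phi] show ?thesis by (rule trans)
qed

end

lemma (in mp_splines) edge_splinesI: "edge_setting M e sm am bm sp ap bp \<Longrightarrow> edge_splines M e sm am bm sp ap bp"
  by (intro edge_splines.intro mp_splines_axioms)

lemma test_function_zero: "\<phi> \<in> test_functions S \<Longrightarrow> x \<notin> S \<Longrightarrow> \<phi> x = 0"
proof (rule ccontr)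
  assume p: "\<phi> \<in> test_functions S" "x \<notin> S" "\<phi> x \<noteq> 0"
  then have "x \<in> closure {x. \<phi> x \<noteq> 0}" using closure_subset[of "{x. \<phi> x \<noteq> 0}"] by auto
  then show False using p(1,2) unfolding test_functions_def by auto
qed

context mp_splines
begin

text \<open>
  All sides are grouped by edges. Interior edges contribute nothing for lack of a jump, and the other edges contribute
  nothing because test functions vanish outside the domain. What remains is the patchwise curl.
\<close>

lemma jump_free_H_curl:
  assumes u: "u \<in> V1_pw M" and jf: "\<And>e. interior_edge M e \<Longrightarrow> jump_free e u"
  shows "u \<in> H_curl (Dom M)"
proof -
  have "\<forall>k\<in>patches M. \<exists>v. rep k (sqsym False False False) u v" using u unfolding V1_pw_iff by blast
  from bchoice[OF this] obtain v where v: "\<And>k. k \<in> patches M \<Longrightarrow> rep k (sqsym False False False) u (v k)" by blast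
  obtain w K where w: "borel_fun w" "\<And>x. \<bar>w x\<bar> \<le> K" and parts: "\<And>\<phi>. (\<forall>j. Ck_fun j \<phi>) \<Longrightarrow>
     (LINT x|leb_Dom. cross2 (u x) (grad \<phi> x)) =
     (LINT x|leb_Dom. w x * \<phi> x) - (\<Sum>x\<in>patches M \<times> UNIV. side_term v \<phi> x)"
    using Dom_by_parts[OF v] by blast
  have "w \<in> L2_on (Dom M)" using w by (intro ae_bounded_L2[OF Dom_lmeasurable w(1), of K]) auto
  moreover have "(LINT x|leb_Dom. u x $ 1 * partial_deriv 2 \<phi> x - u x $ 2 * partial_deriv 1 \<phi> x) =
     (LINT x|leb_Dom. w x * \<phi> x)" if phi: "\<phi> \<in> test_functions (Dom M)" for \<phi>
  proof -
    have Ck: "\<forall>j. Ck_fun j \<phi>" using phi unfolding test_functions_def by blast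
    let ?f = "\<lambda>x. case x of (k, sw, b) \<Rightarrow> side_edge k sw b"
    let ?X = "patches M \<times> (UNIV :: (bool \<times> bool) set)"
    have z: "(\<Sum>x\<in>{x \<in> ?X. ?f x = e}. side_term v \<phi> x) = 0" if e: "e \<in> edges M" for e
    proof (cases "interior_edge M e")
      case True
      obtain sm am bm sp ap bp where "edge_setting M e sm am bm sp ap bp" using ex_edge_setting[OF True splines] by blast
      then interpret S: edge_splines M e sm am bm sp ap bp "kcoarse M e" "kfine M e"
        "side_chart (kcoarse M e) sm am bm" "side_chart (kfine M e) sp ap bp"
        by (rule edge_splinesI) simp_all
      show ?thesis by (rule S.jump_free_edge_terms[OF u v jf[OF True] Ck_grad(3)[OF Ck]])
    next
      case False
      have "side_term v \<phi> (k, sw, b) = 0" if k: "k \<in> patches M" and s: "side_edge k sw b = e" for k sw b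
        using boundary_edge_notin_Dom[OF k, of sw b _ False] False s test_function_zero[OF phi] by (intro side_term_zero) auto
      then show ?thesis by (intro sum.neutral) auto
    qed
    have "(\<Sum>x\<in>?X. side_term v \<phi> x) = (\<Sum>e\<in>edges M. \<Sum>x\<in>{x \<in> ?X. ?f x = e}. side_term v \<phi> x)"
      by (rule sum.group[symmetric]) (use finite_patches finite_edges side_edge_in_edges in auto)
    then have "(\<Sum>x\<in>?X. side_term v \<phi> x) = 0" using z by simp
    then show ?thesis using parts[OF Ck] by (simp add: cross2_def grad_def)
  qed
  moreover have "u \<in> L2_on (Dom M)" using u unfolding V1_pw_def by blast
  ultimately show ?thesis unfolding H_curl_def by blast
qed

end

context edge_splines
begin

text \<open>
  Suppose that there is a jump at some point. By right-continuity it is bounded below by \<open>c > 0\<close> on an interval of the edge. Test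
  functions concentrated at an inner point of this interval see nothing of the other edges, so the boundary term is the
  integral of the jump, which is at least \<open>\<kappa> * \<epsilon>\<close>. But the weak curl and the patchwise curl are square
  integrable, so the same quantity is \<open>o(\<epsilon>)\<close>.
\<close>

lemma H_curl_traces_agree:
  assumes u: "u \<in> V1_pw M" and curl: "u \<in> H_curl (Dom M)"
    and vm: "rep km (sqsym sm am bm) u vm" and vp: "rep kp (sqsym sp ap bp) u vp" and s0: "s0 \<in> {0..<1}"
  shows "bottom_trace vm s0 = bottom_trace vp s0"
proof (rule ccontr)
  assume jump: "bottom_trace vm s0 \<noteq> bottom_trace vp s0"
  define f where "f s = bottom_trace vp s - bottom_trace vm s" for s
  define \<sigma> where "\<sigma> = sgn (f s0)"
  define g where "g s = \<sigma> * f s" for s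
  have \<sigma>: "\<bar>\<sigma>\<bar> = 1" and gpos: "0 < g s0" using jump by (auto simp: \<sigma>_def g_def f_def sgn_if)
  have tr: "bottom_trace vm \<in> V1_spline M km" "bottom_trace vp \<in> V1_spline M kp"
    using V1_hat_trace km kp vm vp unfolding rep_def by auto
  have fb: "bmf f" unfolding f_def[abs_def] using tr V1_spline_bmf km kp by (intro bmf_diff) auto
  have "right_cont f" unfolding f_def[abs_def] using tr V1_spline_right_cont km kp by (intro right_cont_diff) auto
  then have "right_cont g" unfolding right_cont_def g_def by (auto intro: tendsto_mult_left)
  from right_cont_positive[OF this _ _ gpos] s0 obtain \<delta> where
    \<delta>: "s0 < \<delta>" "\<delta> \<le> 1" "\<And>x. s0 \<le> x \<Longrightarrow> x < \<delta> \<Longrightarrow> g s0 / 2 < g x" by auto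
  define s1 \<eta> c where "s1 = (s0 + \<delta>) / 2" and "\<eta> = (\<delta> - s0) / 2" and "c = g s0 / 2"
  have s1: "0 < s1" "s1 < 1" and \<eta>: "0 < \<eta>" and c: "0 < c" using s0 \<delta> gpos by (auto simp: s1_def \<eta>_def c_def)
  have big: "c < g s" if "\<bar>s - s1\<bar> < \<eta>" for s
    using \<delta>(3)[of s] that unfolding s1_def \<eta>_def c_def by (auto simp: abs_less_iff field_simps)
  have near01: "s \<in> {0..1}" if "\<bar>s - s1\<bar> < \<eta>" for s
    using that s0 \<delta> unfolding s1_def \<eta>_def by (auto simp: abs_less_iff field_simps)
  define x0 where "x0 = Ep (vec2 s1 0)"
  have curve: "continuous_on {0..1} (\<lambda>s. Ep (vec2 s 0))"
    by (intro continuous_on_compose2[OF p.cont] continuous_on_vec2 continuous_intros) (auto simp: bottom_vec2)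
  obtain L where L: "0 < L" "\<And>x y. x \<in> cbox 0 1 \<Longrightarrow> y \<in> cbox 0 1 \<Longrightarrow> norm (Ep x - Ep y) \<le> L * norm (x - y)"
    using p.lipschitz by blast
  \<comment> \<open>A neighbourhood of \<open>x0\<close> that meets the skeleton only in the part of \<open>e\<close> where the jump is at least \<open>c\<close>.\<close>
  define far where "far = {0..1} - {s1 - \<eta><..<s1 + \<eta>}"
  define U where "U = Dom M - (\<Union>(edges M - {e}) \<union> (\<lambda>s. Ep (vec2 s 0)) ` far)"
  have "compact far" unfolding far_def by (intro compact_diff compact_Icc) simp
  then have "compact ((\<lambda>s. Ep (vec2 s 0)) ` far)"
    by (intro compact_continuous_image continuous_on_subset[OF curve]) (auto simp: far_def)
  then have "closed (\<Union>(edges M - {e}) \<union> (\<lambda>s. Ep (vec2 s 0)) ` far)"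
    using finite_edges closed_edge by (intro closed_Un closed_Union compact_imp_closed) auto
  then have "open U" unfolding U_def using open_Dom by (intro open_Diff)
  have "x0 \<notin> (\<lambda>s. Ep (vec2 s 0)) ` far"
  proof
    assume "x0 \<in> (\<lambda>s. Ep (vec2 s 0)) ` far"
    then obtain s where s: "s \<in> far" "Ep (vec2 s1 0) = Ep (vec2 s 0)" unfolding x0_def by auto
    then have "vec2 s1 0 = vec2 s 0" using inj_onD[OF p.inj, of "vec2 s1 0" "vec2 s 0"] s1 by (auto simp: bottom_vec2 far_def)
    then show False using s(1) \<eta> by (auto simp: vec2_eq_iff far_def)
  qed
  then have "x0 \<in> U" unfolding U_def x0_def using edge_point_Dom[OF s1] edge_point_other[OF s1] by auto
  with \<open>open U\<close> obtain \<rho> where \<rho>: "0 < \<rho>" "ball x0 \<rho> \<subseteq> U" using openE by blast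
  define \<epsilon>0 where "\<epsilon>0 = min (\<rho> / 4) (L * \<eta>)"
  have \<epsilon>0: "0 < \<epsilon>0" "\<epsilon>0 < \<rho> / 2" "\<epsilon>0 \<le> L * \<eta>" using \<rho> L \<eta> by (auto simp: \<epsilon>0_def)
  have cubeU: "cube x0 \<epsilon> \<subseteq> U" if "\<epsilon> \<le> \<epsilon>0" for \<epsilon>
  proof
    fix x assume "x \<in> cube x0 \<epsilon>"
    then have "\<bar>x$1 - x0$1\<bar> \<le> \<epsilon>0" "\<bar>x$2 - x0$2\<bar> \<le> \<epsilon>0" using that by (auto simp: mem_cube)
    then have "norm (x - x0) < \<rho>" using norm_le_l1_cart[of "x - x0"] \<epsilon>0 by (simp add: sum_2)
    then show "x \<in> U" using \<rho>(2) by (auto simp: dist_norm norm_minus_commute)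
  qed
  have UD: "U \<subseteq> Dom M" unfolding U_def by blast
  \<comment> \<open>The difference of the two weak curls, square integrable, must carry the jump.\<close>
  have "\<forall>k\<in>patches M. \<exists>v. rep k (sqsym False False False) u v" using u unfolding V1_pw_iff by blast
  from bchoice[OF this] obtain v where v: "\<And>k. k \<in> patches M \<Longrightarrow> rep k (sqsym False False False) u (v k)" by blast
  obtain w K where w: "borel_fun w" "\<And>x. \<bar>w x\<bar> \<le> K" and parts: "\<And>\<phi>. (\<forall>j. Ck_fun j \<phi>) \<Longrightarrow>
     (LINT x|leb_Dom. cross2 (u x) (grad \<phi> x)) =
     (LINT x|leb_Dom. w x * \<phi> x) - (\<Sum>x\<in>patches M \<times> UNIV. side_term v \<phi> x)"
    using Dom_by_parts[OF v] by blast
  obtain w' where w': "w' \<in> L2_on (Dom M)" "\<And>\<phi>. \<phi> \<in> test_functions (Dom M) \<Longrightarrow>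
     (LINT x|leb_Dom. u x $ 1 * partial_deriv 2 \<phi> x - u x $ 2 * partial_deriv 1 \<phi> x) =
     (LINT x|leb_Dom. w' x * \<phi> x)"
    using curl unfolding H_curl_def by blast
  have w'm: "w' \<in> borel_measurable (leb_Dom)" and w'i: "integrable (leb_Dom) (\<lambda>x. (w' x)\<^sup>2)"
    using w'(1) unfolding L2_on_def by auto
  have wm: "w \<in> borel_measurable (leb_Dom)" by (rule borel_imp_lebesgue_on[OF w(1)])
  have bi: "integrable (leb_Dom) h" if "h \<in> borel_measurable (leb_Dom)" "\<And>x. \<bar>h x\<bar> \<le> C"
    for h :: "real^2 \<Rightarrow> real" and C
    using that Dom_lmeasurable by (intro integrable_bounded_lebesgue_on[of h _ C]) auto
  have wi: "integrable (leb_Dom) (\<lambda>x. (w x)\<^sup>2)"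
  proof (rule bi[where C = "K\<^sup>2"])
    show "(\<lambda>x. (w x)\<^sup>2) \<in> borel_measurable (leb_Dom)" using wm by simp
    show "\<bar>(w x)\<^sup>2\<bar> \<le> K\<^sup>2" for x using power_mono[OF w(2)[of x], of 2] by simp
  qed
  have "integrable (leb_Dom) (\<lambda>x. (w x - w' x)\<^sup>2)"
  proof (rule Bochner_Integration.integrable_bound)
    show "integrable (leb_Dom) (\<lambda>x. 2 * (w x)\<^sup>2 + 2 * (w' x)\<^sup>2)" using wi w'i by simp
    have "(w x - w' x)\<^sup>2 \<le> 2 * (w x)\<^sup>2 + 2 * (w' x)\<^sup>2" for x
      using sum_squares_ge_zero[of "w x + w' x" 0] by (simp add: power2_eq_square algebra_simps)
    then show "AE x in leb_Dom. norm ((w x - w' x)\<^sup>2) \<le> norm (2 * (w x)\<^sup>2 + 2 * (w' x)\<^sup>2)"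
      by (intro AE_I2) simp
    show "(\<lambda>x. (w x - w' x)\<^sup>2) \<in> borel_measurable (leb_Dom)" using wm w'm by simp
  qed
  then have WL2: "(\<lambda>x. w x - w' x) \<in> L2_on (Dom M)" unfolding L2_on_def using wm w'm by simp
  \<comment> \<open>The jump times the lower bound of the bump, on a parameter interval of length \<open>\<epsilon> / L\<close>.\<close>
  define \<kappa> where "\<kappa> = c * exp (-8) / L"
  have \<kappa>: "0 < \<kappa>" using c L by (simp add: \<kappa>_def)
  obtain \<epsilon> where \<epsilon>: "0 < \<epsilon>" "\<epsilon> \<le> \<epsilon>0" and small: "\<bar>LINT x|leb_Dom. (w x - w' x) * bump x0 \<epsilon> x\<bar> < \<kappa> * \<epsilon>"
    using L2_bump_small[OF WL2 Dom_sets _ \<epsilon>0(1) \<kappa>, of x0] cubeU[of \<epsilon>0] UD by blast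
  define \<phi> where "\<phi> = bump x0 \<epsilon>"
  have Ck: "\<forall>j. Ck_fun j \<phi>" unfolding \<phi>_def using Ck_fun_bump by blast
  note pc = Ck_grad(3)[OF Ck]
  have supp: "x \<in> U" if "\<phi> x \<noteq> 0" for x using bump_support[OF \<epsilon>(1)] cubeU[OF \<epsilon>(2)] that unfolding \<phi>_def by blast
  have test: "\<phi> \<in> test_functions (Dom M)" unfolding \<phi>_def using cubeU[OF \<epsilon>(2)] UD by (intro bump_test \<epsilon>(1)) blast
  have pm: "\<phi> \<in> borel_measurable (leb_Dom)" by (intro borel_imp_lebesgue_on borel_measurable_continuous_onI pc)
  have p01: "0 \<le> \<phi> x" "\<phi> x \<le> 1" for x unfolding \<phi>_def by (rule bump_bounds)+
  have i1: "integrable (leb_Dom) (\<lambda>x. w x * \<phi> x)"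
    using wm pm w(2) p01 order.trans[OF abs_ge_zero w(2)] mult_mono[of _ K _ 1]
    by (intro bi[where C = "K * 1"]) (auto simp: abs_mult)
  have i2: "integrable (leb_Dom) (\<lambda>x. w' x * \<phi> x)"
  proof (rule Bochner_Integration.integrable_bound)
    show "integrable (leb_Dom) (\<lambda>x. 1 + (w' x)\<^sup>2)"
      using bi[of "\<lambda>_. 1" 1] by (intro Bochner_Integration.integrable_add w'i) simp
    have "\<bar>w' x\<bar> \<le> 1 + (w' x)\<^sup>2" for x
    proof -
      have "0 \<le> (\<bar>w' x\<bar> - 1)\<^sup>2" by simp
      then have "2 * \<bar>w' x\<bar> \<le> 1 + (w' x)\<^sup>2" by (simp add: power2_eq_square algebra_simps)
      then show ?thesis by linarith
    qed
    moreover have "\<bar>w' x * \<phi> x\<bar> \<le> \<bar>w' x\<bar>" for x unfolding abs_mult using p01[of x] by (simp add: mult_left_le)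
    ultimately have "\<bar>w' x * \<phi> x\<bar> \<le> 1 + (w' x)\<^sup>2" for x using order.trans by blast
    then show "AE x in leb_Dom. norm (w' x * \<phi> x) \<le> norm (1 + (w' x)\<^sup>2)" by (intro AE_I2) simp
    show "(\<lambda>x. w' x * \<phi> x) \<in> borel_measurable (leb_Dom)" using w'm pm by simp
  qed
  let ?F = "{x \<in> patches M \<times> UNIV. (case x of (k, sw, b) \<Rightarrow> side_edge k sw b) = e}"
  have "(\<Sum>x\<in>patches M \<times> UNIV. side_term v \<phi> x) = (\<Sum>x\<in>?F. side_term v \<phi> x)"
  proof (rule sum.mono_neutral_right)
    show "finite (patches M \<times> (UNIV :: (bool \<times> bool) set))" using finite_patches by simp
    show "\<forall>x\<in>patches M \<times> UNIV - ?F. side_term v \<phi> x = 0"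
    proof
      fix x assume x: "x \<in> patches M \<times> UNIV - ?F"
      obtain k sw b where xk: "x = (k, sw, b)" by (cases x)
      have k: "k \<in> patches M" and "(k, sw, b) \<notin> ?F" using x unfolding xk by auto
      then have ne': "side_edge k sw b \<in> edges M - {e}" using side_edge_in_edges by auto
      have "\<phi> ((side_chart k sw False b) (vec2 s 0)) = 0" if "0 < s" "s < 1" for s
      proof (rule ccontr)
        assume "\<phi> ((side_chart k sw False b) (vec2 s 0)) \<noteq> 0"
        then have "(side_chart k sw False b) (vec2 s 0) \<in> U" by (rule supp)
        moreover have "(side_chart k sw False b) (vec2 s 0) \<in> side_edge k sw b"
          unfolding side_edge_def by (rule imageI) (use that bottom_vec2(2) in auto)
        ultimately show False using ne' unfolding U_def by blast
      qed
      then show "side_term v \<phi> x = 0" unfolding xk by (rule side_term_zero)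
    qed
  qed auto
  also have "\<dots> = p.ori * (LINT s|leb_unit. f s * \<phi> (Ep (vec2 s 0)))"
    unfolding f_def by (rule edge_side_terms[OF v vm vp pc])
  finally have J: "(\<Sum>x\<in>patches M \<times> UNIV. side_term v \<phi> x) = p.ori * (LINT s|leb_unit. f s * \<phi> (Ep (vec2 s 0)))" .
  have "(LINT x|leb_Dom. w' x * \<phi> x) = (LINT x|leb_Dom. cross2 (u x) (grad \<phi> x))"
    using w'(2)[OF test] by (simp add: cross2_def grad_def)
  then have "(LINT x|leb_Dom. (w x - w' x) * \<phi> x) = p.ori * (LINT s|leb_unit. f s * \<phi> (Ep (vec2 s 0)))"
    unfolding left_diff_distrib using parts[OF Ck] J Bochner_Integration.integral_diff[OF i1 i2] by simp
  then have eq: "\<bar>LINT x|leb_Dom. (w x - w' x) * \<phi> x\<bar> = \<bar>LINT s|leb_unit. g s * \<phi> (Ep (vec2 s 0))\<bar>"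
    using p.ori(1) \<sigma> unfolding g_def mult.assoc by (auto simp: abs_mult)
  define h where "h = \<epsilon> / (2 * L)"
  have h: "0 < h" "h < \<eta>" using \<epsilon> \<epsilon>0 L \<eta> by (auto simp: h_def field_simps)
  have low: "c * exp (-8) * indicator {s1 - h..s1 + h} s \<le> g s * \<phi> (Ep (vec2 s 0))" if s: "s \<in> {0..1}" for s
  proof (cases "\<bar>s - s1\<bar> \<le> h")
    case True
    then have gs: "c < g s" using h by (intro big) auto
    have "norm (vec2 s 0 - vec2 s1 0) = \<bar>s - s1\<bar>"
    proof -
      have "vec2 s 0 - vec2 s1 0 = (s - s1) *\<^sub>R axis 1 1" by (simp add: vec2_eq_iff axis_def)
      then show ?thesis by simp
    qed
    then have "norm (Ep (vec2 s 0) - x0) \<le> L * \<bar>s - s1\<bar>"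
      unfolding x0_def using L(2)[of "vec2 s 0" "vec2 s1 0"] s s1 by (simp add: bottom_vec2)
    also have "\<dots> \<le> L * h" using True L by simp
    also have "\<dots> = \<epsilon> / 2" using L by (simp add: h_def)
    finally have n: "norm (Ep (vec2 s 0) - x0) \<le> \<epsilon> / 2" .
    have "\<bar>Ep (vec2 s 0) $ i - x0 $ i\<bar> \<le> \<epsilon> / 2" for i
      using component_le_norm_cart[of "Ep (vec2 s 0) - x0" i] n by simp
    then have "exp (-8) \<le> \<phi> (Ep (vec2 s 0))" unfolding \<phi>_def by (intro bump_lower \<epsilon>(1)) (simp add: mem_cube)
    then have "c * exp (-8) \<le> g s * \<phi> (Ep (vec2 s 0))" using gs c by (intro mult_mono) auto
    then show ?thesis using True by (auto simp: abs_le_iff indicator_def)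
  next
    case False
    have "0 \<le> g s * \<phi> (Ep (vec2 s 0))"
    proof (cases "\<phi> (Ep (vec2 s 0)) = 0")
      case ne: False
      then have "s \<notin> far" using supp unfolding U_def by blast
      then have "c < g s" using s by (intro big) (auto simp: far_def)
      then show ?thesis using c p01 by simp
    qed simp
    then show ?thesis using False by (auto simp: abs_le_iff indicator_def)
  qed
  define q where "q s = indicator {0..1} s *\<^sub>R \<phi> (Ep (vec2 s 0))" for s :: real
  have "borel_fun q" unfolding q_def[abs_def]
    by (intro borel_measurable_continuous_on_indicator continuous_on_compose2[OF pc curve]) auto
  then have "bmf q" unfolding bmf_def q_def using p01 by (auto intro!: exI[of _ 1])
  moreover have "bmf g" unfolding g_def[abs_def] using fb by (rule bmf_cmult)
  ultimately have "integrable leb_unit (\<lambda>s. g s * q s)" by (intro bmf_integrable bmf_mult)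
  then have gi: "integrable leb_unit (\<lambda>s. g s * \<phi> (Ep (vec2 s 0)))"
    by (subst (asm) Bochner_Integration.integrable_cong[of _ _ _ "\<lambda>s. g s * \<phi> (Ep (vec2 s 0))"]) (auto simp: q_def)
  have sub: "{s1 - h..s1 + h} \<subseteq> {0..1}"
  proof
    fix s assume "s \<in> {s1 - h..s1 + h}"
    then have "\<bar>s - s1\<bar> < \<eta>" using h by (auto simp: abs_less_iff)
    then show "s \<in> {0..1}" by (rule near01)
  qed
  have "bmf (indicator {s1 - h..s1 + h})" unfolding bmf_def by (auto simp: indicator_def intro!: exI[of _ 1])
  then have ii: "integrable leb_unit (\<lambda>s. c * exp (-8) * indicator {s1 - h..s1 + h} s :: real)"
    using bmf_integrable by (intro Bochner_Integration.integrable_mult_right) blast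
  have "\<kappa> * \<epsilon> = c * exp (-8) * (2 * h)" using L by (simp add: \<kappa>_def h_def)
  also have "2 * h = (LINT s|leb_unit. indicator {s1 - h..s1 + h} s)"
    using sub h by (simp add: measure_restrict_space Int_absorb2)
  also have "c * exp (-8) * \<dots> = (LINT s|leb_unit. c * exp (-8) * indicator {s1 - h..s1 + h} s)" by simp
  also have "\<dots> \<le> (LINT s|leb_unit. g s * \<phi> (Ep (vec2 s 0)))"
    by (rule integral_mono[OF ii gi]) (use low in simp)
  also have "\<dots> \<le> \<bar>LINT s|leb_unit. g s * \<phi> (Ep (vec2 s 0))\<bar>" by (rule abs_ge_self)
  also have "\<dots> < \<kappa> * \<epsilon>" using small unfolding \<phi>_def[symmetric] eq .
  finally show False by simp
qed

end

lemma (in mp_splines) H_curl_jump_free: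
  assumes "u \<in> V1_pw M" "u \<in> H_curl (Dom M)"
  shows "jump_free e u"
  unfolding jump_free_def
proof (intro allI impI)
  fix sm am bm sp ap bp vm vp
  assume "edge_setting M e sm am bm sp ap bp" and r: "rep (kcoarse M e) (sqsym sm am bm) u vm" "rep (kfine M e) (sqsym sp ap bp) u vp"
  then interpret S: edge_splines M e sm am bm sp ap bp "kcoarse M e" "kfine M e"
    "side_chart (kcoarse M e) sm am bm" "side_chart (kfine M e) sp ap bp"
    by (intro edge_splinesI) simp_all
  show "\<forall>s\<in>{0..<1}. bottom_trace vm s = bottom_trace vp s"
    using S.H_curl_traces_agree[OF assms r] by blast
qed

section \<open>Composition of the edge operators\<close>

locale spline_edges = mp_splines +
  fixes r :: nat and \<gamma> :: "nat \<Rightarrow> nat \<Rightarrow> real"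
  assumes r: "r \<le> sdeg M" and corr: "correction_coeffs M r \<gamma>"
begin

lemma spline_edgeI: "edge_setting M e sm am bm sp ap bp \<Longrightarrow> spline_edge M e sm am bm sp ap bp r \<gamma>"
  by (intro spline_edge.intro mp_splines_axioms spline_edge_axioms.intro r corr)

lemma edge_op_trivial: "\<not> interior_edge M e \<Longrightarrow> edge_op M r \<gamma> e u = u"
  unfolding edge_op_def by simp

text \<open>
  Boundary edges have the identity as their operator; for interior edges these are the results of the preceding sections.
\<close>

lemma edge_op_properties:
  assumes u: "u \<in> V1_pw M"
  shows "edge_op M r \<gamma> e u \<in> V1_pw M" (is ?A)
    and "v \<in> V1_pw M \<Longrightarrow> w \<in> V1_pw M \<Longrightarrow> AE x in leb_Dom. w x = \<alpha> *\<^sub>R u x + \<beta> *\<^sub>R v x \<Longrightarrow>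
      AE x in leb_Dom. edge_op M r \<gamma> e w x = \<alpha> *\<^sub>R edge_op M r \<gamma> e u x + \<beta> *\<^sub>R edge_op M r \<gamma> e v x"
      (is "?B1 \<Longrightarrow> ?B2 \<Longrightarrow> ?B3 \<Longrightarrow> ?B")
    and "k \<in> patches M \<Longrightarrow> q \<in> vec_polys r \<Longrightarrow>
      (LINT x|leb_square. pull (pmap M k) (edge_op M r \<gamma> e u) x \<bullet> q x) =
      (LINT x|leb_square. pull (pmap M k) u x \<bullet> q x)"
      (is "?C1 \<Longrightarrow> ?C2 \<Longrightarrow> ?C")
    and "(interior_edge M e \<Longrightarrow> jump_free e u) \<Longrightarrow> AE x in leb_Dom. edge_op M r \<gamma> e u x = u x"
      (is "(?D1 \<Longrightarrow> ?D2) \<Longrightarrow> ?D")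
proof -
  have "?A \<and> (?B1 \<longrightarrow> ?B2 \<longrightarrow> ?B3 \<longrightarrow> ?B) \<and> (?C1 \<longrightarrow> ?C2 \<longrightarrow> ?C) \<and> ((?D1 \<longrightarrow> ?D2) \<longrightarrow> ?D)"
  proof (cases "interior_edge M e")
    case True
    obtain sm am bm sp ap bp where "edge_setting M e sm am bm sp ap bp" using ex_edge_setting[OF True splines] by blast
    then interpret S: spline_edge M e sm am bm sp ap bp "kcoarse M e" "kfine M e"
      "side_chart (kcoarse M e) sm am bm" "side_chart (kfine M e) sp ap bp" r \<gamma>
      by (intro spline_edgeI) simp_all
    have "S.conforming u" if "jump_free e u"
      using that S.edge_setting_axioms unfolding jump_free_def S.conforming_def by blast
    then show ?thesis using S.edge_op_V1_pw[OF u] S.edge_op_linear[OF u] S.edge_op_moments[OF u] S.edge_op_fixes[OF u] True by blast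
  next
    case False
    then show ?thesis using u by (simp add: edge_op_trivial)
  qed
  then show ?A "?B1 \<Longrightarrow> ?B2 \<Longrightarrow> ?B3 \<Longrightarrow> ?B" "?C1 \<Longrightarrow> ?C2 \<Longrightarrow> ?C" "(?D1 \<Longrightarrow> ?D2) \<Longrightarrow> ?D" by blast+
qed

lemma edge_op_removes_jump:
  assumes u: "u \<in> V1_pw M" and int: "interior_edge M e"
  shows "jump_free e (edge_op M r \<gamma> e u)"
  unfolding jump_free_def
proof (intro allI impI)
  fix sm am bm sp ap bp vm vp
  assume "edge_setting M e sm am bm sp ap bp"
    and v: "rep (kcoarse M e) (sqsym sm am bm) (edge_op M r \<gamma> e u) vm" "rep (kfine M e) (sqsym sp ap bp) (edge_op M r \<gamma> e u) vp"
  then interpret S: spline_edge M e sm am bm sp ap bp "kcoarse M e" "kfine M e"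
    "side_chart (kcoarse M e) sm am bm" "side_chart (kfine M e) sp ap bp" r \<gamma>
    by (intro spline_edgeI) simp_all
  show "\<forall>s\<in>{0..<1}. bottom_trace vm s = bottom_trace vp s"
    using S.edge_op_conforming[OF u] v unfolding S.conforming_def by blast
qed

text \<open>
  The operator of one edge keeps the traces on all other edges; this is why the order of
  composition is immaterial for conformity.
\<close>

lemma edge_op_keeps_jump_free:
  assumes u: "u \<in> V1_pw M" and jf: "jump_free f u"
  shows "jump_free f (edge_op M r \<gamma> e u)"
proof (cases "interior_edge M e")
  case int: True
  obtain sm am bm sp ap bp where "edge_setting M e sm am bm sp ap bp" using ex_edge_setting[OF int splines] by blast
  then interpret S: spline_edge M e sm am bm sp ap bp "kcoarse M e" "kfine M e"
    "side_chart (kcoarse M e) sm am bm" "side_chart (kfine M e) sp ap bp" r \<gamma>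
    by (intro spline_edgeI) simp_all
  show ?thesis
  proof (cases "f = e")
    case True
    then show ?thesis using edge_op_removes_jump[OF u int] by simp
  next
    case ne: False
    show ?thesis unfolding jump_free_def
    proof (intro allI impI ballI)
      fix tm cm dm tp cp dp vm vp s
      assume es: "edge_setting M f tm cm dm tp cp dp" and s: "s \<in> {0..<1::real}"
        and v: "rep (kcoarse M f) (sqsym tm cm dm) (edge_op M r \<gamma> e u) vm" "rep (kfine M f) (sqsym tp cp dp) (edge_op M r \<gamma> e u) vp"
      from es interpret T: edge_setting M f tm cm dm tp cp dp "kcoarse M f" "kfine M f"
        "side_chart (kcoarse M f) tm cm dm" "side_chart (kfine M f) tp cp dp" by simp_all
      obtain um where um: "rep (kcoarse M f) (sqsym tm cm dm) u um" using ex_rep[OF u T.km] by blast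
      obtain up where up: "rep (kfine M f) (sqsym tp cp dp) u up" using ex_rep[OF u T.kp] by blast
      have n: "side_edge (kcoarse M f) tm dm \<noteq> e" "side_edge (kfine M f) tp dp \<noteq> e" using T.e_side ne by auto
      have "bottom_trace vm s = bottom_trace um s" by (rule S.edge_op_other_trace[OF u T.km n(1) um v(1) s])
      also have "\<dots> = bottom_trace up s" using jf es um up s unfolding jump_free_def by blast
      also have "\<dots> = bottom_trace vp s" by (rule S.edge_op_other_trace[OF u T.kp n(2) up v(2) s, symmetric])
      finally show "bottom_trace vm s = bottom_trace vp s" .
    qed
  qed
qed (use jf in \<open>simp add: edge_op_trivial\<close>)

lemma edge_op_prod_simps:
  "edge_op_prod M r \<gamma> [] u = u" "edge_op_prod M r \<gamma> (e # es) u = edge_op M r \<gamma> e (edge_op_prod M r \<gamma> es u)"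
  unfolding edge_op_prod_def by simp_all

lemma prod_V1_pw: "u \<in> V1_pw M \<Longrightarrow> edge_op_prod M r \<gamma> es u \<in> V1_pw M"
  by (induction es) (simp_all add: edge_op_prod_simps edge_op_properties(1))

lemma prod_linear:
  assumes "u \<in> V1_pw M" "v \<in> V1_pw M" "w \<in> V1_pw M" "AE x in leb_Dom. w x = \<alpha> *\<^sub>R u x + \<beta> *\<^sub>R v x"
  shows "AE x in leb_Dom. edge_op_prod M r \<gamma> es w x = \<alpha> *\<^sub>R edge_op_prod M r \<gamma> es u x + \<beta> *\<^sub>R edge_op_prod M r \<gamma> es v x"
proof (induction es)
  case (Cons e es)
  then show ?case unfolding edge_op_prod_simps
    by (intro edge_op_properties(2) prod_V1_pw assms)
qed (use assms in \<open>simp add: edge_op_prod_simps\<close>)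

lemma prod_moments:
  assumes u: "u \<in> V1_pw M" and k: "k \<in> patches M" and q: "q \<in> vec_polys r"
  shows "(LINT x|leb_square. pull (pmap M k) (edge_op_prod M r \<gamma> es u) x \<bullet> q x) =
      (LINT x|leb_square. pull (pmap M k) u x \<bullet> q x)"
proof (induction es)
  case (Cons e es)
  then show ?case unfolding edge_op_prod_simps using edge_op_properties(3)[OF prod_V1_pw[OF u] k q] by simp
qed (simp add: edge_op_prod_simps)

lemma prod_jump_free:
  assumes u: "u \<in> V1_pw M" and f: "interior_edge M f" "f \<in> set es"
  shows "jump_free f (edge_op_prod M r \<gamma> es u)"
  using f(2)
proof (induction es)
  case (Cons e es)
  then show ?case unfolding edge_op_prod_simps
    using edge_op_removes_jump[OF prod_V1_pw[OF u] f(1)] edge_op_keeps_jump_free[OF prod_V1_pw[OF u]] by (cases "f = e") auto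
qed simp

text \<open>
  The induction uses that the operators respect equality almost everywhere, which is the case \<open>1 *\<^sub>R u + 0 *\<^sub>R u\<close> of linearity.
\<close>

lemma prod_fixes:
  assumes u: "u \<in> V1_pw M" and jf: "\<And>f. interior_edge M f \<Longrightarrow> jump_free f u"
  shows "AE x in leb_Dom. edge_op_prod M r \<gamma> es u x = u x"
proof (induction es)
  case (Cons e es)
  then have "AE x in leb_Dom. edge_op_prod M r \<gamma> es u x = 1 *\<^sub>R u x + 0 *\<^sub>R u x" by simp
  from edge_op_properties(2)[OF u u prod_V1_pw[OF u] this, of e]
  have "AE x in leb_Dom. edge_op M r \<gamma> e (edge_op_prod M r \<gamma> es u) x = edge_op M r \<gamma> e u x" by simp
  moreover have "AE x in leb_Dom. edge_op M r \<gamma> e u x = u x" by (rule edge_op_properties(4)[OF u jf])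
  ultimately show ?case unfolding edge_op_prod_simps by eventually_elim simp
qed (simp add: edge_op_prod_simps)

lemma V1_h_iff: "u \<in> V1_h M \<longleftrightarrow> u \<in> V1_pw M \<and> (\<forall>e. interior_edge M e \<longrightarrow> jump_free e u)"
  unfolding V1_h_def using jump_free_H_curl H_curl_jump_free by blast

lemma prod_projection:
  assumes es: "set es = edges M"
  shows "projection_onto M (edge_op_prod M r \<gamma> es) (V1_h M)"
proof -
  let ?P = "edge_op_prod M r \<gamma> es"
  have range: "?P u \<in> V1_h M" if "u \<in> V1_pw M" for u
    unfolding V1_h_iff using prod_V1_pw[OF that] prod_jump_free[OF that] es by (auto simp: interior_edge_def)
  have fix_h: "AE x in leb_Dom. ?P w x = w x" if "w \<in> V1_h M" for w
    using that prod_fixes unfolding V1_h_iff by blast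
  have cong: "ae_eq_on (Dom M) (?P u) (?P v)" if "u \<in> V1_pw M" "v \<in> V1_pw M" "ae_eq_on (Dom M) u v" for u v
    using prod_linear[OF that(2,2,1), of 1 0 es] that(3) unfolding ae_eq_on_def by simp
  have lin: "ae_eq_on (Dom M) (?P (\<lambda>x. a *\<^sub>R u x + b *\<^sub>R v x)) (\<lambda>x. a *\<^sub>R ?P u x + b *\<^sub>R ?P v x)"
    if "u \<in> V1_pw M" "v \<in> V1_pw M" for u v a b
    unfolding ae_eq_on_def by (rule prod_linear[OF that V1_pw_lincomb[OF that]]) simp
  show ?thesis
    unfolding projection_onto_def linear_operator_def
  proof (intro conjI ballI allI impI)
    show "\<exists>u\<in>V1_pw M. ae_eq_on (Dom M) (?P u) w" if w: "w \<in> V1_h M" for w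
      using w fix_h[OF w] unfolding V1_h_iff ae_eq_on_def by blast
    show "ae_eq_on (Dom M) (?P (?P u)) (?P u)" if "u \<in> V1_pw M" for u
      unfolding ae_eq_on_def by (rule fix_h[OF range[OF that]])
  qed (use range cong lin prod_V1_pw in blast)+
qed

end

theorem theorem4p2:
  fixes M :: multipatch and r :: nat and \<gamma> :: "nat \<Rightarrow> nat \<Rightarrow> real" and es :: "(real^2) set list"
  assumes "multipatch_domain M" and "multipatch_splines M" and "edge_maps M"
    and "r \<le> sdeg M" and "correction_coeffs M r \<gamma>"
    and "distinct es" and "set es = edges M"
  shows "projection_onto M (edge_op_prod M r \<gamma> es) (V1_h M) \<and>
         moment_preserving M r (edge_op_prod M r \<gamma> es)"
proof -
  interpret spline_edges M r \<gamma> using assms(1-5) by unfold_locales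
  show ?thesis using prod_projection[OF assms(7)] prod_moments unfolding moment_preserving_def by blast
qed

end
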